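(* For any $\varepsilon>0$ there exists $V_*>0$ such that for all oriented closed hyperbolic 3-orbifolds with volume $V>V_*$, the first nonzero eigenvalue $\lambda_1^{(0)}$ of the Laplace--Beltrami operator on functions satisfies $$\lambda^{(0)}_1 < 1+\frac{54(1+\varepsilon)}{[\log V]^2} .$$
   Context: A closed oriented hyperbolic 3-orbifold is a connected quotient $\Gamma\backslash\mathbb H^3$, with $\mathbb H^3$ hyperbolic 3-space (sectional curvature $-1$) and $\Gamma$ a cocompact discrete subgroup of $\mathrm{PSL}_2(\mathbb C)$, possibly with torsion. The Laplace--Beltrami operator is taken with the nonnegative sign, $\Delta_M=-\mathrm{div}\circ\nabla$. $\log$ is the natural logarithm. *)

theory Defs
  imports "HOL-Analysis.Analysis" "HOL-Algebra.Coset"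
begin

section \<open>Quotient topologies\<close>

definition quotient_topology :: "'a topology \<Rightarrow> ('a \<Rightarrow> 'b) \<Rightarrow> 'b topology" where
  "quotient_topology X f =
     topology (\<lambda>U. U \<subseteq> f ` topspace X \<and> openin X {x \<in> topspace X. f x \<in> U})"

lemma openin_quotient_topology:
  "openin (quotient_topology X f) U \<longleftrightarrow>
     U \<subseteq> f ` topspace X \<and> openin X {x \<in> topspace X. f x \<in> U}"
proof -
  let ?P = "\<lambda>U. U \<subseteq> f ` topspace X \<and> openin X {x \<in> topspace X. f x \<in> U}"
  have "istopology ?P"
    unfolding istopology_def
  proof (rule conjI; intro allI impI)
    fix S T assume S: "?P S" and T: "?P T"
    have "{x \<in> topspace X. f x \<in> S \<inter> T} =
        {x \<in> topspace X. f x \<in> S} \<inter> {x \<in> topspace X. f x \<in> T}"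
      by auto
    then show "?P (S \<inter> T)"
      using S T by (auto intro: openin_Int)
  next
    fix K assume K: "\<forall>S\<in>K. ?P S"
    have "{x \<in> topspace X. f x \<in> \<Union>K} = \<Union>((\<lambda>S. {x \<in> topspace X. f x \<in> S}) ` K)"
      by auto
    moreover have "openin X (\<Union>((\<lambda>S. {x \<in> topspace X. f x \<in> S}) ` K))"
      using K by (intro openin_Union) auto
    ultimately show "?P (\<Union>K)"
      using K by auto
  qed
  then show ?thesis
    unfolding quotient_topology_def by (simp add: topology_inverse')
qed

lemma topspace_quotient_topology: "topspace (quotient_topology X f) = f ` topspace X"
proof -
  have "{x \<in> topspace X. f x \<in> f ` topspace X} = topspace X"
    by auto
  then have "openin (quotient_topology X f) (f ` topspace X)"
    by (simp add: openin_quotient_topology)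
  then show ?thesis
    using openin_quotient_topology[of X f] openin_subset openin_topspace
    by (metis subset_antisym)
qed

lemma quotient_map_quotient_topology: "quotient_map X (quotient_topology X f) f"
  by (auto simp: quotient_map_def topspace_quotient_topology openin_quotient_topology)

section \<open>The group \<open>PSL\<^sub>2(\<complex>)\<close>\<close>

definition SL2C :: "(complex^2^2) monoid" where
  "SL2C = \<lparr>carrier = {A. det A = 1}, monoid.mult = (**), one = mat 1\<rparr>"

definition SL2C_center :: "(complex^2^2) set" where
  "SL2C_center = {mat 1, - mat 1}"

definition PSL2C :: "(complex^2^2) set monoid" where
  "PSL2C = SL2C Mod SL2C_center"

definition PSL2C_topology :: "(complex^2^2) set topology" where
  "PSL2C_topology =
     quotient_topology (top_of_set (carrier SL2C)) (\<lambda>A. SL2C_center #>\<^bsub>SL2C\<^esub> A)"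

definition discrete_subgroup_PSL2C :: "(complex^2^2) set set \<Rightarrow> bool" where
  "discrete_subgroup_PSL2C \<Gamma> \<longleftrightarrow>
     subgroup \<Gamma> PSL2C \<and> subtopology PSL2C_topology \<Gamma> = discrete_topology \<Gamma>"

lemma group_SL2C: "group SL2C"
proof (rule groupI)
  fix A assume "A \<in> carrier SL2C"
  then have d: "det A = 1" by (simp add: SL2C_def)
  then have "invertible A" by (simp add: invertible_det_nz)
  then obtain B where B: "B ** A = mat 1" by (auto simp: invertible_def)
  then have "det B = 1"
    using d det_mul[of B A] by simp
  with B show "\<exists>B\<in>carrier SL2C. B \<otimes>\<^bsub>SL2C\<^esub> A = \<one>\<^bsub>SL2C\<^esub>"
    by (auto simp: SL2C_def)
qed (auto simp: SL2C_def det_mul matrix_mul_assoc)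

lemma uminus_matrix_mult: "(- A) ** B = - (A ** (B :: complex^2^2))"
  by (simp add: vec_eq_iff matrix_matrix_mult_def sum_negf)

lemma matrix_mult_uminus: "A ** (- B) = - (A ** (B :: complex^2^2))"
  by (simp add: vec_eq_iff matrix_matrix_mult_def sum_negf)

lemma det_uminus_2: "det (- A) = det (A :: complex^2^2)"
  by (simp add: det_2)

lemma SL2C_center_rcoset: "SL2C_center #>\<^bsub>SL2C\<^esub> A = {A, - A}"
  by (auto simp: r_coset_def SL2C_center_def SL2C_def uminus_matrix_mult)

lemma normal_SL2C_center: "SL2C_center \<lhd> SL2C"
proof -
  interpret group SL2C by (rule group_SL2C)
  have "subgroup SL2C_center SL2C"
  proof (rule subgroupI)
    fix A assume A: "A \<in> SL2C_center"
    then have "A ** A = mat 1" "det A = 1"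
      by (auto simp: SL2C_center_def uminus_matrix_mult matrix_mult_uminus det_uminus_2)
    then have "inv\<^bsub>SL2C\<^esub> A = A"
      by (intro inv_equality) (auto simp: SL2C_def)
    with A show "inv\<^bsub>SL2C\<^esub> A \<in> SL2C_center" by simp
  qed (auto simp: SL2C_center_def SL2C_def det_uminus_2 uminus_matrix_mult)
  then show ?thesis
    by (rule normalI)
      (auto simp: r_coset_def l_coset_def SL2C_center_def SL2C_def
        uminus_matrix_mult matrix_mult_uminus)
qed

lemma group_PSL2C: "group PSL2C"
  unfolding PSL2C_def by (rule normal.factorgroup_is_group[OF normal_SL2C_center])

section \<open>Hyperbolic 3-space\<close>

text \<open>Upper half-space model: the point \<open>(z, t)\<close> with \<open>t > 0\<close> is the quaternion \<open>z + t j\<close>,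
  with the metric \<open>(|dz|\<^sup>2 + dt\<^sup>2) / t\<^sup>2\<close> of sectional curvature \<open>-1\<close>.\<close>

type_synonym point3 = "complex \<times> real"

definition H3 :: "point3 set" where
  "H3 = {p. snd p > 0}"

definition hyp_metric :: "point3 \<Rightarrow> point3 \<Rightarrow> point3 \<Rightarrow> real" where
  "hyp_metric p u v = (u \<bullet> v) / (snd p)\<^sup>2"

text \<open>The Riemannian measure has density \<open>sqrt (det g) = 1 / t\<^sup>3\<close>.\<close>

definition hyp_volume :: "point3 measure" where
  "hyp_volume = density lborel (\<lambda>p. indicator H3 p * ennreal (1 / (snd p) ^ 3))"

text \<open>Poincare extension \<open>q \<mapsto> (a q + b) (c q + d)\<^sup>-\<^sup>1\<close> of the Moebius action,
  written out for \<open>q = z + t j\<close> and \<open>a d - b c = 1\<close>.\<close>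

definition SL2C_act :: "complex^2^2 \<Rightarrow> point3 \<Rightarrow> point3" where
  "SL2C_act A p =
    (let a = A$1$1; b = A$1$2; c = A$2$1; d = A$2$2; z = fst p; t = snd p;
         N = (norm (c * z + d))\<^sup>2 + (norm c)\<^sup>2 * t\<^sup>2
     in (((a * z + b) * cnj (c * z + d) + a * cnj c * of_real (t\<^sup>2)) / of_real N, t / N))"

lemma SL2C_act_uminus: "SL2C_act (- A) p = SL2C_act A p"
proof -
  have "norm (- (c * z) - d) = norm (c * z + d)" for c z d :: complex
    by (metis minus_add_distrib norm_minus_cancel uminus_add_conv_diff add.commute)
  then show ?thesis
    by (simp add: SL2C_act_def Let_def algebra_simps)
qed

lemma SL2C_act_mat_1: "SL2C_act (mat 1) p = p"
  by (simp add: SL2C_act_def Let_def mat_def)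

lemma SL2C_act_H3:
  assumes "A \<in> carrier SL2C" "p \<in> H3"
  shows "SL2C_act A p \<in> H3"
proof -
  have "A$2$1 \<noteq> 0 \<or> A$2$2 \<noteq> 0"
    using assms(1) by (auto simp: SL2C_def det_2)
  then have "(norm (A$2$1 * fst p + A$2$2))\<^sup>2 + (norm (A$2$1))\<^sup>2 * (snd p)\<^sup>2 > 0"
    using assms(2) by (cases "A$2$1 = 0") (auto simp: H3_def intro: add_nonneg_pos)
  then show ?thesis
    using assms(2) by (simp add: SL2C_act_def Let_def H3_def)
qed

section \<open>Closed hyperbolic 3-orbifolds\<close>

text \<open>Elements of \<open>\<Gamma>\<close> are cosets \<open>{A, -A}\<close>; by \<open>SL2C_act_uminus\<close> both representatives act in
  the same way.\<close>

definition orbit :: "(complex^2^2) set set \<Rightarrow> point3 \<Rightarrow> point3 set" where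
  "orbit \<Gamma> p = {SL2C_act A p | A. A \<in> \<Union>\<Gamma>}"

definition orbifold_topology :: "(complex^2^2) set set \<Rightarrow> point3 set topology" where
  "orbifold_topology \<Gamma> = quotient_topology (top_of_set H3) (orbit \<Gamma>)"

text \<open>The closed oriented hyperbolic 3-orbifold \<open>\<Gamma>\<setminus>H\<^sup>3\<close> is represented by the group \<open>\<Gamma>\<close>.\<close>

definition closed_hyp_3_orbifold :: "(complex^2^2) set set \<Rightarrow> bool" where
  "closed_hyp_3_orbifold \<Gamma> \<longleftrightarrow>
     discrete_subgroup_PSL2C \<Gamma> \<and> compact_space (orbifold_topology \<Gamma>)"

definition strict_fundamental_domain :: "(complex^2^2) set set \<Rightarrow> point3 set \<Rightarrow> bool" where
  "strict_fundamental_domain \<Gamma> D \<longleftrightarrow>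
     D \<in> sets borel \<and> D \<subseteq> H3 \<and> (\<forall>p\<in>H3. \<exists>!q. q \<in> D \<and> q \<in> orbit \<Gamma> p)"

text \<open>For discrete \<open>\<Gamma>\<close> a Borel strict fundamental domain exists, and its volume
  does not depend on the choice, since \<open>\<Gamma>\<close> is countable and preserves the hyperbolic volume.\<close>

definition orbifold_volume :: "(complex^2^2) set set \<Rightarrow> real" where
  "orbifold_volume \<Gamma> =
     (THE V. \<exists>D. strict_fundamental_domain \<Gamma> D \<and> V = measure hyp_volume D)"

section \<open>The Laplace--Beltrami operator and its eigenvalues\<close>

fun C_k_on :: "nat \<Rightarrow> ('a::euclidean_space \<Rightarrow> real) \<Rightarrow> 'a set \<Rightarrow> bool" where
  "C_k_on 0 f S \<longleftrightarrow> continuous_on S f"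
| "C_k_on (Suc k) f S \<longleftrightarrow>
     f differentiable_on S \<and> (\<forall>b\<in>Basis. C_k_on k (\<lambda>x. frechet_derivative f (at x) b) S)"

text \<open>Only meant for open \<open>S\<close>.\<close>

definition smooth_on :: "('a::euclidean_space \<Rightarrow> real) \<Rightarrow> 'a set \<Rightarrow> bool" where
  "smooth_on f S \<longleftrightarrow> (\<forall>k. C_k_on k f S)"

definition hyp_grad :: "(point3 \<Rightarrow> real) \<Rightarrow> point3 \<Rightarrow> point3" where
  "hyp_grad f p = (\<Sum>b\<in>Basis. ((snd p)\<^sup>2 * frechet_derivative f (at p) b) *\<^sub>R b)"

lemma hyp_metric_hyp_grad:
  assumes "p \<in> H3" "f differentiable (at p)"
  shows "hyp_metric p (hyp_grad f p) v = frechet_derivative f (at p) v"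
proof -
  interpret bounded_linear "frechet_derivative f (at p)"
    using assms(2) by (metis frechet_derivative_works has_derivative_bounded_linear)
  have "frechet_derivative f (at p) v = frechet_derivative f (at p) (\<Sum>b\<in>Basis. (v \<bullet> b) *\<^sub>R b)"
    by (simp add: euclidean_representation)
  also have "\<dots> = (\<Sum>b\<in>Basis. (v \<bullet> b) * frechet_derivative f (at p) b)"
    by (simp only: sum scaleR real_scaleR_def)
  finally have eq: "frechet_derivative f (at p) v = \<dots>" .
  have "hyp_grad f p \<bullet> v = (\<Sum>b\<in>Basis. (snd p)\<^sup>2 * ((v \<bullet> b) * frechet_derivative f (at p) b))"
    unfolding hyp_grad_def inner_sum_left
    by (rule sum.cong[OF refl]) (simp add: inner_commute[of v] mult_ac)
  then show ?thesis
    using assms(1) by (simp add: hyp_metric_def H3_def eq flip: sum_distrib_left)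
qed

text \<open>\<open>div X = (1 / sqrt (det g)) \<Sum>\<^sub>i \<partial>\<^sub>i (sqrt (det g) X\<^sub>i)\<close> with \<open>sqrt (det g) = 1 / t\<^sup>3\<close>.\<close>

definition hyp_div :: "(point3 \<Rightarrow> point3) \<Rightarrow> point3 \<Rightarrow> real" where
  "hyp_div X p =
     (snd p) ^ 3 * (\<Sum>b\<in>Basis. frechet_derivative (\<lambda>q. (X q \<bullet> b) / (snd q) ^ 3) (at p) b)"

definition laplace_beltrami :: "(point3 \<Rightarrow> real) \<Rightarrow> point3 \<Rightarrow> real" where
  "laplace_beltrami f p = - hyp_div (hyp_grad f) p"

text \<open>A function on \<open>\<Gamma>\<setminus>H\<^sup>3\<close> is a function of orbits; smoothness and the Laplacian are
  those of its lift to \<open>H\<^sup>3\<close>.\<close>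

definition orbifold_eigenvalue :: "(complex^2^2) set set \<Rightarrow> real \<Rightarrow> bool" where
  "orbifold_eigenvalue \<Gamma> \<mu> \<longleftrightarrow>
     (\<exists>f :: point3 set \<Rightarrow> real.
        smooth_on (\<lambda>p. f (orbit \<Gamma> p)) H3 \<and>
        (\<exists>p\<in>H3. f (orbit \<Gamma> p) \<noteq> 0) \<and>
        (\<forall>p\<in>H3. laplace_beltrami (\<lambda>q. f (orbit \<Gamma> q)) p = \<mu> * f (orbit \<Gamma> p)))"

text \<open>The least element exists because the spectrum of a closed orbifold is an unbounded
  discrete subset of the nonnegative reals.\<close>

definition first_nonzero_eigenvalue :: "(complex^2^2) set set \<Rightarrow> real" where
  "first_nonzero_eigenvalue \<Gamma> = (LEAST \<mu>. orbifold_eigenvalue \<Gamma> \<mu> \<and> \<mu> \<noteq> 0)"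

end

theory Submission
 imports Defs "HOL-Complex_Analysis.Great_Picard" "HOL-Real_Asymp.Real_Asymp"
begin

text \<open>Let \<open>k\<close> be a nonnegative compactly supported function of the hyperbolic distance and \<open>T\<close> the
 corresponding integral operator on \<open>\<Gamma>\<close>-invariant functions. By the mean value property an
 eigenfunction of the Laplacian with eigenvalue \<open>\<mu>\<close> is an eigenfunction of \<open>T\<close>, the eigenvalue \<open>h \<mu>\<close>
 being the spherical transform of \<open>k\<close>. If \<open>V k(0) > h 0\<close>, where \<open>V\<close> is the volume, the quadratic form
 of \<open>T\<close> is positive at a function concentrated near one orbit minus its mean. Compactness then gives a
 mean-zero eigenfunction of \<open>T\<close> with positive eigenvalue; smoothed by two further radial
 operators, its eigenspace is finite-dimensional and preserved by the Laplacian, which yields a nonzero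
 Laplace eigenvalue \<open>m\<close> with \<open>h m > 0\<close>. An explicit kernel supported in a ball of radius \<open>L\<close> slightly below
 \<open>ln V\<close> has \<open>h m \<le> 0\<close> as soon as \<open>m \<ge> 1 + R (2 \<pi> / L)\<^sup>2\<close> with \<open>R\<close> close to 1, and
 \<open>4 \<pi>\<^sup>2 < 54\<close>.

 The same operators show that the set of nonzero eigenvalues has a least element: normalized
 eigenfunctions whose eigenvalues approach the infimum are images of a bounded sequence under a compact operator, so
 they subconverge to a mean-zero eigenfunction, and the maximum principle excludes eigenvalue 0.\<close>

section \<open>Metric geometry and volume of the upper half-space\<close>

section \<open>Hyperbolic distance and isometries\<close>

text \<open>The sizes come from a balance. A kernel divided by sinh as below acts on constants by at
  most a multiple of L e^L, so V k(0) wins as long as L stays a fixed proportion below ln V. In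
  dimension three the spherical transform of k is the sine transform of k(cosh s) sinh s, and 2 pi /
  L is the frequency past which a suitable nonnegative profile on [0, L] has nonpositive transform.
  The difficulty lies in the analysis. No Hilbert space is built: functions are continuous and
  invariant, the inner product is an integral over a bounded fundamental domain, eigenvectors come
  from maximizing a Rayleigh quotient, and Arzela-Ascoli takes the place of completeness. Polar
  coordinates are avoided as well. Integrating an eigenfunction against (c - cosh d)_+^3 gives a
  function of c which, by Green's identity, solves the same singular differential equation as the
  corresponding integral of the spherical function; both vanish at c = 1 and are therefore
  proportional. Accordingly distances enter only through their hyperbolic cosine, a rational
  function of the coordinates.\<close>

definition cosh_dist :: "point3 \<Rightarrow> point3 \<Rightarrow> real" where
 "cosh_dist x y = ((norm (fst x - fst y))^2 + (snd x)^2 + (snd y)^2) / (2 * snd x * snd y)"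

lemma H3_iff: "p \<in> H3 \<longleftrightarrow> snd p > 0" by (simp add: H3_def)

lemma open_H3: "open H3"
proof -
 have "H3 = snd -` {0<..}" by (auto simp: H3_def)
 then show ?thesis by (metis open_vimage_snd open_greaterThan)
qed

lemma H3_borel [measurable]: "H3 \<in> sets borel" using open_H3 by auto

lemma cosh_dist_commute: "cosh_dist x y = cosh_dist y x" by (simp add: cosh_dist_def norm_minus_commute mult_ac add_ac)

lemma norm_point3: "(norm (p :: point3))^2 = (norm (fst p))^2 + (snd p)^2" by (simp add: norm_prod_def)

text \<open>The bridge between the Euclidean and the hyperbolic metric. Positivity and separation of
  points follow at once, and so does the conformal factor of a distance preserving map.\<close>

lemma cosh_dist_norm:
 assumes "x \<in> H3" "y \<in> H3"
 shows "(norm (x - y))^2 = 2 * snd x * snd y * (cosh_dist x y - 1)"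
proof -
 have "2 * snd x * snd y * cosh_dist x y = (norm (fst x - fst y))^2 + (snd x)^2 + (snd y)^2"
  using assms by (simp add: cosh_dist_def H3_iff)
 moreover have "(norm (x - y))^2 = (norm (fst x - fst y))^2 + (snd x - snd y)^2" unfolding norm_point3 by simp
 ultimately show ?thesis by (simp add: power2_diff algebra_simps)
qed

lemma cosh_dist_ge_1: "x \<in> H3 \<Longrightarrow> y \<in> H3 \<Longrightarrow> cosh_dist x y \<ge> 1"
 using cosh_dist_norm[of x y] by (smt (verit) H3_iff mult_pos_pos zero_le_power2 zero_less_mult_iff mult_less_0_iff)

lemma cosh_dist_eq_1_iff: "x \<in> H3 \<Longrightarrow> y \<in> H3 \<Longrightarrow> cosh_dist x y = 1 \<longleftrightarrow> x = y"
 using cosh_dist_norm[of x y] by (auto simp: H3_iff)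

lemma cosh_dist_self [simp]: "x \<in> H3 \<Longrightarrow> cosh_dist x x = 1" using cosh_dist_eq_1_iff by blast

text \<open>Differentiability is demanded because the volume is transported by a change of
  variables; the norm of the derivative is then determined by the preserved distances. Measurability
  concerns the whole space because maps are total functions.\<close>

definition hyp_isometry :: "(point3 \<Rightarrow> point3) \<Rightarrow> bool" where
 "hyp_isometry f \<longleftrightarrow> f \<in> borel_measurable borel \<and> bij_betw f H3 H3 \<and>
  (\<forall>x\<in>H3. f differentiable (at x)) \<and>
  (\<forall>x\<in>H3. \<forall>y\<in>H3. cosh_dist (f x) (f y) = cosh_dist x y)"

lemma hyp_isometryD:
 assumes "hyp_isometry f"
 shows "f \<in> borel_measurable borel" "bij_betw f H3 H3" "x \<in> H3 \<Longrightarrow> f differentiable (at x)"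
  "x \<in> H3 \<Longrightarrow> f x \<in> H3"
  "x \<in> H3 \<Longrightarrow> y \<in> H3 \<Longrightarrow> cosh_dist (f x) (f y) = cosh_dist x y" using assms by (auto simp: hyp_isometry_def bij_betw_def)

text \<open>Apply \<open>cosh_dist_norm\<close> to x and x + s h before and after the map. The
  factor \<open>cosh_dist - 1\<close> is common to both and cancels, so |f(x + s h) - f x|^2 / s^2
  tends to |h|^2 times the squared ratio of the heights.\<close>

lemma hyp_isometry_derivative:
 assumes f: "hyp_isometry f" and x: "x \<in> H3" and D: "(f has_derivative D) (at x)"
 shows "norm (D h) = (snd (f x) / snd x) * norm h"
proof -
 interpret D: bounded_linear D using D by (rule has_derivative_bounded_linear)
 define g where "g s = f (x + s *\<^sub>R h)" for s :: real
 have g0: "g 0 = f x" by (simp add: g_def)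
 have fx: "f x \<in> H3" using f x by (simp add: hyp_isometryD)
 have curve: "((\<lambda>s::real. x + s *\<^sub>R h) has_derivative (\<lambda>s. s *\<^sub>R h)) (at 0)" by (auto intro!: derivative_eq_intros)
 have g': "(g has_derivative (\<lambda>s. D (s *\<^sub>R h))) (at 0)"
  unfolding g_def by (rule has_derivative_compose[OF curve]) (use D in simp)
 have lim0: "(\<lambda>s. norm (g s - g 0 - D (s *\<^sub>R h)) / norm s) \<midarrow>0\<rightarrow> 0" using g' by (simp add: has_derivative_at)
 have lim1: "((\<lambda>s. norm (g s - g 0) / \<bar>s\<bar>) \<longlongrightarrow> norm (D h)) (at 0)"
 proof -
  have "((\<lambda>s. norm (g s - g 0) / \<bar>s\<bar> - norm (D h)) \<longlongrightarrow> 0) (at 0)"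
  proof (rule Lim_null_comparison[OF _ lim0])
   have "norm (norm (g s - g 0) / \<bar>s\<bar> - norm (D h)) \<le> norm (g s - g 0 - D (s *\<^sub>R h)) / norm s"
    if "s \<noteq> 0" for s
   proof -
    have "norm (D h) = norm (D (s *\<^sub>R h)) / \<bar>s\<bar>" using that by (simp add: D.scaleR)
    then have "norm (g s - g 0) / \<bar>s\<bar> - norm (D h) = (norm (g s - g 0) - norm (D (s *\<^sub>R h))) / \<bar>s\<bar>"
     by (simp add: diff_divide_distrib)
    then show ?thesis using norm_triangle_ineq3[of "g s - g 0" "D (s *\<^sub>R h)"] by (simp add: divide_right_mono)
   qed
   then show "\<forall>\<^sub>F s in at 0. norm (norm (g s - g 0) / \<bar>s\<bar> - norm (D h)) \<le> norm (g s - g 0 - D (s *\<^sub>R h)) / norm s"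
    by (auto simp: eventually_at_filter)
  qed
  then show ?thesis by (simp add: LIM_zero_iff)
 qed
 have ev: "\<forall>\<^sub>F s in at 0. x + s *\<^sub>R h \<in> H3"
 proof -
  have "((\<lambda>s. x + s *\<^sub>R h) \<longlongrightarrow> x) (at (0::real))" by (auto intro!: tendsto_eq_intros)
  then show ?thesis using open_H3 x by (rule topological_tendstoD)
 qed
 have lim2: "((\<lambda>s. snd (f x) * snd (g s) / (snd x * snd (x + s *\<^sub>R h)) * (norm h)^2)
   \<longlongrightarrow> snd (f x) * snd (f x) / (snd x * snd x) * (norm h)^2) (at 0)"
 proof -
  have "isCont g 0" using g' by (rule has_derivative_continuous)
  then have "(g \<longlongrightarrow> f x) (at 0)" by (simp add: isCont_def g0)
  then show ?thesis using x by (auto intro!: tendsto_eq_intros simp: H3_iff)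
 qed
 have "((\<lambda>s. (norm (g s - g 0) / \<bar>s\<bar>)^2) \<longlongrightarrow> (norm (D h))^2) (at 0)" by (intro tendsto_power lim1)
 moreover have "\<forall>\<^sub>F s in at 0. (norm (g s - g 0) / \<bar>s\<bar>)^2 =
   snd (f x) * snd (g s) / (snd x * snd (x + s *\<^sub>R h)) * (norm h)^2" using ev eventually_neq_at_within[of 0 0 UNIV]
 proof eventually_elim
  case (elim s)
  have 1: "(norm (g s - g 0))^2 = 2 * snd (g s) * snd (f x) * (cosh_dist (x + s *\<^sub>R h) x - 1)"
   using cosh_dist_norm[of "g s" "f x"] elim f x by (simp add: g_def hyp_isometryD)
  have "(norm (s *\<^sub>R h))^2 = 2 * snd (x + s *\<^sub>R h) * snd x * (cosh_dist (x + s *\<^sub>R h) x - 1)"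
   using cosh_dist_norm[of "x + s *\<^sub>R h" x] elim x by simp
  moreover have "2 * snd (x + s *\<^sub>R h) * snd x \<noteq> 0" using elim x by (simp add: H3_iff)
  ultimately have 2: "cosh_dist (x + s *\<^sub>R h) x - 1 = s^2 * (norm h)^2 / (2 * snd (x + s *\<^sub>R h) * snd x)"
   by (metis mult.commute nonzero_eq_divide_eq norm_scaleR power2_abs power_mult_distrib)
  show ?case
  proof -
   have aux: "2 * p * q * (s^2 * n / (2 * a * b)) / \<bar>s\<bar>^2 = q * p / (b * a) * n" for p q n a b :: real
    using elim by (simp add: mult_ac)
   show ?thesis unfolding power_divide 1 2 by (rule aux)
  qed
 qed
 ultimately have "((\<lambda>s. snd (f x) * snd (g s) / (snd x * snd (x + s *\<^sub>R h)) * (norm h)^2)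
   \<longlongrightarrow> (norm (D h))^2) (at 0)" by (rule Lim_transform_eventually)
 then have "(norm (D h))^2 = snd (f x) * snd (f x) / (snd x * snd x) * (norm h)^2"
  by (rule tendsto_unique[OF at_neq_bot _ lim2])
 also have "\<dots> = ((snd (f x) / snd x) * norm h)^2" by (simp add: power2_eq_square)
 finally show ?thesis using x fx by (simp add: H3_iff power2_eq_iff_nonneg)
qed

section \<open>Coordinates\<close>

lemma Basis_point3: "(Basis :: point3 set) = {(1, 0), (\<i>, 0), (0, 1)}" by (auto simp: Basis_prod_def Basis_complex_def)

lemma sum_Basis_point3: "(\<Sum>b\<in>Basis. g (b :: point3)) = g (1, 0) + g (\<i>, 0) + g (0, 1)"
 unfolding Basis_point3 by (subst sum.insert; simp)+ (simp add: add_ac)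

lemma prod_Basis_point3: "(\<Prod>b\<in>Basis. g (b :: point3)) = g (1, 0) * g (\<i>, 0) * g (0, 1)"
 unfolding Basis_point3 by (subst prod.insert; simp)+ (simp add: mult_ac)

text \<open>Determinants and the change of variables formula live on \<open>real^3\<close>, so the
  volume is carried there and back by this linear isometry.\<close>

definition of_vec3 :: "real^3 \<Rightarrow> point3" where
 "of_vec3 v = (Complex (v$1) (v$2), v$3)"

definition to_vec3 :: "point3 \<Rightarrow> real^3" where
 "to_vec3 p = vector [Re (fst p), Im (fst p), snd p]"

lemma to_vec3_inverse [simp]: "of_vec3 (to_vec3 p) = p" by (simp add: of_vec3_def to_vec3_def vector_3)

lemma of_vec3_inverse [simp]: "to_vec3 (of_vec3 v) = v"
 by (simp add: of_vec3_def to_vec3_def vector_3 vec_eq_iff forall_3)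

lemma linear_of_vec3: "linear of_vec3" by (rule linearI) (simp_all add: of_vec3_def complex_eq_iff)

lemma linear_to_vec3: "linear to_vec3" by (rule linearI) (simp_all add: to_vec3_def vec_eq_iff forall_3 vector_3)

lemma norm_of_vec3 [simp]: "norm (of_vec3 v) = norm v"
proof -
 have "(norm (of_vec3 v))^2 = (norm v)^2"
  unfolding norm_point3 by (simp add: of_vec3_def cmod_power2 norm_vec_def L2_set_def sum_3 real_sqrt_pow2_iff add_nonneg_nonneg)
 then show ?thesis by (simp add: power2_eq_iff_nonneg)
qed

lemma norm_to_vec3 [simp]: "norm (to_vec3 p) = norm p" by (metis norm_of_vec3 to_vec3_inverse)

lemma bounded_linear_of_vec3: "bounded_linear of_vec3" using linear_of_vec3 linear_conv_bounded_linear by blast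

lemma bounded_linear_to_vec3: "bounded_linear to_vec3" using linear_to_vec3 linear_conv_bounded_linear by blast

lemma of_vec3_measurable [measurable]: "of_vec3 \<in> borel_measurable borel"
 by (intro borel_measurable_continuous_onI linear_continuous_on bounded_linear_of_vec3)

lemma to_vec3_measurable [measurable]: "to_vec3 \<in> borel_measurable borel"
 by (intro borel_measurable_continuous_onI linear_continuous_on bounded_linear_to_vec3)

lemma prod_Basis_vec3: "(\<Prod>b\<in>Basis. g (b :: real^3)) = g (axis 1 1) * g (axis 2 1) * g (axis 3 1)"
proof -
 have B: "(Basis :: (real^3) set) = {axis 1 1, axis 2 1, axis 3 1}" by (auto simp: Basis_vec_def) (metis exhaust_3)
 have "axis 1 1 \<noteq> (axis 2 1 :: real^3)" "axis 1 1 \<noteq> (axis 3 1 :: real^3)" "axis 2 1 \<noteq> (axis 3 1 :: real^3)"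
  by (simp_all add: axis_eq_axis)
 then show ?thesis unfolding B by (simp add: mult_ac)
qed

lemma distr_of_vec3: "distr lborel borel of_vec3 = lborel"
proof (rule lborel_eqI[symmetric])
 fix l u :: point3 assume le: "\<And>b. b \<in> Basis \<Longrightarrow> l \<bullet> b \<le> u \<bullet> b"
 have box: "of_vec3 -` box l u = box (to_vec3 l) (to_vec3 u)"
  by (auto simp: mem_box of_vec3_def to_vec3_def Basis_point3 Basis_vec_def vector_3 inner_axis inner_axis' forall_3 inner_complex_def inner_prod_def)
 have "to_vec3 l $ i \<le> to_vec3 u $ i" for i using le[of "(1,0)"] le[of "(\<i>,0)"] le[of "(0,1)"] exhaust_3[of i]
  by (auto simp: Basis_point3 inner_complex_def inner_prod_def to_vec3_def vector_3)
 then have "(to_vec3 l) \<bullet> b \<le> (to_vec3 u) \<bullet> b" if "b \<in> Basis" for b using that by (auto simp: Basis_vec_def inner_axis)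
 with box have "emeasure (distr lborel borel of_vec3) (box l u) = (\<Prod>b\<in>Basis. (to_vec3 u - to_vec3 l) \<bullet> b)"
  by (simp add: emeasure_distr emeasure_lborel_box)
 also have "\<dots> = (\<Prod>b\<in>Basis. (u - l) \<bullet> b)"
  by (simp add: prod_Basis_point3 prod_Basis_vec3 inner_axis inner_axis' to_vec3_def vector_3 inner_complex_def inner_prod_def)
 finally show "emeasure (distr lborel borel of_vec3) (box l u) = (\<Prod>b\<in>Basis. (u - l) \<bullet> b)" .
qed simp

section \<open>Isometries preserve the volume\<close>

lemma fst_point3_measurable [measurable]: "(\<lambda>p::point3. fst p) \<in> borel_measurable borel"
 by (intro borel_measurable_continuous_onI continuous_intros)

lemma snd_point3_measurable [measurable]: "(\<lambda>p::point3. snd p) \<in> borel_measurable borel"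
 by (intro borel_measurable_continuous_onI continuous_intros)

lemma sets_hyp_volume [simp, measurable_cong]: "sets hyp_volume = sets borel" by (simp add: hyp_volume_def)

lemma space_hyp_volume [simp]: "space hyp_volume = UNIV" by (simp add: hyp_volume_def)

lemma hyp_density_measurable [measurable]:
 "(\<lambda>p::point3. indicator H3 p * ennreal (1 / (snd p) ^ 3)) \<in> borel_measurable borel" by measurable

lemma emeasure_hyp_volume:
 assumes [measurable]: "B \<in> sets borel" and "B \<subseteq> H3"
 shows "emeasure hyp_volume B =
  (\<integral>\<^sup>+v. ennreal (1 / (v $ 3) ^ 3) * indicator (of_vec3 -` B) v \<partial>lborel)"
proof -
 have "emeasure hyp_volume B =
   (\<integral>\<^sup>+p. indicator H3 p * ennreal (1 / (snd p) ^ 3) * indicator B p \<partial>distr lborel borel of_vec3)"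
  unfolding hyp_volume_def distr_of_vec3 by (subst emeasure_density) auto
 also have "\<dots> = (\<integral>\<^sup>+v. indicator H3 (of_vec3 v) * ennreal (1 / (snd (of_vec3 v)) ^ 3) * indicator B (of_vec3 v) \<partial>lborel)"
  by (rule nn_integral_distr) measurable
 also have "\<dots> = (\<integral>\<^sup>+v. ennreal (1 / (v $ 3) ^ 3) * indicator (of_vec3 -` B) v \<partial>lborel)"
  using assms(2) by (intro nn_integral_cong) (auto simp: indicator_def of_vec3_def)
 finally show ?thesis .
qed

text \<open>Such a map is c times an orthogonal one; the exponent is the dimension.\<close>

lemma conformal_det:
 fixes F :: "real^3 \<Rightarrow> real^3"
 assumes "linear F" "\<And>h. norm (F h) = c * norm h" "c > 0"
 shows "\<bar>det (matrix F)\<bar> = c ^ 3"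
proof -
 define Q where "Q h = (1 / c) *\<^sub>R F h" for h
 have linQ: "linear Q" using assms(1) by (auto simp: Q_def linear_iff scaleR_add_right)
 have "orthogonal_transformation Q" unfolding orthogonal_transformation using linQ assms by (simp add: Q_def)
 then have detQ: "\<bar>det (matrix Q)\<bar> = 1" by simp
 have "F = (*\<^sub>R) c \<circ> Q" using assms(3) by (auto simp: Q_def)
 then have "matrix F = matrix ((*\<^sub>R) c) ** matrix Q"
  using matrix_compose[OF linQ, of "(*\<^sub>R) c"] by (simp add: linear_scale_self)
 then show ?thesis using detQ assms(3) by (simp add: det_mul abs_mult)
qed

text \<open>The Jacobian is the cube of the ratio of heights, which is exactly the factor by which
  the density 1 / t^3 changes. Finite volume makes the density absolutely integrable, as the change
  of variables formula requires; \<open>hyp_isometry_distr\<close> removes this restriction by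
  exhaustion.\<close>

lemma hyp_isometry_emeasure_finite:
 assumes f: "hyp_isometry f" and C [measurable]: "C \<in> sets borel" and CH: "C \<subseteq> H3" and fin: "emeasure hyp_volume C < \<infinity>"
 shows "emeasure hyp_volume (f -` C \<inter> H3) = emeasure hyp_volume C"
proof -
 note [measurable] = hyp_isometryD(1)[OF f]
 define S where "S = of_vec3 -` (f -` C \<inter> H3)"
 define T where "T = of_vec3 -` C"
 define F where "F = (\<lambda>v. to_vec3 (f (of_vec3 v)))"
 define w where "w v = 1 / (v $ 3) ^ 3" for v :: "real^3"
 define f' where "f' x = (SOME D. (f has_derivative D) (at x))" for x
 have f': "(f has_derivative f' x) (at x)" if "x \<in> H3" for x
  using hyp_isometryD(3)[OF f that] unfolding f'_def differentiable_def by (rule someI_ex)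
 define F' where "F' v h = to_vec3 (f' (of_vec3 v) (of_vec3 h))" for v h
 have SH: "of_vec3 v \<in> H3" if "v \<in> S" for v using that by (auto simp: S_def)
 have [measurable]: "S \<in> sets borel" "T \<in> sets borel"
  unfolding S_def T_def by (rule measurable_sets_borel[of _ borel]; measurable)+
 have FS: "F ` S = T"
 proof (intro equalityI subsetI)
  fix v assume "v \<in> T"
  then have "of_vec3 v \<in> C" by (simp add: T_def)
  then obtain x where "x \<in> H3" "f x = of_vec3 v"
   using hyp_isometryD(2)[OF f] CH by (metis (no_types, opaque_lifting) bij_betw_imp_surj_on imageE subsetD)
  with \<open>of_vec3 v \<in> C\<close> have "to_vec3 x \<in> S" "F (to_vec3 x) = v" by (auto simp: S_def F_def)
  then show "v \<in> F ` S" by blast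
 qed (auto simp: S_def T_def F_def)
 have der: "(F has_derivative F' v) (at v within S)" if "v \<in> S" for v
 proof -
  have "((\<lambda>v. f (of_vec3 v)) has_derivative (\<lambda>h. f' (of_vec3 v) (of_vec3 h))) (at v within S)"
   by (rule has_derivative_compose[OF bounded_linear_imp_has_derivative[OF bounded_linear_of_vec3] f'[OF SH[OF that]]])
  then show ?thesis unfolding F_def F'_def by (rule bounded_linear.has_derivative[OF bounded_linear_to_vec3])
 qed
 have inj: "inj_on F S"
 proof (rule inj_onI)
  fix v v' assume v: "v \<in> S" "v' \<in> S" and "F v = F v'"
  then have "f (of_vec3 v) = f (of_vec3 v')" by (metis F_def to_vec3_inverse)
  then have "of_vec3 v = of_vec3 v'" using hyp_isometryD(2)[OF f] SH v by (meson bij_betw_imp_inj_on inj_onD)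
  then show "v = v'" by (metis of_vec3_inverse)
 qed
 have det: "\<bar>det (matrix (F' v))\<bar> * w (F v) = w v" if "v \<in> S" for v
 proof -
  let ?x = "of_vec3 v"
  have x: "?x \<in> H3" "f ?x \<in> H3" using SH[OF that] hyp_isometryD(4)[OF f] by auto
  have "linear (F' v)" using der[OF that] has_derivative_linear by blast
  moreover have "norm (F' v h) = (snd (f ?x) / snd ?x) * norm h" for h
   using hyp_isometry_derivative[OF f x(1) f'[OF x(1)], of "of_vec3 h"] by (simp add: F'_def)
  ultimately have "\<bar>det (matrix (F' v))\<bar> = (snd (f ?x) / snd ?x) ^ 3"
   by (rule conformal_det) (use x in \<open>auto simp: H3_iff\<close>)
  then show ?thesis using x by (simp add: w_def F_def to_vec3_def vector_3 H3_iff of_vec3_def power_divide)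
 qed
 define b where "b = enn2real (emeasure hyp_volume C)"
 have w_nonneg: "w v \<ge> 0" if "v \<in> S \<union> T" for v using that CH by (auto simp: w_def S_def T_def H3_iff of_vec3_def)
 have "(\<integral>\<^sup>+v. ennreal (indicator T v * w v) \<partial>lborel) = ennreal b"
 proof -
  have "emeasure hyp_volume C = (\<integral>\<^sup>+v. ennreal (indicator T v * w v) \<partial>lborel)" unfolding emeasure_hyp_volume[OF C CH]
   by (intro nn_integral_cong) (auto simp: T_def w_def indicator_def)
  then show ?thesis using fin by (simp add: b_def less_top)
 qed
 then have "((\<lambda>v. indicator T v * w v) has_integral b) UNIV"
  by (intro nn_integral_has_integral) (use w_nonneg in \<open>auto simp: w_def b_def indicator_def\<close>)
 moreover have "(\<lambda>v. indicator T v * w v) = (\<lambda>v. if v \<in> T then w v else 0)" by auto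
 ultimately have wT: "(w has_integral b) T" by (simp add: has_integral_restrict_UNIV)
 have "S \<in> sets lebesgue" by (simp add: sets_completionI_sets)
 \<comment> \<open>The formula is stated for vector valued integrands, so the scalar density is
   passed as a vector of length one.\<close>
 have "(\<lambda>v. \<bar>det (matrix (F' v))\<bar> * w (F v)) absolutely_integrable_on S \<and>
    integral S (\<lambda>v. \<bar>det (matrix (F' v))\<bar> * w (F v)) = b
  \<longleftrightarrow> w absolutely_integrable_on T \<and> integral T w = b"
  using has_absolute_integral_change_of_variables[OF \<open>S \<in> sets lebesgue\<close> der inj, of "\<lambda>v. vec (w v) :: real^1" "vec b"]
  unfolding FS absolutely_integrable_on_1_iff integral_on_1_eq by simp
 moreover have "w absolutely_integrable_on T \<and> integral T w = b"
  using wT w_nonneg by (auto intro: nonnegative_absolutely_integrable_1)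
 ultimately have *: "(\<lambda>v. \<bar>det (matrix (F' v))\<bar> * w (F v)) integrable_on S"
  "integral S (\<lambda>v. \<bar>det (matrix (F' v))\<bar> * w (F v)) = b" by (auto simp: absolutely_integrable_on_def)
 then have "((\<lambda>v. \<bar>det (matrix (F' v))\<bar> * w (F v)) has_integral b) S" using integrable_integral by blast
 then have "(w has_integral b) S" by (rule has_integral_eq[rotated]) (simp add: det)
 then have "(\<integral>\<^sup>+v. ennreal (w v) * indicator S v \<partial>lborel) = ennreal b"
  by (rule nn_integral_has_integral_lebesgue'[rotated]) (simp add: w_nonneg)
 then have "emeasure hyp_volume (f -` C \<inter> H3) = ennreal b"
  by (subst emeasure_hyp_volume) (auto simp: S_def w_def measurable_sets_borel)
 then show ?thesis using fin by (simp add: b_def less_top)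
qed

lemma hyp_volume_outside: "AE p in hyp_volume. p \<in> H3"
 unfolding hyp_volume_def by (subst AE_density) (auto simp: indicator_def)

definition H3_exhaust :: "nat \<Rightarrow> point3 set" where
 "H3_exhaust n = {p. norm p \<le> real n \<and> snd p \<ge> 1 / real (Suc n)}"

lemma H3_exhaust_subset: "H3_exhaust n \<subseteq> H3"
 by (auto simp: H3_exhaust_def H3_def intro: less_le_trans[of 0 "1 / real (Suc n)"])

lemma H3_exhaust_borel [measurable]: "H3_exhaust n \<in> sets borel" unfolding H3_exhaust_def by measurable

lemma incseq_H3_exhaust: "incseq H3_exhaust"
proof (rule incseq_SucI)
 fix n
 have "1 / real (Suc (Suc n)) \<le> 1 / real (Suc n)" by (simp add: field_simps)
 then show "H3_exhaust n \<subseteq> H3_exhaust (Suc n)" unfolding H3_exhaust_def by auto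
qed

lemma H3_exhaust_compact_subset:
 assumes "compact K" "K \<subseteq> H3"
 shows "\<exists>n. K \<subseteq> H3_exhaust n"
proof (cases "K = {}")
 case False
 obtain B where B: "\<And>p. p \<in> K \<Longrightarrow> norm p \<le> B" using compact_imp_bounded[OF assms(1)] by (auto simp: bounded_iff)
 obtain q where q: "q \<in> K" "\<And>p. p \<in> K \<Longrightarrow> snd q \<le> snd p"
  using continuous_attains_inf[OF assms(1) False, of snd] continuous_on_snd[OF continuous_on_id] by metis
 have "snd q > 0" using q assms by (auto simp: H3_iff)
 then obtain m where m: "1 / real (Suc m) < snd q" using nat_approx_posE by blast
 obtain k where k: "B \<le> real k" using real_arch_simple by blast
 have "K \<subseteq> H3_exhaust (max m k)"
 proof
  fix p assume p: "p \<in> K"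
  have "1 / real (Suc (max m k)) \<le> 1 / real (Suc m)" by (simp add: field_simps)
  with p m k B[OF p] q(2)[OF p] show "p \<in> H3_exhaust (max m k)" unfolding H3_exhaust_def by auto
 qed
 then show ?thesis by blast
qed auto

lemma UN_H3_exhaust: "(\<Union>n. H3_exhaust n) = H3" using H3_exhaust_subset H3_exhaust_compact_subset[of "{p}" for p] by auto

lemma emeasure_H3_exhaust: "emeasure hyp_volume (H3_exhaust n) < \<infinity>"
proof -
 have "emeasure hyp_volume (H3_exhaust n) =
  (\<integral>\<^sup>+p. indicator H3 p * ennreal (1 / (snd p) ^ 3) * indicator (H3_exhaust n) p \<partial>lborel)"
  unfolding hyp_volume_def by (rule emeasure_density) auto
 also have "\<dots> \<le> (\<integral>\<^sup>+p. ennreal (real (Suc n) ^ 3) * indicator (cball (0::point3) (real n)) p \<partial>lborel)"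
 proof (rule nn_integral_mono_AE, rule AE_I2)
  fix p :: point3
  show "indicator H3 p * ennreal (1 / (snd p) ^ 3) * indicator (H3_exhaust n) p \<le>
    ennreal (real (Suc n) ^ 3) * indicator (cball 0 (real n)) p"
  proof (cases "p \<in> H3_exhaust n")
   case True
   then have "p \<in> H3" using H3_exhaust_subset by blast
   with True have p: "snd p > 0" "p \<in> H3" "1 / real (Suc n) \<le> snd p" "norm p \<le> real n"
    by (simp_all add: H3_exhaust_def H3_iff)
   then have "1 / snd p \<le> real (Suc n)" by (simp add: field_simps)
   then have "(1 / snd p) ^ 3 \<le> real (Suc n) ^ 3" using p by (intro power_mono) auto
   then show ?thesis using p True by (auto simp: power_divide intro!: ennreal_leI)
  qed simp
 qed
 also have "\<dots> = ennreal (real (Suc n) ^ 3) * emeasure lborel (cball (0::point3) (real n))"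
  by (subst nn_integral_cmult_indicator) auto
 also have "\<dots> < \<infinity>" using emeasure_bounded_finite[of "cball (0::point3) (real n)"] by (auto simp: ennreal_mult_less_top)
 finally show ?thesis .
qed

theorem hyp_isometry_distr:
 assumes f: "hyp_isometry f"
 shows "distr hyp_volume borel f = hyp_volume"
proof (rule measure_eqI)
 note [measurable] = hyp_isometryD(1)[OF f]
 fix A assume "A \<in> sets (distr hyp_volume borel f)"
 then have [measurable]: "A \<in> sets borel" by simp
 have inc: "incseq (\<lambda>n. A \<inter> H3_exhaust n)" "incseq (\<lambda>n. f -` (A \<inter> H3_exhaust n) \<inter> H3)"
  using incseq_H3_exhaust unfolding incseq_def by blast+
 have meas: "f -` (A \<inter> H3_exhaust n) \<inter> H3 \<in> sets borel" for n by (auto intro!: measurable_sets_borel)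
 have "emeasure hyp_volume (A \<inter> H3) = emeasure hyp_volume (\<Union>n. A \<inter> H3_exhaust n)"
  by (rule arg_cong[of _ _ "emeasure hyp_volume"]) (simp flip: UN_H3_exhaust)
 also have "\<dots> = (SUP n. emeasure hyp_volume (A \<inter> H3_exhaust n))"
  using inc by (intro SUP_emeasure_incseq[symmetric]) auto
 also have "\<dots> = (SUP n. emeasure hyp_volume (f -` (A \<inter> H3_exhaust n) \<inter> H3))"
 proof (intro SUP_cong refl hyp_isometry_emeasure_finite[OF f, symmetric])
  fix n
  show "A \<inter> H3_exhaust n \<subseteq> H3" using H3_exhaust_subset by auto
  have "emeasure hyp_volume (A \<inter> H3_exhaust n) \<le> emeasure hyp_volume (H3_exhaust n)" by (intro emeasure_mono) auto
  then show "emeasure hyp_volume (A \<inter> H3_exhaust n) < \<infinity>" using emeasure_H3_exhaust[of n] by simp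
 qed auto
 also have "\<dots> = emeasure hyp_volume (\<Union>n. f -` (A \<inter> H3_exhaust n) \<inter> H3)"
  using inc meas by (intro SUP_emeasure_incseq) auto
 also have "(\<Union>n. f -` (A \<inter> H3_exhaust n) \<inter> H3) = f -` A \<inter> H3"
 proof -
  have "(\<Union>n. f -` (A \<inter> H3_exhaust n) \<inter> H3) = f -` (A \<inter> (\<Union>n. H3_exhaust n)) \<inter> H3" by (rule Set.set_eqI) simp
  moreover have "f -` (A \<inter> H3) \<inter> H3 = f -` A \<inter> H3" using hyp_isometryD(4)[OF f] by (simp add: set_eq_iff) metis
  ultimately show ?thesis unfolding UN_H3_exhaust by simp
 qed
 finally have "emeasure hyp_volume (A \<inter> H3) = emeasure hyp_volume (f -` A \<inter> H3)" .
 moreover have "emeasure hyp_volume (A \<inter> H3) = emeasure hyp_volume A"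
  using hyp_volume_outside by (intro emeasure_eq_AE) auto
 moreover have "emeasure hyp_volume (f -` A \<inter> H3) = emeasure hyp_volume (f -` A)"
 proof -
  have "f -` A \<in> sets borel" by (rule measurable_sets_borel[of _ borel]; measurable)
  then show ?thesis using hyp_volume_outside by (intro emeasure_eq_AE) auto
 qed
 ultimately show "emeasure (distr hyp_volume borel f) A = emeasure hyp_volume A" by (subst emeasure_distr) auto
qed simp

section \<open>The action by isometries\<close>

text \<open>The Hermitian model: \<open>H\<^sup>3\<close> is the set of positive definite Hermitian matrices of
 determinant 1, on which \<open>A\<close> acts by \<open>X \<mapsto> A X A\<^sup>*\<close>.\<close>

definition herm :: "point3 \<Rightarrow> complex^2^2" where
 "herm p = vector [vector [of_real (((norm (fst p))^2 + (snd p)^2) / snd p), fst p / of_real (snd p)],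
          vector [cnj (fst p) / of_real (snd p), of_real (1 / snd p)]]"

definition adj :: "complex^2^2 \<Rightarrow> complex^2^2" where
 "adj A = (\<chi> i j. cnj (A $ j $ i))"

lemma herm_simps:
 "herm p $ 1 $ 1 = of_real (((norm (fst p))^2 + (snd p)^2) / snd p)"
 "herm p $ 1 $ 2 = fst p / of_real (snd p)"
 "herm p $ 2 $ 1 = cnj (fst p) / of_real (snd p)"
 "herm p $ 2 $ 2 = of_real (1 / snd p)" by (simp_all add: herm_def)

lemma adj_mult: "adj (A ** B) = adj B ** adj A"
 by (simp add: adj_def matrix_matrix_mult_def vec_eq_iff forall_2 sum_2 mult.commute)

lemma det_adj: "det (adj A) = cnj (det A)" by (simp add: adj_def det_2 mult.commute)

lemma of_real_norm_square: "(complex_of_real (norm z))^2 = z * cnj z" by (metis complex_norm_square of_real_power)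

lemma matrix_mult_add_left: "((A::complex^2^2) + B) ** C = A ** C + B ** C"
 by (simp add: vec_eq_iff forall_2 matrix_matrix_mult_def sum_2 algebra_simps)

lemma matrix_mult_add_right: "(C::complex^2^2) ** (A + B) = C ** A + C ** B"
 by (simp add: vec_eq_iff forall_2 matrix_matrix_mult_def sum_2 algebra_simps)

lemma det_herm: "snd p > 0 \<Longrightarrow> det (herm p) = 1"
 by (simp add: det_2 herm_simps of_real_norm_square) (simp add: field_simps power2_eq_square)

lemma herm_inj: "p \<in> H3 \<Longrightarrow> q \<in> H3 \<Longrightarrow> herm p = herm q \<Longrightarrow> p = q"
proof -
 assume "p \<in> H3" "q \<in> H3" and eq: "herm p = herm q"
 have 22: "herm p $ 2 $ 2 = herm q $ 2 $ 2" and 12: "herm p $ 1 $ 2 = herm q $ 1 $ 2" using eq by auto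
 from 22 have "1 / snd p = 1 / snd q" unfolding herm_simps of_real_eq_iff .
 then have s: "snd p = snd q" by simp
 with 12 \<open>q \<in> H3\<close> have "fst p = fst q" by (simp add: herm_simps H3_iff)
 with s show "p = q" by (simp add: prod_eq_iff)
qed

lemma SL2C_denominator_pos:
 fixes A :: "complex^2^2"
 assumes "det A = 1" "p \<in> H3"
 shows "(norm (A$2$1 * fst p + A$2$2))^2 + (norm (A$2$1))^2 * (snd p)^2 > 0"
proof -
 have "A$2$1 \<noteq> 0 \<or> A$2$2 \<noteq> 0" using assms(1) by (auto simp: det_2)
 then show ?thesis using assms(2) by (cases "A$2$1 = 0") (auto simp: H3_def intro: add_nonneg_pos)
qed

text \<open>Three entries are computed directly. The upper left one, whose expansion would be the
  worst, follows from the other three because both sides have determinant 1.\<close>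

lemma herm_act:
 assumes A: "det A = 1" and p: "p \<in> H3"
 shows "herm (SL2C_act A p) = A ** herm p ** adj A"
proof -
 obtain z t where pzt: "p = (z, t)" by (cases p)
 have t: "t > 0" using p pzt by (simp add: H3_iff)
 define a b c d where abcd: "a = A$1$1" "b = A$1$2" "c = A$2$1" "d = A$2$2"
 define N where "N = (norm (c * z + d))^2 + (norm c)^2 * t^2"
 have N: "N > 0" using SL2C_denominator_pos[OF A p] by (simp add: N_def abcd pzt)
 define z' where "z' = ((a * z + b) * cnj (c * z + d) + a * cnj c * of_real (t^2)) / of_real N"
 define t' where "t' = t / N"
 have act: "SL2C_act A p = (z', t')" by (simp add: SL2C_act_def Let_def pzt abcd z'_def t'_def N_def)
 have t': "t' > 0" using t N by (simp add: t'_def)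
 define X where "X = A ** herm p ** adj A"
 have Nc: "complex_of_real N = (c * z + d) * cnj (c * z + d) + c * cnj c * of_real t * of_real t"
  by (simp add: N_def of_real_norm_square) (simp add: power2_eq_square algebra_simps)
 have X22: "X $ 2 $ 2 = of_real (1 / t')"
  using t by (simp add: X_def matrix_matrix_mult_def sum_2 adj_def herm_simps pzt t'_def Nc abcd
   of_real_norm_square) (simp add: field_simps power2_eq_square)
 have X12: "X $ 1 $ 2 = z' / of_real t'"
  using t N by (simp add: X_def matrix_matrix_mult_def sum_2 adj_def herm_simps pzt t'_def z'_def abcd
   of_real_norm_square) (simp add: field_simps power2_eq_square)
 have X21: "X $ 2 $ 1 = cnj z' / of_real t'"
  using t N by (simp add: X_def matrix_matrix_mult_def sum_2 adj_def herm_simps pzt t'_def z'_def abcd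
   of_real_norm_square) (simp add: field_simps power2_eq_square)
 have "det X = 1" using A det_herm[of p] p by (simp add: X_def det_mul det_adj H3_iff)
 then have "X $ 1 $ 1 * of_real (1 / t') - z' / of_real t' * (cnj z' / of_real t') = 1"
  by (simp only: det_2 X22 X12 X21)
 then have "X $ 1 $ 1 = of_real (((norm z')^2 + t'^2) / t')"
  using t' by (simp add: of_real_norm_square) (simp add: field_simps power2_eq_square)
 then have "herm (z', t') = X" by (simp add: vec_eq_iff forall_2 herm_simps X22 X12 X21)
 then show ?thesis by (simp add: act X_def)
qed

lemma act_H3: "det A = 1 \<Longrightarrow> p \<in> H3 \<Longrightarrow> SL2C_act A p \<in> H3" using SL2C_act_H3 by (simp add: SL2C_def)

lemma act_mult:
 assumes "det A = 1" "det B = 1" "p \<in> H3"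
 shows "SL2C_act (A ** B) p = SL2C_act A (SL2C_act B p)"
proof (rule herm_inj)
 show "herm (SL2C_act (A ** B) p) = herm (SL2C_act A (SL2C_act B p))"
  using assms by (simp add: herm_act act_H3 det_mul adj_mult matrix_mul_assoc)
qed (use assms in \<open>auto simp: act_H3 det_mul\<close>)

text \<open>Expresses the distance through a determinant of a sum, for which invariance under X
  \<mapsto> A X A* with det A = 1 is immediate by multiplicativity.\<close>

lemma cosh_dist_herm:
 assumes "x \<in> H3" "y \<in> H3"
 shows "complex_of_real (2 * cosh_dist x y) + 2 = det (herm x + herm y)"
proof -
 show ?thesis using assms by (simp add: cosh_dist_def det_2 herm_simps H3_iff of_real_norm_square)
   (simp add: field_simps power2_eq_square)
qed

lemma cosh_dist_act:
 assumes "det A = 1" "x \<in> H3" "y \<in> H3"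
 shows "cosh_dist (SL2C_act A x) (SL2C_act A y) = cosh_dist x y"
proof -
 have "complex_of_real (2 * cosh_dist (SL2C_act A x) (SL2C_act A y)) + 2 =
   det (herm (SL2C_act A x) + herm (SL2C_act A y))" using assms by (intro cosh_dist_herm) (auto simp: act_H3)
 also have "\<dots> = det (A ** (herm x + herm y) ** adj A)"
  using assms by (simp add: herm_act matrix_mult_add_left matrix_mult_add_right)
 also have "\<dots> = complex_of_real (2 * cosh_dist x y) + 2"
  using assms by (simp add: det_mul det_adj cosh_dist_herm del: of_real_mult)
 finally show ?thesis by (metis add_right_cancel mult_left_cancel of_real_eq_iff zero_neq_numeral)
qed

lemma sl2_inverse:
 fixes A :: "complex^2^2"
 assumes "det A = 1" obtains B where "det B = 1" "A ** B = mat 1" "B ** A = mat 1"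
proof -
 have "invertible A" using assms by (simp add: invertible_det_nz)
 then obtain B where B: "A ** B = mat 1" "B ** A = mat 1" by (auto simp: invertible_def)
 then have "det A * det B = 1" by (metis det_I det_mul)
 with B that assms show ?thesis by simp
qed

lemma act_measurable: "SL2C_act A \<in> borel_measurable borel"
proof -
 have "(\<lambda>p. ((A$1$1 * fst p + A$1$2) * cnj (A$2$1 * fst p + A$2$2) + A$1$1 * cnj (A$2$1) * of_real ((snd p)^2)) /
   of_real ((norm (A$2$1 * fst p + A$2$2))^2 + (norm (A$2$1))^2 * (snd p)^2) :: complex) \<in> borel_measurable borel"
  (is "?f \<in> _") by (intro borel_measurable_divide borel_measurable_continuous_onI continuous_intros)
 moreover have "(\<lambda>p. snd p / ((norm (A$2$1 * fst p + A$2$2))^2 + (norm (A$2$1))^2 * (snd p)^2)) \<in> borel_measurable (borel :: point3 measure)"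
  (is "?g \<in> _") by (intro borel_measurable_divide borel_measurable_continuous_onI continuous_intros)
 ultimately have "(\<lambda>p. (?f p, ?g p)) \<in> borel_measurable borel" by (rule borel_measurable_Pair)
 moreover have "SL2C_act A = (\<lambda>p. (?f p, ?g p))" by (simp add: fun_eq_iff SL2C_act_def Let_def)
 ultimately show ?thesis by simp
qed

lemma act_differentiable:
 assumes "det A = 1" "p \<in> H3"
 shows "SL2C_act A differentiable (at p)"
proof -
 have N: "(norm (A$2$1 * fst p + A$2$2))^2 + (norm (A$2$1))^2 * (snd p)^2 \<noteq> 0"
  using SL2C_denominator_pos[OF assms] by simp
 have 1: "(\<lambda>p. A$2$1 * fst p + A$2$2) differentiable (at p)" "(\<lambda>p. A$1$1 * fst p + A$1$2) differentiable (at p)"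
  "(\<lambda>p::point3. snd p) differentiable (at p)" for p :: point3
  by (auto intro!: derivative_intros simp: differentiable_def intro!: exI derivative_eq_intros)
 have cnj: "(\<lambda>p. cnj (f p)) differentiable (at p)" if "f differentiable (at p)" for f :: "point3 \<Rightarrow> complex"
  using that bounded_linear.has_derivative[OF bounded_linear_cnj] unfolding differentiable_def by blast
 have ofr: "(\<lambda>p. complex_of_real (f p)) differentiable (at p)" if "f differentiable (at p)" for f :: "point3 \<Rightarrow> real"
  using that bounded_linear.has_derivative[OF bounded_linear_of_real] unfolding differentiable_def by blast
 have pair: "(\<lambda>p. (f p, g p)) differentiable (at p)" if "f differentiable (at p)" "g differentiable (at p)"
  for f :: "point3 \<Rightarrow> complex" and g :: "point3 \<Rightarrow> real"
  using that has_derivative_Pair unfolding differentiable_def by blast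
 have nrm: "(norm z)^2 = z \<bullet> z" for z :: complex by (simp add: power2_norm_eq_inner)
 have "(\<lambda>p. (((A$1$1 * fst p + A$1$2) * cnj (A$2$1 * fst p + A$2$2) + A$1$1 * cnj (A$2$1) * of_real ((snd p)^2)) /
   of_real ((norm (A$2$1 * fst p + A$2$2))^2 + (norm (A$2$1))^2 * (snd p)^2),
   snd p / ((norm (A$2$1 * fst p + A$2$2))^2 + (norm (A$2$1))^2 * (snd p)^2))) differentiable (at p)"
 proof (rule pair)
  have D: "(\<lambda>p. (norm (A$2$1 * fst p + A$2$2))^2 + (norm (A$2$1))^2 * (snd p)^2) differentiable (at p)" unfolding nrm
   by (rule differentiable_add[OF differentiable_inner[OF 1(1) 1(1)]
      differentiable_mult[OF differentiable_const differentiable_power[OF 1(3)]]])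
  show "(\<lambda>p. snd p / ((norm (A$2$1 * fst p + A$2$2))^2 + (norm (A$2$1))^2 * (snd p)^2)) differentiable (at p)"
   by (rule differentiable_divide[OF 1(3) D N])
  show "(\<lambda>p. ((A$1$1 * fst p + A$1$2) * cnj (A$2$1 * fst p + A$2$2) + A$1$1 * cnj (A$2$1) * of_real ((snd p)^2)) /
   of_real ((norm (A$2$1 * fst p + A$2$2))^2 + (norm (A$2$1))^2 * (snd p)^2)) differentiable (at p)"
   by (rule differentiable_divide[OF differentiable_add[OF differentiable_mult[OF 1(2) cnj[OF 1(1)]]
     differentiable_mult[OF differentiable_const ofr[OF differentiable_power[OF 1(3)]]]] ofr[OF D]])
    (use N in \<open>simp only: of_real_eq_0_iff not_False_eq_True\<close>)
 qed
 moreover have "SL2C_act A = (\<lambda>p. (((A$1$1 * fst p + A$1$2) * cnj (A$2$1 * fst p + A$2$2) + A$1$1 * cnj (A$2$1) * of_real ((snd p)^2)) /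
   of_real ((norm (A$2$1 * fst p + A$2$2))^2 + (norm (A$2$1))^2 * (snd p)^2),
   snd p / ((norm (A$2$1 * fst p + A$2$2))^2 + (norm (A$2$1))^2 * (snd p)^2)))"
  by (simp add: fun_eq_iff SL2C_act_def Let_def)
 ultimately show ?thesis by simp
qed

lemma hyp_isometry_act:
 assumes "det A = 1"
 shows "hyp_isometry (SL2C_act A)" unfolding hyp_isometry_def
proof (intro conjI ballI)
 obtain B where B: "det B = 1" "A ** B = mat 1" "B ** A = mat 1" using sl2_inverse[OF assms] .
 show "bij_betw (SL2C_act A) H3 H3"
 proof (rule bij_betw_byWitness[where f' = "SL2C_act B"])
  show "\<forall>p\<in>H3. SL2C_act B (SL2C_act A p) = p" "\<forall>p\<in>H3. SL2C_act A (SL2C_act B p) = p"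
   using B assms by (simp_all add: SL2C_act_mat_1 flip: act_mult)
 qed (use assms B in \<open>auto simp: act_H3\<close>)
qed (use assms in \<open>auto simp: act_measurable act_differentiable cosh_dist_act\<close>)

text \<open>Inversion in the Euclidean sphere with centre (b, 0) and radius sqrt k. On the
  half-space it is the hyperbolic reflection in a hemisphere, so it reverses orientation and lies
  outside the given group of motions.\<close>

definition sphere_inversion :: "complex \<Rightarrow> real \<Rightarrow> point3 \<Rightarrow> point3" where
 "sphere_inversion b k p =
  (b + (k / ((norm (fst p - b))^2 + (snd p)^2)) *\<^sub>R (fst p - b), k * snd p / ((norm (fst p - b))^2 + (snd p)^2))"

lemma H3_dist_pos: "p \<in> H3 \<Longrightarrow> (norm (fst p - b))^2 + (snd p)^2 > 0" by (simp add: H3_iff add_nonneg_pos)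

lemma sphere_inversion_H3: "p \<in> H3 \<Longrightarrow> k > 0 \<Longrightarrow> sphere_inversion b k p \<in> H3"
 using H3_dist_pos[of p b] by (simp add: sphere_inversion_def H3_iff)

lemma sphere_inversion_involution:
 assumes "p \<in> H3" "k > 0"
 shows "sphere_inversion b k (sphere_inversion b k p) = p"
proof -
 define D where "D = (norm (fst p - b))^2 + (snd p)^2"
 have D: "D > 0" using H3_dist_pos[of p b] assms by (simp add: D_def)
 have f: "sphere_inversion b k p = (b + (k / D) *\<^sub>R (fst p - b), k * snd p / D)"
  by (simp add: sphere_inversion_def D_def)
 have "(norm ((k / D) *\<^sub>R (fst p - b)))^2 + (k * snd p / D)^2 = (k / D)^2 * D"
  by (simp add: D_def power_mult_distrib power_divide distrib_left)
 also have "\<dots> = k^2 / D" using D by (simp add: power2_eq_square)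
 finally have "(norm ((k / D) *\<^sub>R (fst p - b)))^2 + (k * snd p / D)^2 = k^2 / D" .
 then show ?thesis unfolding f unfolding sphere_inversion_def
  using D assms by (simp add: power2_eq_square prod_eq_iff del: norm_scaleR)
qed

lemma cosh_dist_sphere_inversion:
 assumes "x \<in> H3" "y \<in> H3" "k > 0"
 shows "cosh_dist (sphere_inversion b k x) (sphere_inversion b k y) = cosh_dist x y"
proof -
 define v w where "v = fst x - b" and "w = fst y - b"
 define D E where "D = (norm v)^2 + (snd x)^2" and "E = (norm w)^2 + (snd y)^2"
 have pos: "D > 0" "E > 0" "snd x > 0" "snd y > 0"
  using H3_dist_pos assms by (auto simp: D_def E_def v_def w_def H3_iff)
 have nd: "(norm (p - q))^2 = (norm p)^2 + (norm q)^2 - 2 * (p \<bullet> q)" for p q :: complex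
  by (simp add: power2_norm_eq_inner inner_diff inner_commute algebra_simps)
 have x': "sphere_inversion b k x = (b + (k / D) *\<^sub>R v, k * snd x / D)"
  and y': "sphere_inversion b k y = (b + (k / E) *\<^sub>R w, k * snd y / E)"
  by (simp_all add: sphere_inversion_def v_def w_def D_def E_def)
 have "(norm ((k / D) *\<^sub>R v - (k / E) *\<^sub>R w))^2 + (k * snd x / D)^2 + (k * snd y / E)^2
   = (k / D)^2 * D + (k / E)^2 * E - 2 * (k / D) * (k / E) * (v \<bullet> w)"
  unfolding nd by (simp add: D_def E_def power_mult_distrib power_divide add_divide_distrib algebra_simps)
 also have "\<dots> = (k^2 / (D * E)) * (E + D - 2 * (v \<bullet> w))" using pos by (simp add: power2_eq_square field_simps)
 also have "E + D - 2 * (v \<bullet> w) = (norm (v - w))^2 + (snd x)^2 + (snd y)^2" unfolding nd by (simp add: D_def E_def)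
 finally have "cosh_dist (sphere_inversion b k x) (sphere_inversion b k y) =
  (k^2 / (D * E)) * ((norm (v - w))^2 + (snd x)^2 + (snd y)^2) / (2 * (k * snd x / D) * (k * snd y / E))"
  unfolding x' y' cosh_dist_def by simp
 also have "\<dots> = ((norm (v - w))^2 + (snd x)^2 + (snd y)^2) / (2 * snd x * snd y)"
  using pos assms(3) by (simp add: power2_eq_square)
 finally show ?thesis by (simp add: cosh_dist_def v_def w_def)
qed

lemma hyp_isometry_involution:
 assumes "f \<in> borel_measurable borel" "\<And>p. p \<in> H3 \<Longrightarrow> f p \<in> H3" "\<And>p. p \<in> H3 \<Longrightarrow> f (f p) = p"
  "\<And>p. p \<in> H3 \<Longrightarrow> f differentiable (at p)"
  "\<And>x y. x \<in> H3 \<Longrightarrow> y \<in> H3 \<Longrightarrow> cosh_dist (f x) (f y) = cosh_dist x y"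
 shows "hyp_isometry f" unfolding hyp_isometry_def using assms by (auto intro!: bij_betw_byWitness[where f' = f])

lemma hyp_isometry_sphere_inversion:
 assumes k: "k > 0"
 shows "hyp_isometry (sphere_inversion b k)"
proof (rule hyp_isometry_involution)
 have eq: "sphere_inversion b k = (\<lambda>p. (b + (k / ((norm (fst p - b))^2 + (snd p)^2)) *\<^sub>R (fst p - b), k * snd p / ((norm (fst p - b))^2 + (snd p)^2)))"
  by (simp add: fun_eq_iff sphere_inversion_def)
 show "sphere_inversion b k \<in> borel_measurable borel"
  unfolding eq by (intro borel_measurable_Pair borel_measurable_add borel_measurable_scaleR
   borel_measurable_divide borel_measurable_const borel_measurable_continuous_onI continuous_intros)
 fix p :: point3 assume p: "p \<in> H3"
 have nz: "(fst p - b) \<bullet> (fst p - b) + (snd p)^2 \<noteq> 0" using H3_dist_pos[OF p, of b] by (simp add: power2_norm_eq_inner)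
 have 1: "(\<lambda>p. fst p - b) differentiable (at p)" "(\<lambda>p::point3. snd p) differentiable (at p)" for p :: point3
  by (auto simp: differentiable_def intro!: exI derivative_eq_intros)
 have pair: "(\<lambda>p. (f p, g p)) differentiable (at p)" if "f differentiable (at p)" "g differentiable (at p)"
  for f :: "point3 \<Rightarrow> complex" and g :: "point3 \<Rightarrow> real"
  using that has_derivative_Pair unfolding differentiable_def by blast
 show "sphere_inversion b k differentiable (at p)" unfolding eq power2_norm_eq_inner using nz
  by (intro pair differentiable_divide differentiable_add differentiable_mult differentiable_scaleR 1 differentiable_power differentiable_inner)
   (auto)
qed (use k in \<open>auto simp: sphere_inversion_H3 sphere_inversion_involution cosh_dist_sphere_inversion\<close>)

lemma hyp_isometry_reflect: "hyp_isometry (\<lambda>p. (c - fst p, snd p))"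
proof (rule hyp_isometry_involution)
 show "(\<lambda>p. (c - fst p, snd p)) \<in> borel_measurable (borel :: point3 measure)"
  by (intro borel_measurable_continuous_onI continuous_intros)
 show "(\<lambda>p. (c - fst p, snd p)) differentiable (at p)" for p :: point3
  by (auto simp: differentiable_def intro!: exI derivative_eq_intros)
qed (auto simp: H3_iff cosh_dist_def norm_minus_commute)

text \<open>Points of equal height are exchanged by a half-turn about a vertical axis, all others by
  an inversion. Exchanging the points, and not merely moving one to the other, is what later makes
  convolutions of radial kernels commute.\<close>

lemma swap_isometry:
 assumes x: "x \<in> H3" and y: "y \<in> H3" obtains f where "hyp_isometry f" "f x = y" "f y = x"
proof (cases "snd x = snd y")
 case True
 then show ?thesis by (intro that[OF hyp_isometry_reflect[of "fst x + fst y"]]) (auto simp: prod_eq_iff)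
next
 case False
 \<comment> \<open>The inversion multiplies x - (b, 0) by k / D. Comparing heights forces this
   factor to be c, and comparing horizontal parts then determines the centre b.\<close>
 define c where "c = snd y / snd x"
 have c: "c > 0" "c \<noteq> 1" "snd y = c * snd x" using x y False by (auto simp: c_def H3_iff)
 define b where "b = (1 / (1 - c)) *\<^sub>R (fst y - c *\<^sub>R fst x)"
 have "(1 - c) *\<^sub>R b = fst y - c *\<^sub>R fst x" using c by (simp add: b_def)
 then have b: "b + c *\<^sub>R (fst x - b) = fst y" by (simp add: algebra_simps)
 define D where "D = (norm (fst x - b))^2 + (snd x)^2"
 have D: "D > 0" using H3_dist_pos[OF x, of b] by (simp add: D_def)
 have fx: "sphere_inversion b (c * D) x = y"
  using D b c by (simp add: sphere_inversion_def D_def[symmetric] prod_eq_iff)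
 have "c * D > 0" using c D by simp
 moreover have "sphere_inversion b (c * D) y = x" using sphere_inversion_involution[OF x \<open>c * D > 0\<close>, of b] fx by simp
 ultimately show ?thesis using that[OF hyp_isometry_sphere_inversion fx] by blast
qed

definition base_point :: point3 where
 "base_point = (0, 1)"

lemma base_point_H3 [simp]: "base_point \<in> H3" by (simp add: base_point_def H3_iff)

lemma cosh_dist_base: "cosh_dist base_point y = ((norm (fst y))^2 + (snd y)^2 + 1) / (2 * snd y)"
 by (simp add: cosh_dist_def base_point_def add_ac)

text \<open>A multiplicative triangle inequality, namely cosh (a + b) \<le> 2 cosh a cosh b. It
  reduces to an elementary estimate after an isometry has moved x to the base point.\<close>

lemma cosh_dist_triangle:
 assumes x: "x \<in> H3" and y: "y \<in> H3" and z: "z \<in> H3"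
 shows "cosh_dist y z \<le> 2 * cosh_dist x y * cosh_dist x z"
proof -
 have base: "cosh_dist y z \<le> 2 * cosh_dist base_point y * cosh_dist base_point z" if y: "y \<in> H3" and z: "z \<in> H3" for y z
 proof -
  define a b where "a = norm (fst y)" and "b = norm (fst z)"
  have pos: "snd y > 0" "snd z > 0" using y z by (auto simp: H3_iff)
  have "norm (fst y - fst z) \<le> a + b" by (simp add: a_def b_def norm_triangle_ineq4)
  then have "(norm (fst y - fst z))^2 \<le> (a + b)^2" by (intro power_mono) auto
  also have "\<dots> \<le> a^2 + b^2 + a^2 * b^2 + 1"
   using zero_le_power2[of "a * b - 1"] by (simp add: power2_eq_square algebra_simps)
  finally have le: "(norm (fst y - fst z))^2 \<le> a^2 + b^2 + a^2 * b^2 + 1" .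
  have "(norm (fst y - fst z))^2 + (snd y)^2 + (snd z)^2 \<le> (a^2 + (snd y)^2 + 1) * (b^2 + (snd z)^2 + 1)"
  proof -
   have "(a^2 + (snd y)^2 + 1) * (b^2 + (snd z)^2 + 1) =
     a^2 + b^2 + a^2 * b^2 + 1 + (snd y)^2 + (snd z)^2 + ((a * snd z)^2 + (b * snd y)^2 + (snd y * snd z)^2)"
    by (simp add: power_mult_distrib algebra_simps)
   with le zero_le_power2[of "a * snd z"] zero_le_power2[of "b * snd y"] zero_le_power2[of "snd y * snd z"]
   show ?thesis by linarith
  qed
  then have "cosh_dist y z \<le> (a^2 + (snd y)^2 + 1) * (b^2 + (snd z)^2 + 1) / (2 * snd y * snd z)"
   unfolding cosh_dist_def using pos by (intro divide_right_mono) auto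
  also have "\<dots> = 2 * cosh_dist base_point y * cosh_dist base_point z"
  proof -
   have "P * Q / (2 * s * t) = 2 * (P / (2 * s)) * (Q / (2 * t))" for P Q s t :: real by simp
   then show ?thesis unfolding cosh_dist_base a_def b_def .
  qed
  finally show ?thesis .
 qed
 obtain f where f: "hyp_isometry f" "f x = base_point" using swap_isometry[OF x base_point_H3] by blast
 have "cosh_dist y z = cosh_dist (f y) (f z)" "cosh_dist x y = cosh_dist base_point (f y)"
  "cosh_dist x z = cosh_dist base_point (f z)" using hyp_isometryD(5)[OF f(1)] f(2) x y z by metis+
 then show ?thesis using base[of "f y" "f z"] hyp_isometryD(4)[OF f(1)] y z by simp
qed

definition hyp_cball :: "point3 \<Rightarrow> real \<Rightarrow> point3 set" where
 "hyp_cball x c = {y \<in> H3. cosh_dist x y \<le> c}"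

lemma hyp_cball_subset: "hyp_cball x c \<subseteq> H3" by (auto simp: hyp_cball_def)

lemma continuous_on_cosh_dist [continuous_intros]:
 assumes "continuous_on S f" "continuous_on S g" "\<And>s. s \<in> S \<Longrightarrow> f s \<in> H3" "\<And>s. s \<in> S \<Longrightarrow> g s \<in> H3"
 shows "continuous_on S (\<lambda>s. cosh_dist (f s) (g s))" unfolding cosh_dist_def using assms(3,4)
 by (intro continuous_intros assms) (force simp: H3_iff)

lemma hyp_cball_height:
 assumes x: "x \<in> H3" and y: "y \<in> hyp_cball x c"
 shows "snd x \<le> 2 * c * snd y" "snd y \<le> 2 * c * snd x" "norm (fst x - fst y) \<le> 2 * c * snd x" "c \<ge> 1"
proof -
 have pos: "snd x > 0" "snd y > 0" and y': "y \<in> H3" using x y by (auto simp: H3_iff hyp_cball_def)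
 have c: "cosh_dist x y \<le> c" using y by (simp add: hyp_cball_def)
 then show c1: "c \<ge> 1" using cosh_dist_ge_1[OF x y'] by simp
 have *: "(norm (fst x - fst y))^2 + (snd x)^2 + (snd y)^2 \<le> c * (2 * snd x * snd y)"
  using c pos by (simp add: cosh_dist_def divide_le_eq)
 have "c * (2 * snd x * snd y) = (2 * c * snd y) * snd x" by simp
 with * have "(snd x)^2 \<le> (2 * c * snd y) * snd x"
  using zero_le_power2[of "norm (fst x - fst y)"] zero_le_power2[of "snd y"] by linarith
 then have "snd x * snd x \<le> (2 * c * snd y) * snd x" by (simp add: power2_eq_square)
 then show "snd x \<le> 2 * c * snd y" using pos by simp
 have "c * (2 * snd x * snd y) = (2 * c * snd x) * snd y" by simp
 with * have "(snd y)^2 \<le> (2 * c * snd x) * snd y" and x2: "(norm (fst x - fst y))^2 \<le> (2 * c * snd x) * snd y"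
  using zero_le_power2[of "norm (fst x - fst y)"] zero_le_power2[of "snd x"] zero_le_power2[of "snd y"] by linarith+
 then have "snd y * snd y \<le> (2 * c * snd x) * snd y" by (simp add: power2_eq_square)
 then show sy: "snd y \<le> 2 * c * snd x" using pos by simp
 have "(2 * c * snd x) * snd y \<le> (2 * c * snd x) * (2 * c * snd x)" using sy pos c1 by (intro mult_left_mono) auto
 with x2 have "(norm (fst x - fst y))^2 \<le> (2 * c * snd x) * (2 * c * snd x)" by linarith
 then have "(norm (fst x - fst y))^2 \<le> (2 * c * snd x)^2" by (simp only: power2_eq_square)
 moreover have "0 \<le> 2 * c * snd x" using pos c1 by simp
 ultimately show "norm (fst x - fst y) \<le> 2 * c * snd x" by (rule power2_le_imp_le)
qed

lemma compact_hyp_cball: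
 assumes x: "x \<in> H3"
 shows "compact (hyp_cball x c)"
proof -
 have pos: "snd x > 0" using x by (simp add: H3_iff)
 \<comment> \<open>The open condition \<open>snd y > 0\<close> is replaced by the closed condition
   \<open>snd x \<le> 2 * c * snd y\<close>, which makes the ball visibly closed in the whole
   space.\<close>
 have "hyp_cball x c = {y. (norm (fst x - fst y))^2 + (snd x)^2 + (snd y)^2 \<le> c * (2 * snd x * snd y) \<and> snd x \<le> 2 * c * snd y \<and> 1 \<le> c}"
  (is "_ = ?R")
 proof (intro equalityI subsetI)
  fix y assume y: "y \<in> hyp_cball x c"
  then have "snd y > 0" "cosh_dist x y \<le> c" by (auto simp: hyp_cball_def H3_iff)
  then show "y \<in> ?R" using hyp_cball_height[OF x y] pos by (simp add: cosh_dist_def divide_le_eq)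
 next
  fix y assume y: "y \<in> ?R"
  then have "2 * c * snd y > 0" "1 \<le> c" using pos by auto
  then have "snd y > 0" by (simp add: zero_less_mult_iff)
  then show "y \<in> hyp_cball x c" using y pos by (auto simp: hyp_cball_def H3_iff cosh_dist_def divide_le_eq)
 qed
 moreover have "closed ?R" by (intro closed_Collect_conj closed_Collect_le closed_Collect_const continuous_intros)
 moreover have "bounded (hyp_cball x c)"
 proof (rule boundedI)
  fix y assume y: "y \<in> hyp_cball x c"
  have "norm y \<le> norm (fst y) + norm (snd y)" using norm_Pair_le[of "fst y" "snd y"] by simp
  also have "norm (fst y) \<le> norm (fst x) + norm (fst x - fst y)"
   using norm_triangle_ineq4[of "fst x" "fst x - fst y"] by simp
  finally show "norm y \<le> norm (fst x) + 2 * c * snd x + 2 * c * snd x"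
   using hyp_cball_height[OF x y] y by (auto simp: hyp_cball_def H3_iff)
 qed
 ultimately show ?thesis by (simp add: compact_eq_bounded_closed)
qed

lemma emeasure_compact_finite:
 assumes "compact K" "K \<subseteq> H3"
 shows "emeasure hyp_volume K < \<infinity>"
proof -
 obtain n where "K \<subseteq> H3_exhaust n" using H3_exhaust_compact_subset[OF assms] by blast
 then have "emeasure hyp_volume K \<le> emeasure hyp_volume (H3_exhaust n)" by (intro emeasure_mono) auto
 then show ?thesis using emeasure_H3_exhaust[of n] by simp
qed

lemma hyp_cball_subset_cball:
 assumes "x \<in> H3" "y \<in> hyp_cball x c" "x \<in> hyp_cball z c'" "z \<in> H3"
 shows "y \<in> hyp_cball z (2 * c' * c)"
proof -
 have y: "y \<in> H3" "cosh_dist x y \<le> c" "cosh_dist z x \<le> c'" using assms by (auto simp: hyp_cball_def)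
 have "cosh_dist z y \<le> 2 * cosh_dist x z * cosh_dist x y" by (rule cosh_dist_triangle) (use assms y in auto)
 also have "\<dots> \<le> 2 * c' * c" using y assms cosh_dist_ge_1[OF assms(1) y(1)] cosh_dist_ge_1[OF assms(4) assms(1)]
  by (intro mult_mono) (auto simp: cosh_dist_commute)
 finally show ?thesis using y by (simp add: hyp_cball_def)
qed

section \<open>Calculus on the half-space: integral operators and the Laplacian\<close>

section \<open>Integration over hyperbolic space\<close>

text \<open>Restricting the space, and not only the density, makes continuity on \<open>H3\<close>
  sufficient for measurability whatever a total function does elsewhere.\<close>

definition hyp :: "point3 measure" where
 "hyp = restrict_space hyp_volume H3"

lemma space_hyp [simp]: "space hyp = H3" by (simp add: hyp_def space_restrict_space)

lemma sets_hyp: "A \<in> sets hyp \<longleftrightarrow> A \<in> sets borel \<and> A \<subseteq> H3"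
 unfolding hyp_def by (subst sets_restrict_space_iff) (auto simp: space_hyp_volume)

lemma emeasure_hyp: "A \<subseteq> H3 \<Longrightarrow> emeasure hyp A = emeasure hyp_volume A"
 unfolding hyp_def by (rule emeasure_restrict_space) auto

lemma continuous_on_measurable_hyp: "continuous_on H3 F \<Longrightarrow> F \<in> borel_measurable hyp"
 for F :: "point3 \<Rightarrow> 'a::topological_space"
proof -
 assume "continuous_on H3 F"
 then have "F \<in> borel_measurable (restrict_space borel H3)" by (rule borel_measurable_continuous_on_restrict)
 moreover have "sets (restrict_space borel H3) = sets hyp" unfolding hyp_def by (rule sets_restrict_space_cong) simp
 ultimately show ?thesis by (simp cong: measurable_cong_sets)
qed

lemma integral_hyp:
 fixes g :: "point3 \<Rightarrow> real"
 assumes "g \<in> borel_measurable hyp"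
 shows "(\<integral>p. g p \<partial>hyp) = (\<integral>p. (if p \<in> H3 then g p / (snd p) ^ 3 else 0) \<partial>lborel)"
proof -
 have [measurable]: "(\<lambda>p. if p \<in> H3 then g p else 0) \<in> borel_measurable borel"
 proof -
  have "g \<in> borel_measurable (restrict_space borel H3)" using assms unfolding hyp_def
   by (simp cong: measurable_cong_sets add: sets_restrict_space_cong[OF sets_hyp_volume])
  then have "(\<lambda>p. indicator H3 p *\<^sub>R g p) \<in> borel_measurable borel"
   by (subst (asm) borel_measurable_restrict_space_iff) simp_all
  moreover have "(\<lambda>p. indicator H3 p *\<^sub>R g p) = (\<lambda>p. if p \<in> H3 then g p else 0)" by auto
  ultimately show ?thesis by simp
 qed
 have "(\<integral>p. g p \<partial>hyp) = (\<integral>p. indicator H3 p *\<^sub>R g p \<partial>hyp_volume)"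
  unfolding hyp_def by (rule integral_restrict_space) auto
 also have "\<dots> = (\<integral>p. (if p \<in> H3 then g p else 0) \<partial>density lborel (\<lambda>p. ennreal (indicator H3 p * (1 / (snd p) ^ 3))))"
  unfolding hyp_volume_def
  by (intro Bochner_Integration.integral_cong arg_cong2[of _ _ _ _ density]) (auto simp: fun_eq_iff indicator_def)
 also have "\<dots> = (\<integral>p. (indicator H3 p * (1 / (snd p) ^ 3)) *\<^sub>R (if p \<in> H3 then g p else 0) \<partial>lborel)"
  by (rule integral_density) (measurable, auto simp: indicator_def H3_iff)
 also have "\<dots> = (\<integral>p. (if p \<in> H3 then g p / (snd p) ^ 3 else 0) \<partial>lborel)"
  by (intro Bochner_Integration.integral_cong) auto
 finally show ?thesis .
qed

lemma compact_sets_hyp: "compact K \<Longrightarrow> K \<subseteq> H3 \<Longrightarrow> K \<in> sets hyp" by (simp add: sets_hyp borel_compact)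

lemma integrable_hyp_compact:
 fixes g :: "point3 \<Rightarrow> real"
 assumes "g \<in> borel_measurable hyp" and K: "compact K" "K \<subseteq> H3"
  and "\<And>p. p \<in> H3 \<Longrightarrow> p \<notin> K \<Longrightarrow> g p = 0" "\<And>p. p \<in> K \<Longrightarrow> \<bar>g p\<bar> \<le> B"
 shows "integrable hyp g"
proof (rule Bochner_Integration.integrable_bound)
 have "emeasure hyp K < \<infinity>" using emeasure_compact_finite[OF K] K by (simp add: emeasure_hyp)
 then show "integrable hyp (\<lambda>p. B * indicator K p)"
  using compact_sets_hyp[OF K] by (intro integrable_mult_right integrable_real_indicator)
 show "AE p in hyp. norm (g p) \<le> norm (B * indicator K p)"
 proof (rule AE_I2)
  fix p assume "p \<in> space hyp"
  then show "norm (g p) \<le> norm (B * indicator K p)" using assms(4)[of p] assms(5)[of p] by (cases "p \<in> K") auto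
 qed
qed fact

lemma integrable_hyp_continuous:
 fixes g :: "point3 \<Rightarrow> real"
 assumes g: "continuous_on H3 g" and K: "compact K" "K \<subseteq> H3" and 0: "\<And>p. p \<in> H3 \<Longrightarrow> p \<notin> K \<Longrightarrow> g p = 0"
 shows "integrable hyp g"
proof -
 have "bounded (g ` K)"
  using g K by (intro compact_imp_bounded compact_continuous_image) (auto intro: continuous_on_subset)
 then obtain B where "\<And>p. p \<in> K \<Longrightarrow> \<bar>g p\<bar> \<le> B" by (auto simp: bounded_iff)
 then show ?thesis by (intro integrable_hyp_compact[OF continuous_on_measurable_hyp[OF g] K 0])
qed

lemma hyp_isometry_measurable: "hyp_isometry f \<Longrightarrow> f \<in> measurable hyp hyp" unfolding hyp_def
 by (rule measurable_restrict_space3) (auto simp: hyp_isometryD(4) dest: hyp_isometryD(1))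

lemma hyp_isometry_distr_hyp:
 assumes f: "hyp_isometry f"
 shows "distr hyp hyp f = hyp"
proof (rule measure_eqI)
 fix A assume "A \<in> sets (distr hyp hyp f)"
 then have A: "A \<in> sets hyp" "A \<in> sets borel" "A \<subseteq> H3" by (auto simp: sets_hyp)
 have m: "f -` A \<in> sets borel" using hyp_isometryD(1)[OF f] A(2) by (rule measurable_sets_borel)
 have "emeasure (distr hyp hyp f) A = emeasure hyp (f -` A \<inter> H3)"
  using A hyp_isometry_measurable[OF f] by (simp add: emeasure_distr)
 also have "\<dots> = emeasure hyp_volume (f -` A \<inter> H3)" by (simp add: emeasure_hyp)
 also have "\<dots> = emeasure hyp_volume (f -` A)" using hyp_volume_outside m by (intro emeasure_eq_AE) auto
 also have "\<dots> = emeasure (distr hyp_volume borel f) A"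
  using A hyp_isometryD(1)[OF f] by (subst emeasure_distr) (auto simp: measurable_cong_sets[OF sets_hyp_volume])
 also have "\<dots> = emeasure hyp A" using hyp_isometry_distr[OF f] A by (simp add: emeasure_hyp)
 finally show "emeasure (distr hyp hyp f) A = emeasure hyp A" .
qed simp

lemma hyp_isometry_integral:
 fixes g :: "point3 \<Rightarrow> real"
 assumes f: "hyp_isometry f" and "g \<in> borel_measurable hyp"
 shows "(\<integral>p. g (f p) \<partial>hyp) = (\<integral>p. g p \<partial>hyp)"
 using integral_distr[OF hyp_isometry_measurable[OF f] assms(2)] by (simp add: hyp_isometry_distr_hyp[OF f])

section \<open>Differentiation under the integral sign\<close>

text \<open>The mean value inequality on the ball bounds all difference quotients by the function
  dominating the derivative, and dominated convergence along sequences does the rest.\<close>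

lemma has_derivative_integral:
 fixes F :: "'a::euclidean_space \<Rightarrow> 'b \<Rightarrow> real"
 assumes r: "r > 0" and F: "\<And>x. x \<in> ball x0 r \<Longrightarrow> integrable M (F x)"
  and der: "\<And>x y. x \<in> ball x0 r \<Longrightarrow> y \<in> space M \<Longrightarrow> ((\<lambda>x. F x y) has_derivative F' x y) (at x)"
  and bound: "\<And>x y h. x \<in> ball x0 r \<Longrightarrow> y \<in> space M \<Longrightarrow> \<bar>F' x y h\<bar> \<le> g y * norm h" and g: "integrable M g"
  and meas: "\<And>h. (\<lambda>y. F' x0 y h) \<in> borel_measurable M"
 shows "((\<lambda>x. \<integral>y. F x y \<partial>M) has_derivative (\<lambda>h. \<integral>y. F' x0 y h \<partial>M)) (at x0)"
proof -
 have x0: "x0 \<in> ball x0 r" using r by simp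
 have lin: "linear (F' x0 y)" if "y \<in> space M" for y using der[OF x0 that] has_derivative_linear by blast
 have intF': "integrable M (\<lambda>y. F' x0 y h)" for h
  by (rule Bochner_Integration.integrable_bound[OF integrable_mult_left[OF g, of "norm h"] meas])
   (use bound[OF x0, of _ h] in \<open>force intro: AE_I2\<close>)
 have bl: "bounded_linear (\<lambda>h. \<integral>y. F' x0 y h \<partial>M)"
 proof (rule linear_conv_bounded_linear[THEN iffD1], rule linearI)
  fix h k :: 'a and c :: real
  have "(\<integral>y. F' x0 y (h + k) \<partial>M) = (\<integral>y. F' x0 y h + F' x0 y k \<partial>M)"
   using lin by (intro Bochner_Integration.integral_cong) (auto simp: linear_add)
  then show "(\<integral>y. F' x0 y (h + k) \<partial>M) = (\<integral>y. F' x0 y h \<partial>M) + (\<integral>y. F' x0 y k \<partial>M)" using intF' by simp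
  have "(\<integral>y. F' x0 y (c *\<^sub>R h) \<partial>M) = (\<integral>y. c * F' x0 y h \<partial>M)"
   using lin by (intro Bochner_Integration.integral_cong) (auto simp: linear_scale)
  then show "(\<integral>y. F' x0 y (c *\<^sub>R h) \<partial>M) = c *\<^sub>R (\<integral>y. F' x0 y h \<partial>M)" by simp
 qed
 have "((\<lambda>h. norm ((\<integral>y. F (x0 + h) y \<partial>M) - (\<integral>y. F x0 y \<partial>M) - (\<integral>y. F' x0 y h \<partial>M)) / norm h) \<longlongrightarrow> 0)
   (at 0 within ball 0 r)" unfolding tendsto_at_iff_sequentially
 proof (intro allI impI)
  fix X :: "nat \<Rightarrow> 'a" assume X: "\<forall>i. X i \<in> ball 0 r - {0}" and X0: "X \<longlonglongrightarrow> 0"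
  define q where "q n y = (F (x0 + X n) y - F x0 y - F' x0 y (X n)) / norm (X n)" for n y
  have Xb: "x0 + X n \<in> ball x0 r" "X n \<noteq> 0" for n using X by (auto simp: dist_norm)
  have lim: "(\<lambda>n. q n y) \<longlonglongrightarrow> 0" if y: "y \<in> space M" for y
  proof -
   have "((\<lambda>h. norm (F (x0 + h) y - F x0 y - F' x0 y h) / norm h) \<longlongrightarrow> 0) (at 0)"
    using der[OF x0 y] by (simp add: has_derivative_at)
   then have "((\<lambda>h. norm (F (x0 + h) y - F x0 y - F' x0 y h) / norm h) \<circ> X) \<longlonglongrightarrow> 0"
    unfolding tendsto_at_iff_sequentially using Xb X0 by simp
   then have "(\<lambda>n. norm (q n y)) \<longlonglongrightarrow> 0" by (simp add: q_def o_def)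
   then show ?thesis by (rule tendsto_norm_zero_cancel)
  qed
  have bd: "norm (q n y) \<le> 2 * g y" if y: "y \<in> space M" for n y
  proof -
   have "norm (F (x0 + X n) y - F x0 y) \<le> g y * norm (x0 + X n - x0)"
   proof (rule differentiable_bound[of "ball x0 r" "\<lambda>x. F x y" "\<lambda>x. F' x y"])
    fix x assume x: "x \<in> ball x0 r"
    show "((\<lambda>x. F x y) has_derivative F' x y) (at x within ball x0 r)"
     using der[OF x y] by (rule has_derivative_at_withinI)
    show "onorm (F' x y) \<le> g y" by (rule onorm_le) (use bound[OF x y] in simp)
   qed (use Xb x0 in auto)
   then have "\<bar>F (x0 + X n) y - F x0 y - F' x0 y (X n)\<bar> \<le> 2 * g y * norm (X n)" using bound[OF x0 y, of "X n"] by simp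
   then show ?thesis using Xb[of n] by (simp add: q_def divide_le_eq)
  qed
  have intq: "integrable M (q n)" for n unfolding q_def using F[OF Xb(1)] F[OF x0] intF' by simp
  have "(\<lambda>n. \<integral>y. q n y \<partial>M) \<longlonglongrightarrow> (\<integral>y. 0 \<partial>M)" by (rule integral_dominated_convergence[where w = "\<lambda>y. 2 * g y"])
    (use g intq lim bd in \<open>auto intro!: AE_I2 dest: borel_measurable_integrable\<close>)
  then have "(\<lambda>n. norm (\<integral>y. q n y \<partial>M)) \<longlonglongrightarrow> 0" by (auto dest: tendsto_norm)
  moreover have "norm (\<integral>y. q n y \<partial>M) =
    norm ((\<integral>y. F (x0 + X n) y \<partial>M) - (\<integral>y. F x0 y \<partial>M) - (\<integral>y. F' x0 y (X n) \<partial>M)) / norm (X n)" for n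
   unfolding q_def using F[OF Xb(1)] F[OF x0] intF' by simp
  ultimately show "((\<lambda>h. norm ((\<integral>y. F (x0 + h) y \<partial>M) - (\<integral>y. F x0 y \<partial>M) - (\<integral>y. F' x0 y h \<partial>M)) / norm h) \<circ> X) \<longlonglongrightarrow> 0"
   by (simp add: o_def)
 qed
 then have "((\<lambda>h. norm ((\<integral>y. F (x0 + h) y \<partial>M) - (\<integral>y. F x0 y \<partial>M) - (\<integral>y. F' x0 y h \<partial>M)) / norm h) \<longlongrightarrow> 0) (at 0)"
  using r by (simp add: at_within_open[of 0 "ball 0 r"])
 then show ?thesis using bl by (simp add: has_derivative_at)
qed

section \<open>Integral operators with smooth kernels\<close>

abbreviation has_partials :: "('a::euclidean_space \<Rightarrow> real) \<Rightarrow> ('a \<Rightarrow> real) \<Rightarrow> 'a \<Rightarrow> bool" where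
 "has_partials f g x \<equiv> (f has_derivative (\<lambda>h. \<Sum>b\<in>Basis. (h \<bullet> b) * g b)) (at x)"

text \<open>Derivatives are taken in the first variable only, but joint continuity is kept at every
  order. This is the form of regularity that survives repeated differentiation under the integral
  against a merely continuous function.\<close>

fun C_kernel :: "nat \<Rightarrow> (point3 \<Rightarrow> point3 \<Rightarrow> real) \<Rightarrow> bool" where
 "C_kernel 0 Q \<longleftrightarrow> continuous_on (H3 \<times> H3) (\<lambda>(x, y). Q x y)"
| "C_kernel (Suc n) Q \<longleftrightarrow> continuous_on (H3 \<times> H3) (\<lambda>(x, y). Q x y) \<and>
  (\<exists>D. (\<forall>x\<in>H3. \<forall>y\<in>H3. has_partials (\<lambda>x. Q x y) (\<lambda>b. D b x y) x) \<and>
     (\<forall>b\<in>Basis. C_kernel n (D b)))"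

declare C_kernel.simps(2) [simp del]

lemma C_kernel_SucI:
 assumes "continuous_on (H3 \<times> H3) (\<lambda>(x, y). Q x y)" and "\<And>x y. x \<in> H3 \<Longrightarrow> y \<in> H3 \<Longrightarrow>
   has_partials (\<lambda>x. Q x y) (\<lambda>b. D b x y) x" and "\<And>b. b \<in> Basis \<Longrightarrow> C_kernel n (D b)"
 shows "C_kernel (Suc n) Q" unfolding C_kernel.simps(2) using assms by blast

lemma C_kernel_SucE:
 assumes "C_kernel (Suc n) Q" obtains D where "\<And>x y. x \<in> H3 \<Longrightarrow> y \<in> H3 \<Longrightarrow>
   has_partials (\<lambda>x. Q x y) (\<lambda>b. D b x y) x" and "\<And>b. b \<in> Basis \<Longrightarrow> C_kernel n (D b)"
 using assms unfolding C_kernel.simps(2) by blast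

lemma C_kernel_continuous: "C_kernel n Q \<Longrightarrow> continuous_on (H3 \<times> H3) (\<lambda>(x, y). Q x y)"
 by (cases n) (auto simp: C_kernel.simps(2))

lemma C_kernel_SucD: "C_kernel (Suc n) Q \<Longrightarrow> C_kernel n Q"
proof (induction n arbitrary: Q)
 case 0
 then show ?case using C_kernel_continuous by simp
next
 case (Suc n)
 from Suc.prems show ?case by (rule C_kernel_SucE) (rule C_kernel_SucI[OF C_kernel_continuous[OF Suc.prems] _ Suc.IH])
qed

lemma C_kernel_add: "C_kernel n P \<Longrightarrow> C_kernel n Q \<Longrightarrow> C_kernel n (\<lambda>x y. P x y + Q x y)"
proof (induction n arbitrary: P Q)
 case 0
 then show ?case by (auto simp: case_prod_unfold intro: continuous_intros)
next
 case (Suc n)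
 obtain D where D: "\<And>x y. x \<in> H3 \<Longrightarrow> y \<in> H3 \<Longrightarrow> has_partials (\<lambda>x. P x y) (\<lambda>b. D b x y) x"
  "\<And>b. b \<in> Basis \<Longrightarrow> C_kernel n (D b)" by (rule C_kernel_SucE[OF Suc.prems(1)], rule that)
 obtain E where E: "\<And>x y. x \<in> H3 \<Longrightarrow> y \<in> H3 \<Longrightarrow> has_partials (\<lambda>x. Q x y) (\<lambda>b. E b x y) x"
  "\<And>b. b \<in> Basis \<Longrightarrow> C_kernel n (E b)" by (rule C_kernel_SucE[OF Suc.prems(2)], rule that)
 have "has_partials (\<lambda>x. P x y + Q x y) (\<lambda>b. D b x y + E b x y) x"
  if "x \<in> H3" "y \<in> H3" for x y
  using has_derivative_add[OF D(1) E(1), OF that that] by (simp add: sum.distrib distrib_left)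
 moreover have "C_kernel n (\<lambda>x y. D b x y + E b x y)" if "b \<in> Basis" for b using Suc.IH D(2) E(2) that by blast
 ultimately show ?case using C_kernel_continuous[OF Suc.prems(1)] C_kernel_continuous[OF Suc.prems(2)]
  by (intro C_kernel_SucI[where D = "\<lambda>b x y. D b x y + E b x y"]) (auto simp: case_prod_unfold intro!: continuous_intros)
qed

lemma C_kernel_mult: "C_kernel n P \<Longrightarrow> C_kernel n Q \<Longrightarrow> C_kernel n (\<lambda>x y. P x y * Q x y)"
proof (induction n arbitrary: P Q)
 case 0
 then show ?case by (auto simp: case_prod_unfold intro: continuous_intros)
next
 case (Suc n)
 obtain D where D: "\<And>x y. x \<in> H3 \<Longrightarrow> y \<in> H3 \<Longrightarrow> has_partials (\<lambda>x. P x y) (\<lambda>b. D b x y) x"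
  "\<And>b. b \<in> Basis \<Longrightarrow> C_kernel n (D b)" by (rule C_kernel_SucE[OF Suc.prems(1)], rule that)
 obtain E where E: "\<And>x y. x \<in> H3 \<Longrightarrow> y \<in> H3 \<Longrightarrow> has_partials (\<lambda>x. Q x y) (\<lambda>b. E b x y) x"
  "\<And>b. b \<in> Basis \<Longrightarrow> C_kernel n (E b)" by (rule C_kernel_SucE[OF Suc.prems(2)], rule that)
 have "has_partials (\<lambda>x. P x y * Q x y) (\<lambda>b. P x y * E b x y + D b x y * Q x y) x"
  if "x \<in> H3" "y \<in> H3" for x y using has_derivative_mult[OF D(1) E(1), OF that that]
  by (simp add: sum.distrib distrib_left sum_distrib_left sum_distrib_right mult_ac)
 moreover have "C_kernel n (\<lambda>x y. P x y * E b x y + D b x y * Q x y)" if "b \<in> Basis" for b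
  using Suc D(2) E(2) that by (intro C_kernel_add Suc.IH) (auto dest: C_kernel_SucD)
 ultimately show ?case using C_kernel_continuous[OF Suc.prems(1)] C_kernel_continuous[OF Suc.prems(2)]
  by (intro C_kernel_SucI[where D = "\<lambda>b x y. P x y * E b x y + D b x y * Q x y"]) (auto simp: case_prod_unfold intro!: continuous_intros)
qed

lemma C_kernel_right: "continuous_on H3 a \<Longrightarrow> C_kernel n (\<lambda>x y. a y)"
proof (induction n arbitrary: a)
 case 0
 then show ?case by (auto simp: case_prod_unfold intro!: continuous_on_compose2[of H3 a _ snd] continuous_intros)
next
 case (Suc n)
 have "C_kernel n (\<lambda>x y. 0)" by (rule Suc.IH) (rule continuous_on_const)
 moreover have "continuous_on (H3 \<times> H3) (\<lambda>p. a (snd p))"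
  by (rule continuous_on_compose2[of H3 a]) (use Suc in \<open>auto intro!: continuous_intros\<close>)
 ultimately show ?case by (intro C_kernel_SucI[where D = "\<lambda>b x y. 0"]) (auto simp: case_prod_unfold)
qed

lemma C_kernel_coord: "C_kernel n (\<lambda>x y. x \<bullet> w)"
proof (cases n)
 case 0
 then show ?thesis by (auto simp: case_prod_unfold intro!: continuous_intros)
next
 case (Suc m)
 have "has_partials (\<lambda>x. x \<bullet> w) (\<lambda>b. w \<bullet> b) x" for x :: point3
  by (auto intro!: derivative_eq_intros simp: euclidean_inner[of _ w])
 moreover have "C_kernel m (\<lambda>x y. w \<bullet> b)" for b :: point3 by (rule C_kernel_right) (rule continuous_on_const)
 ultimately show ?thesis
  unfolding Suc by (intro C_kernel_SucI[where D = "\<lambda>b x y. w \<bullet> b"]) (auto simp: case_prod_unfold intro!: continuous_intros)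
qed

lemma C_kernel_snd: "C_kernel n (\<lambda>x y. snd x)" using C_kernel_coord[of n "(0, 1)"] by (simp add: inner_prod_def)

lemma C_kernel_uminus: "C_kernel n P \<Longrightarrow> C_kernel n (\<lambda>x y. - P x y)"
 using C_kernel_mult[OF C_kernel_right[OF continuous_on_const, of n "-1"], of P] by simp

lemma C_kernel_diff: "C_kernel n P \<Longrightarrow> C_kernel n Q \<Longrightarrow> C_kernel n (\<lambda>x y. P x y - Q x y)"
 using C_kernel_add[OF _ C_kernel_uminus, of n P Q] by simp

lemma C_kernel_inverse_snd: "C_kernel n (\<lambda>x y. 1 / snd x)"
proof (induction n)
 case 0
 then show ?case by (auto simp: case_prod_unfold H3_iff intro!: continuous_intros)
next
 case (Suc n)
 define D :: "point3 \<Rightarrow> point3 \<Rightarrow> point3 \<Rightarrow> real" where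
  "D b x y = (- snd b) * (1 / snd x * (1 / snd x))" for b x y
 have "has_partials (\<lambda>x. 1 / snd x) (\<lambda>b. D b x y) x" if "x \<in> H3" for x y :: point3
  using that unfolding sum_Basis_point3
  by (auto intro!: derivative_eq_intros simp: D_def H3_iff inner_prod_def power2_eq_square)
 moreover have "C_kernel n (D b)" for b
  unfolding D_def using Suc by (intro C_kernel_mult C_kernel_right continuous_on_const)
 ultimately show ?case
  by (intro C_kernel_SucI[where D = D]) (auto simp: case_prod_unfold H3_iff intro!: continuous_intros)
qed

lemma C_kernel_cong:
 "C_kernel n P \<Longrightarrow> (\<And>x y. x \<in> H3 \<Longrightarrow> y \<in> H3 \<Longrightarrow> P x y = Q x y) \<Longrightarrow> C_kernel n Q"
proof (induction n arbitrary: P Q)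
 case 0
 show ?case unfolding C_kernel.simps by (rule continuous_on_eq[OF C_kernel_continuous[OF 0(1)]]) (use 0(2) in auto)
next
 case (Suc n)
 obtain D where D: "\<And>x y. x \<in> H3 \<Longrightarrow> y \<in> H3 \<Longrightarrow> has_partials (\<lambda>x. P x y) (\<lambda>b. D b x y) x"
  "\<And>b. b \<in> Basis \<Longrightarrow> C_kernel n (D b)" by (rule C_kernel_SucE[OF Suc.prems(1)], rule that)
 have "has_partials (\<lambda>x. Q x y) (\<lambda>b. D b x y) x" if "x \<in> H3" "y \<in> H3" for x y
  by (rule has_derivative_transform_within_open[OF D(1)[OF that] open_H3]) (use that Suc.prems in auto)
 moreover have "continuous_on (H3 \<times> H3) (\<lambda>(x, y). Q x y)"
  by (rule continuous_on_eq[OF C_kernel_continuous[OF Suc.prems(1)]]) (use Suc.prems(2) in auto)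
 ultimately show ?case using D(2) by (intro C_kernel_SucI[where D = D])
qed

lemma C_kernel_cosh_dist: "C_kernel n cosh_dist"
proof (rule C_kernel_cong)
 show "C_kernel n (\<lambda>x y. (((x \<bullet> (1, 0) - fst y \<bullet> 1) * (x \<bullet> (1, 0) - fst y \<bullet> 1) +
   (x \<bullet> (\<i>, 0) - fst y \<bullet> \<i>) * (x \<bullet> (\<i>, 0) - fst y \<bullet> \<i>)) + (snd x * snd x + (snd y)^2)) * ((1 / snd x) * (1 / (2 * snd y))))"
  by (intro C_kernel_mult C_kernel_add C_kernel_diff C_kernel_coord C_kernel_snd C_kernel_inverse_snd C_kernel_right)
   (auto intro!: continuous_intros simp: H3_iff)
 show "(((x \<bullet> (1, 0) - fst y \<bullet> 1) * (x \<bullet> (1, 0) - fst y \<bullet> 1) +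
   (x \<bullet> (\<i>, 0) - fst y \<bullet> \<i>) * (x \<bullet> (\<i>, 0) - fst y \<bullet> \<i>)) + (snd x * snd x + (snd y)^2)) * ((1 / snd x) * (1 / (2 * snd y)))
   = cosh_dist x y" for x y
  unfolding cosh_dist_def cmod_power2 by (simp add: inner_prod_def inner_complex_def power2_eq_square mult_ac)
qed

lemma max_power_derivative:
 assumes m: "m \<ge> 1"
 shows "((\<lambda>v::real. (max 0 v) ^ Suc m) has_real_derivative real (Suc m) * (max 0 v) ^ m) (at v)"
proof -
 consider "v > 0" | "v < 0" | "v = 0" by linarith
 then show ?thesis
 proof cases
  case 1
  have "((\<lambda>v::real. v ^ Suc m) has_real_derivative real (Suc m) * v ^ m) (at v)"
   by (auto intro!: derivative_eq_intros simp del: power_Suc)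
  then show ?thesis
   using 1 by (rule_tac has_field_derivative_transform_within_open[of "\<lambda>v. v ^ Suc m" _ _ "{0<..}"]) (auto simp del: power_Suc)
 next
  case 2
  have "((\<lambda>v::real. 0) has_real_derivative 0) (at v)" by simp
  then have "((\<lambda>v::real. (max 0 v) ^ Suc m) has_real_derivative 0) (at v)"
   using 2 by (rule_tac has_field_derivative_transform_within_open[of "\<lambda>v. 0" _ _ "{..<0}"]) auto
  then show ?thesis using 2 m by (simp add: power_0_left del: power_Suc)
 next
  case 3
  have "((\<lambda>h. (max 0 h) ^ Suc m / h) \<longlongrightarrow> 0) (at (0::real))"
  proof (rule Lim_null_comparison)
   have "norm ((max 0 h) ^ Suc m / h) \<le> \<bar>h\<bar> ^ m" for h :: real by (cases "h > 0") auto
   then show "\<forall>\<^sub>F h in at 0. norm ((max 0 h) ^ Suc m / h) \<le> \<bar>h\<bar> ^ m" for h :: real by simp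
   show "((\<lambda>h::real. \<bar>h\<bar> ^ m) \<longlongrightarrow> 0) (at 0)" using m by (auto intro!: tendsto_eq_intros)
  qed
  then show ?thesis using 3 m by (simp add: DERIV_def power_0_left)
 qed
qed

text \<open>Each derivative costs one power of the truncated function, and one power must be left
  for continuity; hence the strict inequality.\<close>

lemma C_kernel_max_power: "C_kernel n Q \<Longrightarrow> m > n \<Longrightarrow> C_kernel n (\<lambda>x y. (max 0 (Q x y)) ^ m)"
proof (induction n arbitrary: m Q)
 case 0
 then show ?case by (auto simp: case_prod_unfold intro!: continuous_intros)
next
 case (Suc n)
 obtain D where D: "\<And>x y. x \<in> H3 \<Longrightarrow> y \<in> H3 \<Longrightarrow> has_partials (\<lambda>x. Q x y) (\<lambda>b. D b x y) x"
  "\<And>b. b \<in> Basis \<Longrightarrow> C_kernel n (D b)" by (rule C_kernel_SucE[OF Suc.prems(1)], rule that)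
 obtain k where m: "m = Suc k" "k > n" using Suc.prems(2) by (cases m) auto
 define E where "E b x y = real (Suc k) * (max 0 (Q x y)) ^ k * D b x y" for b x y
 have "has_partials (\<lambda>x. (max 0 (Q x y)) ^ m) (\<lambda>b. E b x y) x"
  if "x \<in> H3" "y \<in> H3" for x y
  using has_derivative_compose[OF D(1)[OF that] max_power_derivative[THEN has_field_derivative_imp_has_derivative], of k] m
  by (simp add: E_def sum_distrib_left mult_ac del: power_Suc)
 moreover have "C_kernel n (E b)" if "b \<in> Basis" for b
  unfolding E_def using D(2)[OF that] m Suc.IH[OF C_kernel_SucD[OF Suc.prems(1)]]
  by (intro C_kernel_mult C_kernel_right continuous_on_const) auto
 ultimately show ?case using C_kernel_continuous[OF Suc.prems(1)]
  by (intro C_kernel_SucI[where D = E]) (auto simp: case_prod_unfold intro!: continuous_intros)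
qed

definition kernel_within :: "real \<Rightarrow> (point3 \<Rightarrow> point3 \<Rightarrow> real) \<Rightarrow> bool" where
 "kernel_within c Q \<longleftrightarrow> (\<forall>x\<in>H3. \<forall>y\<in>H3. cosh_dist x y > c \<longrightarrow> Q x y = 0)"

definition kernel_op :: "(point3 \<Rightarrow> point3 \<Rightarrow> real) \<Rightarrow> (point3 \<Rightarrow> real) \<Rightarrow> point3 \<Rightarrow> real" where
 "kernel_op Q F x = (\<integral>y. Q x y * F y \<partial>hyp)"

lemma continuous_kernel_right:
 assumes "continuous_on (H3 \<times> H3) (\<lambda>(x, y). Q x y)" "x \<in> H3"
 shows "continuous_on H3 (Q x)"
proof -
 have "continuous_on H3 (Pair x)" by (intro continuous_intros)
 then show ?thesis using continuous_on_compose2[OF assms(1), of H3 "Pair x"] assms(2) by auto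
qed

lemma kernel_integrable:
 assumes Q: "continuous_on (H3 \<times> H3) (\<lambda>(x, y). Q x y)" "kernel_within c Q" and F: "continuous_on H3 F" and x: "x \<in> H3"
 shows "integrable hyp (\<lambda>y. Q x y * F y)"
proof (rule integrable_hyp_continuous)
 show "continuous_on H3 (\<lambda>y. Q x y * F y)" by (intro continuous_intros continuous_kernel_right[OF Q(1) x] F)
 show "compact (hyp_cball x c)" "hyp_cball x c \<subseteq> H3" using x by (auto simp: compact_hyp_cball hyp_cball_subset)
 show "Q x p * F p = 0" if "p \<in> H3" "p \<notin> hyp_cball x c" for p
  using that Q(2) x by (auto simp: kernel_within_def hyp_cball_def)
qed

text \<open>For x near a given point all the integrals run over one compact set. This supplies the
  dominating functions in the continuity and differentiability proofs below.\<close>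

lemma locally_compact_support:
 assumes x0: "x0 \<in> H3" obtains r K where "r > 0" "cball x0 r \<subseteq> H3" "compact K" "K \<subseteq> H3"
  "\<And>x y. x \<in> cball x0 r \<Longrightarrow> y \<in> H3 \<Longrightarrow> y \<notin> K \<Longrightarrow> cosh_dist x y > c"
proof -
 obtain r where r: "r > 0" "cball x0 r \<subseteq> H3" using open_H3 x0 open_contains_cball by blast
 have "continuous_on (cball x0 r) (\<lambda>x. cosh_dist x0 x)" using r x0 by (intro continuous_intros) auto
 then obtain c' where c': "\<And>x. x \<in> cball x0 r \<Longrightarrow> cosh_dist x0 x \<le> c'"
  using compact_continuous_image[of "cball x0 r" "\<lambda>x. cosh_dist x0 x"] compact_imp_bounded
  by (metis bounded_real compact_cball imageI abs_le_D1)
 have "cosh_dist x y > c" if "x \<in> cball x0 r" "y \<in> H3" "y \<notin> hyp_cball x0 (2 * c' * c)" for x y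
 proof (rule ccontr)
  assume "\<not> c < cosh_dist x y"
  then have "y \<in> hyp_cball x0 (2 * c' * c)"
   using that r x0 c'[OF that(1)] by (intro hyp_cball_subset_cball[of x y c x0 c']) (auto simp: hyp_cball_def)
  then show False using that by simp
 qed
 then show ?thesis using that[OF r compact_hyp_cball[OF x0] hyp_cball_subset] by blast
qed

text \<open>The region where \<open>cosh_dist\<close> exceeds c is open in the first variable, so
  the kernel vanishes near each of its points and its partial derivatives vanish there too.\<close>

lemma kernel_derivative_within:
 assumes D: "\<And>x y. x \<in> H3 \<Longrightarrow> y \<in> H3 \<Longrightarrow>
   has_partials (\<lambda>x. Q x y) (\<lambda>b. D b x y) x" and Q: "kernel_within c Q" and b: "b \<in> Basis"
 shows "kernel_within c (D b)" unfolding kernel_within_def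
proof (intro ballI impI)
 fix x y assume xy: "x \<in> H3" "y \<in> H3" "c < cosh_dist x y"
 have "open (H3 \<inter> {x \<in> H3. c < cosh_dist x y})"
 proof -
  have "open ((\<lambda>x. cosh_dist x y) -` {c<..} \<inter> H3)" by (rule continuous_on_open_vimage[THEN iffD1, rule_format])
    (use open_H3 xy in \<open>auto intro!: continuous_intros\<close>)
  moreover have "(\<lambda>x. cosh_dist x y) -` {c<..} \<inter> H3 = H3 \<inter> {x \<in> H3. c < cosh_dist x y}" by auto
  ultimately show ?thesis by simp
 qed
 then have "has_partials (\<lambda>x. 0) (\<lambda>b. D b x y) x" by (rule has_derivative_transform_within_open[OF D[OF xy(1,2)]])
   (use xy Q in \<open>auto simp: kernel_within_def\<close>)
 moreover have "((\<lambda>x::point3. 0::real) has_derivative (\<lambda>h. 0)) (at x)" by simp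
 ultimately have "(\<lambda>h. \<Sum>b\<in>Basis. (h \<bullet> b) * D b x y) = (\<lambda>h. 0)" by (rule has_derivative_unique)
 then have "(\<Sum>b'\<in>Basis. (b \<bullet> b') * D b' x y) = 0" by (rule fun_cong)
 then show "D b x y = 0" using b by (simp add: inner_Basis if_distrib[of "\<lambda>x. x * _"] sum.delta cong: if_cong)
qed

lemma bounded_on_compact:
 fixes g :: "'a::topological_space \<Rightarrow> real"
 assumes "compact K" "continuous_on K g" obtains B where "B \<ge> 0" "\<And>p. p \<in> K \<Longrightarrow> \<bar>g p\<bar> \<le> B"
proof -
 have "bounded (g ` K)" using assms by (intro compact_imp_bounded compact_continuous_image)
 then obtain B where "\<And>p. p \<in> K \<Longrightarrow> \<bar>g p\<bar> \<le> B" by (auto simp: bounded_iff)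
 then show ?thesis by (intro that[of "max B 0"]) (auto simp: le_max_iff_disj)
qed

lemma continuous_kernel_op:
 assumes Q: "continuous_on (H3 \<times> H3) (\<lambda>(x, y). Q x y)" "kernel_within c Q" and F: "continuous_on H3 F"
 shows "continuous_on H3 (kernel_op Q F)" unfolding continuous_on_eq_continuous_at[OF open_H3]
proof
 fix x0 assume x0: "x0 \<in> H3"
 obtain r K where r: "r > 0" "cball x0 r \<subseteq> H3" and K: "compact K" "K \<subseteq> H3"
  and out: "\<And>x y. x \<in> cball x0 r \<Longrightarrow> y \<in> H3 \<Longrightarrow> y \<notin> K \<Longrightarrow> cosh_dist x y > c"
  by (rule locally_compact_support[OF x0, of c], rule that)
 have "continuous_on (cball x0 r \<times> K) (\<lambda>p. Q (fst p) (snd p) * F (snd p))"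
  by (intro continuous_intros continuous_on_subset[OF Q(1)[unfolded case_prod_unfold]]
    continuous_on_compose2[OF F]) (use r K in auto)
 then obtain B where B: "B \<ge> 0" "\<And>p. p \<in> cball x0 r \<times> K \<Longrightarrow> \<bar>Q (fst p) (snd p) * F (snd p)\<bar> \<le> B"
  by (rule bounded_on_compact[rotated, OF _ that]) (use K in \<open>auto intro: compact_Times\<close>)
 have "((\<lambda>x. kernel_op Q F x) \<longlongrightarrow> kernel_op Q F x0) (at x0 within ball x0 r)" unfolding tendsto_at_iff_sequentially
 proof (intro allI impI)
  fix X assume X: "\<forall>i. X i \<in> ball x0 r - {x0}" "X \<longlonglongrightarrow> x0"
  then have Xb: "X i \<in> cball x0 r" for i by (auto simp: less_imp_le)
  then have Xb: "X i \<in> cball x0 r" "X i \<in> H3" for i using r by blast+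
  have "(\<lambda>i. \<integral>y. Q (X i) y * F y \<partial>hyp) \<longlonglongrightarrow> (\<integral>y. Q x0 y * F y \<partial>hyp)"
  proof (rule integral_dominated_convergence[where w = "\<lambda>y. B * indicator K y"])
   show "integrable hyp (\<lambda>y. B * indicator K y)" using emeasure_compact_finite[OF K] K compact_sets_hyp[OF K]
    by (intro integrable_mult_right integrable_real_indicator) (auto simp: emeasure_hyp)
   show "AE y in hyp. (\<lambda>i. Q (X i) y * F y) \<longlonglongrightarrow> Q x0 y * F y"
   proof (rule AE_I2)
    fix y assume "y \<in> space hyp"
    then have "(\<lambda>i. (\<lambda>(x, y). Q x y) (X i, y)) \<longlonglongrightarrow> (\<lambda>(x, y). Q x y) (x0, y)"
     using Q(1) x0 Xb X(2) by (intro continuous_on_tendsto_compose[OF Q(1)] tendsto_Pair tendsto_const) auto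
    then show "(\<lambda>i. Q (X i) y * F y) \<longlonglongrightarrow> Q x0 y * F y" by (intro tendsto_intros) simp
   qed
   show "AE y in hyp. norm (Q (X i) y * F y) \<le> B * indicator K y" for i
   proof (rule AE_I2)
    fix y assume y: "y \<in> space hyp"
    show "norm (Q (X i) y * F y) \<le> B * indicator K y"
    proof (cases "y \<in> K")
     case True
     then show ?thesis using B(2)[of "(X i, y)"] Xb[of i] by simp
    next
     case False
     then show ?thesis using out[OF Xb(1), of y i] Q(2) y Xb by (simp add: kernel_within_def)
    qed
   qed
  qed (use kernel_integrable[OF Q F] Xb x0 in \<open>auto dest: borel_measurable_integrable\<close>)
  then show "((kernel_op Q F) \<circ> X) \<longlonglongrightarrow> kernel_op Q F x0" by (simp add: o_def kernel_op_def)
 qed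
 then show "isCont (kernel_op Q F) x0" using r by (simp add: isCont_def at_within_open[of x0 "ball x0 r"])
qed

lemma kernel_op_has_derivative:
 assumes Q: "continuous_on (H3 \<times> H3) (\<lambda>(x, y). Q x y)" "kernel_within c Q" and D: "\<And>x y. x \<in> H3 \<Longrightarrow> y \<in> H3 \<Longrightarrow>
   has_partials (\<lambda>x. Q x y) (\<lambda>b. D b x y) x" and Dc: "\<And>b. b \<in> Basis \<Longrightarrow> continuous_on (H3 \<times> H3) (\<lambda>(x, y). D b x y)"
  and F: "continuous_on H3 F" and x0: "x0 \<in> H3"
 shows "has_partials (kernel_op Q F) (\<lambda>b. kernel_op (D b) F x0) x0"
proof -
 obtain r K where r: "r > 0" "cball x0 r \<subseteq> H3" and K: "compact K" "K \<subseteq> H3"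
  and out: "\<And>x y. x \<in> cball x0 r \<Longrightarrow> y \<in> H3 \<Longrightarrow> y \<notin> K \<Longrightarrow> cosh_dist x y > c"
  by (rule locally_compact_support[OF x0, of c], rule that)
 have Dw: "kernel_within c (D b)" if "b \<in> Basis" for b using kernel_derivative_within[OF D Q(2) that] .
 have "continuous_on (cball x0 r \<times> K) (\<lambda>p. (\<Sum>b\<in>Basis. \<bar>D b (fst p) (snd p)\<bar>) * \<bar>F (snd p)\<bar>)"
  by (intro continuous_intros continuous_on_subset[OF Dc[unfolded case_prod_unfold]]
    continuous_on_compose2[OF F]) (use r K in auto)
 then obtain B where B: "B \<ge> 0" "\<And>p. p \<in> cball x0 r \<times> K \<Longrightarrow> \<bar>(\<Sum>b\<in>Basis. \<bar>D b (fst p) (snd p)\<bar>) * \<bar>F (snd p)\<bar>\<bar> \<le> B"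
  by (rule bounded_on_compact[rotated, OF _ that]) (use K in \<open>auto intro: compact_Times\<close>)
 have intD: "integrable hyp (\<lambda>y. D b x y * F y)" if "b \<in> Basis" "x \<in> H3" for b x
  by (rule kernel_integrable[OF Dc[OF that(1)] Dw[OF that(1)] F that(2)])
 have "((\<lambda>x. \<integral>y. Q x y * F y \<partial>hyp) has_derivative (\<lambda>h. \<integral>y. (\<Sum>b\<in>Basis. (h \<bullet> b) * D b x0 y) * F y \<partial>hyp)) (at x0)"
 proof (rule has_derivative_integral[where g = "\<lambda>y. B * indicator K y" and r = r])
  show "integrable hyp (\<lambda>y. B * indicator K y)" using emeasure_compact_finite[OF K] K compact_sets_hyp[OF K]
   by (intro integrable_mult_right integrable_real_indicator) (auto simp: emeasure_hyp)
  fix x assume "x \<in> ball x0 r"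
  then have x: "x \<in> cball x0 r" by simp
  then have x: "x \<in> cball x0 r" "x \<in> H3" using r by blast+
  show "integrable hyp (\<lambda>y. Q x y * F y)" by (rule kernel_integrable[OF Q F x(2)])
  fix y assume y: "y \<in> space hyp"
  then show "((\<lambda>x. Q x y * F y) has_derivative (\<lambda>h. (\<Sum>b\<in>Basis. (h \<bullet> b) * D b x y) * F y)) (at x)"
   using D[OF x(2), of y] by (auto intro!: derivative_eq_intros)
  fix h :: point3
  show "\<bar>(\<Sum>b\<in>Basis. (h \<bullet> b) * D b x y) * F y\<bar> \<le> B * indicator K y * norm h"
  proof (cases "y \<in> K")
   case True
   have "\<bar>\<Sum>b\<in>Basis. (h \<bullet> b) * D b x y\<bar> \<le> (\<Sum>b\<in>Basis. norm h * \<bar>D b x y\<bar>)"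
    by (rule order_trans[OF sum_abs]) (auto intro!: sum_mono mult_right_mono simp: abs_mult Basis_le_norm)
   then have "\<bar>\<Sum>b\<in>Basis. (h \<bullet> b) * D b x y\<bar> * \<bar>F y\<bar> \<le> norm h * (\<Sum>b\<in>Basis. \<bar>D b x y\<bar>) * \<bar>F y\<bar>"
    by (intro mult_right_mono) (auto simp: sum_distrib_left)
   also have "\<dots> \<le> norm h * B" using B(2)[of "(x, y)"] x True by (simp add: mult.assoc mult_left_mono abs_le_iff)
   finally show ?thesis using True by (simp add: abs_mult mult.commute)
  next
   case False
   then have "cosh_dist x y > c" using out x y by simp
   then have "D b x y = 0" if "b \<in> Basis" for b using Dw[OF that] x y by (simp add: kernel_within_def)
   then show ?thesis using False by simp
  qed
 next
  fix h :: point3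
  have "integrable hyp (\<lambda>y. \<Sum>b\<in>Basis. (h \<bullet> b) * (D b x0 y * F y))"
   using intD x0 by (intro Bochner_Integration.integrable_sum integrable_mult_right) auto
  then show "(\<lambda>y. (\<Sum>b\<in>Basis. (h \<bullet> b) * D b x0 y) * F y) \<in> borel_measurable hyp"
   by (auto simp: sum_distrib_right mult.assoc dest: borel_measurable_integrable)
 qed (use r in auto)
 moreover have "(\<integral>y. (\<Sum>b\<in>Basis. (h \<bullet> b) * D b x0 y) * F y \<partial>hyp) = (\<Sum>b\<in>Basis. (h \<bullet> b) * kernel_op (D b) F x0)" for h
 proof -
  have "(\<integral>y. (\<Sum>b\<in>Basis. (h \<bullet> b) * D b x0 y) * F y \<partial>hyp) = (\<integral>y. (\<Sum>b\<in>Basis. (h \<bullet> b) * (D b x0 y * F y)) \<partial>hyp)"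
   by (simp add: sum_distrib_right mult.assoc)
  also have "\<dots> = (\<Sum>b\<in>Basis. \<integral>y. (h \<bullet> b) * (D b x0 y * F y) \<partial>hyp)"
   using intD x0 by (intro Bochner_Integration.integral_sum integrable_mult_right) auto
  finally show ?thesis by (simp add: kernel_op_def)
 qed
 ultimately show ?thesis by (simp add: kernel_op_def[abs_def])
qed

lemma C_k_on_cong:
 assumes S: "open S"
 shows "C_k_on k f S \<Longrightarrow> (\<And>x. x \<in> S \<Longrightarrow> f x = g x) \<Longrightarrow> C_k_on k g S"
proof (induction k arbitrary: f g)
 case 0
 then show ?case using continuous_on_eq by auto
next
 case (Suc k)
 have eq: "frechet_derivative f (at x) = frechet_derivative g (at x)" if x: "x \<in> S" for x
 proof -
  have "f differentiable (at x)"
   using Suc.prems(1) x differentiable_on_eq_differentiable_at[OF S, of f] unfolding C_k_on.simps by blast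
  then have f': "(f has_derivative frechet_derivative f (at x)) (at x)" by (simp add: frechet_derivative_works)
  then have "(g has_derivative frechet_derivative f (at x)) (at x)"
   by (rule has_derivative_transform_within_open[OF _ S x]) (use Suc.prems in auto)
  then show ?thesis by (rule frechet_derivative_at)
 qed
 have "f differentiable_on S" using Suc.prems(1) by simp
 then have "g differentiable_on S" unfolding differentiable_on_def differentiable_def
  using Suc.prems(2) by (metis (no_types, lifting) has_derivative_transform)
 moreover have "C_k_on k (\<lambda>x. frechet_derivative g (at x) b) S" if "b \<in> Basis" for b
  by (rule Suc.IH[of "\<lambda>x. frechet_derivative f (at x) b"]) (use Suc.prems that eq in auto)
 ultimately show ?case by simp
qed

lemma sum_inner_Basis_eq: "b \<in> Basis \<Longrightarrow> (\<Sum>b'\<in>Basis. (b \<bullet> b') * g b') = (g b :: real)"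
 for b :: "'a::euclidean_space" by (simp add: inner_Basis if_distrib[of "\<lambda>x. x * _"] sum.delta cong: if_cong)

text \<open>All derivatives fall on the kernel, so the operator turns continuous functions into
  differentiable ones. This is the only source of regularity in the development.\<close>

theorem C_k_on_kernel_op:
 "C_kernel n Q \<Longrightarrow> kernel_within c Q \<Longrightarrow> continuous_on H3 F \<Longrightarrow> C_k_on n (kernel_op Q F) H3"
proof (induction n arbitrary: Q)
 case 0
 then show ?case using continuous_kernel_op by auto
next
 case (Suc n)
 obtain D where D: "\<And>x y. x \<in> H3 \<Longrightarrow> y \<in> H3 \<Longrightarrow> has_partials (\<lambda>x. Q x y) (\<lambda>b. D b x y) x"
  "\<And>b. b \<in> Basis \<Longrightarrow> C_kernel n (D b)" by (rule C_kernel_SucE[OF Suc.prems(1)], rule that)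
 have der: "has_partials (kernel_op Q F) (\<lambda>b. kernel_op (D b) F x) x" if "x \<in> H3" for x
  by (rule kernel_op_has_derivative[OF C_kernel_continuous[OF Suc.prems(1)] Suc.prems(2) D(1) C_kernel_continuous[OF D(2)] Suc.prems(3) that])
 have fd: "frechet_derivative (kernel_op Q F) (at x) b = kernel_op (D b) F x" if "x \<in> H3" "b \<in> Basis" for x b
  unfolding frechet_derivative_at[OF der[OF that(1)], symmetric] by (rule sum_inner_Basis_eq[OF that(2)])
 have "C_k_on n (\<lambda>x. frechet_derivative (kernel_op Q F) (at x) b) H3" if "b \<in> Basis" for b
  by (rule C_k_on_cong[OF open_H3 Suc.IH[OF D(2)[OF that] kernel_derivative_within[OF D(1) Suc.prems(2) that] Suc.prems(3)]])
   (assumption | rule fd[OF _ that, symmetric])+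
 moreover have "kernel_op Q F differentiable_on H3"
  using der by (auto simp: differentiable_on_def differentiable_def intro: has_derivative_at_withinI)
 ultimately show ?case by simp
qed

section \<open>The Laplacian\<close>

abbreviation partial_deriv :: "point3 \<Rightarrow> (point3 \<Rightarrow> real) \<Rightarrow> point3 \<Rightarrow> real" where
 "partial_deriv b f \<equiv> \<lambda>x. frechet_derivative f (at x) b"

lemma partial_deriv_eq:
 "has_partials f D x \<Longrightarrow> b \<in> Basis \<Longrightarrow> partial_deriv b f x = D b"
 by (metis (mono_tags, lifting) frechet_derivative_at sum_inner_Basis_eq)

lemma has_derivative_partial:
 fixes f :: "point3 \<Rightarrow> real"
 assumes "f differentiable (at x)"
 shows "has_partials f (\<lambda>b. partial_deriv b f x) x"
proof -
 have f: "(f has_derivative frechet_derivative f (at x)) (at x)" using assms by (simp add: frechet_derivative_works)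
 then have lin: "linear (frechet_derivative f (at x))" by (rule has_derivative_linear)
 have "frechet_derivative f (at x) h = (\<Sum>b\<in>Basis. (h \<bullet> b) * partial_deriv b f x)" for h
  by (subst euclidean_representation[of h, symmetric])
   (simp only: linear_sum[OF lin] linear_scale[OF lin] o_def real_scaleR_def)
 then show ?thesis by (intro has_derivative_eq_rhs[OF f] ext)
qed

lemma C2_onD:
 assumes "C_k_on 2 f H3" "b \<in> Basis" "x \<in> H3"
 shows "f differentiable (at x)" "partial_deriv b f differentiable (at x)"
  "b' \<in> Basis \<Longrightarrow> continuous_on H3 (partial_deriv b' (partial_deriv b f))"
 using assms differentiable_on_eq_differentiable_at[OF open_H3, of f]
  differentiable_on_eq_differentiable_at[OF open_H3, of "partial_deriv b f"]
 unfolding numeral_2_eq_2 C_k_on.simps by blast+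

lemma C2_on_continuous:
 assumes "C_k_on 2 f H3" "b \<in> Basis"
 shows "continuous_on H3 f" "continuous_on H3 (partial_deriv b f)"
 using assms differentiable_imp_continuous_on unfolding numeral_2_eq_2 C_k_on.simps by blast+

lemma partial_deriv_cong:
 assumes "open S" "x \<in> S" "\<And>y. y \<in> S \<Longrightarrow> f y = g y" "f differentiable (at x)"
 shows "frechet_derivative f (at x) = frechet_derivative g (at x)"
proof -
 have "(f has_derivative frechet_derivative f (at x)) (at x)" using assms(4) by (simp add: frechet_derivative_works)
 then have "(g has_derivative frechet_derivative f (at x)) (at x)"
  by (rule has_derivative_transform_within_open[OF _ assms(1,2)]) (use assms in auto)
 then show ?thesis by (rule frechet_derivative_at)
qed

text \<open>The divergence form, in which the gradient factor t^2 and the density t^(-3) combine to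
  1 / t, serves Green's identity; the expanded form serves explicit computation.\<close>

lemma laplace_beltrami_explicit:
 assumes f: "C_k_on 2 f H3" and p: "p \<in> H3"
 shows "laplace_beltrami f p = - ((snd p) ^ 3) *
   (\<Sum>b\<in>Basis. partial_deriv b (\<lambda>q. partial_deriv b f q / snd q) p)"
  and "b \<in> Basis \<Longrightarrow> ((\<lambda>q. partial_deriv b f q / snd q) has_derivative
   (\<lambda>h. (\<Sum>b'\<in>Basis. (h \<bullet> b') * (partial_deriv b' (partial_deriv b f) p / snd p
     - snd b' * partial_deriv b f p / (snd p)^2)))) (at p)"
  and "laplace_beltrami f p = - ((snd p)^2) * (\<Sum>b\<in>Basis. partial_deriv b (partial_deriv b f) p)
   + snd p * partial_deriv (0, 1) f p"
proof -
 have pos: "snd p > 0" using p by (simp add: H3_iff)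
 have *: "((\<lambda>q. partial_deriv b f q / snd q) has_derivative
   (\<lambda>h. (\<Sum>b'\<in>Basis. (h \<bullet> b') * (partial_deriv b' (partial_deriv b f) p / snd p
     - snd b' * partial_deriv b f p / (snd p)^2)))) (at p)" if b: "b \<in> Basis" for b
 proof -
  have "(\<Sum>b'\<in>Basis. (h \<bullet> b') * snd b') = snd h" for h :: point3 by (simp add: sum_Basis_point3 inner_prod_def)
  then have "(\<Sum>b'\<in>Basis. (h \<bullet> b') * (snd b' * c)) = snd h * c" for h :: point3 and c
   by (metis (no_types, lifting) mult.assoc sum.cong sum_distrib_right)
  then have eq: "(\<Sum>b'\<in>Basis. (h \<bullet> b') * (partial_deriv b' (partial_deriv b f) p / snd p
     - snd b' * partial_deriv b f p / (snd p)^2)) =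
    ((\<Sum>b'\<in>Basis. (h \<bullet> b') * partial_deriv b' (partial_deriv b f) p) * snd p - partial_deriv b f p * snd h) / (snd p * snd p)" for h
   using pos by (simp add: right_diff_distrib sum_subtractf sum_divide_distrib[symmetric] power2_eq_square
    times_divide_eq_right[symmetric] diff_divide_distrib del: times_divide_eq_right) (simp add: sum_divide_distrib)
  have "((\<lambda>q. partial_deriv b f q / snd q) has_derivative (\<lambda>h.
   ((\<Sum>b'\<in>Basis. (h \<bullet> b') * partial_deriv b' (partial_deriv b f) p) * snd p - partial_deriv b f p * snd h) / (snd p * snd p))) (at p)"
   by (rule has_derivative_divide'[OF has_derivative_partial[OF C2_onD(2)[OF f b p]] has_derivative_snd[OF has_derivative_ident]])
    (use pos in simp)
  then show ?thesis unfolding eq .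
 qed
 then show "b \<in> Basis \<Longrightarrow> ((\<lambda>q. partial_deriv b f q / snd q) has_derivative
   (\<lambda>h. (\<Sum>b'\<in>Basis. (h \<bullet> b') * (partial_deriv b' (partial_deriv b f) p / snd p
     - snd b' * partial_deriv b f p / (snd p)^2)))) (at p)" .
 have "frechet_derivative (\<lambda>q. (hyp_grad f q \<bullet> b) / (snd q) ^ 3) (at p) = frechet_derivative (\<lambda>q. partial_deriv b f q / snd q) (at p)"
  if b: "b \<in> Basis" for b
 proof (rule partial_deriv_cong[OF open_H3 p, symmetric])
  fix q assume "q \<in> H3"
  then have "snd q > 0" by (simp add: H3_iff)
  moreover have "hyp_grad f q \<bullet> b = (snd q)^2 * partial_deriv b f q"
   unfolding hyp_grad_def inner_sum_left inner_scaleR_left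
   using sum_inner_Basis_eq[OF b, of "\<lambda>c. (snd q)^2 * partial_deriv c f q"]
   by (simp add: inner_commute[of b] mult.commute)
  ultimately show "partial_deriv b f q / snd q = (hyp_grad f q \<bullet> b) / (snd q) ^ 3"
   by (simp add: power2_eq_square power3_eq_cube)
 qed (use *[OF b] in \<open>auto simp: differentiable_def\<close>)
 then show lap: "laplace_beltrami f p = - ((snd p) ^ 3) *
   (\<Sum>b\<in>Basis. partial_deriv b (\<lambda>q. partial_deriv b f q / snd q) p)"
  unfolding laplace_beltrami_def hyp_div_def by (simp cong: sum.cong)
 have "(\<Sum>b\<in>Basis. partial_deriv b (\<lambda>q. partial_deriv b f q / snd q) p) =
  (\<Sum>b\<in>Basis. partial_deriv b (partial_deriv b f) p / snd p - snd b * partial_deriv b f p / (snd p)^2)"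
  by (intro sum.cong refl partial_deriv_eq[OF *])
 also have "\<dots> = (\<Sum>b\<in>Basis. partial_deriv b (partial_deriv b f) p) / snd p - partial_deriv (0, 1) f p / (snd p)^2"
  unfolding sum_Basis_point3 by (simp add: add_divide_distrib)
 finally show "laplace_beltrami f p = - ((snd p)^2) * (\<Sum>b\<in>Basis. partial_deriv b (partial_deriv b f) p)
   + snd p * partial_deriv (0, 1) f p"
  unfolding lap using pos by (simp add: power2_eq_square power3_eq_cube right_diff_distrib)
qed

lemma laplace_beltrami_cong:
 assumes "C_k_on 2 f H3" "\<And>q. q \<in> H3 \<Longrightarrow> f q = g q" "p \<in> H3"
 shows "laplace_beltrami f p = laplace_beltrami g p"
proof -
 have g: "C_k_on 2 g H3" using C_k_on_cong[OF open_H3 assms(1,2)] .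
 have 1: "partial_deriv b f q = partial_deriv b g q" if "q \<in> H3" "b \<in> Basis" for q b
  using partial_deriv_cong[OF open_H3 that(1) assms(2) C2_onD(1)[OF assms(1) that(2) that(1)]] by simp
 have 2: "partial_deriv b (partial_deriv b f) p = partial_deriv b (partial_deriv b g) p" if "b \<in> Basis" for b
  using partial_deriv_cong[OF open_H3 assms(3) 1[OF _ that] C2_onD(2)[OF assms(1) that assms(3)]] by simp
 show ?thesis unfolding laplace_beltrami_explicit(3)[OF assms(1,3)] laplace_beltrami_explicit(3)[OF g assms(3)]
  using 1[OF assms(3), of "(0, 1)"] 2 by (simp add: Basis_point3 cong: sum.cong)
qed

lemma C_kernel_C_k_on:
 "C_kernel n Q \<Longrightarrow> y \<in> H3 \<Longrightarrow> C_k_on n (\<lambda>x. Q x y) H3"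
proof (induction n arbitrary: Q)
 case 0
 have "continuous_on H3 (\<lambda>x. (x, y))" by (intro continuous_intros)
 then show ?case using continuous_on_compose2[OF C_kernel_continuous[OF 0(1)], of H3 "\<lambda>x. (x, y)"] 0(2) by auto
next
 case (Suc n)
 obtain D where D: "\<And>x y. x \<in> H3 \<Longrightarrow> y \<in> H3 \<Longrightarrow> has_partials (\<lambda>x. Q x y) (\<lambda>b. D b x y) x"
  "\<And>b. b \<in> Basis \<Longrightarrow> C_kernel n (D b)" by (rule C_kernel_SucE[OF Suc.prems(1)], rule that)
 have "C_k_on n (partial_deriv b (\<lambda>x. Q x y)) H3" if "b \<in> Basis" for b
  by (rule C_k_on_cong[OF open_H3 Suc.IH[OF D(2)[OF that] Suc.prems(2)]])
   (rule partial_deriv_eq[OF D(1) that, symmetric], auto intro: Suc.prems)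
 moreover have "(\<lambda>x. Q x y) differentiable_on H3" unfolding differentiable_on_def differentiable_def
  using has_derivative_at_withinI[OF D(1)] Suc.prems(2) by blast
 ultimately show ?case by simp
qed

theorem laplace_kernel_op:
 assumes Q: "C_kernel 2 Q" "kernel_within c Q" and F: "continuous_on H3 F" and x: "x \<in> H3"
 shows "laplace_beltrami (kernel_op Q F) x = kernel_op (\<lambda>x y. laplace_beltrami (\<lambda>x. Q x y) x) F x"
proof -
 obtain D where D: "\<And>x y. x \<in> H3 \<Longrightarrow> y \<in> H3 \<Longrightarrow> has_partials (\<lambda>x. Q x y) (\<lambda>b. D b x y) x"
  "\<And>b. b \<in> Basis \<Longrightarrow> C_kernel 1 (D b)" by (rule C_kernel_SucE[of 1 Q], use Q in \<open>simp add: numeral_2_eq_2\<close>, rule that)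
 have "\<exists>E. (\<forall>x\<in>H3. \<forall>y\<in>H3. has_partials (\<lambda>x. D b x y) (\<lambda>b'. E b' x y) x) \<and>
  (\<forall>b'\<in>Basis. C_kernel 0 (E b'))" if "b \<in> Basis" for b
  using D(2)[OF that] unfolding One_nat_def C_kernel.simps(2) by blast
 then have "\<forall>b\<in>Basis. \<exists>E. (\<forall>x\<in>H3. \<forall>y\<in>H3. has_partials (\<lambda>x. D b x y) (\<lambda>b'. E b' x y) x) \<and>
  (\<forall>b'\<in>Basis. C_kernel 0 (E b'))" by (rule ballI)
 from bchoice[OF this] obtain E where E0: "\<forall>b\<in>Basis. (\<forall>x\<in>H3. \<forall>y\<in>H3. has_partials (\<lambda>x. D b x y) (\<lambda>b'. E b b' x y) x) \<and>
  (\<forall>b'\<in>Basis. C_kernel 0 (E b b'))" ..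
 have E: "\<And>b x y. b \<in> Basis \<Longrightarrow> x \<in> H3 \<Longrightarrow> y \<in> H3 \<Longrightarrow> has_partials (\<lambda>x. D b x y) (\<lambda>b'. E b b' x y) x"
  "\<And>b b'. b \<in> Basis \<Longrightarrow> b' \<in> Basis \<Longrightarrow> C_kernel 0 (E b b')" using E0 by blast+
 have Dw: "kernel_within c (D b)" if "b \<in> Basis" for b using kernel_derivative_within[OF D(1) Q(2) that] .
 have Ew: "kernel_within c (E b b')" if "b \<in> Basis" "b' \<in> Basis" for b b'
  using kernel_derivative_within[OF E(1)[OF that(1)] Dw[OF that(1)] that(2)] .
 have derQ: "has_partials (kernel_op Q F) (\<lambda>b. kernel_op (D b) F x) x" if "x \<in> H3" for x
  by (rule kernel_op_has_derivative[OF C_kernel_continuous[OF Q(1)] Q(2) D(1) C_kernel_continuous[OF D(2)] F that])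
 have derD: "has_partials (kernel_op (D b) F) (\<lambda>b'. kernel_op (E b b') F x) x" if "b \<in> Basis" "x \<in> H3" for b x
  by (rule kernel_op_has_derivative[OF C_kernel_continuous[OF D(2)[OF that(1)]] Dw[OF that(1)] E(1)[OF that(1)] C_kernel_continuous[OF E(2)[OF that(1)]] F that(2)])
 have p1: "partial_deriv b (kernel_op Q F) x = kernel_op (D b) F x" if "b \<in> Basis" "x \<in> H3" for b x
  using partial_deriv_eq[OF derQ[OF that(2)] that(1)] .
 have p2: "partial_deriv b (partial_deriv b (kernel_op Q F)) x = kernel_op (E b b) F x" if b: "b \<in> Basis" for b
 proof -
  have "frechet_derivative (kernel_op (D b) F) (at x) = frechet_derivative (partial_deriv b (kernel_op Q F)) (at x)"
   by (rule partial_deriv_cong[OF open_H3 x p1[OF b, symmetric]]) (use derD[OF b x] in \<open>auto simp: differentiable_def\<close>)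
  then show ?thesis using partial_deriv_eq[OF derD[OF b x] b] by simp
 qed
 have q1: "partial_deriv b (\<lambda>x. Q x y) x = D b x y" if "b \<in> Basis" "x \<in> H3" "y \<in> H3" for b x y
  using partial_deriv_eq[OF D(1)[OF that(2,3)] that(1)] .
 have q2: "partial_deriv b (partial_deriv b (\<lambda>x. Q x y)) x = E b b x y" if b: "b \<in> Basis" and y: "y \<in> H3" for b y
 proof -
  have "frechet_derivative (\<lambda>x. D b x y) (at x) = frechet_derivative (partial_deriv b (\<lambda>x. Q x y)) (at x)"
   by (rule partial_deriv_cong[OF open_H3 x q1[OF b _ y, symmetric]]) (use E(1)[OF b x y] in \<open>auto simp: differentiable_def\<close>)
  then show ?thesis using partial_deriv_eq[OF E(1)[OF b x y] b] by simp
 qed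
 have iE: "integrable hyp (\<lambda>y. E b b x y * F y)" if "b \<in> Basis" for b
  by (rule kernel_integrable[OF C_kernel_continuous[OF E(2)[OF that that]] Ew[OF that that] F x])
 have b3: "(0, 1) \<in> (Basis :: point3 set)" by (simp add: Basis_point3)
 have iD: "integrable hyp (\<lambda>y. D (0, 1) x y * F y)"
  by (rule kernel_integrable[OF C_kernel_continuous[OF D(2)[OF b3]] Dw[OF b3] F x])
 have "kernel_op (\<lambda>x y. laplace_beltrami (\<lambda>x. Q x y) x) F x =
  (\<integral>y. (- ((snd x)^2) * (\<Sum>b\<in>Basis. E b b x y * F y) + snd x * (D (0, 1) x y * F y)) \<partial>hyp)" unfolding kernel_op_def
 proof (rule Bochner_Integration.integral_cong)
  fix y assume "y \<in> space hyp"
  then have y: "y \<in> H3" by simp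
  have lapeq: "laplace_beltrami (\<lambda>x. Q x y) x = - ((snd x)^2) * (\<Sum>b\<in>Basis. E b b x y) + snd x * D (0, 1) x y"
   using laplace_beltrami_explicit(3)[OF C_kernel_C_k_on[OF Q(1) y] x] q1[OF b3 x y] q2[OF _ y] by simp
  show "laplace_beltrami (\<lambda>x. Q x y) x * F y =
    - ((snd x)^2) * (\<Sum>b\<in>Basis. E b b x y * F y) + snd x * (D (0, 1) x y * F y)"
   unfolding lapeq sum_distrib_right[symmetric] by (simp add: algebra_simps)
 qed simp
 also have "\<dots> = - ((snd x)^2) * (\<Sum>b\<in>Basis. kernel_op (E b b) F x) + snd x * kernel_op (D (0, 1)) F x"
  using iE iD by (simp add: kernel_op_def Bochner_Integration.integral_sum)
 also have "\<dots> = laplace_beltrami (kernel_op Q F) x"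
  using laplace_beltrami_explicit(3)[OF C_k_on_kernel_op[OF Q F] x] p1[OF b3 x] p2 by simp
 finally show ?thesis by simp
qed

section \<open>Green's identity\<close>

text \<open>By translation invariance of Lebesgue measure every difference quotient of G has
  integral zero; the derivative is their dominated limit.\<close>

lemma integral_partial_deriv_zero:
 fixes G :: "'a::euclidean_space \<Rightarrow> real"
 assumes G: "\<And>x. (G has_derivative G' x) (at x)" and cont: "continuous_on UNIV (\<lambda>x. G' x b)"
  and K: "compact K" and out: "\<And>x. x \<notin> K \<Longrightarrow> G x = 0"
 shows "(\<integral>x. G' x b \<partial>lborel) = 0"
proof -
 \<comment> \<open>The support of G swept along segments of length 1 in both directions. It contains
   the support of every difference quotient, since the step sizes 1 / (n + 1) are at most 1.\<close>
 define K' where "K' = (\<lambda>(x, s). x + s *\<^sub>R b) ` (K \<times> {-1..1::real})"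
 have K': "compact K'"
  unfolding K'_def using K by (auto simp: case_prod_unfold intro!: compact_continuous_image continuous_intros compact_Times)
 have mem: "x + s *\<^sub>R b \<in> K'" if "x \<in> K" "s \<in> {-1..1}" for x s
  unfolding K'_def using imageI[of "(x, s)" "K \<times> {-1..1}" "\<lambda>(x, s). x + s *\<^sub>R b"] that by simp
 have sub: "K \<subseteq> K'" using mem[of _ 0] by auto
 obtain B where B: "B \<ge> 0" "\<And>x. x \<in> K' \<Longrightarrow> \<bar>G' x b\<bar> \<le> B"
  using bounded_on_compact[OF K'] continuous_on_subset[OF cont] by (metis subset_UNIV)
 have contG: "continuous_on UNIV G" by (intro continuous_at_imp_continuous_on ballI has_derivative_continuous[OF G])
 have out': "G' x b = 0" if "x \<notin> K" for x
 proof -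
  have "((\<lambda>x. 0) has_derivative G' x) (at x)"
   by (rule has_derivative_transform_within_open[OF G, of "- K"]) (use that K out in \<open>auto simp: compact_imp_closed open_Compl\<close>)
  moreover have "((\<lambda>x::'a. 0::real) has_derivative (\<lambda>h. 0)) (at x)" by simp
  ultimately have "G' x = (\<lambda>h. 0)" by (rule has_derivative_unique)
  then show ?thesis by simp
 qed
 have B': "\<bar>G' x b\<bar> \<le> B" for x using B out' sub by (cases "x \<in> K") auto
 have intG: "integrable lborel (\<lambda>x. G (x + v))" for v
 proof -
  have "integrable lborel (\<lambda>x. indicator K x *\<^sub>R G x)"
   using borel_integrable_compact[OF K continuous_on_subset[OF contG]] by (simp add: set_integrable_def)
  moreover have "(\<lambda>x. indicator K x *\<^sub>R G x) = G"
  proof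
   show "indicator K x *\<^sub>R G x = G x" for x using out by (cases "x \<in> K") auto
  qed
  ultimately have "integrable lborel G" by simp
  then have "integrable (distr lborel borel ((+) v)) G" by (simp add: lborel_distr_plus)
  then show ?thesis by (subst (asm) integrable_distr_eq) (auto simp: add.commute intro!: borel_measurable_continuous_onI contG)
 qed
 have shift: "(\<integral>x. G (x + v) \<partial>lborel) = (\<integral>x. G x \<partial>lborel)" for v
 proof -
  have "(\<integral>x. G x \<partial>lborel) = (\<integral>x. G x \<partial>distr lborel borel ((+) v))" by (simp add: lborel_distr_plus)
  also have "\<dots> = (\<integral>x. G (v + x) \<partial>lborel)"
   by (subst integral_distr) (auto intro!: borel_measurable_continuous_onI contG)
  finally show ?thesis by (simp add: add.commute)
 qed
 define q where "q n x = (G (x + (1 / real (Suc n)) *\<^sub>R b) - G x) / (1 / real (Suc n))" for n x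
 have "(\<lambda>n. \<integral>x. q n x \<partial>lborel) \<longlonglongrightarrow> (\<integral>x. G' x b \<partial>lborel)"
 proof (rule integral_dominated_convergence[where w = "\<lambda>x. B * indicator K' x"])
  show "integrable lborel (\<lambda>x. B * indicator K' x)" using K' emeasure_bounded_finite[OF compact_imp_bounded[OF K']]
   by (intro integrable_mult_right integrable_real_indicator) (auto simp: borel_compact)
  show "AE x in lborel. (\<lambda>n. q n x) \<longlonglongrightarrow> G' x b"
  proof (rule AE_I2)
   fix x
   have "((\<lambda>s::real. x + s *\<^sub>R b) has_derivative (\<lambda>s. s *\<^sub>R b)) (at 0)" by (auto intro!: derivative_eq_intros)
   then have "((\<lambda>s::real. G (x + s *\<^sub>R b)) has_derivative (\<lambda>s. G' x (s *\<^sub>R b))) (at 0)"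
    by (rule has_derivative_compose) (use G[of x] in simp)
   moreover have "(\<lambda>s. G' x (s *\<^sub>R b)) = (*) (G' x b)"
    using linear_scale[OF has_derivative_linear[OF G[of x]]] by (auto simp: mult.commute)
   ultimately have "((\<lambda>s::real. G (x + s *\<^sub>R b)) has_real_derivative G' x b) (at 0)"
    by (simp add: has_field_derivative_def)
   then have "((\<lambda>s. (G (x + s *\<^sub>R b) - G x) / s) \<longlongrightarrow> G' x b) (at 0)" by (simp add: DERIV_def)
   moreover have "filterlim (\<lambda>n. 1 / real (Suc n)) (at 0) sequentially"
    unfolding filterlim_at using LIMSEQ_Suc[OF lim_1_over_n] by (auto simp: inverse_eq_divide)
   ultimately show "(\<lambda>n. q n x) \<longlonglongrightarrow> G' x b" unfolding q_def by (rule filterlim_compose)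
  qed
  show "AE x in lborel. norm (q n x) \<le> B * indicator K' x" for n
  proof (rule AE_I2)
   fix x
   define s where "s = 1 / real (Suc n)"
   have s: "0 < s" "s \<le> 1" by (auto simp: s_def)
   show "norm (q n x) \<le> B * indicator K' x"
   proof (cases "x \<in> K'")
    case True
    have "\<exists>z. 0 < z \<and> z < s \<and> G (x + s *\<^sub>R b) - G (x + 0 *\<^sub>R b) = (s - 0) * G' (x + z *\<^sub>R b) b"
    proof (rule MVT2[of 0 s "\<lambda>s. G (x + s *\<^sub>R b)" "\<lambda>z. G' (x + z *\<^sub>R b) b"])
     fix z
     have "((\<lambda>s::real. x + s *\<^sub>R b) has_derivative (\<lambda>s. s *\<^sub>R b)) (at z)" by (auto intro!: derivative_eq_intros)
     then have "((\<lambda>s::real. G (x + s *\<^sub>R b)) has_derivative (\<lambda>s. G' (x + z *\<^sub>R b) (s *\<^sub>R b))) (at z)"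
      by (rule has_derivative_compose) (rule G)
     moreover have "(\<lambda>s. G' (x + z *\<^sub>R b) (s *\<^sub>R b)) = (*) (G' (x + z *\<^sub>R b) b)"
      using linear_scale[OF has_derivative_linear[OF G]] by (auto simp: mult.commute)
     ultimately show "((\<lambda>s::real. G (x + s *\<^sub>R b)) has_real_derivative G' (x + z *\<^sub>R b) b) (at z)"
      by (simp add: has_field_derivative_def)
    qed (use s in auto)
    then obtain z where "G (x + s *\<^sub>R b) - G x = s * G' (x + z *\<^sub>R b) b" by auto
    moreover have "q n x = (G (x + s *\<^sub>R b) - G x) / s" by (simp only: q_def s_def)
    ultimately have "q n x = G' (x + z *\<^sub>R b) b" using s by simp
    then show ?thesis using True B' by simp
   next
    case False
    then have "x \<notin> K" using sub by auto
    moreover have "x + s *\<^sub>R b \<notin> K"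
    proof
     assume "x + s *\<^sub>R b \<in> K"
     then have "(x + s *\<^sub>R b) + (- s) *\<^sub>R b \<in> K'" using s by (intro mem) auto
     then show False using False by simp
    qed
    moreover have "q n x = (G (x + s *\<^sub>R b) - G x) / s" by (simp only: q_def s_def)
    ultimately show ?thesis using out B(1) by simp
   qed
  qed
  show "(\<lambda>x. G' x b) \<in> borel_measurable lborel" using cont by (simp add: borel_measurable_continuous_onI)
  show "q n \<in> borel_measurable lborel" for n
   unfolding q_def using intG[of "(1 / real (Suc n)) *\<^sub>R b"] intG[of 0] by (auto dest!: borel_measurable_integrable)
 qed
 moreover have "(\<integral>x. q n x \<partial>lborel) = 0" for n
  unfolding q_def using intG[of "(1 / real (Suc n)) *\<^sub>R b"] intG[of 0] shift by simp
 ultimately show ?thesis using LIMSEQ_unique[of "\<lambda>n. 0::real" 0] by simp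
qed

lemma laplace_beltrami_continuous:
 assumes f: "C_k_on 2 f H3"
 shows "continuous_on H3 (laplace_beltrami f)"
proof (rule continuous_on_eq)
 show "continuous_on H3 (\<lambda>p. - ((snd p)^2) * (\<Sum>b\<in>Basis. partial_deriv b (partial_deriv b f) p)
   + snd p * partial_deriv (0, 1) f p)" using C2_on_continuous(2)[OF f, of "(0, 1)"] C2_onD(3)[OF f _ base_point_H3]
  by (intro continuous_intros) (auto simp: Basis_point3)
qed (simp add: laplace_beltrami_explicit(3)[OF f])

lemma laplace_beltrami_support:
 assumes f: "C_k_on 2 f H3" and K: "compact K" and out: "\<And>p. p \<in> H3 \<Longrightarrow> p \<notin> K \<Longrightarrow> f p = 0" and p: "p \<in> H3" "p \<notin> K"
 shows "laplace_beltrami f p = 0" "partial_deriv b f p = 0"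
proof -
 have op: "open (H3 - K)" using open_H3 K by (auto intro: compact_imp_closed)
 have zero: "frechet_derivative g (at q) = (\<lambda>h. 0)" if "q \<in> H3 - K" "\<And>y. y \<in> H3 - K \<Longrightarrow> g y = 0" for g :: "point3 \<Rightarrow> real" and q
 proof -
  have "((\<lambda>x::point3. 0::real) has_derivative (\<lambda>h. 0)) (at q)" by simp
  then have "(g has_derivative (\<lambda>h. 0)) (at q)"
   by (rule has_derivative_transform_within_open[OF _ op that(1)]) (use that in auto)
  then show ?thesis by (metis frechet_derivative_at)
 qed
 have 1: "partial_deriv b f q = 0" if "q \<in> H3 - K" for q b using zero[OF that, of f] out by simp
 have 2: "partial_deriv b (partial_deriv b f) p = 0" for b using zero[of p "partial_deriv b f"] 1 p by simp
 show "partial_deriv b f p = 0" using 1 p by simp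
 show "laplace_beltrami f p = 0" using 1[of p] 2 p by (simp add: laplace_beltrami_explicit(3)[OF f p(1)])
qed

text \<open>Written against Lebesgue measure, the difference of the two integrands is a sum of
  coordinate derivatives of (q \<partial>f - f \<partial>q) / t. Since q vanishes off K this field
  has compact support, and each derivative integrates to zero.\<close>

theorem green_identity:
 assumes f: "C_k_on 2 f H3" and q: "C_k_on 2 q H3" and K: "compact K" "K \<subseteq> H3" and out: "\<And>p. p \<in> H3 \<Longrightarrow> p \<notin> K \<Longrightarrow> q p = 0"
 shows "(\<integral>p. q p * laplace_beltrami f p \<partial>hyp) = (\<integral>p. laplace_beltrami q p * f p \<partial>hyp)"
proof -
 define W where "W f b p = partial_deriv b f p / snd p" for f b and p :: point3
 define D where "D f b b' p = partial_deriv b' (partial_deriv b f) p / snd p - snd b' * partial_deriv b f p / (snd p)^2" for f b b' and p :: point3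
 have W: "has_partials (W f b) (\<lambda>b'. D f b b' p) p"
  if "C_k_on 2 f H3" "p \<in> H3" "b \<in> Basis" for f b p
  unfolding W_def D_def by (rule laplace_beltrami_explicit(2)[OF that])
 have contW: "continuous_on H3 (W f b)" "continuous_on H3 (D f b b)" if "C_k_on 2 f H3" "b \<in> Basis" for f b
  unfolding W_def D_def
  by (intro continuous_intros C2_on_continuous(2)[OF that] C2_onD(3)[OF that base_point_H3 that(2)]; force simp: H3_iff)+
 have lap: "(\<Sum>b\<in>Basis. D f b b p) = - laplace_beltrami f p / (snd p) ^ 3" if "C_k_on 2 f H3" "p \<in> H3" for f p
 proof -
  have "(\<Sum>b\<in>Basis. partial_deriv b (\<lambda>q. partial_deriv b f q / snd q) p) = (\<Sum>b\<in>Basis. D f b b p)"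
   by (intro sum.cong refl partial_deriv_eq[OF W[OF that, unfolded W_def[abs_def]]])
  then show ?thesis using laplace_beltrami_explicit(1)[OF that] that(2) by (simp add: H3_iff)
 qed
 have zero: "(\<integral>p. (if p \<in> H3 then q p * D f b b p - f p * D q b b p else 0) \<partial>lborel) = 0"
  and intz: "integrable lborel (\<lambda>p. if p \<in> H3 then q p * D f b b p - f p * D q b b p else 0)" if b: "b \<in> Basis" for b
 proof -
  define G where "G p = (if p \<in> H3 then q p * W f b p - f p * W q b p else 0)" for p
  define G' where "G' p h = (if p \<in> H3 then
    (q p * (\<Sum>b'\<in>Basis. (h \<bullet> b') * D f b b' p) + (\<Sum>b'\<in>Basis. (h \<bullet> b') * partial_deriv b' q p) * W f b p)
   - (f p * (\<Sum>b'\<in>Basis. (h \<bullet> b') * D q b b' p) + (\<Sum>b'\<in>Basis. (h \<bullet> b') * partial_deriv b' f p) * W q b p) else 0)" for p h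
  have G'b: "G' p b = (if p \<in> H3 then q p * D f b b p - f p * D q b b p else 0)" for p
   by (simp add: G'_def sum_inner_Basis_eq[OF b] W_def)
  have opK: "open (- K)" using K by (simp add: compact_imp_closed open_Compl)
  have outW: "W q b p = 0" "D q b b p = 0" if "p \<in> H3" "p \<notin> K" for p
  proof -
   show "W q b p = 0" using laplace_beltrami_support(2)[OF q K(1) out that] by (simp add: W_def)
   have "open (H3 - K)" using open_H3 K by (auto intro: compact_imp_closed)
   have "((\<lambda>x::point3. 0::real) has_derivative (\<lambda>h. 0)) (at p)" by simp
   then have "(W q b has_derivative (\<lambda>h. 0)) (at p)"
    by (rule has_derivative_transform_within_open[OF _ \<open>open (H3 - K)\<close>])
     (use that laplace_beltrami_support(2)[OF q K(1) out] in \<open>auto simp: W_def\<close>)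
   then have "(\<lambda>h. \<Sum>b'\<in>Basis. (h \<bullet> b') * D q b b' p) = (\<lambda>h. 0)" using W[OF q that(1) b] has_derivative_unique by blast
   then have "(\<Sum>b'\<in>Basis. (b \<bullet> b') * D q b b' p) = 0" by (rule fun_cong)
   then show "D q b b p = 0" by (simp add: sum_inner_Basis_eq[OF b])
  qed
  have Gout: "G p = 0" if "p \<notin> K" for p using that out outW by (simp add: G_def)
  have contb: "continuous_on UNIV (\<lambda>p. G' p b)"
  proof -
   have "continuous_on H3 (\<lambda>p. G' p b)" by (rule continuous_on_eq[of _ "\<lambda>p. q p * D f b b p - f p * D q b b p"])
     (auto simp: G'b intro!: continuous_intros contW b f q C2_on_continuous(1)[OF f b] C2_on_continuous(1)[OF q b])
   moreover have "continuous_on (- K) (\<lambda>p. G' p b)" by (rule continuous_on_eq[of _ "\<lambda>p. 0"]) (auto simp: G'b out outW)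
   ultimately have "continuous_on (H3 \<union> - K) (\<lambda>p. G' p b)" using open_H3 opK by (intro continuous_on_open_Un)
   moreover have "H3 \<union> - K = UNIV" using K by auto
   ultimately show ?thesis by simp
  qed
  have der: "(G has_derivative G' p) (at p)" for p
  proof (cases "p \<in> H3")
   case True
   have "((\<lambda>p. q p * W f b p - f p * W q b p) has_derivative
    (\<lambda>h. (q p * (\<Sum>b'\<in>Basis. (h \<bullet> b') * D f b b' p) + (\<Sum>b'\<in>Basis. (h \<bullet> b') * partial_deriv b' q p) * W f b p)
   - (f p * (\<Sum>b'\<in>Basis. (h \<bullet> b') * D q b b' p) + (\<Sum>b'\<in>Basis. (h \<bullet> b') * partial_deriv b' f p) * W q b p))) (at p)"
    by (intro has_derivative_diff has_derivative_mult has_derivative_partial C2_onD(1)[OF q b True] C2_onD(1)[OF f b True] W f q True b)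
   then have "(G has_derivative (\<lambda>h. (q p * (\<Sum>b'\<in>Basis. (h \<bullet> b') * D f b b' p) + (\<Sum>b'\<in>Basis. (h \<bullet> b') * partial_deriv b' q p) * W f b p)
   - (f p * (\<Sum>b'\<in>Basis. (h \<bullet> b') * D q b b' p) + (\<Sum>b'\<in>Basis. (h \<bullet> b') * partial_deriv b' f p) * W q b p))) (at p)"
    by (rule has_derivative_transform_within_open[OF _ open_H3 True]) (simp add: G_def)
   then show ?thesis using True by (simp add: G'_def[abs_def])
  next
   case False
   have "((\<lambda>x::point3. 0::real) has_derivative (\<lambda>h. 0)) (at p)" by simp
   then have "(G has_derivative (\<lambda>h. 0)) (at p)"
    by (rule has_derivative_transform_within_open[OF _ opK]) (use False K Gout in auto)
   then show ?thesis using False by (simp add: G'_def[abs_def])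
  qed
  have "(\<integral>p. G' p b \<partial>lborel) = 0" by (rule integral_partial_deriv_zero[OF der contb K(1) Gout])
  then show "(\<integral>p. (if p \<in> H3 then q p * D f b b p - f p * D q b b p else 0) \<partial>lborel) = 0" by (simp add: G'b)
  have "integrable lborel (\<lambda>p. indicator K p *\<^sub>R G' p b)"
   using borel_integrable_compact[OF K(1) continuous_on_subset[OF contb]] by (simp add: set_integrable_def)
  moreover have "(\<lambda>p. indicator K p *\<^sub>R G' p b) = (\<lambda>p. G' p b)"
  proof
   show "indicator K p *\<^sub>R G' p b = G' p b" for p by (cases "p \<in> K") (auto simp: G'b out outW)
  qed
  ultimately show "integrable lborel (\<lambda>p. if p \<in> H3 then q p * D f b b p - f p * D q b b p else 0)"
   by (simp add: G'b[abs_def])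
 qed
 have b0: "(0, 1) \<in> (Basis :: point3 set)" by (simp add: Basis_point3)
 have i1: "integrable hyp (\<lambda>p. laplace_beltrami q p * f p)" by (rule integrable_hyp_continuous[OF _ K])
   (auto simp: laplace_beltrami_support(1)[OF q K(1) out]
    intro!: continuous_on_mult laplace_beltrami_continuous[OF q] C2_on_continuous(1)[OF f b0])
 have i2: "integrable hyp (\<lambda>p. q p * laplace_beltrami f p)" by (rule integrable_hyp_continuous[OF _ K])
   (auto simp: out intro!: continuous_on_mult laplace_beltrami_continuous[OF f] C2_on_continuous(1)[OF q b0])
 have "0 = (\<Sum>b\<in>Basis. \<integral>p. (if p \<in> H3 then q p * D f b b p - f p * D q b b p else 0) \<partial>lborel)" using zero by simp
 also have "\<dots> = (\<integral>p. (\<Sum>b\<in>Basis. if p \<in> H3 then q p * D f b b p - f p * D q b b p else 0) \<partial>lborel)"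
  using intz by (simp add: Bochner_Integration.integral_sum)
 also have "\<dots> = (\<integral>p. (if p \<in> H3 then (laplace_beltrami q p * f p - q p * laplace_beltrami f p) / (snd p) ^ 3 else 0) \<partial>lborel)"
 proof (intro Bochner_Integration.integral_cong refl)
  fix p :: point3
  have sumeq: "(\<Sum>b\<in>Basis. q p * D f b b p - f p * D q b b p) = q p * (\<Sum>b\<in>Basis. D f b b p) - f p * (\<Sum>b\<in>Basis. D q b b p)"
   by (simp add: sum_subtractf sum_distrib_left)
  show "(\<Sum>b\<in>Basis. if p \<in> H3 then q p * D f b b p - f p * D q b b p else 0) =
    (if p \<in> H3 then (laplace_beltrami q p * f p - q p * laplace_beltrami f p) / (snd p) ^ 3 else 0)"
  proof (cases "p \<in> H3")
   case True
   then have "snd p > 0" by (simp add: H3_iff)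
   then show ?thesis using True unfolding if_P[OF True] sumeq lap[OF f True] lap[OF q True] by (simp add: field_simps)
  qed simp
 qed
 also have "\<dots> = (\<integral>p. (laplace_beltrami q p * f p - q p * laplace_beltrami f p) \<partial>hyp)"
  using i1 i2 by (subst integral_hyp) (auto dest: borel_measurable_integrable)
 also have "\<dots> = (\<integral>p. laplace_beltrami q p * f p \<partial>hyp) - (\<integral>p. q p * laplace_beltrami f p \<partial>hyp)" using i1 i2 by simp
 finally show ?thesis by simp
qed

section \<open>Spherical means through an ordinary differential equation\<close>

section \<open>Radial kernels\<close>

lemma cosh_dist_derivative:
 assumes "x \<in> H3" "y \<in> H3"
 shows "((\<lambda>x. cosh_dist x y) has_derivative (\<lambda>h.
  (fst h \<bullet> (fst x - fst y)) / (snd x * snd y) + snd h * (1 / snd y - cosh_dist x y / snd x))) (at x)"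
proof -
 have pos: "snd x \<noteq> 0" "snd y \<noteq> 0" using assms by (auto simp: H3_iff)
 have eq: "(\<lambda>x. cosh_dist x y) = (\<lambda>x. ((fst x - fst y) \<bullet> (fst x - fst y) + snd x * snd x + snd y * snd y) / (2 * snd x * snd y))"
  unfolding cosh_dist_def power2_norm_eq_inner by (simp add: fun_eq_iff power2_eq_square)
 show ?thesis unfolding eq using pos
  by (auto intro!: derivative_eq_intros simp: fun_cong[OF eq] fun_eq_iff field_simps inner_commute power2_eq_square)
qed

lemma laplace_radial:
 assumes x: "x \<in> H3" and y: "y \<in> H3"
  and p1: "\<And>u. (p has_real_derivative p' u) (at u)" and p2: "\<And>u. (p' has_real_derivative p'' u) (at u)"
  and C2: "C_k_on 2 (\<lambda>x. p (cosh_dist x y)) H3"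
 shows "laplace_beltrami (\<lambda>x. p (cosh_dist x y)) x =
  - (((cosh_dist x y)^2 - 1) * p'' (cosh_dist x y) + 3 * cosh_dist x y * p' (cosh_dist x y))"
proof -
 let ?f = "\<lambda>x. p (cosh_dist x y)"
 define u where "u = cosh_dist x y"
 define s t where "s = snd y" and "t = snd x"
 define a c where "a = Re (fst x) - Re (fst y)" and "c = Im (fst x) - Im (fst y)"
 have pos: "s > 0" "t > 0" using x y by (auto simp: H3_iff s_def t_def)
 define U where "U h x = (fst h \<bullet> (fst x - fst y)) / (snd x * snd y) + snd h * (1 / snd y - cosh_dist x y / snd x)" for h x :: point3
 have d1: "(?f has_derivative (\<lambda>h. p' (cosh_dist x y) * U h x)) (at x)" if "x \<in> H3" for x unfolding U_def
  by (rule has_derivative_eq_rhs[OF has_derivative_compose[OF cosh_dist_derivative[OF that y] p1[THEN has_field_derivative_imp_has_derivative]]])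
   simp
 have f1: "partial_deriv b ?f x = p' (cosh_dist x y) * U b x" if "x \<in> H3" for b x
  by (simp only: frechet_derivative_at[OF d1[OF that], symmetric])
 have U1: "(U (1,0) has_derivative (\<lambda>h. Re (fst h) / (t * s) - a * snd h / (t^2 * s))) (at x)"
  unfolding U_def a_def t_def s_def using pos
  by (auto intro!: derivative_eq_intros simp: fun_eq_iff field_simps power2_eq_square inner_complex_def t_def s_def)
 have U2: "(U (\<i>,0) has_derivative (\<lambda>h. Im (fst h) / (t * s) - c * snd h / (t^2 * s))) (at x)"
  unfolding U_def c_def t_def s_def using pos
  by (auto intro!: derivative_eq_intros simp: fun_eq_iff field_simps power2_eq_square inner_complex_def t_def s_def)
 have U3: "(U (0,1) has_derivative (\<lambda>h. - (U h x / t - u * snd h / t^2))) (at x)"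
 proof -
  have "((\<lambda>x. 1 / snd y - cosh_dist x y / snd x) has_derivative (\<lambda>h. - ((U h x * t - u * snd h) / (t * t)))) (at x)"
   unfolding U_def t_def u_def using pos by (auto intro!: derivative_eq_intros cosh_dist_derivative x y simp: t_def)
  then show ?thesis
   using pos unfolding U_def[of "(0, 1)", abs_def] by (simp add: diff_divide_distrib power2_eq_square)
 qed
 have second: "partial_deriv b (partial_deriv b ?f) x = p'' u * (U b x)^2 + p' u * V b"
  if "(U b has_derivative V) (at x)" for b V
 proof -
  have "((\<lambda>x. p' (cosh_dist x y)) has_derivative (\<lambda>h. p'' u * U h x)) (at x)" unfolding U_def u_def
   by (rule has_derivative_eq_rhs[OF has_derivative_compose[OF cosh_dist_derivative[OF x y] p2[THEN has_field_derivative_imp_has_derivative]]])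
    simp
  from has_derivative_mult[OF this that]
  have "((\<lambda>x. p' (cosh_dist x y) * U b x) has_derivative (\<lambda>h. p' u * V h + p'' u * U h x * U b x)) (at x)"
   by (simp add: u_def)
  then have "(partial_deriv b ?f has_derivative (\<lambda>h. p' u * V h + p'' u * U h x * U b x)) (at x)"
   by (rule has_derivative_transform_within_open[OF _ open_H3 x]) (simp add: f1)
  then have "partial_deriv b (partial_deriv b ?f) x = p' u * V b + p'' u * U b x * U b x"
   by (subst frechet_derivative_at[symmetric]; simp)
  then show ?thesis by (simp add: power2_eq_square)
 qed
 \<comment> \<open>The definition of u solved for the sum of squares; it reduces the squared
   hyperbolic gradient of u to u^2 - 1.\<close>
 have ueq: "2 * t * s * u = a^2 + c^2 + t^2 + s^2"
  using pos by (simp add: u_def cosh_dist_def cmod_power2 a_def c_def s_def t_def)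
 have Uv: "U (1,0) x = a / (t * s)" "U (\<i>,0) x = c / (t * s)" "U (0,1) x = 1 / s - u / t"
  by (simp_all add: U_def a_def c_def t_def s_def u_def inner_complex_def)
 have "laplace_beltrami ?f x = - (t^2) * (\<Sum>b\<in>Basis. partial_deriv b (partial_deriv b ?f) x) + t * partial_deriv (0, 1) ?f x"
  using laplace_beltrami_explicit(3)[OF C2 x] by (simp add: t_def)
 also have "\<dots> = - (t^2) * (p'' u * ((a / (t * s))^2 + (c / (t * s))^2 + (1 / s - u / t)^2) +
   p' u * (1 / (t * s) + 1 / (t * s) - ((1 / s - u / t) / t - u / t^2))) + t * (p' u * (1 / s - u / t))"
  unfolding sum_Basis_point3 second[OF U1] second[OF U2] second[OF U3] f1[OF x] Uv u_def[symmetric]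
  by (simp add: algebra_simps)
 also have "\<dots> = - (p'' u * ((a^2 + c^2 + t^2 + s^2 - 2 * t * s * u) / s^2 + u^2 - 1) + 3 * u * p' u)"
  using pos by (simp add: field_simps power2_eq_square)
 also have "\<dots> = - ((u^2 - 1) * p'' u + 3 * u * p' u)" using ueq by simp
 finally show ?thesis by (simp add: u_def)
qed

section \<open>An ordinary differential equation\<close>

text \<open>At the singular point c = 1 the equation has exponents 0 and 9/2, and the bounds single
  out the second, so solutions obeying them should be dependent. The Wronskian W satisfies (c^2 - 1)
  W' = 7 c W, hence W^2 / (c^2 - 1)^7 is constant; squaring avoids the power 7/2. The bounds make W
  of order (c - 1)^5, so the constant is 0.\<close>

lemma wronskian_zero:
 fixes y z :: "real \<Rightarrow> real"
 assumes y: "\<And>c. c > 1 \<Longrightarrow> (y has_real_derivative y' c) (at c)" "\<And>c. c > 1 \<Longrightarrow> (y' has_real_derivative y'' c) (at c)"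
   "\<And>c. c > 1 \<Longrightarrow> (c^2 - 1) * y'' c = 7 * c * y' c - \<kappa> * y c"
  and z: "\<And>c. c > 1 \<Longrightarrow> (z has_real_derivative z' c) (at c)" "\<And>c. c > 1 \<Longrightarrow> (z' has_real_derivative z'' c) (at c)"
   "\<And>c. c > 1 \<Longrightarrow> (c^2 - 1) * z'' c = 7 * c * z' c - \<kappa> * z c"
  and ybd: "\<And>c. 1 < c \<Longrightarrow> c < 2 \<Longrightarrow> \<bar>y c\<bar> \<le> B * (c - 1) ^ 3 \<and> \<bar>y' c\<bar> \<le> B * (c - 1) ^ 2"
  and bz: "\<And>c. 1 < c \<Longrightarrow> c < 2 \<Longrightarrow> \<bar>z c\<bar> \<le> B * (c - 1) ^ 3 \<and> \<bar>z' c\<bar> \<le> B * (c - 1) ^ 2" and c: "c > 1"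
 shows "y c * z' c = y' c * z c"
proof -
 define W where "W c = y c * z' c - y' c * z c" for c
 define V where "V c = (W c)^2 / (c^2 - 1) ^ 7" for c
 have pos: "c^2 - 1 > 0" if "c > 1" for c :: real using that power_strict_mono[of 1 c 2] by simp
 have W': "(W has_real_derivative (y c * z'' c - y'' c * z c)) (at c)" if "c > 1" for c
  unfolding W_def using y(1,2)[OF that] z(1,2)[OF that] by (auto intro!: derivative_eq_intros)
 have Weq: "(c^2 - 1) * (y c * z'' c - y'' c * z c) = 7 * c * W c" if "c > 1" for c
 proof -
  have "(c^2 - 1) * (y c * z'' c - y'' c * z c) = y c * ((c^2 - 1) * z'' c) - ((c^2 - 1) * y'' c) * z c"
   by (simp add: algebra_simps)
  then show ?thesis unfolding y(3)[OF that] z(3)[OF that] by (simp add: W_def algebra_simps)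
 qed
 have V': "(V has_real_derivative 0) (at c)" if "c > 1" for c
 proof -
  have "(V has_real_derivative ((2 * W c * (y c * z'' c - y'' c * z c)) * (c^2 - 1) ^ 7 -
    (W c)^2 * (7 * (c^2 - 1) ^ 6 * (2 * c))) / ((c^2 - 1) ^ 7 * (c^2 - 1) ^ 7)) (at c)"
   unfolding V_def using pos[OF that] W'[OF that] by (auto intro!: derivative_eq_intros simp: power2_eq_square)
  moreover have "(2 * W c * (y c * z'' c - y'' c * z c)) * (c^2 - 1) ^ 7 =
    2 * W c * (c^2 - 1) ^ 6 * ((c^2 - 1) * (y c * z'' c - y'' c * z c))" by (simp add: power_eq_if)
  then have num0: "(2 * W c * (y c * z'' c - y'' c * z c)) * (c^2 - 1) ^ 7 - (W c)^2 * (7 * (c^2 - 1) ^ 6 * (2 * c)) = 0"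
   unfolding Weq[OF that] by (simp add: power2_eq_square)
  ultimately show ?thesis by (simp only: num0 div_0)
 qed
 have Vconst: "V a = V c" if "a > 1" for a by (rule has_field_derivative_zero_constant[of "{1<..}", THEN exE])
   (use V' that c in \<open>auto simp: at_within_open[OF _ open_greaterThan] intro: DERIV_subset\<close>)
 have "V c \<le> e" if e: "e > 0" for e
 proof -
  \<comment> \<open>Below 2, so that the bounds apply, and so close to 1 that the resulting estimate
    4 B^4 (a - 1) for V a is at most e.\<close>
  define a where "a = 1 + min (1/2) (e / (4 * B ^ 4 + 1))"
  have a: "1 < a" "a < 2" "(a - 1) * (4 * B ^ 4 + 1) \<le> e"
   using e by (auto simp: a_def min_def field_simps add_pos_nonneg intro: less_le_trans)
  have "B * (a - 1) ^ 2 \<ge> 0" using ybd[OF a(1,2)] by (meson abs_ge_zero order_trans)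
  then have B0: "B \<ge> 0" using a by (simp add: zero_le_mult_iff)
  have "\<bar>W a\<bar> \<le> \<bar>y a\<bar> * \<bar>z' a\<bar> + \<bar>y' a\<bar> * \<bar>z a\<bar>" unfolding W_def by (metis abs_mult abs_triangle_ineq4)
  also have "\<dots> \<le> (B * (a - 1) ^ 3) * (B * (a - 1) ^ 2) + (B * (a - 1) ^ 2) * (B * (a - 1) ^ 3)"
   using ybd[OF a(1,2)] bz[OF a(1,2)] B0 a by (intro add_mono mult_mono) auto
  also have "\<dots> = 2 * B^2 * (a - 1) ^ 5" by (simp add: power2_eq_square power_eq_if)
  finally have "(W a)^2 \<le> (2 * B^2 * (a - 1) ^ 5)^2" by (metis abs_ge_zero power2_abs power_mono)
  also have "\<dots> = 4 * B ^ 4 * (a - 1) ^ 10" by (simp add: power_mult_distrib flip: power_mult)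
  finally have W2: "(W a)^2 \<le> 4 * B ^ 4 * (a - 1) ^ 10" .
  have "(a - 1) ^ 7 \<le> (a^2 - 1) ^ 7" using a by (intro power_mono) (auto simp: power2_eq_square field_simps)
  then have "V a \<le> (4 * B ^ 4 * (a - 1) ^ 10) / (a - 1) ^ 7" unfolding V_def using W2 a by (intro frac_le) auto
  also have "\<dots> = 4 * B ^ 4 * (a - 1) ^ 3" using a by (simp add: power_eq_if)
  also have "\<dots> \<le> 4 * B ^ 4 * (a - 1)"
  proof (rule mult_left_mono)
   show "(a - 1) ^ 3 \<le> a - 1" using power_decreasing[of 1 3 "a - 1"] a by simp
   show "0 \<le> 4 * B ^ 4" by simp
  qed
  also have "\<dots> \<le> e" using a by (simp add: algebra_simps)
  finally show ?thesis using Vconst[OF a(1)] by simp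
 qed
 then have "V c \<le> 0" by (rule field_le_epsilon[of "V c" 0, simplified])
 then have "(W c)^2 \<le> 0" using zero_less_power[OF pos[OF c], of 7] by (simp add: V_def divide_le_0_iff)
 then have "W c = 0" by simp
 then show ?thesis by (simp add: W_def)
qed

text \<open>A Gronwall argument: y^2 + y'^2 damped by a suitable exponential does not increase, and
  it starts at 0.\<close>

lemma ode_unique_continuation:
 fixes y :: "real \<Rightarrow> real"
 assumes y: "\<And>c. c > 1 \<Longrightarrow> (y has_real_derivative y' c) (at c)" "\<And>c. c > 1 \<Longrightarrow> (y' has_real_derivative y'' c) (at c)"
   "\<And>c. c > 1 \<Longrightarrow> (c^2 - 1) * y'' c = 7 * c * y' c - \<kappa> * y c" and a: "a > 1" "y a = 0" "y' a = 0" and b: "b \<ge> a"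
 shows "y b = 0"
proof -
 define q where "q = a^2 - 1"
 have q: "q > 0" using a(1) power_strict_mono[of 1 a 2] by (simp add: q_def)
 \<comment> \<open>Bounds the relative growth of y^2 + y'^2 on [a, b]: the summand 1 covers 2 y y',
   the quotient covers 2 y' y'', with q the least value of c^2 - 1 there.\<close>
 define K where "K = 1 + (14 * b + \<bar>\<kappa>\<bar>) / q"
 define E where "E c = ((y c)^2 + (y' c)^2) * exp (- K * c)" for c
 define E' where "E' c = (2 * y c * y' c + 2 * y' c * y'' c) * exp (- K * c) - K * ((y c)^2 + (y' c)^2) * exp (- K * c)" for c
 have E: "(E has_real_derivative E' c) (at c)" if "c > 1" for c unfolding E_def E'_def using y(1,2)[OF that]
  by (auto intro!: derivative_eq_intros simp: algebra_simps)
 have "E b \<le> E a"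
 proof (rule DERIV_nonpos_imp_nonincreasing[OF b])
  fix c assume c: "a \<le> c" "c \<le> b"
  then have c1: "c > 1" using a by simp
  have qc: "q \<le> c^2 - 1" using c a by (simp add: q_def power_mono)
  have cauchy: "2 * \<bar>y c * y' c\<bar> \<le> (y c)^2 + (y' c)^2"
   using zero_le_power2[of "\<bar>y c\<bar> - \<bar>y' c\<bar>"] by (simp add: power2_diff abs_mult)
  have y''eq: "y'' c = (7 * c * y' c - \<kappa> * y c) / (c^2 - 1)" using y(3)[OF c1] q qc by (simp add: field_simps)
  have "2 * y' c * y'' c = (14 * c * (y' c)^2 - \<kappa> * (2 * (y c * y' c))) / (c^2 - 1)"
   unfolding y''eq by (simp add: power2_eq_square algebra_simps diff_divide_distrib)
  also have "\<dots> \<le> (14 * b * ((y c)^2 + (y' c)^2) + \<bar>\<kappa>\<bar> * ((y c)^2 + (y' c)^2)) / (c^2 - 1)"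
  proof (intro divide_right_mono add_mono diff_mono)
   have "14 * c * (y' c)^2 \<le> 14 * b * ((y c)^2 + (y' c)^2)" using c c1 by (intro mult_mono) auto
   moreover have "- (\<kappa> * (2 * (y c * y' c))) \<le> \<bar>\<kappa>\<bar> * (2 * \<bar>y c * y' c\<bar>)"
    by (metis abs_ge_minus_self abs_mult abs_numeral)
   moreover have "\<bar>\<kappa>\<bar> * (2 * \<bar>y c * y' c\<bar>) \<le> \<bar>\<kappa>\<bar> * ((y c)^2 + (y' c)^2)" using cauchy by (intro mult_left_mono) auto
   ultimately show "14 * c * (y' c)^2 - \<kappa> * (2 * (y c * y' c)) \<le> 14 * b * ((y c)^2 + (y' c)^2) + \<bar>\<kappa>\<bar> * ((y c)^2 + (y' c)^2)"
    by linarith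
  qed (use q qc in auto)
  also have "\<dots> = (14 * b + \<bar>\<kappa>\<bar>) * ((y c)^2 + (y' c)^2) / (c^2 - 1)" by (simp add: algebra_simps)
  also have "\<dots> \<le> (14 * b + \<bar>\<kappa>\<bar>) * ((y c)^2 + (y' c)^2) / q"
   using q qc c c1 by (intro divide_left_mono mult_nonneg_nonneg add_nonneg_nonneg) auto
  finally have "2 * y c * y' c + 2 * y' c * y'' c \<le> K * ((y c)^2 + (y' c)^2)"
   using cauchy by (simp add: K_def algebra_simps add_divide_distrib)
  then have "E' c \<le> 0" unfolding E'_def by (simp flip: left_diff_distrib add: mult_le_0_iff)
  then show "\<exists>d. (E has_real_derivative d) (at c) \<and> d \<le> 0" using E[OF c1] by blast
 qed
 also have "E a = 0" using a by (simp add: E_def)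
 finally have "(y b)^2 + (y' b)^2 \<le> 0" unfolding E_def by (simp add: mult_le_0_iff)
 then have "(y b)^2 \<le> 0" using zero_le_power2[of "y' b"] by linarith
 then show ?thesis by simp
qed

text \<open>Where z is positive the vanishing Wronskian makes y / z constant. Further out z may have
  zeros, as the moments of an oscillating spherical function do, so the relation is continued from
  an interior point of the first interval by uniqueness for the equation.\<close>

lemma ode_proportional:
 fixes y z :: "real \<Rightarrow> real"
 assumes y: "\<And>c. c > 1 \<Longrightarrow> (y has_real_derivative y' c) (at c)" "\<And>c. c > 1 \<Longrightarrow> (y' has_real_derivative y'' c) (at c)"
   "\<And>c. c > 1 \<Longrightarrow> (c^2 - 1) * y'' c = 7 * c * y' c - \<kappa> * y c"
  and z: "\<And>c. c > 1 \<Longrightarrow> (z has_real_derivative z' c) (at c)" "\<And>c. c > 1 \<Longrightarrow> (z' has_real_derivative z'' c) (at c)"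
   "\<And>c. c > 1 \<Longrightarrow> (c^2 - 1) * z'' c = 7 * c * z' c - \<kappa> * z c"
  and ybd: "\<And>c. 1 < c \<Longrightarrow> c < 2 \<Longrightarrow> \<bar>y c\<bar> \<le> B * (c - 1) ^ 3 \<and> \<bar>y' c\<bar> \<le> B * (c - 1) ^ 2"
  and bz: "\<And>c. 1 < c \<Longrightarrow> c < 2 \<Longrightarrow> \<bar>z c\<bar> \<le> B * (c - 1) ^ 3 \<and> \<bar>z' c\<bar> \<le> B * (c - 1) ^ 2"
  and zpos: "c1 > 1" "\<And>c. 1 < c \<Longrightarrow> c < c1 \<Longrightarrow> z c > 0" obtains a where "\<And>c. c > 1 \<Longrightarrow> y c = a * z c"
proof -
 have W: "y c * z' c = y' c * z c" if "c > 1" for c by (rule wronskian_zero[OF y z ybd bz that])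
 have "\<exists>a. \<forall>c\<in>{1<..<c1}. y c / z c = a"
 proof (rule has_field_derivative_zero_constant)
  fix c assume c: "c \<in> {1<..<c1}"
  then have "((\<lambda>c. y c / z c) has_real_derivative (y' c * z c - y c * z' c) / (z c * z c)) (at c)"
   using y(1) z(1) zpos(2)[of c] by (intro DERIV_divide) auto
  then show "((\<lambda>c. y c / z c) has_real_derivative 0) (at c within {1<..<c1})"
   using W[of c] c by (auto intro: has_field_derivative_at_within)
 qed simp
 then obtain a where a: "\<And>c. 1 < c \<Longrightarrow> c < c1 \<Longrightarrow> y c / z c = a" by auto
 define D where "D c = y c - a * z c" for c
 have D0: "D c = 0" if "1 < c" "c < c1" for c using a[OF that] zpos(2)[OF that] by (auto simp: D_def field_simps)
 have D: "(D has_real_derivative y' c - a * z' c) (at c)"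
  "((\<lambda>c. y' c - a * z' c) has_real_derivative y'' c - a * z'' c) (at c)"
  "(c^2 - 1) * (y'' c - a * z'' c) = 7 * c * (y' c - a * z' c) - \<kappa> * D c" if "c > 1" for c
 proof -
  show "(D has_real_derivative y' c - a * z' c) (at c)"
   "((\<lambda>c. y' c - a * z' c) has_real_derivative y'' c - a * z'' c) (at c)"
   unfolding D_def using y(1,2)[OF that] z(1,2)[OF that] by (auto intro!: derivative_eq_intros)
  show "(c^2 - 1) * (y'' c - a * z'' c) = 7 * c * (y' c - a * z' c) - \<kappa> * D c"
   using y(3)[OF that] z(3)[OF that] unfolding D_def by algebra
 qed
 have "D b = 0" if "b > 1" for b
 proof (cases "b < c1")
  case False
  define p where "p = (1 + c1) / 2"
  have p: "1 < p" "p < c1" using zpos(1) by (auto simp: p_def)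
  have "((\<lambda>c. 0) has_real_derivative y' p - a * z' p) (at p)"
   by (rule has_field_derivative_transform_within_open[OF D(1)[OF p(1)], of "{1<..<c1}"]) (use p D0 in auto)
  then have "y' p - a * z' p = 0" using DERIV_unique DERIV_const by blast
  then show ?thesis using ode_unique_continuation[OF D, where a = p and b = b] p False D0[OF p] by simp
 qed (use that D0 in simp)
 then show ?thesis using that[of a] by (simp add: D_def)
qed

section \<open>Families of truncated moments\<close>

text \<open>Describes the image of the signed measure F dM under U without forming it. The two
  instances are the distance to a point of hyperbolic space and cosh on the half-line; since only U
  and F matter, integrals over spaces of different dimension can be compared.\<close>

locale moment_family =
 fixes M :: "'b measure" and U F :: "'b \<Rightarrow> real"
 assumes U_measurable [measurable]: "U \<in> borel_measurable M" and F_measurable [measurable]: "F \<in> borel_measurable M"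
  and U_ge_1: "\<And>y. y \<in> space M \<Longrightarrow> U y \<ge> 1" and F_integrable: "\<And>c. integrable M (\<lambda>y. indicator {..c} (U y) * F y)"
begin

definition profile :: "(real \<Rightarrow> real) \<Rightarrow> real" where
 "profile k = (\<integral>y. k (U y) * F y \<partial>M)"

definition moment :: "nat \<Rightarrow> real \<Rightarrow> real" where
 "moment m c = profile (\<lambda>u. (max 0 (c - u)) ^ m)"

lemma profile_integrable:
 assumes [measurable]: "k \<in> borel_measurable borel" and k: "\<And>u. u \<ge> 1 \<Longrightarrow> \<bar>k u\<bar> \<le> B" "\<And>u. u > c \<Longrightarrow> k u = 0"
 shows "integrable M (\<lambda>y. k (U y) * F y)"
proof (rule Bochner_Integration.integrable_bound[OF integrable_mult_right[OF F_integrable, of B c]])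
 show "AE y in M. norm (k (U y) * F y) \<le> norm (B * (indicator {..c} (U y) * F y))"
 proof (rule AE_I2)
  fix y assume "y \<in> space M"
  then have "\<bar>k (U y)\<bar> \<le> \<bar>B\<bar>" using k(1)[OF U_ge_1] by force
  then show "norm (k (U y) * F y) \<le> norm (B * (indicator {..c} (U y) * F y))"
   using k(2)[of "U y"] by (cases "U y \<le> c") (auto simp: abs_mult intro: mult_right_mono)
 qed
qed measurable

lemma moment_integrable:
 assumes "m \<ge> 1"
 shows "integrable M (\<lambda>y. (max 0 (c - U y)) ^ m * F y)"
 using assms by (intro profile_integrable[where B = "(max 0 (c - 1)) ^ m" and c = c])
  (auto intro!: power_mono simp: power_0_left)

lemma moment_le_1: "m \<ge> 1 \<Longrightarrow> c \<le> 1 \<Longrightarrow> moment m c = 0" unfolding moment_def profile_def using U_ge_1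
 by (intro integral_eq_zero_AE AE_I2) (force simp: max_def power_0_left)

lemma moment_has_derivative:
 assumes m: "m \<ge> 1"
 shows "(moment (Suc m) has_real_derivative real (Suc m) * moment m c) (at c)"
proof -
 have "((\<lambda>c. \<integral>y. (max 0 (c - U y)) ^ Suc m * F y \<partial>M) has_derivative
   (\<lambda>h. \<integral>y. (h * (real (Suc m) * (max 0 (c - U y)) ^ m)) * F y \<partial>M)) (at c)"
 proof (rule has_derivative_integral[where r = 1
    and g = "\<lambda>y. real (Suc m) * (max 0 (c + 1 - 1)) ^ m * \<bar>indicator {..c + 1} (U y) * F y\<bar>"])
  fix x y assume x: "x \<in> ball c 1" and y: "y \<in> space M"
  have "((\<lambda>x. x - U y) has_derivative (\<lambda>h. h)) (at x)" by (auto intro!: derivative_eq_intros)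
  then show "((\<lambda>x. (max 0 (x - U y)) ^ Suc m * F y) has_derivative
    (\<lambda>h. (h * (real (Suc m) * (max 0 (x - U y)) ^ m)) * F y)) (at x)"
   by (intro has_derivative_mult_left has_derivative_eq_rhs[OF has_derivative_compose[OF _
      max_power_derivative[OF m, THEN has_field_derivative_imp_has_derivative]]]) (auto simp: mult.commute)
  fix h :: real
  have x': "x < c + 1" using x by (simp add: dist_real_def)
  show "\<bar>(h * (real (Suc m) * (max 0 (x - U y)) ^ m)) * F y\<bar> \<le>
    real (Suc m) * (max 0 (c + 1 - 1)) ^ m * \<bar>indicator {..c + 1} (U y) * F y\<bar> * norm h"
  proof (cases "U y < x")
   case True
   have "(max 0 (x - U y)) ^ m \<le> (max 0 (c + 1 - 1)) ^ m" using U_ge_1[OF y] x' by (intro power_mono) auto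
   then have "real (Suc m) * (max 0 (x - U y)) ^ m * \<bar>F y\<bar> * \<bar>h\<bar> \<le> real (Suc m) * (max 0 (c + 1 - 1)) ^ m * \<bar>F y\<bar> * \<bar>h\<bar>"
    by (intro mult_right_mono mult_left_mono) auto
   then show ?thesis using True x' by (simp add: abs_mult mult_ac)
  next
   case False
   then show ?thesis using m by (simp add: max_def power_0_left)
  qed
 qed (use m in \<open>auto intro!: moment_integrable F_integrable simp del: power_Suc\<close>)
 moreover have "(\<integral>y. (h * (real (Suc m) * (max 0 (c - U y)) ^ m)) * F y \<partial>M) = real (Suc m) * moment m c * h" for h
 proof -
  have "(\<integral>y. (h * (real (Suc m) * (max 0 (c - U y)) ^ m)) * F y \<partial>M) =
    (\<integral>y. (h * real (Suc m)) * ((max 0 (c - U y)) ^ m * F y) \<partial>M)" by (simp add: mult_ac)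
  then show ?thesis by (simp add: moment_def profile_def)
 qed
 ultimately show ?thesis
  by (simp add: has_field_derivative_def moment_def[abs_def] profile_def mult.commute[of _ "real (Suc m) * _"])
qed

text \<open>The integrand is at most (c - 1)^m times |F| on the region U \<le> 2. For m = 3 and m =
  2 this is the behaviour at c = 1 that \<open>wronskian_zero\<close> asks for.\<close>

lemma moment_bound:
 assumes m: "m \<ge> 1" and c: "1 \<le> c" "c \<le> 2"
 shows "\<bar>moment m c\<bar> \<le> (\<integral>y. \<bar>indicator {..2} (U y) * F y\<bar> \<partial>M) * (c - 1) ^ m"
proof -
 have "\<bar>moment m c\<bar> \<le> (\<integral>y. \<bar>(max 0 (c - U y)) ^ m * F y\<bar> \<partial>M)"
  unfolding moment_def profile_def by (rule integral_abs_bound)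
 also have "\<dots> \<le> (\<integral>y. (c - 1) ^ m * \<bar>indicator {..2} (U y) * F y\<bar> \<partial>M)"
 proof (rule integral_mono)
  fix y assume y: "y \<in> space M"
  show "\<bar>(max 0 (c - U y)) ^ m * F y\<bar> \<le> (c - 1) ^ m * \<bar>indicator {..2} (U y) * F y\<bar>"
  proof (cases "U y < c")
   case True
   have "(max 0 (c - U y)) ^ m \<le> (c - 1) ^ m" using U_ge_1[OF y] c by (intro power_mono) auto
   then show ?thesis using True c by (simp add: abs_mult mult_right_mono)
  next
   case False
   then show ?thesis using m c by (simp add: max_def power_0_left)
  qed
 qed (use m in \<open>auto intro!: moment_integrable F_integrable\<close>)
 finally show ?thesis by (simp add: mult.commute)
qed

text \<open>The ramp has a kink at U = c, so only a one-sided derivative is available. From the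
  right the slope at U = c is already 1, which is why the closed indicator appears.\<close>

lemma moment_1_right_derivative:
 "(\<lambda>n. (moment 1 (c + 1 / real (Suc n)) - moment 1 c) / (1 / real (Suc n))) \<longlonglongrightarrow> profile (indicator {..c})"
proof -
 define q where "q n y = (max 0 (c + 1 / real (Suc n) - U y) - max 0 (c - U y)) / (1 / real (Suc n)) * F y" for n y
 have "(\<lambda>n. \<integral>y. q n y \<partial>M) \<longlonglongrightarrow> (\<integral>y. indicator {..c} (U y) * F y \<partial>M)"
 proof (rule integral_dominated_convergence[where w = "\<lambda>y. \<bar>indicator {..c + 1} (U y) * F y\<bar>"])
  show "AE y in M. (\<lambda>n. q n y) \<longlonglongrightarrow> indicator {..c} (U y) * F y"
  proof (rule AE_I2)
   fix y
   show "(\<lambda>n. q n y) \<longlonglongrightarrow> indicator {..c} (U y) * F y"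
   proof (cases "U y \<le> c")
    case True
    have "max 0 (c + d - U y) - max 0 (c - U y) = d" if "d > 0" for d :: real using that True by auto
    from this[of "1 / real (Suc n)" for n] have "q n y = F y" for n unfolding q_def by (simp del: of_nat_Suc)
    then show ?thesis using True by simp
   next
    case False
    obtain N where N: "1 / real (Suc N) < U y - c" using False nat_approx_posE[of "U y - c"] by auto
    have "q n y = 0" if "n \<ge> N" for n
    proof -
     have "1 / real (Suc n) \<le> 1 / real (Suc N)" using that by (simp add: frac_le)
     then show ?thesis using N False by (simp add: q_def max_def)
    qed
    then have "\<forall>\<^sub>F n in sequentially. q n y = 0" by (auto simp: eventually_sequentially)
    then show ?thesis using False by (simp add: tendsto_eventually)
   qed
  qed
  show "AE y in M. norm (q n y) \<le> \<bar>indicator {..c + 1} (U y) * F y\<bar>" for n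
  proof (rule AE_I2)
   fix y
   have le: "1 / real (Suc n) \<le> 1" "0 < 1 / real (Suc n)" by auto
   show "norm (q n y) \<le> \<bar>indicator {..c + 1} (U y) * F y\<bar>"
   proof (cases "U y \<le> c + 1")
    case True
    have "\<bar>(max 0 (c + 1 / real (Suc n) - U y) - max 0 (c - U y)) / (1 / real (Suc n))\<bar> \<le> 1"
    proof -
     have "\<bar>max 0 (c + d - U y) - max 0 (c - U y)\<bar> \<le> d" if "d > 0" for d :: real using that by auto
     from this[OF le(2)] show ?thesis unfolding abs_divide using le(2) by (simp only: abs_of_pos divide_le_eq_1_pos)
    qed
    then have "\<bar>(max 0 (c + 1 / real (Suc n) - U y) - max 0 (c - U y)) / (1 / real (Suc n))\<bar> * \<bar>F y\<bar> \<le> 1 * \<bar>F y\<bar>"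
     by (intro mult_right_mono) auto
    then show ?thesis using True unfolding q_def real_norm_def abs_mult by simp
   next
    case False
    then have "c + 1 / real (Suc n) - U y \<le> 0" "c - U y \<le> 0" using le by linarith+
    then have "q n y = 0" unfolding q_def by (simp only: max_absorb1 diff_self div_0 mult_zero_left)
    then show ?thesis by simp
   qed
  qed
 qed (use F_integrable in \<open>auto simp: q_def\<close>)
 moreover have "(\<integral>y. q n y \<partial>M) = (moment 1 (c + 1 / real (Suc n)) - moment 1 c) / (1 / real (Suc n))" for n
 proof -
  have i: "integrable M (\<lambda>y. max 0 (c - U y) * F y)" for c using moment_integrable[of 1 c] by simp
  have "(\<integral>y. q n y \<partial>M) = (\<integral>y. (max 0 (c + 1 / real (Suc n) - U y) * F y - max 0 (c - U y) * F y) / (1 / real (Suc n)) \<partial>M)"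
   by (simp only: q_def left_diff_distrib diff_divide_distrib times_divide_eq_left)
  also have "\<dots> = ((\<integral>y. max 0 (c + 1 / real (Suc n) - U y) * F y \<partial>M) - (\<integral>y. max 0 (c - U y) * F y \<partial>M)) / (1 / real (Suc n))"
   by (simp only: integral_divide_zero Bochner_Integration.integral_diff[OF i i])
  finally show ?thesis by (simp only: moment_def profile_def power_one_right)
 qed
 ultimately show ?thesis by (simp only: profile_def)
qed

text \<open>Approximation of a profile by step functions: \<open>k\<close> is replaced on each cell
 \<open>(ic/n, (i+1)c/n]\<close> by its value at the left end.\<close>

lemma profile_step_limit:
 assumes k: "continuous_on UNIV k" "\<And>u. u > c \<Longrightarrow> k u = 0" and c: "c > 0"
 shows "(\<lambda>n. \<Sum>i<Suc n. k (real i * c / real (Suc n)) *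
   (profile (indicator {..real (Suc i) * c / real (Suc n)}) - profile (indicator {..real i * c / real (Suc n)})))
  \<longlonglongrightarrow> profile k"
proof -
 define g where "g n i = real i * c / real (Suc n)" for n i
 define s where "s n u = (\<Sum>i<Suc n. k (g n i) * (indicator {..g n (Suc i)} u - indicator {..g n i} u :: real))" for n u
 have g_mono: "g n i \<le> g n j" if "i \<le> j" for n i j
  using that c by (auto simp: g_def intro!: divide_right_mono mult_right_mono)
 have g_last: "g n (Suc n) = c" for n by (simp add: g_def)
 obtain B where B: "B \<ge> 0" "\<And>u. u \<in> {0..c} \<Longrightarrow> \<bar>k u\<bar> \<le> B"
  using bounded_on_compact[of "{0..c}" k] continuous_on_subset[OF k(1)] by (metis compact_Icc subset_UNIV)
 have cell: "\<exists>i\<le>n. g n i < u \<and> u \<le> g n (Suc i) \<and> s n u = k (g n i)" if u: "0 < u" "u \<le> c" for n u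
 proof -
  define i where "i = (LEAST i. u \<le> g n (Suc i))"
  have ex: "u \<le> g n (Suc n)" using u g_last by simp
  have i1: "u \<le> g n (Suc i)" unfolding i_def using ex by (rule LeastI)
  have i2: "i \<le> n" unfolding i_def using ex by (rule Least_le)
  have i3: "g n i < u"
  proof (cases i)
   case 0
   then show ?thesis using u by (simp add: g_def)
  next
   case (Suc j)
   have "\<not> u \<le> g n (Suc j)" using not_less_Least[of j "\<lambda>i. u \<le> g n (Suc i)"] Suc by (simp add: i_def[symmetric])
   then show ?thesis using Suc by simp
  qed
  have "s n u = (\<Sum>j<Suc n. if j = i then k (g n i) else 0)" unfolding s_def
  proof (rule sum.cong[OF refl])
   fix j assume "j \<in> {..<Suc n}"
   show "k (g n j) * (indicator {..g n (Suc j)} u - indicator {..g n j} u) = (if j = i then k (g n i) else 0)"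
   proof (cases j i rule: linorder_cases)
    case less
    then have "g n (Suc j) \<le> g n i" "g n j \<le> g n i" by (auto intro: g_mono)
    then show ?thesis using less i3 by (simp add: indicator_def)
   next
    case equal
    then show ?thesis using i1 i3 by (simp add: indicator_def)
   next
    case greater
    then have "g n (Suc i) \<le> g n j" "g n j \<le> g n (Suc j)" by (auto intro: g_mono)
    then show ?thesis using greater i1 by (simp add: indicator_def)
   qed
  qed
  also have "\<dots> = k (g n i)" using i2 by simp
  finally show ?thesis using i1 i2 i3 by blast
 qed
 have s_out: "s n u = 0" if "u > c" for n u unfolding s_def
 proof (rule sum.neutral, rule ballI)
  fix i assume "i \<in> {..<Suc n}"
  then have "g n (Suc i) \<le> c" "g n i \<le> c" using g_mono[of _ "Suc n" n] g_last by (metis Suc_leI lessThan_iff, metis less_imp_le lessThan_iff)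
  then show "k (g n i) * (indicator {..g n (Suc i)} u - indicator {..g n i} u) = 0"
   using that by (simp add: indicator_def)
 qed
 have "(\<lambda>n. \<integral>y. s n (U y) * F y \<partial>M) \<longlonglongrightarrow> (\<integral>y. k (U y) * F y \<partial>M)"
 proof (rule integral_dominated_convergence[where w = "\<lambda>y. B * \<bar>indicator {..c} (U y) * F y\<bar>"])
  show "AE y in M. (\<lambda>n. s n (U y) * F y) \<longlonglongrightarrow> k (U y) * F y"
  proof (rule AE_I2)
   fix y assume y: "y \<in> space M"
   have "(\<lambda>n. s n (U y)) \<longlonglongrightarrow> k (U y)"
   proof (cases "U y \<le> c")
    case True
    then have u: "0 < U y" "U y \<le> c" using U_ge_1[OF y] by auto
    obtain i where i: "\<And>n. g n (i n) < U y" "\<And>n. U y \<le> g n (Suc (i n))" "\<And>n. s n (U y) = k (g n (i n))"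
     using cell[OF u] by metis
    have "(\<lambda>n. g n (i n)) \<longlonglongrightarrow> U y"
    proof (rule real_tendsto_sandwich)
     show "(\<lambda>n. U y - c / real (Suc n)) \<longlonglongrightarrow> U y"
      using tendsto_diff[OF tendsto_const[of "U y"] LIMSEQ_Suc[OF lim_const_over_n[of c]]] by simp
     have "U y - c / real (Suc n) \<le> g n (i n)" for n
      using i(2)[of n] by (simp add: g_def add_divide_distrib distrib_right)
     then show "\<forall>\<^sub>F n in sequentially. U y - c / real (Suc n) \<le> g n (i n)" by simp
     show "\<forall>\<^sub>F n in sequentially. g n (i n) \<le> U y" using i(1) by (simp add: less_imp_le)
    qed simp
    moreover have "isCont k (U y)" using k(1) by (simp add: continuous_on_eq_continuous_at)
    ultimately show ?thesis unfolding i(3) by (rule isCont_tendsto_compose[rotated])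
   next
    case False
    then show ?thesis using s_out k(2) by simp
   qed
   then show "(\<lambda>n. s n (U y) * F y) \<longlonglongrightarrow> k (U y) * F y" by (intro tendsto_intros)
  qed
  show "AE y in M. norm (s n (U y) * F y) \<le> B * \<bar>indicator {..c} (U y) * F y\<bar>" for n
  proof (rule AE_I2)
   fix y assume y: "y \<in> space M"
   show "norm (s n (U y) * F y) \<le> B * \<bar>indicator {..c} (U y) * F y\<bar>"
   proof (cases "U y \<le> c")
    case True
    then obtain i where i: "g n i < U y" "s n (U y) = k (g n i)" using cell[of "U y" n] U_ge_1[OF y] by auto
    have "g n i \<ge> 0" using c by (simp add: g_def)
    then have "\<bar>s n (U y)\<bar> \<le> B" using i True B(2)[of "g n i"] by simp
    then show ?thesis using True by (simp add: abs_mult mult_right_mono)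
   next
    case False
    then show ?thesis using s_out B by simp
   qed
  qed
  show "(\<lambda>y. k (U y) * F y) \<in> borel_measurable M" using borel_measurable_continuous_onI[OF k(1)] by measurable
  show "(\<lambda>y. s n (U y) * F y) \<in> borel_measurable M" for n unfolding s_def by measurable
 qed (use F_integrable in auto)
 moreover have "(\<integral>y. s n (U y) * F y \<partial>M) = (\<Sum>i<Suc n. k (g n i) * (profile (indicator {..g n (Suc i)}) - profile (indicator {..g n i})))" for n
 proof -
  have "(\<integral>y. s n (U y) * F y \<partial>M) =
   (\<integral>y. (\<Sum>i<Suc n. k (g n i) * (indicator {..g n (Suc i)} (U y) * F y - indicator {..g n i} (U y) * F y)) \<partial>M)"
   unfolding s_def sum_distrib_right by (simp only: left_diff_distrib mult.assoc)
  also have "\<dots> = (\<Sum>i<Suc n. \<integral>y. k (g n i) * (indicator {..g n (Suc i)} (U y) * F y - indicator {..g n i} (U y) * F y) \<partial>M)"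
   by (intro Bochner_Integration.integral_sum integrable_mult_right Bochner_Integration.integrable_diff F_integrable)
  finally show ?thesis
   by (simp only: integral_mult_right_zero Bochner_Integration.integral_diff[OF F_integrable F_integrable] profile_def)
 qed
 ultimately show ?thesis unfolding profile_def[of k] g_def by simp
qed

end

text \<open>Differentiating the third moments in c yields proportional second and first moments, and
  one more right derivative yields proportional distribution functions. These determine the integral
  of every continuous profile through step functions.\<close>

lemma profiles_proportional:
 assumes 1: "moment_family M1 U1 F1" and 2: "moment_family M2 U2 F2"
  and eq: "\<And>c. c > 1 \<Longrightarrow> moment_family.moment M1 U1 F1 3 c = a * moment_family.moment M2 U2 F2 3 c"
  and k: "continuous_on UNIV k" "\<And>u. u > c \<Longrightarrow> k u = 0"
 shows "moment_family.profile M1 U1 F1 k = a * moment_family.profile M2 U2 F2 k"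
proof -
 interpret m1: moment_family M1 U1 F1 by fact
 interpret m2: moment_family M2 U2 F2 by fact
 have step: "m1.moment m c = a * m2.moment m c"
  if m: "m \<ge> 1" and "\<And>c. m1.moment (Suc m) c = a * m2.moment (Suc m) c" for m c
 proof -
  have "m1.moment (Suc m) = (\<lambda>c. a * m2.moment (Suc m) c)" using that(2) by auto
  then have "((\<lambda>c. a * m2.moment (Suc m) c) has_real_derivative real (Suc m) * m1.moment m c) (at c)"
   using m1.moment_has_derivative[OF m, of c] by simp
  moreover have "((\<lambda>c. a * m2.moment (Suc m) c) has_real_derivative a * (real (Suc m) * m2.moment m c)) (at c)"
   by (intro DERIV_cmult m2.moment_has_derivative[OF m])
  ultimately have "real (Suc m) * m1.moment m c = a * (real (Suc m) * m2.moment m c)" by (rule DERIV_unique)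
  then show ?thesis by (simp add: mult.left_commute[of a])
 qed
 have e3: "m1.moment 3 c = a * m2.moment 3 c" for c
  using eq[of c] m1.moment_le_1[of 3 c] m2.moment_le_1[of 3 c] by (cases "c > 1") auto
 have e2: "m1.moment 2 c = a * m2.moment 2 c" for c using step[of 2 c] e3 by (simp add: eval_nat_numeral)
 have e1: "m1.moment 1 c = a * m2.moment 1 c" for c using step[of 1 c] e2 by (simp add: eval_nat_numeral)
 have e0: "m1.profile (indicator {..c}) = a * m2.profile (indicator {..c})" for c
 proof (rule LIMSEQ_unique[OF m1.moment_1_right_derivative])
  have "(\<lambda>n. a * ((m2.moment 1 (c + 1 / real (Suc n)) - m2.moment 1 c) / (1 / real (Suc n)))) \<longlonglongrightarrow> a * m2.profile (indicator {..c})"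
   by (intro tendsto_mult tendsto_const m2.moment_1_right_derivative)
  then show "(\<lambda>n. (m1.moment 1 (c + 1 / real (Suc n)) - m1.moment 1 c) / (1 / real (Suc n))) \<longlonglongrightarrow> a * m2.profile (indicator {..c})"
   unfolding e1 by (simp only: right_diff_distrib[symmetric] times_divide_eq_right)
 qed
 \<comment> \<open>The mesh of the step functions needs a positive right end.\<close>
 define c' where "c' = max c 1"
 have c': "c' > 0" "\<And>u. u > c' \<Longrightarrow> k u = 0" using k(2) by (auto simp: c'_def)
 have "(\<lambda>n. a * (\<Sum>i<Suc n. k (real i * c' / real (Suc n)) *
   (m2.profile (indicator {..real (Suc i) * c' / real (Suc n)}) - m2.profile (indicator {..real i * c' / real (Suc n)}))))
  \<longlonglongrightarrow> a * m2.profile k" by (intro tendsto_mult tendsto_const m2.profile_step_limit k(1) c')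
 moreover have "a * (\<Sum>i<Suc n. k (real i * c' / real (Suc n)) *
   (m2.profile (indicator {..real (Suc i) * c' / real (Suc n)}) - m2.profile (indicator {..real i * c' / real (Suc n)}))) =
  (\<Sum>i<Suc n. k (real i * c' / real (Suc n)) *
   (m1.profile (indicator {..real (Suc i) * c' / real (Suc n)}) - m1.profile (indicator {..real i * c' / real (Suc n)})))" for n
  unfolding e0 sum_distrib_left by (intro sum.cong refl) (simp add: algebra_simps)
 ultimately show ?thesis using LIMSEQ_unique[OF m1.profile_step_limit[OF k(1) c'(2) c'(1)]] by simp
qed

section \<open>Radial eigenfunctions\<close>

text \<open>\<open>sph \<mu> s / sinh s\<close> is the spherical function with eigenvalue \<open>\<mu>\<close>.\<close>

definition sph :: "real \<Rightarrow> real \<Rightarrow> real" where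
 "sph \<mu> s = (if \<mu> > 1 then sin (sqrt (\<mu> - 1) * s) / sqrt (\<mu> - 1)
       else if \<mu> = 1 then s else sinh (sqrt (1 - \<mu>) * s) / sqrt (1 - \<mu>))"

definition sph' :: "real \<Rightarrow> real \<Rightarrow> real" where
 "sph' \<mu> s = (if \<mu> > 1 then cos (sqrt (\<mu> - 1) * s)
       else if \<mu> = 1 then 1 else cosh (sqrt (1 - \<mu>) * s))"

lemma sph_derivative: "(sph \<mu> has_real_derivative sph' \<mu> s) (at s within A)"
proof -
 consider "\<mu> > 1" | "\<mu> = 1" | "\<mu> < 1" by linarith
 then show ?thesis
 proof cases
  case 1
  define r where "r = sqrt (\<mu> - 1)"
  have r: "r > 0" using 1 by (auto simp: r_def)
  have "((\<lambda>s. sin (r * s) / r) has_real_derivative cos (r * s)) (at s within A)"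
   using r by (auto intro!: derivative_eq_intros)
  then show ?thesis using 1 by (simp add: sph'_def sph_def[abs_def] r_def[symmetric])
 next
  case 3
  define r where "r = sqrt (1 - \<mu>)"
  have r: "r > 0" using 3 by (auto simp: r_def)
  have "((\<lambda>s. sinh (r * s) / r) has_real_derivative cosh (r * s)) (at s within A)"
   using r by (auto intro!: derivative_eq_intros)
  then show ?thesis using 3 by (simp add: sph'_def sph_def[abs_def] r_def[symmetric])
 qed (simp add: sph_def[abs_def] sph'_def)
qed

lemma sph'_derivative: "(sph' \<mu> has_real_derivative (1 - \<mu>) * sph \<mu> s) (at s within A)"
proof -
 consider "\<mu> > 1" | "\<mu> = 1" | "\<mu> < 1" by linarith
 then show ?thesis
 proof cases
  case 1
  define r where "r = sqrt (\<mu> - 1)"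
  have r: "r > 0" "r * r = \<mu> - 1" using 1 by (auto simp: r_def)
  have "((\<lambda>s. cos (r * s)) has_real_derivative - (r * r) * (sin (r * s) / r)) (at s within A)"
   using r(1) by (auto intro!: derivative_eq_intros)
  then show ?thesis using 1 r by (simp add: sph_def sph'_def[abs_def] r_def[symmetric])
 next
  case 3
  define r where "r = sqrt (1 - \<mu>)"
  have r: "r > 0" "r * r = 1 - \<mu>" using 3 by (auto simp: r_def)
  have "((\<lambda>s. cosh (r * s)) has_real_derivative (r * r) * (sinh (r * s) / r)) (at s within A)"
   using r(1) by (auto intro!: derivative_eq_intros)
  then show ?thesis using 3 r by (simp add: sph_def sph'_def[abs_def] r_def[symmetric])
 qed (simp add: sph'_def[abs_def])
qed

lemma sph_0 [simp]: "sph \<mu> 0 = 0" and sph'_0 [simp]: "sph' \<mu> 0 = 1" by (simp_all add: sph_def sph'_def)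

lemma sph_eq_sinh: "sph 0 = sinh" by (auto simp: sph_def)

lemma continuous_on_sph [continuous_intros]: "continuous_on A (sph \<mu>)"
 using sph_derivative by (rule DERIV_continuous_on)

lemma continuous_on_sph' [continuous_intros]: "continuous_on A (sph' \<mu>)"
 using sph'_derivative by (rule DERIV_continuous_on)

lemma sph_positive_near_0: obtains r where "r > 0" "\<And>s. 0 < s \<Longrightarrow> s < r \<Longrightarrow> sph \<mu> s > 0"
 using DERIV_pos_inc_right[OF sph_derivative[of \<mu> 0]] by (force simp: add_0)

definition half_line :: "real measure" where
 "half_line = restrict_space lborel {0..}"

lemma space_half_line [simp]: "space half_line = {0..}" by (simp add: half_line_def space_restrict_space)

lemma continuous_on_measurable_half_line: "continuous_on {0..} F \<Longrightarrow> F \<in> borel_measurable half_line"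
 for F :: "real \<Rightarrow> real"
proof -
 assume "continuous_on {0..} F"
 then have "F \<in> borel_measurable (restrict_space borel {0..})" by (rule borel_measurable_continuous_on_restrict)
 moreover have "sets (restrict_space borel {0..}) = sets half_line"
  unfolding half_line_def by (rule sets_restrict_space_cong) simp
 ultimately show ?thesis by (simp cong: measurable_cong_sets)
qed

lemma arcosh_le_iff: "s \<ge> 0 \<Longrightarrow> c \<ge> 1 \<Longrightarrow> cosh s \<le> c \<longleftrightarrow> s \<le> arcosh (c::real)"
 by (metis arcosh_nonneg_real cosh_arcosh_real cosh_real_nonneg_le_iff)

lemma integrable_half_line_cut:
 fixes g :: "real \<Rightarrow> real"
 assumes "continuous_on {0..\<rho>} g"
 shows "integrable half_line (\<lambda>s. indicator {0..\<rho>} s * g s)"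
  and "(\<integral>s. indicator {0..\<rho>} s * g s \<partial>half_line) = integral {0..\<rho>} g"
proof -
 have i: "set_integrable lborel {0..\<rho>} g"
  using borel_integrable_compact[OF compact_Icc assms] by (simp add: set_integrable_def)
 have eq: "(\<lambda>s. indicator {0..} s *\<^sub>R (indicator {0..\<rho>} s * g s)) = (\<lambda>s. indicator {0..\<rho>} s *\<^sub>R g s)"
  by (auto simp: indicator_def)
 show "integrable half_line (\<lambda>s. indicator {0..\<rho>} s * g s)"
 proof -
  have "integrable half_line (\<lambda>s. indicator {0..\<rho>} s * g s) \<longleftrightarrow>
    integrable lborel (\<lambda>s. indicator {0..} s *\<^sub>R (indicator {0..\<rho>} s * g s))"
   unfolding half_line_def by (rule integrable_restrict_space) simp
  then show ?thesis using i unfolding eq set_integrable_def by blast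
 qed
 have "(\<integral>s. indicator {0..\<rho>} s * g s \<partial>half_line) = (LINT s:{0..\<rho>}|lborel. g s)"
  unfolding half_line_def set_lebesgue_integral_def eq[symmetric] by (rule integral_restrict_space) simp
 also have "\<dots> = integral {0..\<rho>} g" by (rule set_borel_integral_eq_integral(2)[OF i])
 finally show "(\<integral>s. indicator {0..\<rho>} s * g s \<partial>half_line) = integral {0..\<rho>} g" .
qed

lemma moment_family_sph: "moment_family half_line cosh (\<lambda>s. sinh s * sph \<mu> s)"
proof
 show "cosh \<in> borel_measurable half_line" "(\<lambda>s. sinh s * sph \<mu> s) \<in> borel_measurable half_line"
  by (auto intro!: continuous_on_measurable_half_line continuous_intros)
 fix c :: real
 show "integrable half_line (\<lambda>y. indicator {..c} (cosh y) * (sinh y * sph \<mu> y))"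
 proof (cases "c \<ge> 1")
  case True
  show ?thesis
  proof (rule Bochner_Integration.integrable_cong[THEN iffD1, OF refl _ integrable_half_line_cut(1)[of "arcosh c" "\<lambda>y. sinh y * sph \<mu> y"]])
   fix s assume "s \<in> space half_line"
   then show "indicator {0..arcosh c} s * (sinh s * sph \<mu> s) = indicator {..c} (cosh s) * (sinh s * sph \<mu> s)"
    using arcosh_le_iff[OF _ True, of s] by (auto simp: indicator_def)
  qed (intro continuous_intros)
 next
  case False
  have "indicator {..c} (cosh y) * (sinh y * sph \<mu> y) = 0" for y :: real
   using False cosh_real_ge_1[of y] by (simp add: indicator_def)
  then have "(\<lambda>y. indicator {..c} (cosh y) * (sinh y * sph \<mu> y)) = (\<lambda>y. 0)" by (intro ext)
  then show ?thesis by (simp only: Bochner_Integration.integrable_zero)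
 qed
qed (use cosh_real_ge_1 in simp)

interpretation sph: moment_family half_line cosh "\<lambda>s. sinh s * sph \<mu> s" for \<mu> by (rule moment_family_sph)

lemma sph_profile_eq_integral:
 assumes k: "continuous_on {1..} k" "\<And>u. u > c \<Longrightarrow> k u = 0" and c: "c \<ge> 1"
 shows "sph.profile \<mu> k = integral {0..arcosh c} (\<lambda>s. k (cosh s) * (sinh s * sph \<mu> s))"
proof -
 have "sph.profile \<mu> k = (\<integral>s. indicator {0..arcosh c} s * (k (cosh s) * (sinh s * sph \<mu> s)) \<partial>half_line)"
  unfolding sph.profile_def
 proof (intro Bochner_Integration.integral_cong refl)
  fix s assume "s \<in> space half_line"
  then show "k (cosh s) * (sinh s * sph \<mu> s) = indicator {0..arcosh c} s * (k (cosh s) * (sinh s * sph \<mu> s))"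
   using arcosh_le_iff[OF _ c, of s] k(2)[of "cosh s"] by (cases "cosh s \<le> c") auto
 qed
 also have "\<dots> = integral {0..arcosh c} (\<lambda>s. k (cosh s) * (sinh s * sph \<mu> s))"
  by (intro integrable_half_line_cut(2) continuous_intros continuous_on_compose2[OF k(1)])
   (auto intro: cosh_real_ge_1)
 finally show ?thesis .
qed

lemma sph_moment_eq_integral:
 assumes "m \<ge> 1" "c \<ge> 1"
 shows "sph.moment \<mu> m c = integral {0..arcosh c} (\<lambda>s. (c - cosh s) ^ m * (sinh s * sph \<mu> s))"
proof -
 have "sph.moment \<mu> m c = integral {0..arcosh c} (\<lambda>s. (max 0 (c - cosh s)) ^ m * (sinh s * sph \<mu> s))"
  unfolding sph.moment_def
  by (rule sph_profile_eq_integral) (use assms in \<open>auto intro!: continuous_intros simp: power_0_left\<close>)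
 also have "\<dots> = integral {0..arcosh c} (\<lambda>s. (c - cosh s) ^ m * (sinh s * sph \<mu> s))"
  using arcosh_le_iff[OF _ assms(2)] by (intro integral_cong) (auto simp: max_def)
 finally show ?thesis .
qed

text \<open>Integration by parts against sph'' = (1 - \<mu>) sph with the weight w = (c - cosh s)^3
  sinh s. The boundary terms vanish at the right end because w and w' keep a factor c - cosh s, at
  the left end because \<open>sinh\<close> and \<open>sph\<close> are 0. Substituting cosh s = c -
  (c - cosh s) expands w'' into the three moments.\<close>

lemma sph_moment_ode:
 assumes c: "c > 1"
 shows "6 * (c^2 - 1) * sph.moment \<mu> 1 c - 21 * c * sph.moment \<mu> 2 c + (15 + \<mu>) * sph.moment \<mu> 3 c = 0"
proof -
 define g where "g m s = (c - cosh s) ^ m * (sinh s * sph \<mu> s)" for m and s :: real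
 define w where "w s = (c - cosh s) ^ 3 * sinh s" for s :: real
 define w' where "w' s = (c - cosh s) ^ 3 * cosh s - 3 * (c - cosh s)^2 * (sinh s)^2" for s :: real
 define w'' where "w'' s = 6 * (c - cosh s) * sinh s ^ 3 - 9 * (c - cosh s)^2 * sinh s * cosh s + (c - cosh s) ^ 3 * sinh s" for s :: real
 have w: "(w has_real_derivative w' s) (at s within A)" for s A
  unfolding w_def[abs_def] w'_def by (auto intro!: derivative_eq_intros simp: power2_eq_square)
 have w': "(w' has_real_derivative w'' s) (at s within A)" for s A unfolding w'_def[abs_def] w''_def
  by (auto intro!: derivative_eq_intros simp: power2_eq_square power3_eq_cube algebra_simps)
 have cc: "cosh (arcosh c) = c" using c by simp
 have ps: "0 \<le> arcosh c" using c by simp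
 have int: "(g m has_integral sph.moment \<mu> m c) {0..arcosh c}" if "m \<ge> 1" for m
 proof -
  have "continuous_on {0..arcosh c} (g m)" unfolding g_def by (intro continuous_intros)
  then have "g m integrable_on {0..arcosh c}" by (rule integrable_continuous_real)
  then show ?thesis using sph_moment_eq_integral[OF that, of c \<mu>] c unfolding g_def
   by (simp add: has_integral_integrable_integral)
 qed
 have "((\<lambda>s. w'' s * sph \<mu> s - w s * ((1 - \<mu>) * sph \<mu> s)) has_integral
   (w' (arcosh c) * sph \<mu> (arcosh c) - w (arcosh c) * sph' \<mu> (arcosh c)) - (w' 0 * sph \<mu> 0 - w 0 * sph' \<mu> 0)) {0..arcosh c}"
 proof (rule fundamental_theorem_of_calculus[OF ps])
  fix s
  have "((\<lambda>s. w' s * sph \<mu> s - w s * sph' \<mu> s) has_real_derivative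
    (w'' s * sph \<mu> s + sph' \<mu> s * w' s) - (w' s * sph' \<mu> s + (1 - \<mu>) * sph \<mu> s * w s)) (at s within {0..arcosh c})"
   by (intro DERIV_diff DERIV_mult w w' sph_derivative sph'_derivative)
  then show "((\<lambda>s. w' s * sph \<mu> s - w s * sph' \<mu> s) has_vector_derivative
    w'' s * sph \<mu> s - w s * ((1 - \<mu>) * sph \<mu> s)) (at s within {0..arcosh c})"
   unfolding has_real_derivative_iff_has_vector_derivative[symmetric] by (rule DERIV_cong) (simp add: algebra_simps)
 qed
 moreover have "(w' (arcosh c) * sph \<mu> (arcosh c) - w (arcosh c) * sph' \<mu> (arcosh c)) - (w' 0 * sph \<mu> 0 - w 0 * sph' \<mu> 0) = 0"
  by (simp add: w_def w'_def cc)
 moreover have "(\<lambda>s. w'' s * sph \<mu> s - w s * ((1 - \<mu>) * sph \<mu> s)) =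
   (\<lambda>s. 6 * (c^2 - 1) * g 1 s - 21 * c * g 2 s + (15 + \<mu>) * g 3 s)"
 proof
  fix s :: real
  have sh: "sinh s ^ 3 = ((cosh s)^2 - 1) * sinh s"
   by (simp add: cosh_square_eq power3_eq_cube) (simp add: power2_eq_square)
  show "w'' s * sph \<mu> s - w s * ((1 - \<mu>) * sph \<mu> s) = 6 * (c^2 - 1) * g 1 s - 21 * c * g 2 s + (15 + \<mu>) * g 3 s"
   unfolding w''_def w_def g_def sh by (simp add: power2_eq_square power3_eq_cube algebra_simps)
 qed
 ultimately have "((\<lambda>s. 6 * (c^2 - 1) * g 1 s - 21 * c * g 2 s + (15 + \<mu>) * g 3 s) has_integral 0) {0..arcosh c}"
  by simp
 moreover have "((\<lambda>s. 6 * (c^2 - 1) * g 1 s - 21 * c * g 2 s + (15 + \<mu>) * g 3 s) has_integral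
   6 * (c^2 - 1) * sph.moment \<mu> 1 c - 21 * c * sph.moment \<mu> 2 c + (15 + \<mu>) * sph.moment \<mu> 3 c) {0..arcosh c}"
  by (intro has_integral_add has_integral_diff has_integral_mult_right int) auto
 ultimately show ?thesis by (rule has_integral_unique[symmetric])
qed

lemma sph_moment_pos:
 assumes m: "m \<ge> 1" and r: "\<And>s. 0 < s \<Longrightarrow> s < r \<Longrightarrow> sph \<mu> s > 0" and c: "c > 1" "arcosh c \<le> r"
 shows "sph.moment \<mu> m c > 0"
proof -
 let ?g = "\<lambda>s. (c - cosh s) ^ m * (sinh s * sph \<mu> s)"
 define \<rho> where "\<rho> = arcosh c"
 have \<rho>: "\<rho> > 0" "cosh \<rho> = c" using c by (auto simp: \<rho>_def arcosh_real_gt_1_iff)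
 have pos: "?g s > 0" if "0 < s" "s < \<rho>" for s
 proof -
  have "cosh s < cosh \<rho>" using that by (simp add: cosh_real_nonneg_less_iff)
  then show ?thesis using that r[of s] c \<rho> by (auto simp: \<rho>_def intro!: mult_pos_pos)
 qed
 have nonneg: "?g s \<ge> 0" if "s \<in> {0..\<rho>}" for s
  using pos[of s] that \<rho> m by (cases "s = 0 \<or> s = \<rho>") (auto simp: power_0_left)
 have cont: "continuous_on {0..\<rho>} ?g" by (intro continuous_intros)
 have "integral {0..\<rho>} ?g \<noteq> 0"
 proof
  assume "integral {0..\<rho>} ?g = 0"
  moreover have "integral {0..\<rho>} ?g = 0 \<longleftrightarrow> (\<forall>s\<in>{0..\<rho>}. ?g s = 0)"
   by (rule integral_eq_0_iff[OF cont \<rho>(1)]) (rule nonneg)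
  ultimately have "\<forall>s\<in>{0..\<rho>}. ?g s = 0" by blast
  from bspec[OF this, of "\<rho> / 2"] have "?g (\<rho> / 2) = 0" using \<rho>(1) by simp
  moreover have "?g (\<rho> / 2) > 0" by (rule pos) (use \<rho>(1) in auto)
  ultimately show False by linarith
 qed
 moreover have "integral {0..\<rho>} ?g \<ge> 0" by (intro integral_nonneg integrable_continuous_real cont) (use nonneg in auto)
 ultimately show ?thesis using sph_moment_eq_integral[OF m, of c \<mu>] c by (simp add: \<rho>_def)
qed

section \<open>Moments of eigenfunctions\<close>

text \<open>The nonvanishing set is open; having hyperbolic volume zero it is Lebesgue null, as the
  density is positive, and hence empty.\<close>

lemma AE_hyp_imp_zero:
 fixes F :: "point3 \<Rightarrow> real"
 assumes F: "continuous_on H3 F" and ae: "AE y in hyp. F y = 0" and y: "y \<in> H3"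
 shows "F y = 0"
proof (rule ccontr)
 assume "F y \<noteq> 0"
 define S where "S = {p \<in> H3. F p \<noteq> 0}"
 have "open (F -` (- {0}) \<inter> H3)" by (rule continuous_on_open_vimage[THEN iffD1, rule_format, OF open_H3 F]) auto
 moreover have "F -` (- {0}) \<inter> H3 = S" by (auto simp: S_def)
 ultimately have S: "open S" by simp
 have "S \<subseteq> H3" by (auto simp: S_def)
 have Sb: "S \<in> sets borel" using S by auto
 have "S \<in> sets hyp" using Sb \<open>S \<subseteq> H3\<close> by (simp add: sets_hyp)
 then have "emeasure hyp S = 0" using ae AE_iff_measurable[of S hyp "\<lambda>y. F y = 0"] by (simp add: S_def)
 then have "emeasure hyp_volume S = 0" using \<open>S \<subseteq> H3\<close> by (simp add: emeasure_hyp)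
 then have "(\<integral>\<^sup>+p. indicator H3 p * ennreal (1 / (snd p) ^ 3) * indicator S p \<partial>lborel) = 0"
  unfolding hyp_volume_def using Sb by (subst (asm) emeasure_density) auto
 then have "AE p in lborel. indicator H3 p * ennreal (1 / (snd p) ^ 3) * indicator S p = 0"
  using Sb by (subst (asm) nn_integral_0_iff_AE) auto
 then have "AE p in lborel. p \<notin> S"
  using \<open>S \<subseteq> H3\<close> by (elim eventually_mono) (auto simp: indicator_def H3_iff split: if_splits)
 then have "emeasure lborel S = 0" using Sb by (subst (asm) AE_iff_measurable[of S]) auto
 then have "S \<in> null_sets lborel" using Sb by (auto simp: null_sets_def)
 then have "negligible S" by (simp add: negligible_iff_null_sets null_sets_completionI)
 then have "S = {}" using open_not_negligible[OF S] by blast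
 moreover have "y \<in> S" using \<open>F y \<noteq> 0\<close> y by (simp add: S_def)
 ultimately show False by simp
qed

lemma moment_family_hyp:
 assumes f: "continuous_on H3 f" and x: "x \<in> H3"
 shows "moment_family hyp (cosh_dist x) f"
proof
 have c: "continuous_on H3 (cosh_dist x)" using x by (intro continuous_intros) auto
 show m: "cosh_dist x \<in> borel_measurable hyp" "f \<in> borel_measurable hyp"
  using c f by (auto intro: continuous_on_measurable_hyp)
 fix c :: real
 have K: "compact (hyp_cball x c)" "hyp_cball x c \<subseteq> H3" using compact_hyp_cball[OF x] hyp_cball_subset by auto
 obtain B where B: "\<And>p. p \<in> hyp_cball x c \<Longrightarrow> \<bar>f p\<bar> \<le> B"
  using bounded_on_compact[OF K(1) continuous_on_subset[OF f K(2)]] by blast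
 show "integrable hyp (\<lambda>y. indicator {..c} (cosh_dist x y) * f y)"
 proof (rule integrable_hyp_compact[OF _ K])
  show "(\<lambda>y. indicator {..c} (cosh_dist x y) * f y) \<in> borel_measurable hyp" using m by measurable
  show "\<bar>indicator {..c} (cosh_dist x p) * f p\<bar> \<le> B" if "p \<in> hyp_cball x c" for p
   using B[OF that] that by (auto simp: indicator_def hyp_cball_def)
 qed (auto simp: hyp_cball_def indicator_def)
qed (use x cosh_dist_ge_1 in auto)

definition radial :: "(real \<Rightarrow> real) \<Rightarrow> point3 \<Rightarrow> point3 \<Rightarrow> real" where
 "radial k x y = k (cosh_dist x y)"

abbreviation "radial_op k \<equiv> kernel_op (radial k)"

text \<open>As a kernel this has m - 1 continuous derivatives, so m = 3 is the least exponent to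
  which the Laplacian can be applied. It serves both as the moment weight and as the smoothing
  kernel.\<close>

definition cut_power :: "real \<Rightarrow> nat \<Rightarrow> real \<Rightarrow> real" where
 "cut_power c m u = (max 0 (c - u)) ^ m"

lemma radial_profile: "x \<in> H3 \<Longrightarrow> continuous_on H3 f \<Longrightarrow> moment_family.profile hyp (cosh_dist x) f k = radial_op k f x"
 using moment_family.profile_def[OF moment_family_hyp] by (simp add: kernel_op_def radial_def)

lemma kernel_within_radial: "(\<And>u. u > c \<Longrightarrow> k u = 0) \<Longrightarrow> kernel_within c (radial k)"
 by (simp add: kernel_within_def radial_def)

lemma continuous_radial:
 "continuous_on UNIV k \<Longrightarrow> continuous_on (H3 \<times> H3) (\<lambda>(x, y). radial k x y)" unfolding radial_def case_prod_unfold
 by (rule continuous_on_compose2[of UNIV k]) (auto intro!: continuous_intros)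

lemma sph_moment_cut_power: "sph.moment \<mu> m c = sph.profile \<mu> (cut_power c m)"
 by (simp add: sph.moment_def cut_power_def[abs_def])

lemma cut_power_out: "m \<ge> 1 \<Longrightarrow> u > c \<Longrightarrow> cut_power c m u = 0" by (simp add: cut_power_def power_0_left)

lemma continuous_cut_power: "continuous_on A (cut_power c m)"
 unfolding cut_power_def[abs_def] by (intro continuous_intros)

lemma C_kernel_cut_power: "m > n \<Longrightarrow> C_kernel n (radial (cut_power c m))" unfolding radial_def cut_power_def
 by (intro C_kernel_max_power C_kernel_diff C_kernel_right C_kernel_cosh_dist continuous_on_const)

text \<open>The radial Laplacian of (c - u)_+^3 with u eliminated through u = c - (c - u). The
  coefficients depend on c alone, so integrals against it are combinations of truncated
  moments.\<close>

definition lap_cut_power :: "real \<Rightarrow> real \<Rightarrow> real" where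
 "lap_cut_power c u = - 6 * (c^2 - 1) * cut_power c 1 u + 21 * c * cut_power c 2 u - 15 * cut_power c 3 u"

lemma radial_commute: "radial k x y = radial k y x" by (simp add: radial_def cosh_dist_commute)

lemma laplace_cut_power:
 assumes "x \<in> H3" "y \<in> H3"
 shows "laplace_beltrami (\<lambda>x. radial (cut_power c 3) x y) x = radial (lap_cut_power c) x y"
proof -
 define u where "u = cosh_dist x y"
 have d: "(cut_power c (Suc m) has_real_derivative - (real (Suc m) * cut_power c m u)) (at u)" if "m \<ge> 1" for m u
 proof -
  have "((\<lambda>u. c - u) has_real_derivative -1) (at u)" by (auto intro!: derivative_eq_intros)
  from DERIV_chain2[OF max_power_derivative[OF that] this]
  show ?thesis unfolding cut_power_def[abs_def] by simp
 qed
 have d3: "(cut_power c 3 has_real_derivative - (3 * cut_power c 2 u)) (at u)" for u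
  using d[of 2 u] by (simp add: eval_nat_numeral)
 have d2: "((\<lambda>u. - (3 * cut_power c 2 u)) has_real_derivative 6 * cut_power c 1 u) (at u)" for u
  using d[of 1 u] by (auto intro!: derivative_eq_intros simp: eval_nat_numeral)
 have "laplace_beltrami (\<lambda>x. cut_power c 3 (cosh_dist x y)) x =
   - ((u^2 - 1) * (6 * cut_power c 1 u) + 3 * u * (- (3 * cut_power c 2 u)))" unfolding u_def
  by (rule laplace_radial[OF assms d3 d2]) (use C_kernel_C_k_on[OF C_kernel_cut_power[of 2 3 c] assms(2)] in \<open>simp add: radial_def\<close>)
 also have "\<dots> = lap_cut_power c u"
 proof (cases "u \<le> c")
  case True
  define v where "v = c - u"
  have c: "c = u + v" and v: "max 0 (c - u) = v" using True by (auto simp: v_def)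
  have "- ((u^2 - 1) * (6 * v) + 3 * u * (- (3 * v^2))) = - 6 * ((u + v)^2 - 1) * v + 21 * (u + v) * v^2 - 15 * v ^ 3"
   by (simp add: power2_eq_square power3_eq_cube algebra_simps)
  then show ?thesis unfolding lap_cut_power_def cut_power_def v by (simp only: c[symmetric] power_one_right)
 qed (simp add: lap_cut_power_def cut_power_def)
 finally show ?thesis by (simp add: radial_def u_def)
qed

lemma continuous_lap_cut_power: "continuous_on A (lap_cut_power c)"
 unfolding lap_cut_power_def[abs_def] by (intro continuous_intros continuous_cut_power)

lemma lap_cut_power_out: "u > c \<Longrightarrow> lap_cut_power c u = 0" by (simp add: lap_cut_power_def cut_power_out)

lemma laplace_op_cut_power:
 assumes "continuous_on H3 F" "x \<in> H3"
 shows "laplace_beltrami (radial_op (cut_power c 3) F) x = radial_op (lap_cut_power c) F x"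
proof -
 have "laplace_beltrami (radial_op (cut_power c 3) F) x =
   kernel_op (\<lambda>x y. laplace_beltrami (\<lambda>x. radial (cut_power c 3) x y) x) F x"
  by (rule laplace_kernel_op[OF C_kernel_cut_power kernel_within_radial[of c] assms]) (simp_all add: cut_power_out)
 also have "\<dots> = radial_op (lap_cut_power c) F x"
  unfolding kernel_op_def using assms(2) by (intro Bochner_Integration.integral_cong) (auto simp: laplace_cut_power)
 finally show ?thesis .
qed

text \<open>Green's identity in the integration variable, the kernel being symmetric and compactly
  supported. No growth or invariance of f is involved.\<close>

lemma op_lap_cut_power:
 assumes f: "C_k_on 2 f H3" and x: "x \<in> H3"
 shows "radial_op (lap_cut_power c) f x = radial_op (cut_power c 3) (laplace_beltrami f) x"
proof -
 have C2: "C_k_on 2 (\<lambda>y. radial (cut_power c 3) y x) H3" by (rule C_kernel_C_k_on[OF C_kernel_cut_power x]) simp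
 have "(\<integral>y. radial (cut_power c 3) y x * laplace_beltrami f y \<partial>hyp) =
   (\<integral>y. laplace_beltrami (\<lambda>y. radial (cut_power c 3) y x) y * f y \<partial>hyp)"
  by (rule green_identity[OF f C2 compact_hyp_cball[OF x, of c] hyp_cball_subset])
   (auto simp: radial_def hyp_cball_def cut_power_out cosh_dist_commute[of _ x])
 also have "\<dots> = (\<integral>y. radial (lap_cut_power c) y x * f y \<partial>hyp)"
  using x by (intro Bochner_Integration.integral_cong) (auto simp: laplace_cut_power)
 finally show ?thesis by (simp add: kernel_op_def radial_commute[of _ x])
qed

text \<open>Two derivatives suffice to state the equation; smoothness of all orders is recovered in
  \<open>eigenfunction_smooth\<close>.\<close>

definition eigenfunction :: "real \<Rightarrow> (point3 \<Rightarrow> real) \<Rightarrow> bool" where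
 "eigenfunction \<mu> f \<longleftrightarrow> C_k_on 2 f H3 \<and> (\<forall>p\<in>H3. laplace_beltrami f p = \<mu> * f p)"

lemma eigenfunction_continuous: "eigenfunction \<mu> f \<Longrightarrow> continuous_on H3 f"
 unfolding eigenfunction_def using C2_on_continuous(1)[of f "(0, 1)"] by (simp add: Basis_point3)

text \<open>The Laplacian of the kernel is evaluated twice: moved onto f it gives \<mu> times the
  third moment, expanded explicitly it gives the other terms. The outcome is the equation of
  \<open>sph_moment_ode\<close>, around any centre and without symmetry of f.\<close>

lemma eigenfunction_moment_ode:
 assumes f: "eigenfunction \<mu> f" and x: "x \<in> H3"
 defines "mom \<equiv> moment_family.moment hyp (cosh_dist x) f"
 shows "6 * (c^2 - 1) * mom 1 c - 21 * c * mom 2 c + (15 + \<mu>) * mom 3 c = 0"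
proof -
 interpret m: moment_family hyp "cosh_dist x" f by (rule moment_family_hyp[OF eigenfunction_continuous[OF f] x])
 have mom: "mom m c = radial_op (cut_power c m) f x" for m
  unfolding mom_def m.moment_def m.profile_def kernel_op_def radial_def cut_power_def ..
 have "radial_op (lap_cut_power c) f x = radial_op (cut_power c 3) (laplace_beltrami f) x"
  using f x by (intro op_lap_cut_power) (auto simp: eigenfunction_def)
 also have "\<dots> = (\<integral>y. \<mu> * (radial (cut_power c 3) x y * f y) \<partial>hyp)"
  unfolding kernel_op_def using f by (intro Bochner_Integration.integral_cong) (auto simp: eigenfunction_def)
 also have "\<dots> = \<mu> * mom 3 c" by (simp add: mom kernel_op_def)
 finally have "radial_op (lap_cut_power c) f x = \<mu> * mom 3 c" .
 moreover have "radial_op (lap_cut_power c) f x = - 6 * (c^2 - 1) * mom 1 c + 21 * c * mom 2 c - 15 * mom 3 c"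
 proof -
  have i: "integrable hyp (\<lambda>y. cut_power c m (cosh_dist x y) * f y)" if "m \<ge> 1" for m
   using m.moment_integrable[OF that, of c] by (simp add: cut_power_def)
  have "radial_op (lap_cut_power c) f x =
   (\<integral>y. - 6 * (c^2 - 1) * (cut_power c 1 (cosh_dist x y) * f y) + 21 * c * (cut_power c 2 (cosh_dist x y) * f y)
     - 15 * (cut_power c 3 (cosh_dist x y) * f y) \<partial>hyp)" unfolding kernel_op_def radial_def lap_cut_power_def
   by (intro Bochner_Integration.integral_cong refl) (simp only: algebra_simps)
  also have "\<dots> = - 6 * (c^2 - 1) * mom 1 c + 21 * c * mom 2 c - 15 * mom 3 c"
   using i[of 1] i[of 2] i[of 3] by (simp add: mom kernel_op_def radial_def)
  finally show ?thesis .
 qed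
 ultimately show ?thesis by (simp add: algebra_simps)
qed

text \<open>Radial integrals of f around x are a multiple of those of the spherical function,
  because both families of third moments solve one equation and vanish at 1 to the required order.
  The factor depends on f and x only; \<open>mean_value\<close> identifies it.\<close>

lemma eigenfunction_profile:
 assumes f: "eigenfunction \<mu> f" and x: "x \<in> H3" obtains a where
  "\<And>m c. moment_family.moment hyp (cosh_dist x) f 3 c = a * sph.moment \<mu> 3 c"
  "\<And>k c. continuous_on UNIV k \<Longrightarrow> (\<And>u. u > c \<Longrightarrow> k u = 0) \<Longrightarrow> radial_op k f x = a * sph.profile \<mu> k"
proof -
 have fc: "continuous_on H3 f" by (rule eigenfunction_continuous[OF f])
 interpret m: moment_family hyp "cosh_dist x" f by (rule moment_family_hyp[OF fc x])
 define A1 where "A1 = (\<integral>y. \<bar>indicator {..2} (cosh_dist x y) * f y\<bar> \<partial>hyp)"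
 define A2 where "A2 = (\<integral>s. \<bar>indicator {..2} (cosh s) * (sinh s * sph \<mu> s)\<bar> \<partial>half_line)"
 have A: "A1 \<ge> 0" "A2 \<ge> 0" by (simp_all add: A1_def A2_def)
 obtain r where r: "r > 0" "\<And>s. 0 < s \<Longrightarrow> s < r \<Longrightarrow> sph \<mu> s > 0" by (rule sph_positive_near_0) blast
 have ode: "(c^2 - 1) * (6 * g 1) = 7 * c * (3 * g 2) - (15 + \<mu>) * g 3"
  if "6 * (c^2 - 1) * g 1 - 21 * c * g 2 + (15 + \<mu>) * g 3 = 0" for c and g :: "nat \<Rightarrow> real"
  using that by (simp add: algebra_simps)
 \<comment> \<open>One constant has to bound both third moments and their derivatives; the factor 3
   comes from differentiating a cube. Up to \<open>cosh r\<close> the spherical function is still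
   positive, and so is its moment.\<close>
 obtain a where a: "\<And>c. c > 1 \<Longrightarrow> m.moment 3 c = a * sph.moment \<mu> 3 c"
 proof (rule ode_proportional[of "m.moment 3" "\<lambda>c. 3 * m.moment 2 c" "\<lambda>c. 6 * m.moment 1 c" "15 + \<mu>"
   "sph.moment \<mu> 3" "\<lambda>c. 3 * sph.moment \<mu> 2 c" "\<lambda>c. 6 * sph.moment \<mu> 1 c" "3 * (A1 + A2)" "cosh r"])
  fix c :: real assume c: "1 < c"
  show "(m.moment 3 has_real_derivative 3 * m.moment 2 c) (at c)"
   "(sph.moment \<mu> 3 has_real_derivative 3 * sph.moment \<mu> 2 c) (at c)"
   using m.moment_has_derivative[of 2 c] sph.moment_has_derivative[of 2 \<mu> c] by (simp_all add: eval_nat_numeral)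
  show "((\<lambda>c. 3 * m.moment 2 c) has_real_derivative 6 * m.moment 1 c) (at c)"
   "((\<lambda>c. 3 * sph.moment \<mu> 2 c) has_real_derivative 6 * sph.moment \<mu> 1 c) (at c)"
   using DERIV_cmult[OF m.moment_has_derivative[of 1 c], of 3] DERIV_cmult[OF sph.moment_has_derivative[of 1 \<mu> c], of 3]
   by (simp_all add: eval_nat_numeral)
  show "(c^2 - 1) * (6 * m.moment 1 c) = 7 * c * (3 * m.moment 2 c) - (15 + \<mu>) * m.moment 3 c"
   by (rule ode[of c "\<lambda>i. m.moment i c"]) (rule eigenfunction_moment_ode[OF f x])
  show "(c^2 - 1) * (6 * sph.moment \<mu> 1 c) = 7 * c * (3 * sph.moment \<mu> 2 c) - (15 + \<mu>) * sph.moment \<mu> 3 c"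
   by (rule ode[of c "\<lambda>i. sph.moment \<mu> i c"]) (rule sph_moment_ode[OF c])
 next
  fix c :: real assume c: "1 < c" "c < 2"
  have "\<bar>m.moment 3 c\<bar> \<le> A1 * (c - 1) ^ 3" "\<bar>m.moment 2 c\<bar> \<le> A1 * (c - 1) ^ 2"
   unfolding A1_def by (rule m.moment_bound; use c in simp)+
  moreover have "A1 * (c - 1) ^ 3 \<le> 3 * (A1 + A2) * (c - 1) ^ 3" "3 * (A1 * (c - 1) ^ 2) \<le> 3 * (A1 + A2) * (c - 1) ^ 2"
   using A c by (auto intro!: mult_right_mono simp flip: mult.assoc)
  ultimately show "\<bar>m.moment 3 c\<bar> \<le> 3 * (A1 + A2) * (c - 1) ^ 3 \<and> \<bar>3 * m.moment 2 c\<bar> \<le> 3 * (A1 + A2) * (c - 1) ^ 2"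
   by (simp add: abs_mult)
  have "\<bar>sph.moment \<mu> 3 c\<bar> \<le> A2 * (c - 1) ^ 3" "\<bar>sph.moment \<mu> 2 c\<bar> \<le> A2 * (c - 1) ^ 2"
   unfolding A2_def by (rule sph.moment_bound; use c in simp)+
  moreover have "A2 * (c - 1) ^ 3 \<le> 3 * (A1 + A2) * (c - 1) ^ 3" "3 * (A2 * (c - 1) ^ 2) \<le> 3 * (A1 + A2) * (c - 1) ^ 2"
   using A c by (auto intro!: mult_right_mono simp flip: mult.assoc)
  ultimately show "\<bar>sph.moment \<mu> 3 c\<bar> \<le> 3 * (A1 + A2) * (c - 1) ^ 3 \<and> \<bar>3 * sph.moment \<mu> 2 c\<bar> \<le> 3 * (A1 + A2) * (c - 1) ^ 2"
   by (simp add: abs_mult)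
 next
  show "cosh r > 1" using r(1) cosh_real_strict_mono[of 0 r] by simp
  fix c :: real assume c: "1 < c" "c < cosh r"
  then have "arcosh c \<le> r" using r(1) cosh_real_nonneg_less_iff[of "arcosh c" r] by simp
  then show "sph.moment \<mu> 3 c > 0" using r(2) c by (intro sph_moment_pos) auto
 qed blast
 show thesis
 proof (rule that[of a])
  show "m.moment 3 c = a * sph.moment \<mu> 3 c" for c
   using a[of c] m.moment_le_1[of 3 c] sph.moment_le_1[of 3 c \<mu>] by (cases "c > 1") auto
  show "radial_op k f x = a * sph.profile \<mu> k" if "continuous_on UNIV k" "\<And>u. u > c \<Longrightarrow> k u = 0" for k c
   unfolding radial_profile[OF x fc, symmetric]
   by (rule profiles_proportional[OF moment_family_hyp[OF fc x] moment_family_sph a that])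
 qed
qed

lemma C_k_on_const: "C_k_on k (\<lambda>_. a) S"
proof (induction k arbitrary: a)
 case (Suc k)
 have "frechet_derivative (\<lambda>_. a) (at x) = (\<lambda>_. 0)" for x :: 'a by (rule frechet_derivative_at[symmetric]) simp
 then show ?case using Suc by simp
qed simp

lemma eigenfunction_const: "eigenfunction 0 (\<lambda>_. a)"
proof -
 have "frechet_derivative (\<lambda>_. c) (at x) = (\<lambda>_. 0)" for x :: point3 and c :: real
  by (rule frechet_derivative_at[symmetric]) simp
 then show ?thesis unfolding eigenfunction_def using laplace_beltrami_explicit(3)[OF C_k_on_const] C_k_on_const by auto
qed

lemma kernel_op_const_homogeneous:
 assumes k: "continuous_on UNIV k" and x: "x \<in> H3" and y: "y \<in> H3"
 shows "radial_op k (\<lambda>_. 1) x = radial_op k (\<lambda>_. 1) y"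
proof -
 obtain f where f: "hyp_isometry f" "f x = y" by (rule swap_isometry[OF x y]) blast
 have "radial k y \<in> borel_measurable hyp"
  by (intro continuous_on_measurable_hyp continuous_kernel_right[OF continuous_radial[OF k] y])
 then have "(\<integral>p. radial k y (f p) \<partial>hyp) = (\<integral>p. radial k y p \<partial>hyp)" by (rule hyp_isometry_integral[OF f(1)])
 moreover have "(\<integral>p. radial k y (f p) \<partial>hyp) = (\<integral>p. radial k x p \<partial>hyp)"
  using hyp_isometryD(5)[OF f(1) x] f(2) by (intro Bochner_Integration.integral_cong) (auto simp: radial_def)
 ultimately show ?thesis by (simp add: kernel_op_def)
qed

text \<open>The area of the unit sphere in \<open>R\<^sup>3\<close>; its value is never needed.\<close>

definition sphere_area :: real where
 "sphere_area = radial_op (cut_power 2 3) (\<lambda>_. 1) base_point / sph.moment 0 3 2"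

lemma sph_moment_0_pos: "c > 1 \<Longrightarrow> sph.moment 0 3 c > 0"
 by (rule sph_moment_pos[of _ "arcosh c"]) (auto simp: sph_eq_sinh)

text \<open>Integration in polar coordinates without the coordinates: constants are eigenfunctions
  for the eigenvalue 0, and the factor is normalized by one particular kernel.\<close>

lemma integral_radial:
 assumes k: "continuous_on UNIV k" "\<And>u. u > c \<Longrightarrow> k u = 0" and x: "x \<in> H3"
 shows "radial_op k (\<lambda>_. 1) x = sphere_area * sph.profile 0 k"
proof -
 obtain a where a: "\<And>k c. continuous_on UNIV k \<Longrightarrow> (\<And>u. u > c \<Longrightarrow> k u = 0) \<Longrightarrow>
   radial_op k (\<lambda>_. 1) base_point = a * sph.profile 0 k"
  by (rule eigenfunction_profile[OF eigenfunction_const base_point_H3]) blast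
 have "radial_op (cut_power 2 3) (\<lambda>_. 1) base_point = a * sph.moment 0 3 2"
  using a[of "cut_power 2 3" 2] by (simp add: continuous_cut_power cut_power_out sph_moment_cut_power)
 then have "a = sphere_area" using sph_moment_0_pos[of 2] by (simp add: sphere_area_def)
 then show ?thesis using a[OF k] kernel_op_const_homogeneous[OF k(1) x base_point_H3] by simp
qed

lemma sphere_area_pos: "sphere_area > 0"
proof -
 let ?k = "cut_power 2 3"
 have c: "continuous_on H3 (radial ?k base_point)"
  by (rule continuous_kernel_right[OF continuous_radial[OF continuous_cut_power] base_point_H3])
 have i: "integrable hyp (radial ?k base_point)"
  by (rule integrable_hyp_continuous[OF c compact_hyp_cball[OF base_point_H3, of 2] hyp_cball_subset])
   (auto simp: radial_def hyp_cball_def cut_power_out)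
 have nn: "AE y in hyp. 0 \<le> radial ?k base_point y" by (rule AE_I2) (simp add: radial_def cut_power_def)
 have "(\<integral>y. radial ?k base_point y \<partial>hyp) \<noteq> 0"
 proof
  assume "(\<integral>y. radial ?k base_point y \<partial>hyp) = 0"
  then have "AE y in hyp. radial ?k base_point y = 0" using integral_nonneg_eq_0_iff_AE[OF i nn] by simp
  then have "radial ?k base_point base_point = 0" by (rule AE_hyp_imp_zero[OF c _ base_point_H3])
  then show False by (simp add: radial_def cut_power_def)
 qed
 moreover have "(\<integral>y. radial ?k base_point y \<partial>hyp) \<ge> 0" by (rule integral_nonneg_AE[OF nn])
 ultimately show ?thesis using sph_moment_0_pos[of 2] by (simp add: sphere_area_def kernel_op_def)
qed

section \<open>The lattice: discreteness, cocompactness, fundamental domains\<close>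

section \<open>Discrete cocompact groups\<close>

lemma carrier_PSL2C: "carrier PSL2C = {{A, - A} | A. det A = 1}"
proof -
 have "carrier PSL2C = {{A, - A} | A. A \<in> carrier SL2C}"
  by (auto simp: PSL2C_def FactGroup_def RCOSETS_def SL2C_center_rcoset)
 then show ?thesis by (simp add: SL2C_def)
qed

lemma PSL2C_mult:
 assumes "X \<in> carrier PSL2C" "Y \<in> carrier PSL2C" "A \<in> X" "B \<in> Y"
 shows "A ** B \<in> X \<otimes>\<^bsub>PSL2C\<^esub> Y" using assms(3,4) by (auto simp: PSL2C_def FactGroup_def set_mult_def SL2C_def)

lemma norm_entry_le: "norm (M $ i $ j) \<le> norm (M :: complex^2^2)"
 using Finite_Cartesian_Product.norm_nth_le[of M i] Finite_Cartesian_Product.norm_nth_le[of "M $ i" j] by linarith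

lemma norm_le_entries:
 assumes "\<And>i j. norm (M $ i $ j) \<le> c"
 shows "norm (M :: complex^2^2) \<le> 4 * c"
proof -
 have "norm M \<le> (\<Sum>i\<in>UNIV. norm (M $ i))" unfolding norm_vec_def by (rule L2_set_le_sum) simp
 also have "\<dots> \<le> (\<Sum>i\<in>UNIV. \<Sum>j\<in>UNIV. norm (M $ i $ j))"
  by (intro sum_mono) (simp add: norm_vec_def[of "M $ _"] L2_set_le_sum)
 also have "\<dots> \<le> 4 * c" using assms[of 1 1] assms[of 1 2] assms[of 2 1] assms[of 2 2] by (simp add: sum_2)
 finally show ?thesis .
qed

lemma matrix_norm_le: "norm ((A :: complex^2^2) ** (B :: complex^2^2)) \<le> 8 * (norm A * norm B)"
proof -
 have "norm ((A ** B) $ i $ j) \<le> 2 * (norm A * norm B)" for i j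
 proof -
  have "norm ((A ** B) $ i $ j) \<le> norm (A $ i $ 1 * B $ 1 $ j) + norm (A $ i $ 2 * B $ 2 $ j)"
   by (simp add: matrix_matrix_mult_def sum_2 norm_triangle_ineq)
  also have "\<dots> \<le> norm A * norm B + norm A * norm B"
   unfolding norm_mult by (intro add_mono mult_mono norm_entry_le) (auto simp: norm_entry_le)
  finally show ?thesis by simp
 qed
 then have "norm (A ** B) \<le> 4 * (2 * (norm A * norm B))" by (rule norm_le_entries)
 then show ?thesis by simp
qed

lemma sl2_left_inverse_norm:
 fixes A :: "complex^2^2"
 assumes "det A = 1" "B ** A = mat 1"
 shows "norm B \<le> 4 * norm A"
proof -
 \<comment> \<open>The adjugate, whose entries are up to sign those of A.\<close>
 define X :: "complex^2^2" where "X = vector [vector [A$2$2, - A$1$2], vector [- A$2$1, A$1$1]]"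
 have "A ** X = mat 1"
  using assms(1) by (simp add: X_def matrix_matrix_mult_def sum_2 vec_eq_iff forall_2 mat_def det_2 mult.commute)
 then have "B ** (A ** X) = B" by simp
 then have "B = X" by (simp add: matrix_mul_assoc assms(2))
 then have "norm (B $ i $ j) \<le> norm A" for i j
  using exhaust_2[of i] exhaust_2[of j] by (auto simp: X_def norm_entry_le)
 then show ?thesis by (rule norm_le_entries)
qed

lemma matrix_mult_diff_right: "(C::complex^2^2) ** (A - B) = C ** A - C ** B"
 by (simp add: vec_eq_iff forall_2 matrix_matrix_mult_def sum_2 algebra_simps)

locale cocompact_group =
 fixes \<Gamma> :: "(complex^2^2) set set"
 assumes orbifold: "closed_hyp_3_orbifold \<Gamma>"
begin

text \<open>The full preimage of \<Gamma> in the special linear group. Matrices are handled instead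
  of cosets, at the price of counting every motion twice.\<close>

definition G :: "(complex^2^2) set" where
 "G = \<Union>\<Gamma>"

lemma subgroup_Gamma: "subgroup \<Gamma> PSL2C"
 using orbifold by (simp add: closed_hyp_3_orbifold_def discrete_subgroup_PSL2C_def)

lemma Gamma_carrier: "X \<in> \<Gamma> \<Longrightarrow> X \<in> carrier PSL2C" using subgroup.subset[OF subgroup_Gamma] by blast

lemma GammaE: "X \<in> \<Gamma> \<Longrightarrow> \<exists>A. X = {A, - A} \<and> det A = 1" using Gamma_carrier by (auto simp: carrier_PSL2C)

lemma G_det: "A \<in> G \<Longrightarrow> det A = 1"
 unfolding G_def using GammaE by (auto simp: det_uminus_2) (metis det_uminus_2 insertE singletonD)

lemma G_coset: "A \<in> G \<Longrightarrow> {A, - A} \<in> \<Gamma>"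
proof -
 assume "A \<in> G"
 then obtain X where X: "X \<in> \<Gamma>" "A \<in> X" by (auto simp: G_def)
 obtain B where "X = {B, - B}" using GammaE[OF X(1)] by blast
 then have "X = {A, - A}" using X(2) by auto
 then show ?thesis using X(1) by simp
qed

lemma G_uminus: "A \<in> G \<Longrightarrow> - A \<in> G" using G_coset by (auto simp: G_def)

lemma one_PSL2C: "\<one>\<^bsub>PSL2C\<^esub> = {mat 1, - mat 1}" by (simp add: PSL2C_def FactGroup_def SL2C_center_def)

lemma G_one: "mat 1 \<in> G" using subgroup.one_closed[OF subgroup_Gamma] by (auto simp: G_def one_PSL2C)

lemma G_mult: "A \<in> G \<Longrightarrow> B \<in> G \<Longrightarrow> A ** B \<in> G" using subgroup.m_closed[OF subgroup_Gamma G_coset G_coset, of A B]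
  PSL2C_mult[of "{A, - A}" "{B, - B}" A B] Gamma_carrier[OF G_coset] by (auto simp: G_def)

lemma G_inverse:
 assumes A: "A \<in> G" obtains B where "B \<in> G" "A ** B = mat 1" "B ** A = mat 1"
proof -
 let ?X = "{A, - A}"
 have X: "?X \<in> \<Gamma>" by (rule G_coset[OF A])
 let ?Y = "inv\<^bsub>PSL2C\<^esub> ?X"
 have Y: "?Y \<in> \<Gamma>" using subgroup.m_inv_closed[OF subgroup_Gamma X] .
 have XY: "?X \<otimes>\<^bsub>PSL2C\<^esub> ?Y = {mat 1, - mat 1}"
  using group.r_inv[OF group_PSL2C Gamma_carrier[OF X]] by (simp add: one_PSL2C)
 obtain B where B: "?Y = {B, - B}" using GammaE[OF Y] by blast
 have BG: "B \<in> G" "- B \<in> G" using Y B by (auto simp: G_def)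
 have "A ** B \<in> {mat 1, - mat 1}" using PSL2C_mult[OF Gamma_carrier[OF X] Gamma_carrier[OF Y], of A B] B XY by auto
 then have "A ** B = mat 1 \<or> A ** (- B) = mat 1" by (auto simp: matrix_mult_uminus)
 then obtain C where C: "C \<in> G" "A ** C = mat 1" using BG by blast
 moreover have "C ** A = mat 1" using C(2) matrix_left_right_inverse by blast
 ultimately show thesis using that by blast
qed

definition ginv :: "complex^2^2 \<Rightarrow> complex^2^2" where
 "ginv A = (SOME B. B \<in> G \<and> A ** B = mat 1 \<and> B ** A = mat 1)"

lemma ginv: assumes "A \<in> G" shows "ginv A \<in> G" "A ** ginv A = mat 1" "ginv A ** A = mat 1"
proof -
 have "\<exists>B. B \<in> G \<and> A ** B = mat 1 \<and> B ** A = mat 1" using G_inverse[OF assms] by blast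
 from someI_ex[OF this] show "ginv A \<in> G" "A ** ginv A = mat 1" "ginv A ** A = mat 1" by (simp_all add: ginv_def)
qed

lemma ginv_ginv:
 assumes A: "A \<in> G"
 shows "ginv (ginv A) = A"
proof -
 have "ginv (ginv A) = (A ** ginv A) ** ginv (ginv A)" by (simp add: ginv(2)[OF A])
 also have "\<dots> = A ** (ginv A ** ginv (ginv A))" by (rule matrix_mul_assoc[symmetric])
 also have "\<dots> = A" by (simp add: ginv(2)[OF ginv(1)[OF A]])
 finally show ?thesis .
qed

lemma G_act_H3: "A \<in> G \<Longrightarrow> p \<in> H3 \<Longrightarrow> SL2C_act A p \<in> H3" by (simp add: act_H3 G_det)

lemma G_act_mult: "A \<in> G \<Longrightarrow> B \<in> G \<Longrightarrow> p \<in> H3 \<Longrightarrow> SL2C_act (A ** B) p = SL2C_act A (SL2C_act B p)"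
 by (simp add: act_mult G_det)

lemma G_act_ginv: "A \<in> G \<Longrightarrow> p \<in> H3 \<Longrightarrow> SL2C_act (ginv A) (SL2C_act A p) = p"
 "A \<in> G \<Longrightarrow> p \<in> H3 \<Longrightarrow> SL2C_act A (SL2C_act (ginv A) p) = p"
 using G_act_mult[of "ginv A" A p] G_act_mult[of A "ginv A" p] ginv by (auto simp: SL2C_act_mat_1)

lemma G_isometry: "A \<in> G \<Longrightarrow> hyp_isometry (SL2C_act A)" by (simp add: hyp_isometry_act G_det)

lemma G_cosh_dist: "A \<in> G \<Longrightarrow> x \<in> H3 \<Longrightarrow> y \<in> H3 \<Longrightarrow> cosh_dist (SL2C_act A x) (SL2C_act A y) = cosh_dist x y"
 by (simp add: cosh_dist_act G_det)

lemma G_cosh_dist_ginv: "A \<in> G \<Longrightarrow> x \<in> H3 \<Longrightarrow> y \<in> H3 \<Longrightarrow> cosh_dist x (SL2C_act A y) = cosh_dist (SL2C_act (ginv A) x) y"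
 using G_cosh_dist[of "ginv A" x "SL2C_act A y"] by (simp add: ginv G_act_ginv G_act_H3)

lemma orbit_eq: "orbit \<Gamma> p = {SL2C_act A p | A. A \<in> G}" by (simp add: orbit_def G_def)

lemma orbit_self: "p \<in> orbit \<Gamma> p" using G_one by (force simp: orbit_eq SL2C_act_mat_1)

lemma orbit_act: assumes "A \<in> G" "p \<in> H3" shows "orbit \<Gamma> (SL2C_act A p) = orbit \<Gamma> p"
proof -
 have "\<exists>C\<in>G. SL2C_act B (SL2C_act A p) = SL2C_act C p" if "B \<in> G" for B
  using G_act_mult[OF that assms(1,2)] G_mult[OF that assms(1)] by metis
 moreover have "\<exists>C\<in>G. SL2C_act B p = SL2C_act C (SL2C_act A p)" if "B \<in> G" for B
 proof -
  have "SL2C_act (B ** ginv A) (SL2C_act A p) = SL2C_act B (SL2C_act (ginv A) (SL2C_act A p))"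
   using that assms by (intro G_act_mult) (auto simp: ginv G_act_H3)
  then show ?thesis using that assms G_act_ginv by (metis G_mult ginv(1))
 qed
 ultimately show ?thesis by (auto simp: orbit_eq) blast+
qed

text \<open>An open set isolating the trivial coset pulls back along the quotient map to a
  neighbourhood of the identity matrix that meets \<open>G\<close> at most in the two signs of the
  identity.\<close>

lemma G_discrete: obtains e where "e > 0" "\<And>A. A \<in> G \<Longrightarrow> norm (A - mat 1) < e \<Longrightarrow> A = mat 1"
proof -
 let ?I = "{mat 1, - mat 1} :: (complex^2^2) set"
 have "?I \<in> \<Gamma>" using subgroup.one_closed[OF subgroup_Gamma] by (simp add: one_PSL2C)
 then have "openin (subtopology PSL2C_topology \<Gamma>) {?I}"
  using orbifold by (simp add: closed_hyp_3_orbifold_def discrete_subgroup_PSL2C_def)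
 then obtain U where U: "openin PSL2C_topology U" "{?I} = U \<inter> \<Gamma>" by (auto simp: openin_subtopology)
 have "openin (top_of_set (carrier SL2C)) {A \<in> carrier SL2C. SL2C_center #>\<^bsub>SL2C\<^esub> A \<in> U}"
  using U(1) by (simp add: PSL2C_topology_def openin_quotient_topology)
 then obtain W where W: "open W" "{A \<in> carrier SL2C. SL2C_center #>\<^bsub>SL2C\<^esub> A \<in> U} = carrier SL2C \<inter> W"
  by (auto simp: openin_open)
 have "mat 1 \<in> W"
 proof -
  have "?I \<in> U" using U(2) by blast
  moreover have "mat 1 \<in> carrier SL2C" by (simp add: SL2C_def)
  ultimately have "mat 1 \<in> {A \<in> carrier SL2C. SL2C_center #>\<^bsub>SL2C\<^esub> A \<in> U}" by (simp add: SL2C_center_rcoset)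
  then show ?thesis using W(2) by blast
 qed
 then obtain e1 where e1: "e1 > 0" "ball (mat 1) e1 \<subseteq> W" using W(1) open_contains_ball by blast
 \<comment> \<open>The second term in the minimum excludes the matrix - 1.\<close>
 define e where "e = min e1 (norm (mat 1 - (- mat 1) :: complex^2^2))"
 have "(mat 1 :: complex^2^2) \<noteq> - mat 1" by (simp add: vec_eq_iff mat_def)
 then have e: "e > 0" using e1(1) by (simp add: e_def)
 have "A = mat 1" if A: "A \<in> G" "norm (A - mat 1) < e" for A
 proof -
  have "A \<in> W" using A(2) e1(2) by (auto simp: e_def dist_norm norm_minus_commute)
  then have "A \<in> {A \<in> carrier SL2C. SL2C_center #>\<^bsub>SL2C\<^esub> A \<in> U}" using W(2) G_det[OF A(1)] by (auto simp: SL2C_def)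
  then have "{A, - A} \<in> U" by (simp add: SL2C_center_rcoset)
  then have "{A, - A} \<in> U \<inter> \<Gamma>" using G_coset[OF A(1)] by (rule IntI)
  then have "{A, - A} = ?I" unfolding U(2)[symmetric] by (rule singletonD)
  moreover have "A \<in> {A, - A}" by simp
  ultimately have "A \<in> ?I" by (simp only:)
  then have "A = mat 1 \<or> A = - mat 1" by simp
  moreover have "A \<noteq> - mat 1" using A(2) by (auto simp: e_def norm_minus_commute)
  ultimately show ?thesis by simp
 qed
 then show thesis using that e by blast
qed

text \<open>An infinite bounded set of matrices has an accumulation point, and for two distinct
  elements A, B near it the product of the inverse of A with B is too close to the identity.\<close>

lemma G_finite_norm: "finite {A \<in> G. norm A \<le> c}"
proof (rule ccontr)
 assume inf: "\<not> finite {A \<in> G. norm A \<le> c}" (is "\<not> finite ?S")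
 obtain e where e: "e > 0" "\<And>A. A \<in> G \<Longrightarrow> norm (A - mat 1) < e \<Longrightarrow> A = mat 1" by (rule G_discrete) blast
 have "compact (cball 0 c :: (complex^2^2) set)" by simp
 moreover have "?S \<subseteq> cball 0 c" by auto
 ultimately obtain L where L: "L islimpt ?S" using inf compact_eq_Bolzano_Weierstrass by blast
 \<comment> \<open>The 64 is 8 from the norm of a product, 4 from the norm of an inverse, and 2 from
   passing through L.\<close>
 define d where "d = e / (64 * (\<bar>c\<bar> + 1))"
 have d: "d > 0" using e(1) by (simp add: d_def)
 obtain A where A: "A \<in> ?S" "A \<noteq> L" "dist A L < d" using L d unfolding islimpt_approachable by blast
 have "min d (dist A L) > 0" using A d by simp
 then obtain B where B: "B \<in> ?S" "B \<noteq> L" "dist B L < min d (dist A L)" using L unfolding islimpt_approachable by blast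
 have AB: "A \<noteq> B" using B(3) by auto
 have AG: "A \<in> G" "B \<in> G" "norm A \<le> c" using A B by auto
 have "norm (B - A) < 2 * d"
  using A(3) B(3) dist_triangle[of B A L] norm_minus_commute[of L A] by (simp add: dist_norm)
 have "norm (ginv A ** B - mat 1) = norm (ginv A ** (B - A))" by (simp add: matrix_mult_diff_right ginv AG)
 also have "\<dots> \<le> 8 * (norm (ginv A) * norm (B - A))" by (rule matrix_norm_le)
 also have "\<dots> \<le> 8 * ((4 * (\<bar>c\<bar> + 1)) * norm (B - A))"
  using sl2_left_inverse_norm[OF G_det[OF AG(1)] ginv(3)[OF AG(1)]] AG(3) by (intro mult_left_mono mult_right_mono) auto
 also have "\<dots> < 8 * ((4 * (\<bar>c\<bar> + 1)) * (2 * d))" using \<open>norm (B - A) < 2 * d\<close> by (intro mult_strict_left_mono) auto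
 also have "\<dots> = e" by (simp add: d_def field_simps)
 finally have "ginv A ** B = mat 1" using e(2) AG by (simp add: G_mult ginv)
 then have "A ** (ginv A ** B) = A" by simp
 then have "A = B" by (simp add: matrix_mul_assoc ginv(2)[OF AG(1)])
 then show False using AB by simp
qed

lemma countable_G: "countable G"
proof -
 have "G = (\<Union>n::nat. {A \<in> G. norm A \<le> real n})" using real_arch_simple by auto
 moreover have "countable (\<Union>n::nat. {A \<in> G. norm A \<le> real n})"
  by (intro countable_UN[OF countableI_type] countable_finite G_finite_norm)
 ultimately show ?thesis by (rule ssubst)
qed

text \<open>A quantitative form of proper discontinuity. The diagonal entries of \<open>herm\<close>
  at the image point are at most 2 c because the image lies in the ball; they are also the values at
  p of the quadratic forms attached to the two rows of A, so each row is bounded.\<close>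

lemma act_norm_bound:
 assumes A: "det A = 1" and p: "p \<in> H3" and p': "cosh_dist base_point p \<le> c"
  and q: "cosh_dist base_point (SL2C_act A p) \<le> c"
 shows "norm A \<le> 16 * c"
proof -
 have q': "SL2C_act A p \<in> H3" using A p by (rule act_H3)
 define z t where "z = fst p" and "t = snd p"
 define w s where "w = fst (SL2C_act A p)" and "s = snd (SL2C_act A p)"
 have t: "t > 0" and s: "s > 0" using p q' by (auto simp: H3_iff t_def s_def)
 have c: "c \<ge> 1" using p' cosh_dist_ge_1[OF base_point_H3 p] by simp
 have tz: "(norm z)^2 + t^2 + 1 \<le> 2 * c * t" using p' t by (simp add: cosh_dist_base z_def t_def divide_le_eq mult_ac)
 have sw: "(norm w)^2 + s^2 + 1 \<le> 2 * c * s" using q s by (simp add: cosh_dist_base w_def s_def divide_le_eq mult_ac)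
 have row: "norm a \<le> 4 * c \<and> norm b \<le> 4 * c" if "(norm (a * z + b))^2 + (norm a)^2 * t^2 \<le> 2 * c * t" for a b
 proof -
  have "(norm a)^2 * t^2 \<le> 2 * c * t" using that zero_le_power2[of "norm (a * z + b)"] by linarith
  then have "((norm a)^2 * t) * t \<le> (2 * c) * t" by (simp add: power2_eq_square mult_ac)
  then have at: "(norm a)^2 * t \<le> 2 * c" using t by simp
  have zt: "(norm z)^2 \<le> 2 * c * t" and t1: "1 \<le> 2 * c * t" and t2: "t^2 \<le> 2 * c * t"
   using tz zero_le_power2[of "norm z"] zero_le_power2[of t] by linarith+
  have t3: "t \<le> 2 * c" using t2 t by (simp add: power2_eq_square)
  have "(norm a)^2 * 1 \<le> (norm a)^2 * (2 * c * t)" by (rule mult_left_mono[OF t1]) simp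
  also have "\<dots> = 2 * c * ((norm a)^2 * t)" by simp
  also have "\<dots> \<le> 2 * c * (2 * c)" using at c by (intro mult_left_mono) auto
  finally have a2: "(norm a)^2 \<le> (2 * c)^2" by (simp add: power2_eq_square)
  then have a3: "norm a \<le> 2 * c" by (rule power2_le_imp_le) (use c in simp)
  have "(norm (a * z))^2 = (norm a)^2 * (norm z)^2" by (simp add: norm_mult power_mult_distrib)
  also have "\<dots> \<le> (norm a)^2 * (2 * c * t)" by (rule mult_left_mono[OF zt]) simp
  also have "\<dots> = 2 * c * ((norm a)^2 * t)" by simp
  also have "\<dots> \<le> 2 * c * (2 * c)" using at c by (intro mult_left_mono) auto
  finally have az2: "(norm (a * z))^2 \<le> (2 * c)^2" by (simp add: power2_eq_square)
  then have az: "norm (a * z) \<le> 2 * c" by (rule power2_le_imp_le) (use c in simp)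
  have "0 \<le> (norm a)^2 * t^2" by simp
  then have "(norm (a * z + b))^2 \<le> 2 * c * t" using that by linarith
  also have "\<dots> \<le> 2 * c * (2 * c)" using t3 c by (intro mult_left_mono) auto
  finally have "(norm (a * z + b))^2 \<le> (2 * c)^2" by (simp add: power2_eq_square)
  then have "norm (a * z + b) \<le> 2 * c" by (rule power2_le_imp_le) (use c in simp)
  moreover have "norm b \<le> norm (a * z + b) + norm (a * z)" using norm_triangle_ineq4[of "a * z + b" "a * z"] by simp
  ultimately show ?thesis using a3 az c by linarith
 qed
 have herm: "herm (SL2C_act A p) = A ** herm p ** adj A" by (rule herm_act[OF A p])
 have quad: "(A ** herm p ** adj A) $ i $ i = of_real (((norm (A$i$1 * z + A$i$2))^2 + (norm (A$i$1))^2 * t^2) / t)" for i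
  using t by (simp add: matrix_matrix_mult_def sum_2 adj_def herm_simps z_def[symmetric] t_def[symmetric] of_real_norm_square)
   (simp add: field_simps power2_eq_square)
 have r1: "(norm (A$1$1 * z + A$1$2))^2 + (norm (A$1$1))^2 * t^2 \<le> 2 * c * t"
 proof -
  have "complex_of_real (((norm w)^2 + s^2) / s) = of_real (((norm (A$1$1 * z + A$1$2))^2 + (norm (A$1$1))^2 * t^2) / t)"
   using quad[of 1] unfolding herm[symmetric] herm_simps w_def s_def .
  then have "((norm w)^2 + s^2) / s = ((norm (A$1$1 * z + A$1$2))^2 + (norm (A$1$1))^2 * t^2) / t"
   unfolding of_real_eq_iff .
  moreover have "((norm w)^2 + s^2) / s \<le> 2 * c" using sw s by (simp add: divide_le_eq)
  ultimately show ?thesis using t by (simp add: divide_le_eq)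
 qed
 have r2: "(norm (A$2$1 * z + A$2$2))^2 + (norm (A$2$1))^2 * t^2 \<le> 2 * c * t"
 proof -
  have "complex_of_real (1 / s) = of_real (((norm (A$2$1 * z + A$2$2))^2 + (norm (A$2$1))^2 * t^2) / t)"
   using quad[of 2] unfolding herm[symmetric] herm_simps s_def .
  then have "1 / s = ((norm (A$2$1 * z + A$2$2))^2 + (norm (A$2$1))^2 * t^2) / t" unfolding of_real_eq_iff .
  moreover have "1 / s \<le> 2 * c"
  proof -
   have "1 \<le> 2 * c * s" using sw zero_le_power2[of "norm w"] zero_le_power2[of s] by linarith
   then show ?thesis using s by (simp add: divide_le_eq)
  qed
  ultimately show ?thesis using t by (simp add: divide_le_eq)
 qed
 have "norm (A $ i $ j) \<le> 4 * c" for i j using row[OF r1] row[OF r2] exhaust_2[of i] exhaust_2[of j] by auto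
 then have "norm A \<le> 4 * (4 * c)" by (rule norm_le_entries)
 then show ?thesis by simp
qed

text \<open>A finite set closed under inverses, to which sums over the group are reduced once the
  points involved are confined to a ball.\<close>

definition hits :: "real \<Rightarrow> (complex^2^2) set" where
 "hits c = {A \<in> G. \<exists>p\<in>hyp_cball base_point c. SL2C_act A p \<in> hyp_cball base_point c}"

lemma finite_hits: "finite (hits c)"
proof (rule finite_subset[OF _ G_finite_norm[of "16 * c"]])
 show "hits c \<subseteq> {A \<in> G. norm A \<le> 16 * c}" using act_norm_bound[OF G_det] by (auto simp: hits_def hyp_cball_def)
qed

lemma hits_subset: "hits c \<subseteq> G" by (auto simp: hits_def)

lemma ginv_hits: "ginv A \<in> hits c" if "A \<in> hits c"
proof -
 from that obtain p where A: "A \<in> G" and p: "p \<in> hyp_cball base_point c" "SL2C_act A p \<in> hyp_cball base_point c"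
  by (auto simp: hits_def)
 have "p \<in> H3" using p(1) hyp_cball_subset by blast
 then have "SL2C_act (ginv A) (SL2C_act A p) = p" by (rule G_act_ginv(1)[OF A])
 then show ?thesis unfolding hits_def using p ginv(1)[OF A] by (intro CollectI conjI bexI[of _ "SL2C_act A p"]) simp_all
qed

lemma bij_ginv_hits: "bij_betw ginv (hits c) (hits c)"
proof (rule bij_betw_byWitness[where f' = ginv])
 have "ginv (ginv A) = A" if "A \<in> hits c" for A using ginv_ginv hits_subset that by blast
 then show "\<forall>A\<in>hits c. ginv (ginv A) = A" "\<forall>A\<in>hits c. ginv (ginv A) = A" by blast+
qed (use ginv_hits in auto)

text \<open>The images of the open balls around the base point form an open cover of the compact
  quotient; the largest radius in a finite subcover serves all points.\<close>

lemma cocompact: obtains c where "\<And>x. x \<in> H3 \<Longrightarrow> \<exists>A\<in>G. SL2C_act A x \<in> hyp_cball base_point c"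
proof -
 define W where "W n = orbit \<Gamma> ` {x \<in> H3. cosh_dist base_point x < real n}" for n
 let ?T = "orbifold_topology \<Gamma>"
 have opW: "openin ?T (W n)" for n
 proof -
  have pre: "{x \<in> H3. orbit \<Gamma> x \<in> W n} = (\<Union>A\<in>G. {x \<in> H3. cosh_dist base_point (SL2C_act A x) < real n})"
  proof (intro equalityI subsetI)
   fix x assume "x \<in> {x \<in> H3. orbit \<Gamma> x \<in> W n}"
   then obtain y where y: "x \<in> H3" "y \<in> H3" "cosh_dist base_point y < real n" "orbit \<Gamma> x = orbit \<Gamma> y"
    by (auto simp: W_def)
   then obtain A where "A \<in> G" "y = SL2C_act A x" using orbit_self[of y] by (auto simp: orbit_eq)
   then show "x \<in> (\<Union>A\<in>G. {x \<in> H3. cosh_dist base_point (SL2C_act A x) < real n})" using y by blast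
  next
   fix x assume "x \<in> (\<Union>A\<in>G. {x \<in> H3. cosh_dist base_point (SL2C_act A x) < real n})"
   then obtain A where A: "A \<in> G" "x \<in> H3" "cosh_dist base_point (SL2C_act A x) < real n" by blast
   then have "orbit \<Gamma> x = orbit \<Gamma> (SL2C_act A x)" using orbit_act by simp
   then show "x \<in> {x \<in> H3. orbit \<Gamma> x \<in> W n}" using A G_act_H3 by (auto simp: W_def)
  qed
  have "open {x \<in> H3. cosh_dist base_point (SL2C_act A x) < real n}" if "A \<in> G" for A
  proof -
   have "continuous_on H3 (SL2C_act A)"
    by (intro continuous_at_imp_continuous_on ballI differentiable_imp_continuous_within
      hyp_isometryD(3)[OF G_isometry[OF that]])
   then have "continuous_on H3 (\<lambda>x. cosh_dist base_point (SL2C_act A x))"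
    using G_act_H3[OF that] by (intro continuous_intros) auto
   then have "open ((\<lambda>x. cosh_dist base_point (SL2C_act A x)) -` {..<real n} \<inter> H3)"
    using continuous_on_open_vimage[OF open_H3] open_lessThan by blast
   moreover have "(\<lambda>x. cosh_dist base_point (SL2C_act A x)) -` {..<real n} \<inter> H3 = {x \<in> H3. cosh_dist base_point (SL2C_act A x) < real n}" by auto
   ultimately show ?thesis by simp
  qed
  then have "open {x \<in> H3. orbit \<Gamma> x \<in> W n}" unfolding pre by (intro open_UN) auto
  then have "openin (top_of_set H3) {x \<in> H3. orbit \<Gamma> x \<in> W n}" by (intro open_subset) auto
  moreover have "W n \<subseteq> orbit \<Gamma> ` H3" by (auto simp: W_def)
  ultimately show ?thesis by (simp add: orbifold_topology_def openin_quotient_topology)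
 qed
 have top: "topspace ?T = orbit \<Gamma> ` H3" by (simp add: orbifold_topology_def topspace_quotient_topology)
 have cover: "orbit \<Gamma> ` H3 \<subseteq> \<Union>(range W)"
 proof
  fix X assume "X \<in> orbit \<Gamma> ` H3"
  then obtain x where x: "x \<in> H3" "X = orbit \<Gamma> x" by blast
  obtain n where "cosh_dist base_point x < real n" using reals_Archimedean2 by blast
  then show "X \<in> \<Union>(range W)" using x by (auto simp: W_def)
 qed
 have "compact_space ?T" using orbifold by (simp add: closed_hyp_3_orbifold_def)
 then have "\<exists>F. finite F \<and> F \<subseteq> range W \<and> topspace ?T \<subseteq> \<Union>F"
 proof -
  have "(\<forall>U\<in>range W. openin ?T U) \<and> topspace ?T \<subseteq> \<Union>(range W)" using opW cover unfolding top by simp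
  with spec[OF iffD1[OF compact_space_alt \<open>compact_space ?T\<close>], of "range W"] show ?thesis by (rule mp)
 qed
 then obtain F where "finite F \<and> F \<subseteq> range W \<and> topspace ?T \<subseteq> \<Union>F" ..
 then have F: "finite F" "F \<subseteq> range W" "orbit \<Gamma> ` H3 \<subseteq> \<Union>F" using top by simp_all
 obtain N where N: "finite N" "F = W ` N" using finite_subset_image[OF F(1,2)] by auto
 define c where "c = real (Max (insert 0 N))"
 show thesis
 proof (rule that[of c])
  fix x assume x: "x \<in> H3"
  then obtain n where n: "n \<in> N" "orbit \<Gamma> x \<in> W n" using F(3) N(2) by blast
  then obtain y where y: "y \<in> H3" "cosh_dist base_point y < real n" "orbit \<Gamma> x = orbit \<Gamma> y" by (auto simp: W_def)
  then obtain A where A: "A \<in> G" "y = SL2C_act A x" using orbit_self[of y] by (auto simp: orbit_eq)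
  have "n \<le> Max (insert 0 N)" using n N by (intro Max_ge) auto
  then have "y \<in> hyp_cball base_point c" using y by (simp add: hyp_cball_def c_def)
  then show "\<exists>A\<in>G. SL2C_act A x \<in> hyp_cball base_point c" using A by blast
 qed
qed

end

section \<open>Fundamental domains\<close>

text \<open>A total order on points; its minimum on an orbit exists because balls meet orbits in
 finite sets, and selects a Borel fundamental domain.\<close>

definition point_less :: "point3 \<Rightarrow> point3 \<Rightarrow> bool" where
 "point_less p q \<longleftrightarrow> cosh_dist base_point p < cosh_dist base_point q \<or> cosh_dist base_point p = cosh_dist base_point q \<and>
  (Re (fst p) < Re (fst q) \<or> Re (fst p) = Re (fst q) \<and>
  (Im (fst p) < Im (fst q) \<or> Im (fst p) = Im (fst q) \<and> snd p < snd q))"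

lemma point_less_irrefl: "\<not> point_less p p" by (simp add: point_less_def)

lemma point_less_trans: "point_less p q \<Longrightarrow> point_less q r \<Longrightarrow> point_less p r" unfolding point_less_def by linarith

lemma point_less_total: "p \<noteq> q \<Longrightarrow> point_less p q \<or> point_less q p"
 unfolding point_less_def prod_eq_iff complex_eq_iff by linarith

lemma point_less_min:
 assumes "finite S" "S \<noteq> {}"
 shows "\<exists>m\<in>S. \<forall>q\<in>S. \<not> point_less q m" using assms
proof (induction S rule: finite_ne_induct)
 case (singleton x)
 then show ?case by (simp add: point_less_irrefl)
next
 case (insert x S)
 then obtain m where m: "m \<in> S" "\<forall>q\<in>S. \<not> point_less q m" by blast
 show ?case
 proof (cases "point_less x m")
  case True
  then have "\<not> point_less q x" if "q \<in> insert x S" for q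
   using that m(2) point_less_trans[of q x m] point_less_irrefl by blast
  then show ?thesis by blast
 next
  case False
  then show ?thesis using m by blast
 qed
qed

lemma point_less_measurable:
 assumes [measurable]: "f \<in> borel_measurable borel"
 shows "{p. point_less (f p) p} \<in> sets borel"
proof -
 have [measurable]: "cosh_dist base_point \<in> borel_measurable borel" unfolding cosh_dist_base[abs_def] by measurable
 have [measurable]: "(\<lambda>p. Re (fst p)) \<in> borel_measurable (borel :: point3 measure)"
  "(\<lambda>p. Im (fst p)) \<in> borel_measurable (borel :: point3 measure)"
  by (intro borel_measurable_continuous_onI continuous_intros)+
 have [measurable]: "(\<lambda>p. Re (fst (f p))) \<in> borel_measurable borel"
  "(\<lambda>p. Im (fst (f p))) \<in> borel_measurable borel" "(\<lambda>p. snd (f p)) \<in> borel_measurable borel"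
  "(\<lambda>p. cosh_dist base_point (f p)) \<in> borel_measurable borel"
  using measurable_compose[OF assms, of "\<lambda>p. Re (fst p)" borel] measurable_compose[OF assms, of "\<lambda>p. Im (fst p)" borel]
   measurable_compose[OF assms, of snd borel] measurable_compose[OF assms, of "cosh_dist base_point" borel]
  by simp_all
 show ?thesis unfolding point_less_def by measurable
qed

text \<open>Comparing heights, a fixed point has denominator 1. For c \<noteq> 0 this is the
  equation of a sphere. For c = 0 it says |d| = 1, so that the conjugate of d is a and the fixed
  point equation becomes (a z + b) a = z; this either has no solution or determines z, which puts
  the fixed points in a hyperplane.\<close>

lemma fixed_points_negligible:
 assumes A: "det A = 1" "A \<noteq> mat 1" "A \<noteq> - mat 1"
 shows "negligible {p \<in> H3. SL2C_act A p = p}"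
proof -
 define a b c d where abcd: "a = A$1$1" "b = A$1$2" "c = A$2$1" "d = A$2$2"
 have det: "a * d - b * c = 1" using A(1) by (simp add: det_2 abcd)
 define N where "N p = (norm (c * fst p + d))^2 + (norm c)^2 * (snd p)^2" for p :: point3
 have act: "SL2C_act A p = (((a * fst p + b) * cnj (c * fst p + d) + a * cnj c * of_real ((snd p)^2)) / of_real (N p), snd p / N p)" for p
  by (simp add: SL2C_act_def Let_def abcd N_def)
 have N1: "N p = 1" if "p \<in> H3" "SL2C_act A p = p" for p
 proof -
  have "N p > 0" using SL2C_denominator_pos[OF A(1) that(1)] by (simp add: N_def abcd)
  moreover have "snd p / N p = snd p" using that(2) by (metis act snd_conv)
  ultimately show ?thesis using that(1) by (simp add: H3_iff field_simps)
 qed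
 show ?thesis
 proof (cases "c = 0")
  case False
  have "{p \<in> H3. SL2C_act A p = p} \<subseteq> sphere (- d / c, 0) (1 / norm c)"
  proof
   fix p assume "p \<in> {p \<in> H3. SL2C_act A p = p}"
   then have "N p = 1" using N1 by simp
   then have 1: "(norm (c * fst p + d))^2 + (norm c)^2 * (snd p)^2 = 1" by (simp add: N_def)
   have "c * fst p + d = c * (fst p - (- d / c))" using False by (simp add: field_simps)
   then have "norm (c * fst p + d) = norm c * norm (fst p - (- d / c))"
    using arg_cong[of _ _ norm] by (simp only: norm_mult)
   then have "(norm c)^2 * ((norm (fst p - (- d / c)))^2 + (snd p)^2) = 1"
    using 1 by (simp only: power_mult_distrib distrib_left)
   then have "(norm (p - (- d / c, 0)))^2 = (1 / norm c)^2"
    unfolding norm_point3 using False by (simp add: field_simps power2_eq_square)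
   then have "norm (p - (- d / c, 0)) = 1 / norm c" by (simp add: power2_eq_iff_nonneg)
   then show "p \<in> sphere (- d / c, 0) (1 / norm c)" by (simp add: dist_norm norm_minus_commute)
  qed
  then show ?thesis using negligible_sphere negligible_subset by blast
 next
  case True
  have ad: "a * d = 1" using det True by simp
  have fixed: "(a * fst p + b) * a = fst p" if "p \<in> H3" "SL2C_act A p = p" for p
  proof -
   have "N p = 1" by (rule N1[OF that])
   then have dd: "d * cnj d = 1" using True by (simp add: N_def complex_norm_square[symmetric])
   then have "cnj d = a * (d * cnj d)" using ad by (metis mult.assoc mult.left_neutral)
   then have "cnj d = a" using dd by simp
   then show ?thesis using that(2) \<open>N p = 1\<close> True by (metis act add.commute add_0 complex_cnj_zero div_by_1 fst_conv mult_zero_left mult_zero_right of_real_1)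
  qed
  have "a * a \<noteq> 1 \<or> b \<noteq> 0"
  proof (rule ccontr)
   assume "\<not> (a * a \<noteq> 1 \<or> b \<noteq> 0)"
   then have aa: "a * a = 1" "b = 0" by auto
   then have "a = 1 \<or> a = -1" by (simp add: square_eq_1_iff)
   moreover have "d = a" using aa ad by (metis mult.left_commute mult.right_neutral)
   ultimately have "A = mat 1 \<or> A = - mat 1" using True aa by (auto simp: vec_eq_iff forall_2 mat_def abcd)
   then show False using A by simp
  qed
  show ?thesis
  proof (cases "a * a = 1")
   case True
   then have "b \<noteq> 0" using \<open>a * a \<noteq> 1 \<or> b \<noteq> 0\<close> by simp
   then have False if "p \<in> H3" "SL2C_act A p = p" for p
    using fixed[OF that] True ad by (auto simp: algebra_simps mult.assoc[symmetric])
   then have "{p \<in> H3. SL2C_act A p = p} = {}" by blast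
   then show ?thesis by (simp only: negligible_empty)
  next
   case False
   have "{p \<in> H3. SL2C_act A p = p} \<subseteq> {p. (1, 0) \<bullet> p = Re (a * b / (1 - a * a))}"
   proof
    fix p assume "p \<in> {p \<in> H3. SL2C_act A p = p}"
    then have "(a * fst p + b) * a = fst p" using fixed by simp
    then have "(1 - a * a) * fst p = a * b" by (simp add: algebra_simps)
    then have "fst p = a * b / (1 - a * a)" using False by (simp add: field_simps)
    then show "p \<in> {p. (1, 0) \<bullet> p = Re (a * b / (1 - a * a))}" by (simp add: inner_prod_def inner_complex_def)
   qed
   moreover have "negligible {p::point3. (1, 0) \<bullet> p = Re (a * b / (1 - a * a))}"
    by (rule negligible_hyperplane) (simp add: prod_eq_iff)
   ultimately show ?thesis using negligible_subset by blast
  qed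
 qed
qed

lemma negligible_imp_AE_hyp: "negligible S \<Longrightarrow> AE p in hyp. p \<notin> S"
proof -
 assume "negligible S"
 then have "AE p in lebesgue. p \<notin> S" unfolding negligible_iff_null_sets by (rule AE_not_in)
 then have "AE p in lborel. p \<notin> S" by (simp add: AE_completion_iff)
 then have "AE p in hyp_volume. p \<notin> S" unfolding hyp_volume_def by (subst AE_density) (auto elim: eventually_mono)
 then show ?thesis unfolding hyp_def by (subst AE_restrict_space_iff) (auto elim: eventually_mono)
qed

context cocompact_group
begin

definition dirichlet :: "point3 set" where
 "dirichlet = {p \<in> H3. \<forall>A\<in>G. \<not> point_less (SL2C_act A p) p}"

lemma orbit_finite_ball:
 assumes p: "p \<in> H3"
 shows "finite {q \<in> orbit \<Gamma> p. cosh_dist base_point q \<le> c}"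
proof (rule finite_subset)
 define c' where "c' = max c (cosh_dist base_point p)"
 show "finite ((\<lambda>A. SL2C_act A p) ` hits c')" by (intro finite_imageI finite_hits)
 show "{q \<in> orbit \<Gamma> p. cosh_dist base_point q \<le> c} \<subseteq> (\<lambda>A. SL2C_act A p) ` hits c'"
 proof
  fix q assume "q \<in> {q \<in> orbit \<Gamma> p. cosh_dist base_point q \<le> c}"
  then obtain A where A: "A \<in> G" "q = SL2C_act A p" "cosh_dist base_point q \<le> c" by (auto simp: orbit_eq)
  then have "A \<in> hits c'" unfolding hits_def using p G_act_H3[OF A(1) p]
   by (intro CollectI conjI bexI[of _ p]) (auto simp: hyp_cball_def c'_def)
  then show "q \<in> (\<lambda>A. SL2C_act A p) ` hits c'" using A by blast
 qed
qed

lemma orbit_sym: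
 assumes "p \<in> H3" "q \<in> orbit \<Gamma> p"
 shows "q \<in> H3 \<and> orbit \<Gamma> q = orbit \<Gamma> p"
proof -
 obtain A where "A \<in> G" "q = SL2C_act A p" using assms(2) by (auto simp: orbit_eq)
 then show ?thesis using orbit_act[OF _ assms(1)] G_act_H3[OF _ assms(1)] by simp
qed

lemma dirichlet_strict_fundamental_domain: "strict_fundamental_domain \<Gamma> dirichlet"
 unfolding strict_fundamental_domain_def
proof (intro conjI ballI)
 have "dirichlet = H3 - (\<Union>A\<in>G. {p. point_less (SL2C_act A p) p})" by (auto simp: dirichlet_def)
 then show "dirichlet \<in> sets borel"
  using countable_G by (auto intro!: sets.Diff sets.countable_UN'' point_less_measurable act_measurable)
 show "dirichlet \<subseteq> H3" by (auto simp: dirichlet_def)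
 fix p assume p: "p \<in> H3"
 define S where "S = {q \<in> orbit \<Gamma> p. cosh_dist base_point q \<le> cosh_dist base_point p}"
 have "finite S" using orbit_finite_ball[OF p] by (simp add: S_def)
 have "p \<in> S" by (simp add: S_def orbit_self)
 then have "S \<noteq> {}" by (metis empty_iff)
 with \<open>finite S\<close> have "\<exists>m\<in>S. \<forall>q\<in>S. \<not> point_less q m" by (rule point_less_min)
 then obtain m where m: "m \<in> S" "\<And>q. q \<in> S \<Longrightarrow> \<not> point_less q m" by blast
 have mp: "m \<in> orbit \<Gamma> p" "cosh_dist base_point m \<le> cosh_dist base_point p" using m(1) by (auto simp: S_def)
 have mo: "m \<in> H3" "orbit \<Gamma> m = orbit \<Gamma> p" using orbit_sym[OF p mp(1)] by auto
 have min: "\<not> point_less q m" if q: "q \<in> orbit \<Gamma> p" for q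
 proof
  assume "point_less q m"
  then have "q \<in> S" using q mp by (auto simp: S_def point_less_def)
  then show False using m(2) \<open>point_less q m\<close> by blast
 qed
 have "SL2C_act A m \<in> orbit \<Gamma> p" if "A \<in> G" for A
 proof -
  have "SL2C_act A m \<in> orbit \<Gamma> m" unfolding orbit_eq using that by blast
  then show ?thesis using mo(2) by simp
 qed
 then have "m \<in> dirichlet" unfolding dirichlet_def using mo(1) min by blast
 show "\<exists>!q. q \<in> dirichlet \<and> q \<in> orbit \<Gamma> p"
 proof (rule ex1I[of _ m])
  show "m \<in> dirichlet \<and> m \<in> orbit \<Gamma> p" using \<open>m \<in> dirichlet\<close> mp by simp
  fix q assume q: "q \<in> dirichlet \<and> q \<in> orbit \<Gamma> p"
  then have "m \<in> orbit \<Gamma> q" using orbit_sym[OF p] orbit_self mo by metis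
  then obtain A where "A \<in> G" "m = SL2C_act A q" by (auto simp: orbit_eq)
  then have "\<not> point_less m q" using q by (auto simp: dirichlet_def)
  then show "q = m" using min[of q] q point_less_total by blast
 qed
qed

lemma dirichlet_bounded: obtains c where "dirichlet \<subseteq> hyp_cball base_point c"
proof -
 obtain c where c: "\<And>x. x \<in> H3 \<Longrightarrow> \<exists>A\<in>G. SL2C_act A x \<in> hyp_cball base_point c" by (rule cocompact) blast
 have "p \<in> hyp_cball base_point c" if p: "p \<in> dirichlet" for p
 proof -
  obtain A where A: "A \<in> G" "SL2C_act A p \<in> hyp_cball base_point c" using c[of p] p unfolding dirichlet_def by blast
  then have "\<not> point_less (SL2C_act A p) p" using p by (simp add: dirichlet_def)
  then show ?thesis using A p by (auto simp: hyp_cball_def dirichlet_def point_less_def)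
 qed
 then show thesis using that by blast
qed

text \<open>Cut D according to the first group element, in an enumeration, that carries a point into
  E, and move each piece by its element. A point in two of the images would come from points of D in
  one orbit, hence from a single point lying in two disjoint pieces.\<close>

lemma fundamental_domain_le:
 assumes D: "strict_fundamental_domain \<Gamma> D" and E: "strict_fundamental_domain \<Gamma> E"
 shows "emeasure hyp D \<le> emeasure hyp E"
proof -
 have DE: "D \<in> sets hyp" "E \<in> sets hyp" "D \<subseteq> H3" "E \<subseteq> H3"
  using D E by (auto simp: strict_fundamental_domain_def sets_hyp)
 define g where "g = from_nat_into G"
 have gG: "g n \<in> G" for n unfolding g_def using G_one by (intro from_nat_into) auto
 have g_surj: "\<exists>n. A = g n" if "A \<in> G" for A unfolding g_def using from_nat_into_surj[OF countable_G that] by metis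
 define P where "P n = {p \<in> D. SL2C_act (g n) p \<in> E}" for n
 define Q where "Q = disjointed P"
 have meas: "SL2C_act A \<in> measurable hyp hyp" if "A \<in> G" for A
  by (rule hyp_isometry_measurable[OF G_isometry[OF that]])
 have Pm: "P n \<in> sets hyp" for n
 proof -
  have "P n = D \<inter> (SL2C_act (g n) -` E \<inter> space hyp)" using DE by (auto simp: P_def)
  then show ?thesis using DE measurable_sets[OF meas[OF gG]] by auto
 qed
 have Qm: "range Q \<subseteq> sets hyp" unfolding Q_def using Pm by (intro sets.range_disjointed_sets) auto
 have QP: "Q n \<subseteq> P n" for n unfolding Q_def by (rule disjointed_subset)
 have "D = (\<Union>n. P n)"
 proof (intro equalityI subsetI)
  fix p assume p: "p \<in> D"
  then have "p \<in> H3" using DE by blast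
  then have "\<exists>q. q \<in> E \<and> q \<in> orbit \<Gamma> p" using E unfolding strict_fundamental_domain_def by blast
  then obtain q where "q \<in> E" "q \<in> orbit \<Gamma> p" by blast
  then obtain A where "A \<in> G" "SL2C_act A p \<in> E" by (auto simp: orbit_eq)
  then show "p \<in> (\<Union>n. P n)" using g_surj[of A] p by (auto simp: P_def)
 qed (auto simp: P_def)
 then have DQ: "D = (\<Union>n. Q n)" unfolding Q_def by (simp add: UN_disjointed_eq)
 define R where "R n = {y \<in> H3. SL2C_act (ginv (g n)) y \<in> Q n}" for n
 have RQ: "SL2C_act (ginv (g n)) -` Q n \<inter> H3 = R n" for n by (auto simp: R_def)
 have Rm: "range R \<subseteq> sets hyp" using measurable_sets[OF meas[OF ginv(1)[OF gG]]] Qm by (auto simp flip: RQ)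
 have eqm: "emeasure hyp (R n) = emeasure hyp (Q n)" for n
 proof -
  have "emeasure hyp (Q n) = emeasure (distr hyp hyp (SL2C_act (ginv (g n)))) (Q n)"
   by (simp add: hyp_isometry_distr_hyp[OF G_isometry[OF ginv(1)[OF gG]]])
  then show ?thesis using Qm by (simp add: emeasure_distr[OF meas[OF ginv(1)[OF gG]]] RQ)
 qed
 have RE: "R n \<subseteq> E" for n
 proof
  fix y assume "y \<in> R n"
  then have y: "y \<in> H3" "SL2C_act (ginv (g n)) y \<in> P n" using QP by (auto simp: R_def)
  then show "y \<in> E" using G_act_ginv(2)[OF gG y(1)] by (auto simp: P_def)
 qed
 have "disjoint_family R" unfolding disjoint_family_on_def
 proof (intro ballI impI)
  fix m n :: nat assume "m \<noteq> n"
  show "R m \<inter> R n = {}"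
  proof (rule ccontr)
   assume "R m \<inter> R n \<noteq> {}"
   then obtain y where y: "y \<in> H3" "SL2C_act (ginv (g m)) y \<in> Q m" "SL2C_act (ginv (g n)) y \<in> Q n" by (auto simp: R_def)
   have "SL2C_act (ginv (g m)) y \<in> D" "SL2C_act (ginv (g n)) y \<in> D" using y QP by (auto simp: P_def)
   moreover have "SL2C_act (ginv (g m)) y \<in> orbit \<Gamma> y" "SL2C_act (ginv (g n)) y \<in> orbit \<Gamma> y"
    using ginv(1)[OF gG] by (auto simp: orbit_eq)
   ultimately have "SL2C_act (ginv (g m)) y = SL2C_act (ginv (g n)) y"
    using D y(1) by (auto simp: strict_fundamental_domain_def)
   then have "SL2C_act (ginv (g m)) y \<in> Q m \<inter> Q n" using y by simp
   then show False using disjoint_family_disjointed[of P] \<open>m \<noteq> n\<close> by (auto simp: Q_def disjoint_family_on_def)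
  qed
 qed
 have "emeasure hyp D = (\<Sum>n. emeasure hyp (Q n))"
  unfolding DQ using Qm by (intro suminf_emeasure[symmetric]) (auto simp: Q_def disjoint_family_disjointed)
 also have "\<dots> = (\<Sum>n. emeasure hyp (R n))" by (simp add: eqm)
 also have "\<dots> = emeasure hyp (\<Union>n. R n)" using Rm \<open>disjoint_family R\<close> by (rule suminf_emeasure)
 also have "\<dots> \<le> emeasure hyp E" using RE DE by (intro emeasure_mono) auto
 finally show ?thesis .
qed

lemma orbifold_volume_eq:
 assumes D: "strict_fundamental_domain \<Gamma> D"
 shows "orbifold_volume \<Gamma> = measure hyp D"
proof -
 have eq: "measure hyp_volume E = measure hyp D" if E: "strict_fundamental_domain \<Gamma> E" for E
 proof -
  have "emeasure hyp E = emeasure hyp D" using fundamental_domain_le[OF D E] fundamental_domain_le[OF E D] by simp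
  moreover have "emeasure hyp E = emeasure hyp_volume E" using E by (simp add: emeasure_hyp strict_fundamental_domain_def)
  ultimately show ?thesis by (simp add: measure_def)
 qed
 show ?thesis unfolding orbifold_volume_def
 proof (rule the_equality)
  show "\<exists>E. strict_fundamental_domain \<Gamma> E \<and> measure hyp D = measure hyp_volume E" using D eq by metis
  fix V assume "\<exists>E. strict_fundamental_domain \<Gamma> E \<and> V = measure hyp_volume E"
  then show "V = measure hyp D" using eq by blast
 qed
qed

lemma AE_trivial_stabilizer: "AE p in hyp. \<forall>A\<in>G. SL2C_act A p = p \<longrightarrow> A = mat 1 \<or> A = - mat 1"
proof -
 have "AE p in hyp. A \<noteq> mat 1 \<longrightarrow> A \<noteq> - mat 1 \<longrightarrow> SL2C_act A p \<noteq> p" if "A \<in> G" for A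
 proof (cases "A = mat 1 \<or> A = - mat 1")
  case False
  then have "AE p in hyp. p \<notin> {p \<in> H3. SL2C_act A p = p}"
   by (intro negligible_imp_AE_hyp fixed_points_negligible G_det that) auto
  moreover have "AE p in hyp. p \<in> H3" using AE_space[of hyp] by simp
  ultimately show ?thesis by eventually_elim auto
 qed auto
 then have "AE p in hyp. \<forall>A\<in>G. A \<noteq> mat 1 \<longrightarrow> A \<noteq> - mat 1 \<longrightarrow> SL2C_act A p \<noteq> p"
  using countable_G by (subst AE_ball_countable) auto
 then show ?thesis by eventually_elim blast
qed

end

locale fundamental_domain = cocompact_group +
 fixes D :: "point3 set" and c0 :: real
 assumes D: "strict_fundamental_domain \<Gamma> D" and D_bounded: "D \<subseteq> hyp_cball base_point c0"
begin

lemma D_sets: "D \<in> sets hyp" and D_H3: "D \<subseteq> H3" using D by (auto simp: strict_fundamental_domain_def sets_hyp)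

lemma D_meets: "x \<in> H3 \<Longrightarrow> \<exists>A\<in>G. SL2C_act A x \<in> D" using D by (force simp: strict_fundamental_domain_def orbit_eq)

lemma emeasure_D: "emeasure hyp D < \<infinity>"
proof -
 have "emeasure hyp D \<le> emeasure hyp (hyp_cball base_point c0)"
  using D_bounded by (intro emeasure_mono compact_sets_hyp compact_hyp_cball hyp_cball_subset) auto
 then show ?thesis using emeasure_compact_finite[OF compact_hyp_cball[OF base_point_H3] hyp_cball_subset, of c0]
  by (simp add: emeasure_hyp hyp_cball_subset)
qed

lemma volume_eq: "orbifold_volume \<Gamma> = measure hyp D" by (rule orbifold_volume_eq[OF D])

text \<open>Both \<open>A\<close> and \<open>-A\<close> occur in \<open>G\<close>, hence the factor 2.\<close>

lemma AE_two_translates: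
 "AE x in hyp. card {A \<in> G. SL2C_act A x \<in> D} = 2 \<and> finite {A \<in> G. SL2C_act A x \<in> D}"
proof -
 have "AE p in hyp. p \<in> H3" using AE_space[of hyp] by simp
 with AE_trivial_stabilizer show ?thesis
 proof eventually_elim
  case (elim x)
  then obtain A where A: "A \<in> G" "SL2C_act A x \<in> D" using D_meets by blast
  have "{B \<in> G. SL2C_act B x \<in> D} = {A, - A}"
  proof (intro equalityI subsetI)
   fix B assume "B \<in> {B \<in> G. SL2C_act B x \<in> D}"
   then have B: "B \<in> G" "SL2C_act B x \<in> D" by auto
   have "SL2C_act A x \<in> orbit \<Gamma> x" "SL2C_act B x \<in> orbit \<Gamma> x" using A B by (auto simp: orbit_eq)
   then have "SL2C_act B x = SL2C_act A x" using D A(2) B(2) \<open>x \<in> H3\<close> unfolding strict_fundamental_domain_def by blast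
   then have "SL2C_act (ginv A ** B) x = x" using A B elim by (simp add: G_act_mult ginv G_act_ginv)
   moreover have "ginv A ** B \<in> G" using A B by (simp add: G_mult ginv)
   ultimately have "ginv A ** B = mat 1 \<or> ginv A ** B = - mat 1" using elim by blast
   then have "A ** (ginv A ** B) = A \<or> A ** (ginv A ** B) = - A" by (auto simp: matrix_mult_uminus)
   then show "B \<in> {A, - A}" by (simp add: matrix_mul_assoc ginv(2)[OF A(1)])
  qed (use A in \<open>auto simp: G_uminus SL2C_act_uminus\<close>)
  moreover have "A \<noteq> - A"
  proof
   assume "A = - A"
   from arg_cong[OF this, of "\<lambda>M. M $ i $ j" for i j] have "A $ i $ j = 0" for i j
    by (simp add: eq_neg_iff_add_eq_0 flip: mult_2)
   then show False using G_det[OF A(1)] by (simp add: det_2)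
  qed
  ultimately show ?case by simp
 qed
qed

text \<open>Almost every point has exactly two elements of \<open>G\<close> carrying it into D, so
  the indicators sum to 2. The finite set S only has to contain the elements that can occur where g
  is nonzero.\<close>

lemma AE_unfold:
 fixes g :: "point3 \<Rightarrow> real"
 assumes "finite S" "S \<subseteq> G" and S: "\<And>x A. x \<in> H3 \<Longrightarrow> g x \<noteq> 0 \<Longrightarrow> A \<in> G \<Longrightarrow> SL2C_act A x \<in> D \<Longrightarrow> A \<in> S"
 shows "AE x in hyp. 2 * g x = (\<Sum>A\<in>S. indicator D (SL2C_act A x) * g x)"
proof -
 have "AE p in hyp. p \<in> H3" using AE_space[of hyp] by simp
 with AE_two_translates show ?thesis
 proof eventually_elim
  case (elim x)
  show ?case
  proof (cases "g x = 0")
   case False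
   then have "{A \<in> S. SL2C_act A x \<in> D} = {A \<in> G. SL2C_act A x \<in> D}" using S[of x] assms(2) \<open>x \<in> H3\<close> by blast
   then have "card {A \<in> S. SL2C_act A x \<in> D} = 2" using elim by simp
   moreover have "(\<Sum>A\<in>S. indicator D (SL2C_act A x)) = real (card {A \<in> S. SL2C_act A x \<in> D})"
    using assms(1) by (simp add: indicator_def sum.If_cases Int_def of_bool_def)
   ultimately show ?thesis by (simp flip: sum_distrib_right)
  qed simp
 qed
qed

end

section \<open>Spectral theory of radial operators on invariant functions\<close>

section \<open>Invariant functions\<close>

text \<open>The discriminant inequality in a form that covers degenerate quadratics. It gives
  Cauchy-Schwarz for \<open>ip\<close> and, in \<open>top_eigenvector\<close>, for a form that is
  only semidefinite.\<close>

lemma nonneg_quadratic: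
 fixes a b c :: real
 assumes "\<And>t. 0 \<le> a + 2 * t * b + t^2 * c"
 shows "b^2 \<le> a * c"
proof (cases "c = 0")
 case True
 have a: "0 \<le> a" using assms[of 0] by simp
 have "b = 0"
 proof (rule ccontr)
  assume "b \<noteq> 0"
  then show False using assms[of "- (a + 1) / (2 * b)"] a True by (simp add: field_simps)
 qed
 then show ?thesis using True by simp
next
 case False
 have "c > 0"
 proof (rule ccontr)
  assume "\<not> c > 0"
  then have c: "c < 0" using False by simp
  define t where "t = (\<bar>a\<bar> + 2 * \<bar>b\<bar> + 1) / (- c) + 1"
  have t: "t \<ge> 1" "t * (- c) \<ge> \<bar>a\<bar> + 2 * \<bar>b\<bar> + 1" using c by (auto simp: t_def field_simps)
  have "t * (t * (- c)) \<ge> t * (\<bar>a\<bar> + 2 * \<bar>b\<bar> + 1)" using t by (intro mult_left_mono) auto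
  moreover have "t * (\<bar>a\<bar> + 1) \<ge> 1 * (\<bar>a\<bar> + 1)" using t by (intro mult_right_mono) auto
  moreover have "t * b \<le> t * \<bar>b\<bar>" using t by (intro mult_left_mono) auto
  ultimately have "a + 2 * t * b + t^2 * c < 0" by (simp add: power2_eq_square algebra_simps)
  then show False using assms[of t] by simp
 qed
 then show ?thesis using assms[of "- b / c"] by (simp add: field_simps power2_eq_square)
qed

context fundamental_domain
begin

definition dom :: "point3 measure" where
 "dom = restrict_space hyp D"

lemma space_dom [simp]: "space dom = D" using D_H3 by (auto simp: dom_def space_restrict_space)

lemma emeasure_dom: "emeasure dom D = emeasure hyp D"
 unfolding dom_def by (rule emeasure_restrict_space) (use D_sets D_H3 in \<open>auto simp: Int_absorb2\<close>)

sublocale dom: finite_measure dom by (rule finite_measureI) (use emeasure_D in \<open>simp add: emeasure_dom\<close>)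

lemma measurable_dom: "f \<in> measurable hyp M \<Longrightarrow> f \<in> measurable dom M"
 unfolding dom_def by (rule measurable_restrict_space1)

lemma dom_integral: "(\<integral>x. g x \<partial>dom) = (\<integral>x. indicator D x * g x \<partial>hyp)" for g :: "point3 \<Rightarrow> real"
 unfolding dom_def by (subst integral_restrict_space) (use D_sets D_H3 in \<open>auto simp: Int_absorb2\<close>)

definition vol :: real where
 "vol = measure dom D"

lemma vol_eq: "orbifold_volume \<Gamma> = vol" by (simp add: volume_eq vol_def measure_def emeasure_dom)

lemma bounded_on_D:
 fixes g :: "point3 \<Rightarrow> real"
 assumes "continuous_on H3 g" obtains B where "B \<ge> 0" "\<And>x. x \<in> D \<Longrightarrow> \<bar>g x\<bar> \<le> B"
proof -
 obtain B where "B \<ge> 0" "\<And>x. x \<in> hyp_cball base_point c0 \<Longrightarrow> \<bar>g x\<bar> \<le> B"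
  by (rule bounded_on_compact[OF compact_hyp_cball[OF base_point_H3] continuous_on_subset[OF assms hyp_cball_subset]]) blast
 then show thesis using that[of B] D_bounded by blast
qed

lemma dom_integrable:
 fixes g :: "point3 \<Rightarrow> real"
 assumes "continuous_on H3 g"
 shows "integrable dom g"
proof -
 obtain B where "\<And>x. x \<in> D \<Longrightarrow> \<bar>g x\<bar> \<le> B" by (rule bounded_on_D[OF assms]) blast
 then show ?thesis
  by (intro dom.integrable_const_bound[where B = B] AE_I2 measurable_dom continuous_on_measurable_hyp[OF assms]) auto
qed

text \<open>The inner product of square integrable functions on the quotient, evaluated on
  representatives. It is applied to continuous functions, so no completion or equivalence classes
  occur.\<close>

definition ip :: "(point3 \<Rightarrow> real) \<Rightarrow> (point3 \<Rightarrow> real) \<Rightarrow> real" where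
 "ip F H = (\<integral>x. F x * H x \<partial>dom)"

lemma ip_commute: "ip F H = ip H F" by (simp add: ip_def mult.commute)

lemma ip_cong: "(\<And>x. x \<in> H3 \<Longrightarrow> F x = F' x) \<Longrightarrow> (\<And>x. x \<in> H3 \<Longrightarrow> H x = H' x) \<Longrightarrow> ip F H = ip F' H'"
 unfolding ip_def using D_H3 by (intro Bochner_Integration.integral_cong) auto

lemma ip_lincomb_left:
 assumes "continuous_on H3 F" "continuous_on H3 H" "continuous_on H3 K"
 shows "ip (\<lambda>x. a * F x + b * H x) K = a * ip F K + b * ip H K"
proof -
 have "ip (\<lambda>x. a * F x + b * H x) K = (\<integral>x. a * (F x * K x) + b * (H x * K x) \<partial>dom)"
  unfolding ip_def by (simp add: algebra_simps)
 also have "\<dots> = a * ip F K + b * ip H K" unfolding ip_def using assms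
  by (subst Bochner_Integration.integral_add) (auto intro!: dom_integrable continuous_intros)
 finally show ?thesis .
qed

lemma ip_lincomb_right:
 assumes "continuous_on H3 F" "continuous_on H3 H" "continuous_on H3 K"
 shows "ip K (\<lambda>x. a * F x + b * H x) = a * ip K F + b * ip K H"
 using ip_lincomb_left[OF assms] by (simp add: ip_commute)

lemma ip_lincomb_both:
 assumes "continuous_on H3 F" "continuous_on H3 H"
 shows "ip (\<lambda>x. a * F x + b * H x) (\<lambda>x. a * F x + b * H x) = a^2 * ip F F + 2 * a * b * ip F H + b^2 * ip H H"
proof -
 have c: "continuous_on H3 (\<lambda>x. a * F x + b * H x)" using assms by (intro continuous_intros)
 show ?thesis
  by (simp add: ip_lincomb_left[OF assms c] ip_lincomb_right[OF assms assms(1)] ip_lincomb_right[OF assms assms(2)]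
    ip_commute[of H F] power2_eq_square algebra_simps)
qed

lemma ip_nonneg: "ip F F \<ge> 0" unfolding ip_def by (rule integral_nonneg_AE) simp

lemma ip_Cauchy_Schwarz:
 assumes "continuous_on H3 F" "continuous_on H3 H"
 shows "(ip F H)^2 \<le> ip F F * ip H H"
proof (rule nonneg_quadratic)
 fix t :: real
 have "0 \<le> ip (\<lambda>x. 1 * F x + t * H x) (\<lambda>x. 1 * F x + t * H x)" by (rule ip_nonneg)
 also have "\<dots> = ip F F + 2 * t * ip F H + t^2 * ip H H" unfolding ip_lincomb_both[OF assms] by simp
 finally show "0 \<le> ip F F + 2 * t * ip F H + t^2 * ip H H" .
qed

lemma ip_parallelogram:
 assumes "continuous_on H3 F" "continuous_on H3 H"
 shows "ip (\<lambda>x. a * F x + b * H x) (\<lambda>x. a * F x + b * H x) \<le> 2 * a^2 * ip F F + 2 * b^2 * ip H H"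
proof -
 have "0 \<le> ip (\<lambda>x. a * F x + (- b) * H x) (\<lambda>x. a * F x + (- b) * H x)" by (rule ip_nonneg)
 then show ?thesis unfolding ip_lincomb_both[OF assms] by (simp add: algebra_simps)
qed

definition invariant :: "(point3 \<Rightarrow> real) \<Rightarrow> bool" where
 "invariant F \<longleftrightarrow> continuous_on H3 F \<and> (\<forall>A\<in>G. \<forall>x\<in>H3. F (SL2C_act A x) = F x)"

lemma invariant_continuous: "invariant F \<Longrightarrow> continuous_on H3 F" by (simp add: invariant_def)

lemma invariantD: "invariant F \<Longrightarrow> A \<in> G \<Longrightarrow> x \<in> H3 \<Longrightarrow> F (SL2C_act A x) = F x" by (simp add: invariant_def)

lemma invariant_lincomb: "invariant F \<Longrightarrow> invariant H \<Longrightarrow> invariant (\<lambda>x. a * F x + b * H x)"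
 by (auto simp: invariant_def intro!: continuous_intros)

lemma invariant_const: "invariant (\<lambda>x. a)" by (simp add: invariant_def)

text \<open>Vanishing almost everywhere on D spreads by invariance over the countably many
  translates of D, and continuity removes the null set.\<close>

lemma ip_zero_imp_zero:
 assumes F: "invariant F" and 0: "ip F F = 0" and x: "x \<in> H3"
 shows "F x = 0"
proof (rule AE_hyp_imp_zero[OF invariant_continuous[OF F] _ x])
 have i: "integrable dom (\<lambda>x. F x * F x)" by (intro dom_integrable continuous_intros invariant_continuous[OF F])
 have "AE x in dom. F x * F x = 0" using integral_nonneg_eq_0_iff_AE[OF i] 0 by (simp add: ip_def)
 then have ae: "AE x in hyp. x \<in> D \<longrightarrow> F x = 0"
  unfolding dom_def by (subst (asm) AE_restrict_space_iff) (use D_sets D_H3 in \<open>auto simp: Int_absorb2\<close>)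
 then have "AE x in distr hyp hyp (SL2C_act A). x \<in> D \<longrightarrow> F x = 0" if "A \<in> G" for A
  by (subst hyp_isometry_distr_hyp[OF G_isometry[OF that]]) (rule ae)
 then have "AE x in hyp. SL2C_act A x \<in> D \<longrightarrow> F (SL2C_act A x) = 0" if "A \<in> G" for A
  using AE_distrD[OF hyp_isometry_measurable[OF G_isometry[OF that]]] that by blast
 then have "AE x in hyp. \<forall>A\<in>G. SL2C_act A x \<in> D \<longrightarrow> F (SL2C_act A x) = 0"
  using countable_G by (subst AE_ball_countable) auto
 moreover have "AE x in hyp. x \<in> H3" using AE_space[of hyp] by simp
 ultimately show "AE x in hyp. F x = 0"
 proof eventually_elim
  case (elim x)
  then obtain A where "A \<in> G" "SL2C_act A x \<in> D" using D_meets by blast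
  then show ?case using elim invariantD[OF F, of A x] by simp
 qed
qed

section \<open>The top of the spectrum\<close>

text \<open>Let M be the supremum of the Rayleigh quotient and f n a normalized maximizing sequence.
  Semidefiniteness of M - T forces M f n - T (f n) to 0, compactness gives a limit H of T (f n)
  inside W, hence M f n tends to H and T H = M H by boundedness. Asking the limit to lie in W stands
  in for completeness; W stays abstract because the result is applied to all mean-zero functions and
  again to one eigenspace.\<close>

lemma top_eigenvector:
 fixes T :: "(point3 \<Rightarrow> real) \<Rightarrow> point3 \<Rightarrow> real"
 assumes W: "\<And>F. F \<in> W \<Longrightarrow> invariant F" and W_lin: "\<And>F H a b. F \<in> W \<Longrightarrow> H \<in> W \<Longrightarrow> (\<lambda>x. a * F x + b * H x) \<in> W"
  and TW: "\<And>F. F \<in> W \<Longrightarrow> T F \<in> W"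
  and T_lin: "\<And>F H a b x. F \<in> W \<Longrightarrow> H \<in> W \<Longrightarrow> x \<in> H3 \<Longrightarrow> T (\<lambda>x. a * F x + b * H x) x = a * T F x + b * T H x"
  and T_sym: "\<And>F H. F \<in> W \<Longrightarrow> H \<in> W \<Longrightarrow> ip (T F) H = ip F (T H)" and T_bound: "\<And>F. F \<in> W \<Longrightarrow> ip (T F) (T F) \<le> B * ip F F"
  and F0: "F0 \<in> W" "ip (T F0) F0 > 0"
  and T_compact: "\<And>f :: nat \<Rightarrow> point3 \<Rightarrow> real. (\<And>n. f n \<in> W) \<Longrightarrow> (\<And>n. ip (f n) (f n) \<le> 1) \<Longrightarrow>
   \<exists>r H. strict_mono (r :: nat \<Rightarrow> nat) \<and> H \<in> W \<and>
    (\<lambda>n. ip (\<lambda>x. 1 * T (f (r n)) x + (-1) * H x) (\<lambda>x. 1 * T (f (r n)) x + (-1) * H x)) \<longlonglongrightarrow> 0"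
 obtains M F where "M > 0" "F \<in> W" "ip F F > 0" "\<And>x. x \<in> H3 \<Longrightarrow> T F x = M * F x"
proof -
 have Wc: "F \<in> W \<Longrightarrow> continuous_on H3 F" for F using W invariant_continuous by blast
 have scale: "(\<lambda>x. a * F x) \<in> W" if "F \<in> W" for F a using W_lin[OF that that, of a 0] by simp
 have T_scale: "T (\<lambda>x. a * F x) x = a * T F x" if "F \<in> W" "x \<in> H3" for F a x
  using T_lin[OF that(1) that(1) that(2), of a 0] by simp
 have ip_scale: "ip (\<lambda>x. a * F x) (\<lambda>x. b * H x) = a * b * ip F H" for F H a b
  unfolding ip_def by (simp add: mult_ac flip: integral_mult_right_zero)
 have ipT_scale: "ip (T (\<lambda>x. a * F x)) (\<lambda>x. a * F x) = a^2 * ip (T F) F" if "F \<in> W" for F a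
 proof -
  have "ip (T (\<lambda>x. a * F x)) (\<lambda>x. a * F x) = ip (\<lambda>x. a * T F x) (\<lambda>x. a * F x)"
   using T_scale[OF that] by (intro ip_cong) auto
  then show ?thesis by (simp add: ip_scale power2_eq_square)
 qed
 have abs_bound: "\<bar>ip (T F) F\<bar> \<le> (\<bar>B\<bar> + 1) * ip F F" if F: "F \<in> W" for F
 proof -
  have "(ip (T F) F)^2 \<le> ip (T F) (T F) * ip F F" by (rule ip_Cauchy_Schwarz[OF Wc[OF TW[OF F]] Wc[OF F]])
  also have "\<dots> \<le> (B * ip F F) * ip F F" using T_bound[OF F] ip_nonneg by (intro mult_right_mono)
  also have "\<dots> \<le> ((\<bar>B\<bar> + 1) * ip F F)^2"
  proof -
   have "(\<bar>B\<bar> + 1)^2 = B^2 + 2 * \<bar>B\<bar> + 1" by (simp add: power2_sum)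
   then have "B \<le> (\<bar>B\<bar> + 1)^2" using zero_le_power2[of B] abs_ge_self[of B] abs_ge_zero[of B] by linarith
   then have "B * (ip F F)^2 \<le> (\<bar>B\<bar> + 1)^2 * (ip F F)^2" by (rule mult_right_mono) simp
   then show ?thesis by (simp add: power2_eq_square mult_ac)
  qed
  finally have "\<bar>ip (T F) F\<bar>^2 \<le> ((\<bar>B\<bar> + 1) * ip F F)^2" by simp
  then show ?thesis by (rule power2_le_imp_le) (use ip_nonneg in simp)
 qed
 have N0: "ip F0 F0 > 0"
 proof (rule ccontr)
  assume "\<not> ip F0 F0 > 0"
  then have "ip F0 F0 = 0" using ip_nonneg[of F0] by simp
  then show False using abs_bound[OF F0(1)] F0(2) by simp
 qed
 define Q where "Q = {ip (T F) F | F. F \<in> W \<and> ip F F = 1}"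
 have normalize: "ip (T F) F / ip F F \<in> Q" if F: "F \<in> W" "ip F F > 0" for F
 proof -
  define a where "a = 1 / sqrt (ip F F)"
  have a: "a^2 = 1 / ip F F" using F(2) by (simp add: a_def power_divide)
  have "ip (\<lambda>x. a * F x) (\<lambda>x. a * F x) = 1" using F(2) a by (simp add: ip_scale flip: power2_eq_square)
  moreover have "ip (T (\<lambda>x. a * F x)) (\<lambda>x. a * F x) = ip (T F) F / ip F F" using a ipT_scale[OF F(1)] by simp
  ultimately show ?thesis unfolding Q_def using scale[OF F(1), of a] by (intro CollectI exI[of _ "\<lambda>x. a * F x"]) simp
 qed
 have bdd: "bdd_above Q" unfolding Q_def using abs_bound by (intro bdd_aboveI[of _ "\<bar>B\<bar> + 1"]) fastforce
 define M where "M = Sup Q"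
 have M: "M > 0"
 proof -
  have "ip (T F0) F0 / ip F0 F0 \<le> M" unfolding M_def by (rule cSup_upper[OF normalize[OF F0(1) N0] bdd])
  moreover have "ip (T F0) F0 / ip F0 F0 > 0" using F0(2) N0 by simp
  ultimately show ?thesis by linarith
 qed
 have le_M: "ip (T F) F \<le> M * ip F F" if F: "F \<in> W" for F
 proof (cases "ip F F = 0")
  case True
  then show ?thesis using abs_bound[OF F] by simp
 next
  case False
  then have "ip F F > 0" using ip_nonneg[of F] by simp
  moreover have "ip (T F) F / ip F F \<le> M" unfolding M_def by (rule cSup_upper[OF normalize[OF F \<open>ip F F > 0\<close>] bdd])
  ultimately show ?thesis by (simp add: divide_le_eq)
 qed
 have "\<exists>F. F \<in> W \<and> ip F F = 1 \<and> ip (T F) F > M - 1 / real (Suc n)" for n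
 proof -
  have "\<exists>q\<in>Q. M - 1 / real (Suc n) < q" unfolding M_def by (rule less_cSupD) (use normalize[OF F0(1) N0] in auto)
  then show ?thesis unfolding Q_def by blast
 qed
 then obtain f where f: "\<And>n. f n \<in> W" "\<And>n. ip (f n) (f n) = 1" "\<And>n. ip (T (f n)) (f n) > M - 1 / real (Suc n)" by metis
 define E where "E n x = M * f n x + (-1) * T (f n) x" for n x
 have EW: "E n \<in> W" for n unfolding E_def using W_lin[OF f(1) TW[OF f(1)]] .
 define C where "C = M + (\<bar>B\<bar> + 1)"
 have C: "C > 0" using M by (simp add: C_def)
 have E_small: "ip (E n) (E n) \<le> C / real (Suc n)" for n
 proof -
  define a where "a F H = M * ip F H - ip (T F) H" for F H
  have a_nonneg: "a F F \<ge> 0" if "F \<in> W" for F using le_M[OF that] by (simp add: a_def)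
  have "(a (f n) (E n))^2 \<le> a (f n) (f n) * a (E n) (E n)"
  proof (rule nonneg_quadratic)
   fix t :: real
   let ?F = "\<lambda>x. 1 * f n x + t * E n x"
   have FW: "?F \<in> W" by (rule W_lin[OF f(1) EW])
   have "ip (T ?F) ?F = ip (\<lambda>x. 1 * T (f n) x + t * T (E n) x) ?F" by (rule ip_cong[OF T_lin[OF f(1) EW] refl])
   also have "\<dots> = ip (T (f n)) (f n) + t * ip (T (f n)) (E n) + t * ip (T (E n)) (f n) + t^2 * ip (T (E n)) (E n)"
    unfolding ip_lincomb_left[OF Wc[OF TW[OF f(1)]] Wc[OF TW[OF EW]] Wc[OF FW]]
     ip_lincomb_right[OF Wc[OF f(1)] Wc[OF EW] Wc[OF TW[OF f(1)]]] ip_lincomb_right[OF Wc[OF f(1)] Wc[OF EW] Wc[OF TW[OF EW]]]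
    by (simp add: power2_eq_square algebra_simps)
   also have "ip (T (E n)) (f n) = ip (T (f n)) (E n)" using T_sym[OF EW f(1)] by (simp add: ip_commute)
   finally have "ip (T ?F) ?F = ip (T (f n)) (f n) + 2 * t * ip (T (f n)) (E n) + t^2 * ip (T (E n)) (E n)" by simp
   moreover have "ip ?F ?F = ip (f n) (f n) + 2 * t * ip (f n) (E n) + t^2 * ip (E n) (E n)"
    unfolding ip_lincomb_both[OF Wc[OF f(1)] Wc[OF EW]] by simp
   ultimately have "a ?F ?F = a (f n) (f n) + 2 * t * a (f n) (E n) + t^2 * a (E n) (E n)"
    by (simp add: a_def algebra_simps)
   then show "0 \<le> a (f n) (f n) + 2 * t * a (f n) (E n) + t^2 * a (E n) (E n)" using a_nonneg[OF FW] by simp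
  qed
  moreover have "a (f n) (E n) = ip (E n) (E n)"
  proof -
   have "ip (E n) (E n) = ip (\<lambda>x. M * f n x + (-1) * T (f n) x) (E n)" by (simp add: E_def[abs_def])
   also have "\<dots> = M * ip (f n) (E n) + (-1) * ip (T (f n)) (E n)"
    by (rule ip_lincomb_left[OF Wc[OF f(1)] Wc[OF TW[OF f(1)]] Wc[OF EW]])
   finally show ?thesis by (simp add: a_def)
  qed
  ultimately have "ip (E n) (E n) * ip (E n) (E n) \<le> a (f n) (f n) * a (E n) (E n)" by (simp add: power2_eq_square)
  also have "\<dots> \<le> (1 / real (Suc n)) * (C * ip (E n) (E n))"
  proof (rule mult_mono)
   show "a (f n) (f n) \<le> 1 / real (Suc n)" using f(2,3)[of n] by (simp add: a_def)
   show "a (E n) (E n) \<le> C * ip (E n) (E n)" using abs_bound[OF EW[of n]] by (simp add: a_def C_def algebra_simps)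
  qed (use a_nonneg EW in auto)
  finally have *: "ip (E n) (E n) * ip (E n) (E n) \<le> (C / real (Suc n)) * ip (E n) (E n)" by simp
  show ?thesis
  proof (cases "ip (E n) (E n) = 0")
   case False
   then have "ip (E n) (E n) > 0" using ip_nonneg[of "E n"] by simp
   then show ?thesis using * by (metis mult_right_le_imp_le)
  qed (use C in simp)
 qed
 from T_compact[of f, OF f(1) eq_refl[OF f(2)]]
 obtain r H where r: "strict_mono (r :: nat \<Rightarrow> nat)" and H: "H \<in> W"
  and lim: "(\<lambda>n. ip (\<lambda>x. 1 * T (f (r n)) x + (-1) * H x) (\<lambda>x. 1 * T (f (r n)) x + (-1) * H x)) \<longlonglongrightarrow> 0"
  by (elim exE conjE) (rule that)
 define d where "d n x = 1 * T (f (r n)) x + (-1) * H x" for n x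
 have dW: "d n \<in> W" for n unfolding d_def by (rule W_lin[OF TW[OF f(1)] H])
 have d_lim: "(\<lambda>n. ip (d n) (d n)) \<longlonglongrightarrow> 0" using lim by (simp only: d_def[abs_def])
 have E_lim: "(\<lambda>n. ip (E (r n)) (E (r n))) \<longlonglongrightarrow> 0"
 proof (rule real_tendsto_sandwich[OF _ _ tendsto_const])
  have "(\<lambda>n. C / real (Suc n)) \<longlonglongrightarrow> 0" using LIMSEQ_Suc[OF lim_const_over_n[of C]] .
  then show "(\<lambda>n. C / real (Suc (r n))) \<longlonglongrightarrow> 0" using LIMSEQ_subseq_LIMSEQ[OF _ r] by (auto simp: o_def)
 qed (use E_small ip_nonneg in auto)
 define u where "u n x = 1 * E (r n) x + 1 * d n x" for n x
 have uW: "u n \<in> W" for n unfolding u_def by (rule W_lin[OF EW dW])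
 have u_eq: "u n x = M * f (r n) x + (-1) * H x" for n x by (simp add: u_def E_def d_def)
 have u_lim: "(\<lambda>n. ip (u n) (u n)) \<longlonglongrightarrow> 0"
 proof (rule real_tendsto_sandwich[OF _ _ tendsto_const])
  have "(\<lambda>n. 2 * 1^2 * ip (E (r n)) (E (r n)) + 2 * 1^2 * ip (d n) (d n)) \<longlonglongrightarrow> 2 * 1^2 * 0 + 2 * 1^2 * 0"
   by (intro tendsto_intros E_lim d_lim)
  then show "(\<lambda>n. 2 * 1^2 * ip (E (r n)) (E (r n)) + 2 * 1^2 * ip (d n) (d n)) \<longlonglongrightarrow> 0" by simp
  show "\<forall>\<^sub>F n in sequentially. ip (u n) (u n) \<le> 2 * 1^2 * ip (E (r n)) (E (r n)) + 2 * 1^2 * ip (d n) (d n)"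
   unfolding u_def[abs_def] by (intro always_eventually allI ip_parallelogram[OF Wc[OF EW] Wc[OF dW]])
 qed (use ip_nonneg in auto)
 define g where "g x = M * H x + (-1) * T H x" for x
 have gW: "g \<in> W" unfolding g_def[abs_def] by (rule W_lin[OF H TW[OF H]])
 have g_eq: "g x = (- M) * d n x + 1 * T (u n) x" if "x \<in> H3" for n x
 proof -
  have "T (u n) x = M * T (f (r n)) x + (-1) * T H x" unfolding u_eq[abs_def] by (rule T_lin[OF f(1) H that])
  then show ?thesis by (simp add: g_def d_def algebra_simps)
 qed
 have "ip g g \<le> 2 * (- M)^2 * ip (d n) (d n) + 2 * 1^2 * (B * ip (u n) (u n))" for n
 proof -
  have "ip g g = ip (\<lambda>x. (- M) * d n x + 1 * T (u n) x) (\<lambda>x. (- M) * d n x + 1 * T (u n) x)" by (intro ip_cong g_eq)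
  also have "\<dots> \<le> 2 * (- M)^2 * ip (d n) (d n) + 2 * 1^2 * ip (T (u n)) (T (u n))"
   by (rule ip_parallelogram[OF Wc[OF dW] Wc[OF TW[OF uW]]])
  finally show ?thesis using T_bound[OF uW[of n]] by simp
 qed
 moreover have "(\<lambda>n. 2 * (- M)^2 * ip (d n) (d n) + 2 * 1^2 * (B * ip (u n) (u n))) \<longlonglongrightarrow> 2 * (- M)^2 * 0 + 2 * 1^2 * (B * 0)"
  by (intro tendsto_intros d_lim u_lim)
 ultimately have "ip g g \<le> 2 * (- M)^2 * 0 + 2 * 1^2 * (B * 0)" by (intro LIMSEQ_le_const) auto
 then have "ip g g = 0" using ip_nonneg[of g] by simp
 then have TH: "T H x = M * H x" if "x \<in> H3" for x using ip_zero_imp_zero[OF W[OF gW] _ that] by (simp add: g_def)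
 \<comment> \<open>M f is u + H with f normalized and u tending to 0, so H cannot be zero.\<close>
 have "M^2 \<le> 2 * 1^2 * ip (u n) (u n) + 2 * 1^2 * ip H H" for n
 proof -
  have "M^2 = ip (\<lambda>x. M * f (r n) x) (\<lambda>x. M * f (r n) x)" by (simp add: ip_scale f(2) power2_eq_square)
  also have "\<dots> = ip (\<lambda>x. 1 * u n x + 1 * H x) (\<lambda>x. 1 * u n x + 1 * H x)" by (simp add: u_eq)
  also have "\<dots> \<le> 2 * 1^2 * ip (u n) (u n) + 2 * 1^2 * ip H H" by (rule ip_parallelogram[OF Wc[OF uW] Wc[OF H]])
  finally show ?thesis .
 qed
 moreover have "(\<lambda>n. 2 * 1^2 * ip (u n) (u n) + 2 * 1^2 * ip H H) \<longlonglongrightarrow> 2 * 1^2 * 0 + 2 * 1^2 * ip H H"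
  by (intro tendsto_intros u_lim)
 ultimately have "M^2 \<le> 2 * 1^2 * 0 + 2 * 1^2 * ip H H" by (intro LIMSEQ_le_const) auto
 then have "M^2 \<le> 2 * ip H H" by simp
 moreover have "M^2 > 0" using M by (rule zero_less_power)
 ultimately have "ip H H > 0" by linarith
 then show thesis using that[OF M H _ TH] by blast
qed

end

section \<open>Radial integral operators on invariant functions\<close>

definition profile_fun :: "real \<Rightarrow> (real \<Rightarrow> real) \<Rightarrow> bool" where
 "profile_fun c k \<longleftrightarrow> continuous_on UNIV k \<and> (\<forall>u>c. k u = 0)"

lemma profile_funD: "profile_fun c k \<Longrightarrow> continuous_on UNIV k" "profile_fun c k \<Longrightarrow> u > c \<Longrightarrow> k u = 0"
 by (auto simp: profile_fun_def)

lemma profile_fun_kernel: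
 assumes "profile_fun c k"
 shows "continuous_on (H3 \<times> H3) (\<lambda>(x, y). radial k x y)" "kernel_within c (radial k)"
 using assms by (auto intro!: continuous_radial kernel_within_radial simp: profile_fun_def)

lemma radial_op_continuous:
 "profile_fun c k \<Longrightarrow> continuous_on H3 F \<Longrightarrow> continuous_on H3 (radial_op k F)"
 using continuous_kernel_op profile_fun_kernel by blast

lemma radial_op_integrable:
 "profile_fun c k \<Longrightarrow> continuous_on H3 F \<Longrightarrow> x \<in> H3 \<Longrightarrow> integrable hyp (\<lambda>y. radial k x y * F y)"
 using kernel_integrable profile_fun_kernel by blast

lemma radial_op_lincomb:
 assumes "profile_fun c k" "continuous_on H3 F" "continuous_on H3 H" "x \<in> H3"
 shows "radial_op k (\<lambda>x. a * F x + b * H x) x = a * radial_op k F x + b * radial_op k H x"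
proof -
 have "radial_op k (\<lambda>x. a * F x + b * H x) x =
   (\<integral>y. a * (radial k x y * F y) + b * (radial k x y * H y) \<partial>hyp)"
  unfolding kernel_op_def by (simp add: algebra_simps)
 then show ?thesis using radial_op_integrable[OF assms(1,2,4)] radial_op_integrable[OF assms(1,3,4)]
  by (simp add: kernel_op_def)
qed

lemma kernel_op_cong: "(\<And>y. y \<in> H3 \<Longrightarrow> F y = H y) \<Longrightarrow> kernel_op Q F x = kernel_op Q H x"
 unfolding kernel_op_def by (intro Bochner_Integration.integral_cong) auto

lemma radial_op_bound:
 assumes k: "profile_fun c k" and F: "continuous_on H3 F" and x: "x \<in> H3"
  and e: "\<And>y. y \<in> H3 \<Longrightarrow> cosh_dist x y \<le> c \<Longrightarrow> \<bar>F y\<bar> \<le> e"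
 shows "\<bar>radial_op k F x\<bar> \<le> e * radial_op (\<lambda>u. \<bar>k u\<bar>) (\<lambda>_. 1) x"
proof -
 have ka: "profile_fun c (\<lambda>u. \<bar>k u\<bar>)" using k by (auto simp: profile_fun_def intro!: continuous_intros)
 have "\<bar>radial_op k F x\<bar> \<le> (\<integral>y. \<bar>radial k x y * F y\<bar> \<partial>hyp)" unfolding kernel_op_def by (rule integral_abs_bound)
 also have "\<dots> \<le> (\<integral>y. e * (radial (\<lambda>u. \<bar>k u\<bar>) x y * 1) \<partial>hyp)"
 proof (rule integral_mono)
  fix y assume y: "y \<in> space hyp"
  show "\<bar>radial k x y * F y\<bar> \<le> e * (radial (\<lambda>u. \<bar>k u\<bar>) x y * 1)"
  proof (cases "cosh_dist x y \<le> c")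
   case True
   then have "\<bar>radial k x y\<bar> * \<bar>F y\<bar> \<le> \<bar>radial k x y\<bar> * e" using e[of y] y by (intro mult_left_mono) auto
   then show ?thesis by (simp add: abs_mult radial_def mult.commute)
  next
   case False
   then show ?thesis using profile_funD(2)[OF k, of "cosh_dist x y"] by (simp add: radial_def)
  qed
 qed (use radial_op_integrable[OF k F x] radial_op_integrable[OF ka continuous_on_const x, of 1] in \<open>auto intro!: integrable_abs\<close>)
 finally show ?thesis by (simp add: kernel_op_def)
qed

lemma sigma_finite_hyp: "sigma_finite_measure hyp"
proof
 show "\<exists>A. countable A \<and> A \<subseteq> sets hyp \<and> \<Union> A = space hyp \<and> (\<forall>a\<in>A. emeasure hyp a \<noteq> \<infinity>)"
 proof (intro exI[of _ "range H3_exhaust"] conjI ballI)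
  show "range H3_exhaust \<subseteq> sets hyp" using H3_exhaust_subset by (auto simp: sets_hyp)
  show "\<Union> (range H3_exhaust) = space hyp" by (simp add: UN_H3_exhaust)
  fix a assume "a \<in> range H3_exhaust"
  then obtain n where "a = H3_exhaust n" by blast
  then show "emeasure hyp a \<noteq> \<infinity>" using emeasure_H3_exhaust[of n] by (simp add: emeasure_hyp H3_exhaust_subset)
 qed simp
qed

lemma id_measurable_hyp [measurable]: "(\<lambda>x. x) \<in> measurable hyp borel"
 unfolding hyp_def by (rule measurable_restrict_space1) simp

lemma cosh_dist_measurable_pair:
 assumes f: "f \<in> measurable M hyp" and g: "g \<in> measurable M hyp"
 shows "(\<lambda>p. cosh_dist (f p) (g p)) \<in> borel_measurable M"
proof -
 have f': "f \<in> borel_measurable M" and g': "g \<in> borel_measurable M"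
  using measurable_compose[OF f id_measurable_hyp] measurable_compose[OF g id_measurable_hyp] by simp_all
 have [measurable]: "(\<lambda>p. fst (f p)) \<in> borel_measurable M" "(\<lambda>p. snd (f p)) \<in> borel_measurable M"
  "(\<lambda>p. fst (g p)) \<in> borel_measurable M" "(\<lambda>p. snd (g p)) \<in> borel_measurable M"
  using measurable_compose[OF f' fst_point3_measurable] measurable_compose[OF f' snd_point3_measurable]
   measurable_compose[OF g' fst_point3_measurable] measurable_compose[OF g' snd_point3_measurable] by simp_all
 show ?thesis unfolding cosh_dist_def by measurable
qed

text \<open>Two points can be swapped by an isometry, so convolutions of radial kernels are symmetric and
 the operators commute.\<close>

lemma radial_convolution_commute:
 assumes k: "profile_fun c k" and l: "profile_fun c' l" and x: "x \<in> H3" and z: "z \<in> H3"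
 shows "(\<integral>y. radial k x y * radial l y z \<partial>hyp) = (\<integral>y. radial l x y * radial k y z \<partial>hyp)"
proof -
 obtain f where f: "hyp_isometry f" "f x = z" "f z = x" by (rule swap_isometry[OF x z]) blast
 let ?g = "\<lambda>y. radial k x y * radial l y z"
 have "continuous_on H3 (\<lambda>y. radial k x y)" "continuous_on H3 (\<lambda>y. radial l z y)"
  using continuous_kernel_right[OF profile_fun_kernel(1)[OF k] x] continuous_kernel_right[OF profile_fun_kernel(1)[OF l] z] by simp_all
 then have "?g \<in> borel_measurable hyp"
  by (intro continuous_on_measurable_hyp continuous_intros) (simp_all add: radial_commute[of l _ z])
 then have "(\<integral>y. ?g (f y) \<partial>hyp) = (\<integral>y. ?g y \<partial>hyp)" by (rule hyp_isometry_integral[OF f(1)])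
 moreover have "?g (f y) = radial l x y * radial k y z" if "y \<in> H3" for y
 proof -
  have "cosh_dist (f z) (f y) = cosh_dist z y" "cosh_dist (f y) (f x) = cosh_dist y x"
   using hyp_isometryD(5)[OF f(1)] that x z by auto
  then show ?thesis by (simp add: f radial_def cosh_dist_commute mult.commute)
 qed
 then have "(\<integral>y. ?g (f y) \<partial>hyp) = (\<integral>y. radial l x y * radial k y z \<partial>hyp)"
  by (intro Bochner_Integration.integral_cong) auto
 ultimately show ?thesis by simp
qed

text \<open>Fubini applies because k confines y to a ball around x and l then confines z to a larger
  one, so the double integrand is bounded with compact support.\<close>

lemma radial_op_compose:
 assumes k: "profile_fun c k" and l: "profile_fun c' l" and F: "continuous_on H3 F" and x: "x \<in> H3"
 shows "radial_op k (radial_op l F) x = (\<integral>z. (\<integral>y. radial k x y * radial l y z \<partial>hyp) * F z \<partial>hyp)"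
proof -
 interpret sigma_finite_measure hyp by (rule sigma_finite_hyp)
 interpret pair_sigma_finite hyp hyp ..
 define K where "K = hyp_cball x c"
 define K' where "K' = hyp_cball x (2 * c * c')"
 have K: "compact K" "K \<subseteq> H3" and K': "compact K'" "K' \<subseteq> H3"
  by (auto simp: K_def K'_def compact_hyp_cball x hyp_cball_subset)
 have inK: "y \<in> K" if "y \<in> H3" "radial k x y \<noteq> 0" for y
  using that profile_funD(2)[OF k, of "cosh_dist x y"] by (force simp: K_def hyp_cball_def radial_def)
 have inK': "z \<in> K'" if "y \<in> K" "z \<in> H3" "radial l y z \<noteq> 0" for y z
 proof -
  have "y \<in> H3" using that K by blast
  have "z \<in> hyp_cball y c'" using that profile_funD(2)[OF l, of "cosh_dist y z"] by (force simp: hyp_cball_def radial_def)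
  then show ?thesis unfolding K'_def using hyp_cball_subset_cball[OF \<open>y \<in> H3\<close> _ _ x, of z c' c] that(1) by (simp add: K_def)
 qed
 obtain B1 where B1: "B1 \<ge> 0" "\<And>y. y \<in> K \<Longrightarrow> \<bar>radial k x y\<bar> \<le> B1"
  by (rule bounded_on_compact[OF K(1) continuous_on_subset[OF continuous_kernel_right[OF profile_fun_kernel(1)[OF k] x] K(2)]]) blast
 have "continuous_on (K \<times> K') (\<lambda>p. radial l (fst p) (snd p) * F (snd p))"
  by (intro continuous_intros continuous_on_subset[OF profile_fun_kernel(1)[OF l, unfolded case_prod_unfold]]
    continuous_on_compose2[OF F]) (use K K' in auto)
 then obtain B2 where B2: "B2 \<ge> 0" "\<And>p. p \<in> K \<times> K' \<Longrightarrow> \<bar>radial l (fst p) (snd p) * F (snd p)\<bar> \<le> B2"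
  by (rule bounded_on_compact[OF compact_Times[OF K(1) K'(1)]]) blast
 let ?f = "\<lambda>(y, z). radial k x y * (radial l y z * F z)"
 have mF: "F \<in> borel_measurable hyp" by (rule continuous_on_measurable_hyp[OF F])
 have kb: "k \<in> borel_measurable borel" "l \<in> borel_measurable borel"
  using profile_funD(1)[OF k] profile_funD(1)[OF l] borel_measurable_continuous_onI by auto
 have meas: "?f \<in> borel_measurable (hyp \<Otimes>\<^sub>M hyp)"
 proof -
  have "(\<lambda>p. radial k x (fst p)) \<in> borel_measurable (hyp \<Otimes>\<^sub>M hyp)" "(\<lambda>p. radial l (fst p) (snd p)) \<in> borel_measurable (hyp \<Otimes>\<^sub>M hyp)"
   unfolding radial_def using x
   by (intro measurable_compose[OF cosh_dist_measurable_pair kb(1)] measurable_compose[OF cosh_dist_measurable_pair kb(2)]; simp)+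
  moreover have "(\<lambda>p. F (snd p)) \<in> borel_measurable (hyp \<Otimes>\<^sub>M hyp)" by (rule measurable_compose[OF measurable_snd mF])
  ultimately show ?thesis by (simp add: case_prod_unfold)
 qed
 have fin: "emeasure (hyp \<Otimes>\<^sub>M hyp) (K \<times> K') < \<infinity>"
 proof -
  have "emeasure (hyp \<Otimes>\<^sub>M hyp) (K \<times> K') = emeasure hyp K * emeasure hyp K'"
   using K K' by (subst sigma_finite_measure.emeasure_pair_measure_Times[OF sigma_finite_hyp]) (auto simp: compact_sets_hyp)
  then show ?thesis using emeasure_compact_finite[OF K] emeasure_compact_finite[OF K'] K K'
   by (simp add: emeasure_hyp ennreal_mult_less_top)
 qed
 have int: "integrable (hyp \<Otimes>\<^sub>M hyp) ?f"
 proof (rule Bochner_Integration.integrable_bound[OF _ meas])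
  show "integrable (hyp \<Otimes>\<^sub>M hyp) (\<lambda>p. (B1 * B2) * indicator (K \<times> K') p)"
   using fin K K' by (intro integrable_mult_right integrable_real_indicator) (auto simp: compact_sets_hyp)
  show "AE p in hyp \<Otimes>\<^sub>M hyp. norm (?f p) \<le> norm ((B1 * B2) * indicator (K \<times> K') p)"
  proof (rule AE_I2)
   fix p assume "p \<in> space (hyp \<Otimes>\<^sub>M hyp)"
   then obtain y z where p: "p = (y, z)" "y \<in> H3" "z \<in> H3" by (auto simp: space_pair_measure)
   show "norm (?f p) \<le> norm ((B1 * B2) * indicator (K \<times> K') p)"
   proof (cases "?f p = 0")
    case False
    then have "y \<in> K" "z \<in> K'" using inK[OF p(2)] inK'[of y z] p by auto
    then have "\<bar>radial k x y\<bar> * \<bar>radial l y z * F z\<bar> \<le> B1 * B2" using B1 B2(2)[of "(y, z)"] by (intro mult_mono) auto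
    then show ?thesis using \<open>y \<in> K\<close> \<open>z \<in> K'\<close> B1(1) B2(1) by (simp add: p abs_mult)
   qed simp
  qed
 qed
 have "radial_op k (radial_op l F) x = (\<integral>y. (\<integral>z. radial k x y * (radial l y z * F z) \<partial>hyp) \<partial>hyp)"
  by (simp add: kernel_op_def)
 also have "\<dots> = (\<integral>z. (\<integral>y. radial k x y * (radial l y z * F z) \<partial>hyp) \<partial>hyp)"
  by (rule Fubini_integral[symmetric]) (use int in \<open>simp add: case_prod_unfold\<close>)
 also have "\<dots> = (\<integral>z. (\<integral>y. radial k x y * radial l y z \<partial>hyp) * F z \<partial>hyp)" by (simp add: mult.assoc[symmetric])
 finally show ?thesis .
qed

lemma radial_op_commute:
 assumes k: "profile_fun c k" and l: "profile_fun c' l" and F: "continuous_on H3 F" and x: "x \<in> H3"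
 shows "radial_op k (radial_op l F) x = radial_op l (radial_op k F) x"
 unfolding radial_op_compose[OF k l F x] radial_op_compose[OF l k F x]
 using radial_convolution_commute[OF k l x] by (intro Bochner_Integration.integral_cong) auto

context fundamental_domain
begin

lemma radial_op_invariant:
 assumes k: "profile_fun c k" and F: "invariant F"
 shows "invariant (radial_op k F)" unfolding invariant_def
proof (intro conjI ballI)
 show "continuous_on H3 (radial_op k F)" by (rule radial_op_continuous[OF k invariant_continuous[OF F]])
 fix A x assume A: "A \<in> G" and x: "x \<in> H3"
 let ?g = "\<lambda>y. radial k (SL2C_act A x) y * F y"
 have "(\<integral>y. ?g (SL2C_act A y) \<partial>hyp) = (\<integral>y. ?g y \<partial>hyp)"
  by (rule hyp_isometry_integral[OF G_isometry[OF A] borel_measurable_integrable[OF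
    radial_op_integrable[OF k invariant_continuous[OF F] G_act_H3[OF A x]]]])
 moreover have "(\<integral>y. ?g (SL2C_act A y) \<partial>hyp) = (\<integral>y. radial k x y * F y \<partial>hyp)"
  by (intro Bochner_Integration.integral_cong) (auto simp: radial_def G_cosh_dist[OF A x] invariantD[OF F A])
 ultimately show "radial_op k F (SL2C_act A x) = radial_op k F x" by (simp add: kernel_op_def)
qed

text \<open>The automorphic kernel of k, cut down to a finite sum; it is the right kernel only for
  points confined in terms of R. The factor 1/2 compensates for the two signs of each
  matrix.\<close>

definition auto_kernel :: "real \<Rightarrow> (real \<Rightarrow> real) \<Rightarrow> point3 \<Rightarrow> point3 \<Rightarrow> real" where
 "auto_kernel R k x y = (1/2) * (\<Sum>A\<in>hits R. radial k x (SL2C_act A y))"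

lemma auto_kernel_commute:
 assumes "x \<in> H3" "y \<in> H3"
 shows "auto_kernel R k x y = auto_kernel R k y x"
proof -
 have "(\<Sum>A\<in>hits R. radial k x (SL2C_act A y)) = (\<Sum>A\<in>hits R. radial k y (SL2C_act (ginv A) x))"
  using assms hits_subset by (intro sum.cong refl) (auto simp: radial_def G_cosh_dist_ginv cosh_dist_commute[of y] subset_iff)
 also have "\<dots> = (\<Sum>A\<in>hits R. radial k y (SL2C_act A x))" by (rule sum.reindex_bij_betw[OF bij_ginv_hits])
 finally show ?thesis by (simp add: auto_kernel_def)
qed

lemma G_act_continuous: "A \<in> G \<Longrightarrow> continuous_on H3 (SL2C_act A)"
 by (intro continuous_at_imp_continuous_on ballI differentiable_imp_continuous_within hyp_isometryD(3)[OF G_isometry])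

lemma auto_kernel_continuous:
 assumes k: "profile_fun c k"
 shows "continuous_on (H3 \<times> H3) (\<lambda>p. auto_kernel R k (fst p) (snd p))"
proof -
 have "continuous_on (H3 \<times> H3) (\<lambda>p. radial k (fst p) (SL2C_act A (snd p)))" if "A \<in> G" for A unfolding radial_def
  by (rule continuous_on_compose2[OF profile_funD(1)[OF k]])
   (use that in \<open>auto intro!: continuous_intros continuous_on_compose2[OF G_act_continuous[OF that]] G_act_H3\<close>)
 then show ?thesis unfolding auto_kernel_def using hits_subset by (intro continuous_intros) auto
qed

text \<open>Unfolding of the integral over hyperbolic space onto D. One lower bound on R places D in
  the ball of \<open>hits\<close>, the other places there the support of the kernel around
  x.\<close>

lemma radial_op_auto_kernel:
 assumes k: "profile_fun c k" and F: "invariant F" and x: "x \<in> hyp_cball base_point r" and R: "R \<ge> c0" "R \<ge> 2 * r * c"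
 shows "radial_op k F x = (\<integral>y. auto_kernel R k x y * F y \<partial>dom)"
proof -
 have xH: "x \<in> H3" using x hyp_cball_subset by blast
 have Fc: "continuous_on H3 F" by (rule invariant_continuous[OF F])
 let ?g = "\<lambda>y. radial k x y * F y"
 have gi: "integrable hyp ?g" by (rule radial_op_integrable[OF k Fc xH])
 have Gm: "SL2C_act A \<in> measurable hyp hyp" if "A \<in> G" for A by (rule hyp_isometry_measurable[OF G_isometry[OF that]])
 have unf: "AE y in hyp. 2 * ?g y = (\<Sum>A\<in>hits R. indicator D (SL2C_act A y) * ?g y)"
 proof (rule AE_unfold[OF finite_hits hits_subset])
  fix y A assume y: "y \<in> H3" and "?g y \<noteq> 0" and A: "A \<in> G" "SL2C_act A y \<in> D"
  then have "y \<in> hyp_cball x c" using profile_funD(2)[OF k, of "cosh_dist x y"] by (force simp: hyp_cball_def radial_def)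
  then have "y \<in> hyp_cball base_point (2 * r * c)" by (rule hyp_cball_subset_cball[OF xH _ x base_point_H3])
  then have "y \<in> hyp_cball base_point R" using R by (auto simp: hyp_cball_def)
  moreover have "SL2C_act A y \<in> hyp_cball base_point R" using D_bounded A(2) R by (auto simp: hyp_cball_def)
  ultimately show "A \<in> hits R" using A(1) by (auto simp: hits_def)
 qed
 have ind_i: "integrable hyp (\<lambda>y. indicator D (SL2C_act A y) * ?g y)" if A: "A \<in> G" for A
 proof (rule Bochner_Integration.integrable_bound[OF gi])
  have "(\<lambda>y. indicator D (SL2C_act A y) :: real) \<in> borel_measurable hyp"
   using measurable_compose[OF Gm[OF A] borel_measurable_indicator[OF D_sets]] by simp
  then show "(\<lambda>y. indicator D (SL2C_act A y) * ?g y) \<in> borel_measurable hyp"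
   using borel_measurable_integrable[OF gi] by (rule borel_measurable_times)
  show "AE y in hyp. norm (indicator D (SL2C_act A y) * ?g y) \<le> norm (?g y)"
   by (intro AE_I2) (simp add: indicator_def abs_mult)
 qed
 have "2 * radial_op k F x = (\<integral>y. 2 * ?g y \<partial>hyp)" by (simp add: kernel_op_def)
 also have "\<dots> = (\<integral>y. (\<Sum>A\<in>hits R. indicator D (SL2C_act A y) * ?g y) \<partial>hyp)" by (rule integral_cong_AE[OF _ _ unf])
   (use borel_measurable_integrable[OF gi] borel_measurable_integrable[OF ind_i] hits_subset in \<open>auto intro!: borel_measurable_sum\<close>)
 also have "\<dots> = (\<Sum>A\<in>hits R. \<integral>y. indicator D (SL2C_act A y) * ?g y \<partial>hyp)"
  by (rule Bochner_Integration.integral_sum) (use ind_i hits_subset in blast)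
 also have "\<dots> = (\<Sum>A\<in>hits R. \<integral>y. indicator D y * (radial k x (SL2C_act (ginv A) y) * F y) \<partial>hyp)"
 proof (rule sum.cong[OF refl])
  fix A assume "A \<in> hits R"
  then have A: "A \<in> G" using hits_subset by blast
  let ?h = "\<lambda>y. indicator D y * (radial k x (SL2C_act (ginv A) y) * F y)"
  have "?h \<in> borel_measurable hyp"
  proof -
   have "continuous_on H3 (\<lambda>y. radial k x (SL2C_act (ginv A) y))"
    by (rule continuous_on_compose2[OF continuous_kernel_right[OF profile_fun_kernel(1)[OF k] xH] G_act_continuous[OF ginv(1)[OF A]]])
     (use G_act_H3[OF ginv(1)[OF A]] in auto)
   then show ?thesis using D_sets Fc by (intro borel_measurable_times borel_measurable_indicator continuous_on_measurable_hyp)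
  qed
  then have "(\<integral>y. ?h (SL2C_act A y) \<partial>hyp) = (\<integral>y. ?h y \<partial>hyp)" by (rule hyp_isometry_integral[OF G_isometry[OF A]])
  moreover have "(\<integral>y. ?h (SL2C_act A y) \<partial>hyp) = (\<integral>y. indicator D (SL2C_act A y) * ?g y \<partial>hyp)"
   by (intro Bochner_Integration.integral_cong) (auto simp: G_act_ginv(1)[OF A] invariantD[OF F A])
  ultimately show "(\<integral>y. indicator D (SL2C_act A y) * ?g y \<partial>hyp) = (\<integral>y. ?h y \<partial>hyp)" by simp
 qed
 also have "\<dots> = (\<Sum>A\<in>hits R. \<integral>y. radial k x (SL2C_act (ginv A) y) * F y \<partial>dom)" by (simp add: dom_integral)
 also have "\<dots> = (\<Sum>A\<in>hits R. \<integral>y. radial k x (SL2C_act A y) * F y \<partial>dom)" by (rule sum.reindex_bij_betw[OF bij_ginv_hits])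
 also have "\<dots> = (\<integral>y. (\<Sum>A\<in>hits R. radial k x (SL2C_act A y) * F y) \<partial>dom)"
 proof (rule Bochner_Integration.integral_sum[symmetric])
  fix A assume "A \<in> hits R"
  then have A: "A \<in> G" using hits_subset by blast
  have "continuous_on H3 (\<lambda>y. radial k x (SL2C_act A y))"
   by (rule continuous_on_compose2[OF continuous_kernel_right[OF profile_fun_kernel(1)[OF k] xH] G_act_continuous[OF A]])
    (use G_act_H3[OF A] in auto)
  then show "integrable dom (\<lambda>y. radial k x (SL2C_act A y) * F y)" by (intro dom_integrable continuous_intros Fc)
 qed
 also have "\<dots> = 2 * (\<integral>y. auto_kernel R k x y * F y \<partial>dom)" by (simp add: auto_kernel_def sum_distrib_right mult.assoc)
 finally show ?thesis by simp
qed

text \<open>Fubini on the square of D, where the automorphic kernel is bounded and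
  symmetric.\<close>

lemma radial_op_symmetric:
 assumes k: "profile_fun c k" and F: "invariant F" and H: "invariant H"
 shows "ip (radial_op k F) H = ip F (radial_op k H)"
proof -
 interpret pair_sigma_finite dom dom by (intro pair_sigma_finite.intro) (unfold_locales)
 define R where "R = max c0 (2 * c0 * c)"
 have R: "R \<ge> c0" "R \<ge> 2 * c0 * c" by (auto simp: R_def)
 let ?f = "\<lambda>(x, y). auto_kernel R k x y * (F y * H x)"
 have cont: "continuous_on (H3 \<times> H3) (\<lambda>p. auto_kernel R k (fst p) (snd p) * (F (snd p) * H (fst p)))"
  by (intro continuous_intros auto_kernel_continuous[OF k] continuous_on_compose2[OF invariant_continuous[OF F]]
    continuous_on_compose2[OF invariant_continuous[OF H]]) auto
 let ?C = "hyp_cball base_point c0"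
 have C: "compact ?C" "?C \<subseteq> H3" by (auto simp: compact_hyp_cball hyp_cball_subset)
 obtain B where B: "B \<ge> 0" "\<And>p. p \<in> ?C \<times> ?C \<Longrightarrow> \<bar>auto_kernel R k (fst p) (snd p) * (F (snd p) * H (fst p))\<bar> \<le> B"
  by (rule bounded_on_compact[OF compact_Times[OF C(1) C(1)] continuous_on_subset[OF cont]]) (use C in blast)+
 have kb: "k \<in> borel_measurable borel" using profile_funD(1)[OF k] borel_measurable_continuous_onI by auto
 have id: "(\<lambda>x. x) \<in> measurable dom hyp" by (rule measurable_dom) simp
 have m1: "fst \<in> measurable (dom \<Otimes>\<^sub>M dom) hyp" "snd \<in> measurable (dom \<Otimes>\<^sub>M dom) hyp"
  by (rule measurable_compose[OF measurable_fst id], rule measurable_compose[OF measurable_snd id])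
 have meas: "?f \<in> borel_measurable (dom \<Otimes>\<^sub>M dom)"
 proof -
  have "(\<lambda>p. radial k (fst p) (SL2C_act A (snd p))) \<in> borel_measurable (dom \<Otimes>\<^sub>M dom)" if "A \<in> G" for A
   unfolding radial_def
   by (rule measurable_compose[OF cosh_dist_measurable_pair[OF m1(1) measurable_compose[OF m1(2) hyp_isometry_measurable[OF G_isometry[OF that]]]] kb])
  then have "(\<lambda>p. auto_kernel R k (fst p) (snd p)) \<in> borel_measurable (dom \<Otimes>\<^sub>M dom)"
   unfolding auto_kernel_def using hits_subset by (intro borel_measurable_times borel_measurable_sum) auto
  moreover have "(\<lambda>p. F (snd p)) \<in> borel_measurable (dom \<Otimes>\<^sub>M dom)" "(\<lambda>p. H (fst p)) \<in> borel_measurable (dom \<Otimes>\<^sub>M dom)"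
   by (rule measurable_compose[OF m1(2) continuous_on_measurable_hyp[OF invariant_continuous[OF F]]],
    rule measurable_compose[OF m1(1) continuous_on_measurable_hyp[OF invariant_continuous[OF H]]])
  ultimately show ?thesis by (simp add: case_prod_unfold)
 qed
 interpret pair: finite_measure "dom \<Otimes>\<^sub>M dom" by (intro finite_measure_pair_measure dom.finite_measure_axioms)
 have int: "integrable (dom \<Otimes>\<^sub>M dom) ?f"
 proof (rule pair.integrable_const_bound[OF AE_I2 meas, of B])
  fix p assume "p \<in> space (dom \<Otimes>\<^sub>M dom)"
  then have "p \<in> ?C \<times> ?C" using D_bounded by (auto simp: space_pair_measure)
  then show "norm (?f p) \<le> B" using B(2)[of p] by (simp add: case_prod_unfold)
 qed
 have opF: "radial_op k F' x = (\<integral>y. auto_kernel R k x y * F' y \<partial>dom)" if "x \<in> D" "invariant F'" for F' x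
  by (rule radial_op_auto_kernel[OF k that(2) _ R]) (use that(1) D_bounded in blast)
 have "ip (radial_op k F) H = (\<integral>x. (\<integral>y. auto_kernel R k x y * (F y * H x) \<partial>dom) \<partial>dom)"
  unfolding ip_def by (intro Bochner_Integration.integral_cong) (auto simp: opF F mult.assoc[symmetric])
 also have "\<dots> = (\<integral>y. (\<integral>x. auto_kernel R k x y * (F y * H x) \<partial>dom) \<partial>dom)" by (rule Fubini_integral[symmetric, OF int])
 also have "\<dots> = (\<integral>y. F y * radial_op k H y \<partial>dom)"
 proof (intro Bochner_Integration.integral_cong refl)
  fix y assume y: "y \<in> space dom"
  have "(\<integral>x. auto_kernel R k x y * (F y * H x) \<partial>dom) = (\<integral>x. F y * (auto_kernel R k y x * H x) \<partial>dom)"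
  proof (intro Bochner_Integration.integral_cong refl)
   fix x assume "x \<in> space dom"
   then have "x \<in> H3" "y \<in> H3" using y D_H3 by auto
   then show "auto_kernel R k x y * (F y * H x) = F y * (auto_kernel R k y x * H x)"
    by (simp add: auto_kernel_commute[of x y])
  qed
  then show "(\<integral>x. auto_kernel R k x y * (F y * H x) \<partial>dom) = F y * radial_op k H y" using y by (simp add: opF H)
 qed
 finally show ?thesis by (simp add: ip_def)
qed

end

section \<open>Compactness\<close>

lemma uniform_limit_real_iff:
 fixes H :: "'a \<Rightarrow> real"
 shows "uniform_limit S f H sequentially \<longleftrightarrow> (\<forall>e>0. \<forall>\<^sub>F n in sequentially. \<forall>x\<in>S. \<bar>f n x - H x\<bar> < e)"
 by (simp add: uniform_limit_iff dist_real_def)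

text \<open>Products of radial operators are kept as lists of profiles, so that invariance,
  boundedness, symmetry and commutation are each proved once by induction.\<close>

fun ops :: "(real \<Rightarrow> real) list \<Rightarrow> (point3 \<Rightarrow> real) \<Rightarrow> point3 \<Rightarrow> real" where
 "ops [] F = F"
| "ops (k # ks) F = radial_op k (ops ks F)"

definition profiles :: "(real \<Rightarrow> real) list \<Rightarrow> bool" where
 "profiles ks \<longleftrightarrow> (\<forall>k\<in>set ks. \<exists>c. profile_fun c k)"

lemma profiles_Cons: "profiles (k # ks) \<longleftrightarrow> (\<exists>c. profile_fun c k) \<and> profiles ks"
 and profiles_Nil: "profiles []" and profiles_append: "profiles (ks @ ls) \<longleftrightarrow> profiles ks \<and> profiles ls"
 by (auto simp: profiles_def)

lemma ops_append: "ops (ks @ ls) F = ops ks (ops ls F)" by (induction ks) auto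

lemma ops_continuous: "profiles ks \<Longrightarrow> continuous_on H3 F \<Longrightarrow> continuous_on H3 (ops ks F)"
 by (induction ks) (auto simp: profiles_Cons intro: radial_op_continuous)

lemma ops_cong: "(\<And>y. y \<in> H3 \<Longrightarrow> F y = H y) \<Longrightarrow> x \<in> H3 \<Longrightarrow> ops ks F x = ops ks H x"
 by (induction ks arbitrary: x) (auto intro!: kernel_op_cong)

lemma ops_lincomb:
 assumes "profiles ks" "continuous_on H3 F" "continuous_on H3 H" "x \<in> H3"
 shows "ops ks (\<lambda>x. a * F x + b * H x) x = a * ops ks F x + b * ops ks H x" using assms
proof (induction ks arbitrary: x)
 case (Cons k ks)
 then obtain c where k: "profile_fun c k" and ks: "profiles ks" by (auto simp: profiles_Cons)
 have "ops (k # ks) (\<lambda>x. a * F x + b * H x) x = radial_op k (\<lambda>x. a * ops ks F x + b * ops ks H x) x"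
  using Cons.IH[OF ks Cons.prems(2,3)] by (auto intro!: kernel_op_cong)
 also have "\<dots> = a * ops (k # ks) F x + b * ops (k # ks) H x"
  using radial_op_lincomb[OF k ops_continuous[OF ks Cons.prems(2)] ops_continuous[OF ks Cons.prems(3)] Cons.prems(4)] by simp
 finally show ?case .
qed simp

lemma ops_radial_commute:
 assumes "profile_fun c k" "profiles ls" "continuous_on H3 F" "x \<in> H3"
 shows "radial_op k (ops ls F) x = ops ls (radial_op k F) x" using assms
proof (induction ls arbitrary: x)
 case (Cons l ls)
 then obtain c' where l: "profile_fun c' l" and ls: "profiles ls" by (auto simp: profiles_Cons)
 have "radial_op k (ops (l # ls) F) x = radial_op l (radial_op k (ops ls F)) x"
  using radial_op_commute[OF Cons.prems(1) l ops_continuous[OF ls Cons.prems(3)] Cons.prems(4)] by simp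
 also have "\<dots> = radial_op l (ops ls (radial_op k F)) x"
  using Cons.IH[OF Cons.prems(1) ls Cons.prems(3)] by (rule kernel_op_cong)
 finally show ?case by simp
qed simp

lemma ops_commute:
 assumes "profiles ks" "profiles ls" "continuous_on H3 F" "x \<in> H3"
 shows "ops ks (ops ls F) x = ops ls (ops ks F) x" using assms
proof (induction ks arbitrary: x)
 case (Cons k ks)
 then obtain c where k: "profile_fun c k" and ks: "profiles ks" by (auto simp: profiles_Cons)
 have "ops (k # ks) (ops ls F) x = radial_op k (ops ls (ops ks F)) x"
  using Cons.IH[OF ks Cons.prems(2,3)] by (auto intro!: kernel_op_cong)
 also have "\<dots> = ops ls (ops (k # ks) F) x"
  using ops_radial_commute[OF k Cons.prems(2) ops_continuous[OF ks Cons.prems(3)] Cons.prems(4)] by simp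
 finally show ?case .
qed simp

text \<open>The kernel has the same absolute integral around every point, since isometries exchange
  any two points; hence one constant serves all of \<open>H3\<close>.\<close>

lemma uniform_limit_radial_op:
 assumes k: "profile_fun c k" and f: "\<And>n. continuous_on H3 (f n)" and H: "continuous_on H3 H"
  and lim: "uniform_limit H3 f H sequentially"
 shows "uniform_limit H3 (\<lambda>n. radial_op k (f n)) (radial_op k H) sequentially" unfolding uniform_limit_real_iff
proof (intro allI impI)
 fix e :: real assume e: "e > 0"
 define B where "B = radial_op (\<lambda>u. \<bar>k u\<bar>) (\<lambda>_. 1) base_point"
 have B: "B \<ge> 0" unfolding B_def kernel_op_def radial_def by (rule integral_nonneg_AE) simp
 have B_eq: "radial_op (\<lambda>u. \<bar>k u\<bar>) (\<lambda>_. 1) x = B" if "x \<in> H3" for x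
  unfolding B_def by (rule kernel_op_const_homogeneous[OF _ that base_point_H3])
   (use profile_funD(1)[OF k] in \<open>intro continuous_intros\<close>)
 define d where "d = e / (B + 1)"
 have d: "d > 0" "d * B < e" using e B by (auto simp: d_def field_simps)
 have "\<forall>\<^sub>F n in sequentially. \<forall>x\<in>H3. \<bar>f n x - H x\<bar> < d" using lim d(1) unfolding uniform_limit_real_iff by blast
 then show "\<forall>\<^sub>F n in sequentially. \<forall>x\<in>H3. \<bar>radial_op k (f n) x - radial_op k H x\<bar> < e"
 proof eventually_elim
  case (elim n)
  show ?case
  proof
   fix x assume x: "x \<in> H3"
   let ?g = "\<lambda>x. 1 * f n x + (-1) * H x"
   have "radial_op k (f n) x - radial_op k H x = radial_op k ?g x" unfolding radial_op_lincomb[OF k f H x] by simp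
   also have "\<bar>\<dots>\<bar> \<le> d * radial_op (\<lambda>u. \<bar>k u\<bar>) (\<lambda>_. 1) x"
    using elim by (intro radial_op_bound[OF k _ x] continuous_intros f H) force
   finally show "\<bar>radial_op k (f n) x - radial_op k H x\<bar> < e" using d B_eq[OF x] by simp
  qed
 qed
qed

lemma uniform_limit_ops:
 assumes "profiles ks" "\<And>n. continuous_on H3 (f n)" "continuous_on H3 H" "uniform_limit H3 f H sequentially"
 shows "uniform_limit H3 (\<lambda>n. ops ks (f n)) (ops ks H) sequentially" using assms
proof (induction ks)
 case (Cons k ks)
 then obtain c where k: "profile_fun c k" and ks: "profiles ks" by (auto simp: profiles_Cons)
 show ?case using uniform_limit_radial_op[OF k _ _ Cons.IH[OF ks Cons.prems(2-4)]] ops_continuous[OF ks] Cons.prems by simp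
qed simp

context fundamental_domain
begin

lemma ip_1_1: "ip (\<lambda>_. 1) (\<lambda>_. 1) = vol" by (simp add: ip_def vol_def)

lemma vol_nonneg: "vol \<ge> 0" by (simp add: vol_def)

lemma ip_scale_left: "ip (\<lambda>x. a * F x) H = a * ip F H" by (simp add: ip_def mult.assoc flip: integral_mult_right_zero)

lemma abs_ip_le:
 assumes F: "continuous_on H3 F" and K: "continuous_on H3 K" and b: "\<And>y. y \<in> D \<Longrightarrow> \<bar>K y\<bar> \<le> b" and "b \<ge> 0"
 shows "\<bar>ip K F\<bar> \<le> b * (sqrt vol * sqrt (ip F F))"
proof -
 have Fa: "continuous_on H3 (\<lambda>x. \<bar>F x\<bar>)" by (intro continuous_intros F)
 have "\<bar>ip K F\<bar> \<le> (\<integral>y. \<bar>K y * F y\<bar> \<partial>dom)" unfolding ip_def by (rule integral_abs_bound)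
 also have "\<dots> \<le> (\<integral>y. b * (1 * \<bar>F y\<bar>) \<partial>dom)"
  by (intro integral_mono dom_integrable continuous_intros F K) (auto simp: abs_mult b intro!: mult_right_mono)
 also have "\<dots> = b * ip (\<lambda>_. 1) (\<lambda>x. \<bar>F x\<bar>)" by (simp add: ip_def)
 also have "ip (\<lambda>_. 1) (\<lambda>x. \<bar>F x\<bar>) \<le> sqrt (vol * ip F F)"
 proof (rule real_le_rsqrt)
  have "ip (\<lambda>x. \<bar>F x\<bar>) (\<lambda>x. \<bar>F x\<bar>) = ip F F" by (simp add: ip_def)
  then show "(ip (\<lambda>_. 1) (\<lambda>x. \<bar>F x\<bar>))^2 \<le> vol * ip F F"
   using ip_Cauchy_Schwarz[OF continuous_on_const Fa, of 1] by (simp add: ip_1_1)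
 qed
 finally show ?thesis using \<open>b \<ge> 0\<close> by (simp add: real_sqrt_mult mult_left_mono)
qed

lemma ip_le_sup:
 assumes F: "continuous_on H3 F" and b: "\<And>y. y \<in> D \<Longrightarrow> \<bar>F y\<bar> \<le> b"
 shows "ip F F \<le> b^2 * vol"
proof -
 have "ip F F \<le> (\<integral>y. b^2 \<partial>dom)" unfolding ip_def
 proof (intro integral_mono dom_integrable continuous_intros F)
  fix y assume "y \<in> space dom"
  then have "\<bar>F y\<bar>^2 \<le> b^2" using b by (intro power_mono) auto
  then show "F y * F y \<le> b^2" by (simp add: power2_eq_square)
 qed
 then show ?thesis by (simp add: vol_def mult.commute)
qed

text \<open>By invariance x may be moved into D, where the operator is an inner product with a
  bounded automorphic kernel; Cauchy-Schwarz bounds it by the square norm.\<close>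

lemma radial_op_sup_bound:
 assumes k: "profile_fun c k"
 obtains B where "B \<ge> 0" "\<And>F x. invariant F \<Longrightarrow> x \<in> H3 \<Longrightarrow> \<bar>radial_op k F x\<bar> \<le> B * sqrt (ip F F)"
proof -
 define R where "R = max c0 (2 * c0 * c)"
 have R: "R \<ge> c0" "R \<ge> 2 * c0 * c" by (auto simp: R_def)
 let ?C = "hyp_cball base_point c0"
 have C: "compact ?C" "?C \<subseteq> H3" by (auto simp: compact_hyp_cball hyp_cball_subset)
 obtain b where b: "b \<ge> 0" "\<And>p. p \<in> ?C \<times> ?C \<Longrightarrow> \<bar>auto_kernel R k (fst p) (snd p)\<bar> \<le> b"
  by (rule bounded_on_compact[OF compact_Times[OF C(1) C(1)] continuous_on_subset[OF auto_kernel_continuous[OF k]]]) (use C in blast)+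
 show thesis
 proof (rule that[of "b * sqrt vol"])
  show "b * sqrt vol \<ge> 0" using b vol_nonneg by simp
  fix F x assume F: "invariant F" and x: "x \<in> H3"
  obtain A where A: "A \<in> G" "SL2C_act A x \<in> D" using D_meets[OF x] by blast
  then have y: "SL2C_act A x \<in> ?C" using D_bounded by blast
  have "radial_op k F x = radial_op k F (SL2C_act A x)"
   using invariantD[OF radial_op_invariant[OF k F] A(1) x] by simp
  also have "\<dots> = ip (auto_kernel R k (SL2C_act A x)) F" unfolding ip_def by (rule radial_op_auto_kernel[OF k F y R])
  also have "\<bar>\<dots>\<bar> \<le> b * (sqrt vol * sqrt (ip F F))"
  proof (rule abs_ip_le[OF invariant_continuous[OF F] _ _ b(1)])
   show "continuous_on H3 (auto_kernel R k (SL2C_act A x))"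
    by (rule continuous_on_compose2[OF auto_kernel_continuous[OF k], of _ "\<lambda>y. (SL2C_act A x, y)", simplified])
     (use y C in \<open>auto intro!: continuous_intros\<close>)
   show "\<bar>auto_kernel R k (SL2C_act A x) z\<bar> \<le> b" if "z \<in> D" for z using b(2)[of "(SL2C_act A x, z)"] y that D_bounded by auto
  qed
  finally show "\<bar>radial_op k F x\<bar> \<le> b * sqrt vol * sqrt (ip F F)" by (simp add: mult.assoc)
 qed
qed

lemma ops_invariant: "profiles ks \<Longrightarrow> invariant F \<Longrightarrow> invariant (ops ks F)"
 by (induction ks) (auto simp: profiles_Cons intro: radial_op_invariant)

lemma ops_bound:
 assumes "profiles ks"
 shows "\<exists>B\<ge>0. \<forall>F. invariant F \<longrightarrow> ip (ops ks F) (ops ks F) \<le> B * ip F F" using assms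
proof (induction ks)
 case Nil
 show ?case by (rule exI[of _ 1]) simp
next
 case (Cons k ks)
 then obtain c where k: "profile_fun c k" and ks: "profiles ks" by (auto simp: profiles_Cons)
 from Cons.IH[OF ks] obtain B where B: "B \<ge> 0" "\<And>F. invariant F \<Longrightarrow> ip (ops ks F) (ops ks F) \<le> B * ip F F" by blast
 obtain B' where B': "B' \<ge> 0" "\<And>F x. invariant F \<Longrightarrow> x \<in> H3 \<Longrightarrow> \<bar>radial_op k F x\<bar> \<le> B' * sqrt (ip F F)"
  by (rule radial_op_sup_bound[OF k]) blast
 show ?case
 proof (intro exI[of _ "B'^2 * vol * B"] conjI allI impI)
  fix F assume F: "invariant F"
  have inv: "invariant (ops ks F)" by (rule ops_invariant[OF ks F])
  have "ip (ops (k # ks) F) (ops (k # ks) F) \<le> (B' * sqrt (ip (ops ks F) (ops ks F)))^2 * vol"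
   by (rule ip_le_sup[OF invariant_continuous[OF ops_invariant[OF Cons.prems F]]]) (use B'(2)[OF inv] D_H3 in auto)
  also have "\<dots> = B'^2 * vol * ip (ops ks F) (ops ks F)" using ip_nonneg by (simp add: power_mult_distrib)
  also have "\<dots> \<le> B'^2 * vol * (B * ip F F)" using B(2)[OF F] vol_nonneg by (intro mult_left_mono) auto
  finally show "ip (ops (k # ks) F) (ops (k # ks) F) \<le> B'^2 * vol * B * ip F F" by (simp add: mult.assoc)
 qed (use B vol_nonneg in simp)
qed

lemma ops_symmetric:
 assumes "profiles ks" "invariant F" "invariant H"
 shows "ip (ops ks F) H = ip F (ops ks H)" using assms
proof (induction ks arbitrary: H)
 case (Cons k ks)
 then obtain c where k: "profile_fun c k" and ks: "profiles ks" by (auto simp: profiles_Cons)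
 have "ip (ops (k # ks) F) H = ip (ops ks F) (radial_op k H)"
  using radial_op_symmetric[OF k ops_invariant[OF ks Cons.prems(2)] Cons.prems(3)] by simp
 also have "\<dots> = ip F (ops ks (radial_op k H))"
  by (rule Cons.IH[OF ks Cons.prems(2) radial_op_invariant[OF k Cons.prems(3)]])
 also have "\<dots> = ip F (ops (k # ks) H)"
  using ops_radial_commute[OF k ks invariant_continuous[OF Cons.prems(3)]] by (intro ip_cong) auto
 finally show ?case .
qed simp

lemma invariant_uniform_limit:
 assumes f: "\<And>n. invariant (f n)" and lim: "uniform_limit H3 f H sequentially"
 shows "invariant H" unfolding invariant_def
proof (intro conjI ballI)
 show "continuous_on H3 H" by (rule uniform_limit_theorem[OF _ lim]) (use f invariant_continuous in auto)
 fix A x assume A: "A \<in> G" and x: "x \<in> H3"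
 have "(\<lambda>n. f n x) \<longlonglongrightarrow> H (SL2C_act A x)"
  using tendsto_uniform_limitI[OF lim G_act_H3[OF A x]] by (simp add: invariantD[OF f A x])
 then show "H (SL2C_act A x) = H x" by (rule LIMSEQ_unique) (rule tendsto_uniform_limitI[OF lim x])
qed

text \<open>Uniform continuity of the automorphic kernel on a compact square turns a bound on square
  norms into equicontinuity of the images, so Arzela-Ascoli applies although the functions F n
  themselves are not equicontinuous.\<close>

lemma radial_op_compact:
 assumes k: "profile_fun c k" and F: "\<And>n. invariant (F n)" and F1: "\<And>n. ip (F n) (F n) \<le> 1"
 obtains r H where "strict_mono (r :: nat \<Rightarrow> nat)" "invariant H"
  "uniform_limit H3 (\<lambda>n. radial_op k (F (r n))) H sequentially"
proof -
 define T where "T = radial_op k"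
 have inv: "invariant (T (F n))" for n unfolding T_def by (rule radial_op_invariant[OF k F])
 define R where "R = max c0 (2 * c0 * c)"
 have R: "R \<ge> c0" "R \<ge> 2 * c0 * c" by (auto simp: R_def)
 let ?C = "hyp_cball base_point c0"
 have C: "compact ?C" "?C \<subseteq> H3" by (auto simp: compact_hyp_cball hyp_cball_subset)
 have sqrt1: "sqrt (ip (F n) (F n)) \<le> 1" for n using F1[of n] ip_nonneg by simp
 obtain B where B: "B \<ge> 0" "\<And>F x. invariant F \<Longrightarrow> x \<in> H3 \<Longrightarrow> \<bar>T F x\<bar> \<le> B * sqrt (ip F F)"
  unfolding T_def by (rule radial_op_sup_bound[OF k]) blast
 have bound: "norm (T (F n) x) \<le> B" if "x \<in> ?C" for n x
  using order_trans[OF B(2)[OF F, of x n] mult_left_mono[OF sqrt1 B(1)]] that C by auto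
 have "uniformly_continuous_on (?C \<times> ?C) (\<lambda>p. auto_kernel R k (fst p) (snd p))"
  using C by (intro compact_uniformly_continuous compact_Times continuous_on_subset[OF auto_kernel_continuous[OF k]]) auto
 note uc = this[unfolded uniformly_continuous_on_def, rule_format]
 have equi: "\<exists>d>0. \<forall>n y. y \<in> ?C \<and> norm (x - y) < d \<longrightarrow> norm (T (F n) x - T (F n) y) < e" if x: "x \<in> ?C" and e: "e > 0" for x e
 proof -
  define e' where "e' = e / (sqrt vol + 1)"
  have "sqrt vol \<ge> 0" using vol_nonneg by simp
  then have e': "e' > 0" "e' * sqrt vol < e" unfolding e'_def using e by (simp_all add: add_nonneg_pos divide_less_eq)
  obtain d where d: "d > 0" "\<And>p q. p \<in> ?C \<times> ?C \<Longrightarrow> q \<in> ?C \<times> ?C \<Longrightarrow> dist q p < d \<Longrightarrow>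
    dist (auto_kernel R k (fst q) (snd q)) (auto_kernel R k (fst p) (snd p)) < e'" using uc[OF e'(1)] by metis
  show ?thesis
  proof (intro exI[of _ d] conjI allI impI)
   fix n y assume y: "y \<in> ?C \<and> norm (x - y) < d"
   have cont: "continuous_on H3 (auto_kernel R k z)" if "z \<in> ?C" for z
    by (rule continuous_on_compose2[OF auto_kernel_continuous[OF k], of _ "\<lambda>y. (z, y)", simplified])
     (use that C in \<open>auto intro!: continuous_intros\<close>)
   note Fc = invariant_continuous[OF F]
   let ?K = "\<lambda>z. 1 * auto_kernel R k x z + (-1) * auto_kernel R k y z"
   have "T (F n) x - T (F n) y = ip (auto_kernel R k x) (F n) - ip (auto_kernel R k y) (F n)"
    unfolding ip_def T_def using radial_op_auto_kernel[OF k F _ R] x y by simp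
   also have "\<dots> = ip ?K (F n)" unfolding ip_lincomb_left[OF cont[OF x] cont[OF conjunct1[OF y]] Fc] by simp
   also have "\<bar>\<dots>\<bar> \<le> e' * (sqrt vol * sqrt (ip (F n) (F n)))"
   proof (rule abs_ip_le[OF Fc])
    show "continuous_on H3 ?K" using cont x y by (intro continuous_intros) auto
    show "\<bar>?K z\<bar> \<le> e'" if "z \<in> D" for z
     using d(2)[of "(y, z)" "(x, z)"] that D_bounded x y by (auto simp: dist_Pair_Pair dist_norm)
   qed (use e' in simp)
   also have "\<dots> \<le> e' * (sqrt vol * 1)" using sqrt1 e' vol_nonneg by (intro mult_left_mono) auto
   finally show "norm (T (F n) x - T (F n) y) < e" using e' by simp
  qed (rule d)
 qed
 obtain H0 r where H0: "continuous_on ?C H0" "strict_mono (r :: nat \<Rightarrow> nat)"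
  "\<And>e. 0 < e \<Longrightarrow> \<exists>N. \<forall>n x. n \<ge> N \<and> x \<in> ?C \<longrightarrow> norm (T (F (r n)) x - H0 x) < e"
  by (rule Arzela_Ascoli[OF C(1), of "\<lambda>n. T (F n)" B]) (use bound equi in blast)+
 \<comment> \<open>The limit is so far known only on the ball containing D; a chosen translate into
   D carries it to all of \<open>H3\<close>.\<close>
 define a where "a x = (SOME A. A \<in> G \<and> SL2C_act A x \<in> D)" for x
 have a: "a x \<in> G" "SL2C_act (a x) x \<in> D" if "x \<in> H3" for x
  using someI_ex[of "\<lambda>A. A \<in> G \<and> SL2C_act A x \<in> D"] D_meets[OF that] unfolding a_def by blast+
 define H where "H x = H0 (SL2C_act (a x) x)" for x
 have lim: "uniform_limit H3 (\<lambda>n. T (F (r n))) H sequentially" unfolding uniform_limit_real_iff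
 proof (intro allI impI)
  fix e :: real assume "e > 0"
  then obtain N where N: "\<And>n x. n \<ge> N \<Longrightarrow> x \<in> ?C \<Longrightarrow> norm (T (F (r n)) x - H0 x) < e" using H0(3) by blast
  have "\<bar>T (F (r n)) x - H x\<bar> < e" if "n \<ge> N" "x \<in> H3" for n x
   using N[OF that(1), of "SL2C_act (a x) x"] a[OF that(2)] D_bounded invariantD[OF inv a(1)[OF that(2)] that(2)]
   by (auto simp: H_def)
  then show "\<forall>\<^sub>F n in sequentially. \<forall>x\<in>H3. \<bar>T (F (r n)) x - H x\<bar> < e" unfolding eventually_sequentially by blast
 qed
 have "invariant H" by (rule invariant_uniform_limit[OF inv lim])
 then show thesis using that[OF H0(2) _ lim[unfolded T_def]] by blast
qed

lemma ip_uniform_limit: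
 assumes f: "\<And>n. continuous_on H3 (f n)" and H: "continuous_on H3 H" and K: "continuous_on H3 K"
  and lim: "uniform_limit H3 f H sequentially"
 shows "(\<lambda>n. ip (f n) K) \<longlonglongrightarrow> ip H K" and "(\<lambda>n. ip (\<lambda>x. 1 * f n x + (-1) * H x) (\<lambda>x. 1 * f n x + (-1) * H x)) \<longlonglongrightarrow> 0"
proof -
 let ?d = "\<lambda>n x. 1 * f n x + (-1) * H x"
 have dc: "continuous_on H3 (?d n)" for n by (intro continuous_intros f H)
 show d0: "(\<lambda>n. ip (?d n) (?d n)) \<longlonglongrightarrow> 0"
 proof (rule LIMSEQ_I)
  fix e :: real assume e: "e > 0"
  define d where "d = sqrt (e / (vol + 1))"
  have d: "d > 0" "d^2 * vol < e" using e vol_nonneg by (auto simp: d_def field_simps)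
  then obtain N where N: "\<And>n x. n \<ge> N \<Longrightarrow> x \<in> H3 \<Longrightarrow> \<bar>f n x - H x\<bar> < d"
   using lim unfolding uniform_limit_real_iff eventually_sequentially by metis
  have "norm (ip (?d n) (?d n) - 0) < e" if "n \<ge> N" for n
  proof -
   have "ip (?d n) (?d n) \<le> d^2 * vol" by (rule ip_le_sup[OF dc]) (use N[OF that] D_H3 in force)
   then show ?thesis using d ip_nonneg[of "?d n"] by simp
  qed
  then show "\<exists>N. \<forall>n\<ge>N. norm (ip (?d n) (?d n) - 0) < e" by blast
 qed
 have "(\<lambda>n. ip (?d n) K) \<longlonglongrightarrow> 0"
 proof (rule tendsto_rabs_zero_cancel, rule real_tendsto_sandwich[OF _ _ tendsto_const])
  show "(\<lambda>n. sqrt (ip (?d n) (?d n) * ip K K)) \<longlonglongrightarrow> 0"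
   using tendsto_real_sqrt[OF tendsto_mult_left_zero[OF d0, of "ip K K"]] by simp
  show "\<forall>\<^sub>F n in sequentially. \<bar>ip (?d n) K\<bar> \<le> sqrt (ip (?d n) (?d n) * ip K K)"
   using ip_Cauchy_Schwarz[OF dc K] by (intro always_eventually allI real_le_rsqrt) simp
 qed simp
 then have "(\<lambda>n. ip (?d n) K + ip H K) \<longlonglongrightarrow> 0 + ip H K" by (intro tendsto_intros)
 then show "(\<lambda>n. ip (f n) K) \<longlonglongrightarrow> ip H K" unfolding ip_lincomb_left[OF f H K] by simp
qed

end

section \<open>From radial operators to Laplace eigenvalues\<close>

section \<open>The mean value property\<close>

text \<open>All functions \<open>sph\<close> vanish at 0, so an inequality between derivatives
  integrates to one between the functions, and the weight in the moment is nonnegative.\<close>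

lemma sph_moment_mono:
 assumes m: "m \<ge> 1" and c: "c \<ge> 1" and d: "\<And>s. 0 \<le> s \<Longrightarrow> s \<le> arcosh c \<Longrightarrow> a * sph' \<nu> s \<le> sph' \<mu> s"
 shows "a * sph.moment \<nu> m c \<le> sph.moment \<mu> m c"
proof -
 let ?I = "{0..arcosh c}"
 have le: "a * sph \<nu> s \<le> sph \<mu> s" if s: "s \<in> ?I" for s
 proof -
  have "sph \<mu> 0 - a * sph \<nu> 0 \<le> sph \<mu> s - a * sph \<nu> s"
  proof (rule DERIV_nonneg_imp_nondecreasing[of 0 s "\<lambda>s. sph \<mu> s - a * sph \<nu> s"])
   fix x assume x: "0 \<le> x" "x \<le> s"
   have "((\<lambda>s. sph \<mu> s - a * sph \<nu> s) has_real_derivative sph' \<mu> x - a * sph' \<nu> x) (at x)"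
    by (intro derivative_intros DERIV_cmult sph_derivative)
   then show "\<exists>y. ((\<lambda>s. sph \<mu> s - a * sph \<nu> s) has_real_derivative y) (at x) \<and> y \<ge> 0"
    using d[of x] x s by (intro exI[of _ "sph' \<mu> x - a * sph' \<nu> x"] conjI) auto
  qed (use s in auto)
  then show ?thesis by simp
 qed
 have "a * sph.moment \<nu> m c = integral ?I (\<lambda>s. a * ((c - cosh s) ^ m * (sinh s * sph \<nu> s)))"
  unfolding sph_moment_eq_integral[OF m c] by simp
 also have "\<dots> \<le> integral ?I (\<lambda>s. (c - cosh s) ^ m * (sinh s * sph \<mu> s))"
 proof (intro integral_le integrable_continuous_interval continuous_intros)
  fix s assume s: "s \<in> ?I"
  then have "cosh s \<le> c" using c by (simp add: arcosh_le_iff)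
  then have "(c - cosh s) ^ m * sinh s * (a * sph \<nu> s) \<le> (c - cosh s) ^ m * sinh s * sph \<mu> s"
   using s le[OF s] by (intro mult_left_mono) auto
  then show "a * ((c - cosh s) ^ m * (sinh s * sph \<nu> s)) \<le> (c - cosh s) ^ m * (sinh s * sph \<mu> s)"
   by (simp add: mult_ac)
 qed
 also have "\<dots> = sph.moment \<mu> m c" by (rule sph_moment_eq_integral[OF m c, symmetric])
 finally show ?thesis .
qed

text \<open>Heights are bounded on K, so \<open>cosh_dist_norm\<close> converts a small value of
  \<open>cosh_dist - 1\<close> into a small Euclidean distance. The bound 2 on c lets the balls
  around a point stay in one fixed compact ball.\<close>

lemma cosh_dist_small:
 assumes K: "compact K" "K \<subseteq> H3" and d: "d > 0"
 obtains c where "1 < c" "c \<le> 2" "\<And>x y. x \<in> K \<Longrightarrow> y \<in> K \<Longrightarrow> cosh_dist x y \<le> c \<Longrightarrow> dist x y < d"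
proof -
 obtain h where h: "h \<ge> 0" "\<And>x. x \<in> K \<Longrightarrow> \<bar>snd x\<bar> \<le> h"
  by (rule bounded_on_compact[OF K(1) continuous_on_snd[OF continuous_on_id]]) blast
 define c where "c = 1 + min 1 (d^2 / (2 * h * h + 1) / 2)"
 have h2: "2 * h * h + 1 > 0" using h(1) by (simp add: add_nonneg_pos)
 have c: "1 < c" "c \<le> 2" using d h2 by (auto simp: c_def)
 show thesis
 proof (rule that[OF c])
  fix x y assume x: "x \<in> K" and y: "y \<in> K" and xy: "cosh_dist x y \<le> c"
  have xH: "x \<in> H3" "y \<in> H3" using K x y by auto
  have "(norm (x - y))^2 = 2 * snd x * snd y * (cosh_dist x y - 1)" by (rule cosh_dist_norm[OF xH])
  also have "\<dots> \<le> (2 * h * h) * (d^2 / (2 * h * h + 1) / 2)"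
  proof (rule mult_mono)
   show "2 * snd x * snd y \<le> 2 * h * h" using h(2)[OF x] h(2)[OF y] h(1) xH by (intro mult_mono) (auto simp: H3_iff)
   show "cosh_dist x y - 1 \<le> d^2 / (2 * h * h + 1) / 2" using xy by (simp add: c_def)
  qed (use h(1) cosh_dist_ge_1[OF xH] in auto)
  also have "\<dots> = (2 * h * h) / (2 * h * h + 1) * (d^2 / 2)" by simp
  also have "\<dots> \<le> 1 * (d^2 / 2)" using h2 by (intro mult_right_mono) (simp_all add: divide_le_eq)
  also have "\<dots> < d^2" using d by simp
  finally show "dist x y < d" unfolding dist_norm by (rule power_less_imp_less_base) (use d in simp)
 qed
qed

lemma profile_fun_cut_power: "m \<ge> 1 \<Longrightarrow> profile_fun c (cut_power c m)"
 and profile_fun_lap_cut_power: "profile_fun c (lap_cut_power c)"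
 by (auto simp: profile_fun_def continuous_cut_power continuous_lap_cut_power cut_power_out lap_cut_power_out)

text \<open>Only the factor a from \<open>eigenfunction_profile\<close> is left to identify. On
  small balls around x the function is nearly f x, so its third moment is nearly f x times that of
  1; also \<open>sph' \<mu>\<close> is nearly \<open>sph' 0\<close>, so the two spherical moments
  nearly agree. Hence a and f x times \<open>sphere_area\<close> differ by arbitrarily
  little.\<close>

theorem mean_value:
 assumes f: "eigenfunction \<mu> f" and x: "x \<in> H3" and k: "continuous_on UNIV k" "\<And>u. u > c \<Longrightarrow> k u = 0"
 shows "radial_op k f x = sphere_area * sph.profile \<mu> k * f x"
proof -
 have fc: "continuous_on H3 f" by (rule eigenfunction_continuous[OF f])
 obtain a where a: "\<And>c. moment_family.moment hyp (cosh_dist x) f 3 c = a * sph.moment \<mu> 3 c"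
  "radial_op k f x = a * sph.profile \<mu> k" using eigenfunction_profile[OF f x] k by metis
 have mom: "radial_op (cut_power c 3) f x = a * sph.moment \<mu> 3 c" for c
  unfolding radial_profile[OF x fc, symmetric] a(1)[symmetric] moment_family.moment_def[OF moment_family_hyp[OF fc x]]
  by (simp add: cut_power_def[abs_def])
 have bound: "\<bar>a - f x * sphere_area\<bar> \<le> e * (sphere_area + \<bar>a\<bar>)" if e: "0 < e" "e < 1" for e
 proof -
  obtain d where d: "d > 0" "\<And>y. y \<in> H3 \<Longrightarrow> dist y x < d \<Longrightarrow> \<bar>f y - f x\<bar> < e"
   using fc x e unfolding continuous_on_iff dist_real_def by metis
  obtain c1 where c1: "1 < c1" "c1 \<le> 2" "\<And>y z. y \<in> hyp_cball x 2 \<Longrightarrow> z \<in> hyp_cball x 2 \<Longrightarrow> cosh_dist y z \<le> c1 \<Longrightarrow> dist y z < d"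
   by (rule cosh_dist_small[OF compact_hyp_cball[OF x] hyp_cball_subset d(1)]) blast
  have "isCont (\<lambda>s. sph' \<mu> s - sph' 0 s) 0"
   using continuous_on_sph'[of UNIV] by (intro continuous_intros) (auto simp: continuous_on_eq_continuous_at)
  then obtain r where r: "r > 0" "\<And>s. \<bar>s\<bar> < r \<Longrightarrow> \<bar>sph' \<mu> s - sph' 0 s\<bar> < e"
   using e(1) unfolding continuous_at_eps_delta dist_real_def by force
  define c where "c = min c1 (cosh (r / 2))"
  have c: "c > 1" unfolding c_def using c1(1) r(1) cosh_real_strict_mono[of 0 "r / 2"] by simp
  have ac: "arcosh c \<le> r / 2" using c r(1) arcosh_le_iff[of "arcosh c" "cosh (r / 2)"]
   by (simp add: c_def arcosh_cosh_real arcosh_nonneg_real cosh_real_ge_1)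
  define P where "P = sph.moment 0 3 c"
  have P: "P > 0" unfolding P_def by (rule sph_moment_0_pos[OF c])
  have pf: "profile_fun c (cut_power c 3)" by (simp add: profile_fun_cut_power)
  have one: "radial_op (cut_power c 3) (\<lambda>_. 1) x = sphere_area * P"
   unfolding P_def sph_moment_cut_power by (rule integral_radial[OF profile_funD[OF pf] x])
  have "\<bar>a * sph.moment \<mu> 3 c - f x * (sphere_area * P)\<bar> = \<bar>radial_op (cut_power c 3) (\<lambda>y. 1 * f y + (- f x) * 1) x\<bar>"
   unfolding radial_op_lincomb[OF pf fc continuous_on_const x] one mom by simp
  also have "\<dots> \<le> e * radial_op (\<lambda>u. \<bar>cut_power c 3 u\<bar>) (\<lambda>_. 1) x"
  proof (rule radial_op_bound[OF pf _ x])
   fix y assume y: "y \<in> H3" "cosh_dist x y \<le> c"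
   then have "dist x y < d" using c1 x by (intro c1(3)) (auto simp: hyp_cball_def cosh_dist_self c_def)
   then show "\<bar>1 * f y + (- f x) * 1\<bar> \<le> e" using d(2)[OF y(1)] by (simp add: dist_commute)
  qed (intro continuous_intros fc)
  also have "(\<lambda>u. \<bar>cut_power c 3 u\<bar>) = cut_power c 3" by (auto simp: cut_power_def)
  finally have 1: "\<bar>a * sph.moment \<mu> 3 c - f x * (sphere_area * P)\<bar> \<le> e * (sphere_area * P)" unfolding one .
  have near: "\<bar>sph' \<mu> s - sph' 0 s\<bar> \<le> e * sph' 0 s" if "0 \<le> s" "s \<le> arcosh c" for s
  proof -
   have "e * 1 \<le> e * cosh s" using e cosh_real_ge_1 by (intro mult_left_mono) auto
   then show ?thesis using r(2)[of s] that ac r(1) by (simp add: sph'_def)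
  qed
  have "(1 - e) * sph.moment 0 3 c \<le> sph.moment \<mu> 3 c"
   by (rule sph_moment_mono) (use near c in \<open>force simp: algebra_simps\<close>)+
  moreover have "1 / (1 + e) * sph.moment \<mu> 3 c \<le> sph.moment 0 3 c"
   by (rule sph_moment_mono) (use near c e in \<open>force simp: field_simps\<close>)+
  ultimately have 2: "\<bar>sph.moment \<mu> 3 c - P\<bar> \<le> e * P" using e by (simp add: P_def field_simps abs_le_iff)
  have "\<bar>a - f x * sphere_area\<bar> * P = \<bar>(a - f x * sphere_area) * P\<bar>" using P by (simp add: abs_mult)
  also have "\<dots> \<le> \<bar>a * sph.moment \<mu> 3 c - f x * (sphere_area * P)\<bar> + \<bar>a\<bar> * \<bar>sph.moment \<mu> 3 c - P\<bar>"
   unfolding abs_mult[of a, symmetric] by (simp add: algebra_simps)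
  also have "\<dots> \<le> e * (sphere_area * P) + \<bar>a\<bar> * (e * P)" using 1 2 by (intro add_mono mult_left_mono) auto
  also have "\<dots> = (e * (sphere_area + \<bar>a\<bar>)) * P" by (simp add: algebra_simps)
  finally show ?thesis using P by simp
 qed
 have pos: "sphere_area + \<bar>a\<bar> > 0" using sphere_area_pos by linarith
 have "\<bar>a - f x * sphere_area\<bar> \<le> 0 + e" if e: "e > 0" for e
 proof -
  define t where "t = min (1/2) (e / (sphere_area + \<bar>a\<bar>))"
  have "\<bar>a - f x * sphere_area\<bar> \<le> t * (sphere_area + \<bar>a\<bar>)" using e pos by (intro bound) (auto simp: t_def)
  also have "\<dots> \<le> e / (sphere_area + \<bar>a\<bar>) * (sphere_area + \<bar>a\<bar>)" using pos by (intro mult_right_mono) (auto simp: t_def)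
  finally show ?thesis using pos by simp
 qed
 then have "\<bar>a - f x * sphere_area\<bar> \<le> 0" by (rule field_le_epsilon)
 then show ?thesis using a(2) by simp
qed

section \<open>Eigenfunctions of the Laplacian from radial operators\<close>

text \<open>Exhibiting F as the image of a continuous function under a smoothing kernel gives its
  two derivatives and computes its Laplacian through the second kernel. Eigenfunctions found as
  limits are recognized in this way.\<close>

lemma eigenfunctionI:
 assumes F': "continuous_on H3 F'" and F: "\<And>x. x \<in> H3 \<Longrightarrow> radial_op (cut_power c 3) F' x = F x"
  and L: "\<And>x. x \<in> H3 \<Longrightarrow> radial_op (lap_cut_power c) F' x = \<mu> * F x"
 shows "eigenfunction \<mu> F" unfolding eigenfunction_def
proof (intro conjI ballI)
 have C2: "C_k_on 2 (radial_op (cut_power c 3) F') H3"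
  by (rule C_k_on_kernel_op[OF C_kernel_cut_power kernel_within_radial[of c] F']) (simp_all add: cut_power_out)
 then show "C_k_on 2 F H3" by (rule C_k_on_cong[OF open_H3]) (rule F)
 fix p assume p: "p \<in> H3"
 show "laplace_beltrami F p = \<mu> * F p"
  using laplace_beltrami_cong[OF C2 F p] laplace_op_cut_power[OF F' p] L[OF p] by simp
qed

lemma eigenfunction_ops:
 assumes f: "eigenfunction \<mu> f" and "profiles ks" "x \<in> H3"
 shows "ops ks f x = (\<Prod>k\<leftarrow>ks. sphere_area * sph.profile \<mu> k) * f x" using assms(2,3)
proof (induction ks arbitrary: x)
 case (Cons k ks)
 then obtain c where k: "profile_fun c k" and ks: "profiles ks" by (auto simp: profiles_Cons)
 define a where "a = (\<Prod>k\<leftarrow>ks. sphere_area * sph.profile \<mu> k)"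
 \<comment> \<open>The summand with coefficient 0 lets the lemma on linear combinations serve for
   scalar multiples; the same device recurs below.\<close>
 have "ops (k # ks) f x = radial_op k (\<lambda>x. a * f x + 0 * f x) x"
  using Cons.IH[OF ks] by (auto simp: a_def intro!: kernel_op_cong)
 also have "\<dots> = a * radial_op k f x"
  using radial_op_lincomb[OF k eigenfunction_continuous[OF f] eigenfunction_continuous[OF f] Cons.prems(2), of a 0] by simp
 also have "radial_op k f x = sphere_area * sph.profile \<mu> k * f x"
  by (rule mean_value[OF f Cons.prems(2) profile_funD[OF k]])
 finally show ?case by (simp add: a_def)
qed simp

lemma uniform_limit_lincomb:
 fixes H K :: "'a \<Rightarrow> real"
 assumes "uniform_limit S f H sequentially" "uniform_limit S g K sequentially"
 shows "uniform_limit S (\<lambda>n x. a * f n x + b * g n x) (\<lambda>x. a * H x + b * K x) sequentially"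
 by (intro uniform_limit_intros assms)

context fundamental_domain
begin

definition mean_zero :: "(point3 \<Rightarrow> real) \<Rightarrow> bool" where
 "mean_zero F \<longleftrightarrow> invariant F \<and> ip F (\<lambda>_. 1) = 0"

lemma mean_zeroD: "mean_zero F \<Longrightarrow> invariant F" "mean_zero F \<Longrightarrow> continuous_on H3 F" "mean_zero F \<Longrightarrow> ip F (\<lambda>_. 1) = 0"
 by (simp_all add: mean_zero_def invariant_continuous)

lemma mean_zero_lincomb: "mean_zero F \<Longrightarrow> mean_zero H \<Longrightarrow> mean_zero (\<lambda>x. a * F x + b * H x)"
 using ip_lincomb_left[of F H "\<lambda>_. 1" a b] by (simp add: mean_zero_def invariant_lincomb invariant_continuous)

lemma ops_mean_zero:
 assumes "profiles ks" "mean_zero F"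
 shows "mean_zero (ops ks F)" using assms
proof (induction ks)
 case (Cons k ks)
 then obtain c where k: "profile_fun c k" and ks: "profiles ks" by (auto simp: profiles_Cons)
 define a where "a = radial_op k (\<lambda>_. 1) base_point"
 have F: "mean_zero (ops ks F)" by (rule Cons.IH[OF ks Cons.prems(2)])
 have "ip (ops (k # ks) F) (\<lambda>_. 1) = ip (radial_op k (\<lambda>_. 1)) (ops ks F)"
  using radial_op_symmetric[OF k mean_zeroD(1)[OF F] invariant_const] by (simp add: ip_commute)
 also have "\<dots> = ip (\<lambda>_. a * 1) (ops ks F)"
  unfolding a_def mult_1_right by (rule ip_cong[OF kernel_op_const_homogeneous[OF profile_funD(1)[OF k] _ base_point_H3] refl])
 also have "\<dots> = 0" using mean_zeroD(3)[OF F] unfolding ip_scale_left by (simp add: ip_commute)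
 finally show ?case using ops_invariant[OF Cons.prems(1) mean_zeroD(1)[OF Cons.prems(2)]] by (simp add: mean_zero_def)
qed simp

lemma mean_zero_uniform_limit:
 assumes f: "\<And>n. mean_zero (f n)" and lim: "uniform_limit H3 f H sequentially"
 shows "mean_zero H"
proof -
 have H: "invariant H" by (rule invariant_uniform_limit[OF mean_zeroD(1)[OF f] lim])
 have "(\<lambda>n. ip (f n) (\<lambda>_. 1)) \<longlonglongrightarrow> ip H (\<lambda>_. 1)"
  by (rule ip_uniform_limit(1)[OF mean_zeroD(2)[OF f] invariant_continuous[OF H] continuous_on_const lim])
 then have "(\<lambda>n. 0 :: real) \<longlonglongrightarrow> ip H (\<lambda>_. 1)" by (simp add: mean_zeroD(3)[OF f])
 then have "ip H (\<lambda>_. 1) = 0" by (simp add: LIMSEQ_const_iff)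
 then show ?thesis using H by (simp add: mean_zero_def)
qed

lemma ops_compact:
 assumes ks: "profiles ks" and k: "profile_fun c k" and F: "\<And>n. mean_zero (F n)" and F1: "\<And>n. ip (F n) (F n) \<le> 1"
 obtains r H where "strict_mono (r :: nat \<Rightarrow> nat)" "mean_zero H"
  "uniform_limit H3 (\<lambda>n. ops (ks @ [k]) (F (r n))) H sequentially"
proof -
 obtain r H where r: "strict_mono (r :: nat \<Rightarrow> nat)" and H: "invariant H"
  and lim: "uniform_limit H3 (\<lambda>n. radial_op k (F (r n))) H sequentially"
  by (rule radial_op_compact[OF k, of F, OF mean_zeroD(1)[OF F] F1])
 have lim': "uniform_limit H3 (\<lambda>n. ops (ks @ [k]) (F (r n))) (ops ks H) sequentially"
  using uniform_limit_ops[OF ks radial_op_continuous[OF k mean_zeroD(2)[OF F]] invariant_continuous[OF H] lim]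
  by (simp add: ops_append)
 have "profiles (ks @ [k])" using ks k by (auto simp: profiles_append profiles_Cons profiles_Nil)
 then have "mean_zero (ops ks H)" using mean_zero_uniform_limit[OF _ lim'] ops_mean_zero F by blast
 then show thesis by (rule that[OF r _ lim'])
qed

lemma nonzero_point:
 assumes "ip F F > 0" obtains x where "x \<in> H3" "F x \<noteq> 0"
proof -
 have "\<not> (\<forall>x\<in>H3. F x = 0)"
 proof
  assume "\<forall>x\<in>H3. F x = 0"
  then have "ip F F = ip (\<lambda>x. 0 * F x) F" by (intro ip_cong) auto
  then show False using assms unfolding ip_scale_left by simp
 qed
 then show thesis using that by blast
qed

text \<open>The Laplacian preserves the finite-dimensional eigenspaces of a compact operator built from
 smoothing radial kernels, so it has an eigenvector there.\<close>

theorem ops_eigenfunction: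
 assumes k: "profile_fun ck k" and F0: "mean_zero F0" and pos: "ip (ops [cut_power c 3, k, cut_power c 3] F0) F0 > 0"
 obtains m F where "mean_zero F" "eigenfunction m F" "ip F F > 0" "sph.profile m k > 0"
proof -
 define P where "P = cut_power c 3"
 define ks where "ks = [P, k, P]"
 \<comment> \<open>The leading smoothing factor is replaced by its Laplacian. On the eigenspace of
   \<open>ops ks\<close> for M this bounded operator equals M times the Laplacian.\<close>
 define ls where "ls = [lap_cut_power c, k, P]"
 have P: "profile_fun c P" and Q: "profile_fun c (lap_cut_power c)"
  by (simp_all add: P_def profile_fun_cut_power profile_fun_lap_cut_power)
 have ks: "profiles ks" "profiles [P, k]" "profiles [k, P]" and ls: "profiles ls"
  using P Q k unfolding ks_def ls_def profiles_def by auto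
 note cont = mean_zeroD(2)
 obtain B where B: "\<And>F. invariant F \<Longrightarrow> ip (ops ks F) (ops ks F) \<le> B * ip F F" using ops_bound[OF ks(1)] by blast
 obtain B' where B': "B' \<ge> 0" "\<And>F. invariant F \<Longrightarrow> ip (ops ls F) (ops ls F) \<le> B' * ip F F" using ops_bound[OF ls] by blast
 have compact: "\<exists>r H. strict_mono (r :: nat \<Rightarrow> nat) \<and> mean_zero H \<and> uniform_limit H3 (\<lambda>n. ops ks (f (r n))) H sequentially"
  if f: "\<And>n. mean_zero (f n)" and f1: "\<And>n. ip (f n) (f n) \<le> 1" for f :: "nat \<Rightarrow> point3 \<Rightarrow> real"
 proof -
  obtain r H where "strict_mono (r :: nat \<Rightarrow> nat)" "mean_zero H" "uniform_limit H3 (\<lambda>n. ops ([P, k] @ [P]) (f (r n))) H sequentially"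
   by (rule ops_compact[OF ks(2) P, of f, OF f f1])
  then show ?thesis unfolding ks_def append.simps by (intro exI conjI)
 qed
 obtain M F1 where M: "M > 0" and F1: "mean_zero F1" "ip F1 F1 > 0" "\<And>x. x \<in> H3 \<Longrightarrow> ops ks F1 x = M * F1 x"
 proof (rule top_eigenvector[where W = "Collect mean_zero" and T = "ops ks" and B = B and ?F0.0 = F0, unfolded mem_Collect_eq])
  show "ip (ops ks F0) F0 > 0" using pos by (simp add: ks_def P_def)
  show "\<exists>r H. strict_mono (r :: nat \<Rightarrow> nat) \<and> mean_zero H \<and>
    (\<lambda>n. ip (\<lambda>x. 1 * ops ks (f (r n)) x + (-1) * H x) (\<lambda>x. 1 * ops ks (f (r n)) x + (-1) * H x)) \<longlonglongrightarrow> 0"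
   if f: "\<And>n. mean_zero (f n)" "\<And>n. ip (f n) (f n) \<le> 1" for f :: "nat \<Rightarrow> point3 \<Rightarrow> real"
  proof -
   from compact[of f, OF f] obtain r H where rH: "strict_mono (r :: nat \<Rightarrow> nat)" "mean_zero H"
    "uniform_limit H3 (\<lambda>n. ops ks (f (r n))) H sequentially" by (elim exE conjE) (rule that)
   show ?thesis
    by (rule exI[of _ r], rule exI[of _ H], intro conjI rH(1,2) ip_uniform_limit(2)[OF _ _ continuous_on_const rH(3)]
      ops_continuous[OF ks(1)] cont f)
  qed
 qed (use F0 ks(1) B in \<open>auto intro: mean_zeroD mean_zero_lincomb ops_mean_zero ops_symmetric ops_lincomb\<close>)
 define W where "W = {F. mean_zero F \<and> (\<forall>x\<in>H3. ops ks F x = M * F x)}"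
 have W: "mean_zero F" "continuous_on H3 F" "invariant F" "\<And>x. x \<in> H3 \<Longrightarrow> ops ks F x = M * F x" if "F \<in> W" for F
  using that by (auto simp: W_def mean_zeroD)
 \<comment> \<open>Chosen so that C minus the Laplacian has a positive quadratic form at F1; a top
   eigenvector of this difference is then an eigenvector of the Laplacian.\<close>
 define C where "C = 1 + \<bar>ip (ops ls F1) F1\<bar> / (M * ip F1 F1)"
 define S where "S F x = C * F x + (- 1 / M) * ops ls F x" for F x
 have W_lin: "(\<lambda>x. a * F x + b * H x) \<in> W" if "F \<in> W" "H \<in> W" for F H a b
  using that unfolding W_def by (auto simp: mean_zero_lincomb ops_lincomb[OF ks(1)] cont algebra_simps)
 have lsW: "ops ls F \<in> W" if F: "F \<in> W" for F unfolding W_def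
 proof (intro CollectI conjI ballI)
  show "mean_zero (ops ls F)" by (rule ops_mean_zero[OF ls W(1)[OF F]])
  fix x assume x: "x \<in> H3"
  have "ops ks (ops ls F) x = ops ls (ops ks F) x" by (rule ops_commute[OF ks(1) ls W(2)[OF F] x])
  also have "\<dots> = ops ls (\<lambda>x. M * F x + 0 * F x) x" by (rule ops_cong[OF _ x]) (simp add: W(4)[OF F])
  also have "\<dots> = M * ops ls F x" unfolding ops_lincomb[OF ls W(2)[OF F] W(2)[OF F] x] by simp
  finally show "ops ks (ops ls F) x = M * ops ls F x" .
 qed
 obtain M2 F where "M2 > 0" and F: "F \<in> W" "ip F F > 0" "\<And>x. x \<in> H3 \<Longrightarrow> S F x = M2 * F x"
 proof (rule top_eigenvector[where W = W and T = S and B = "2 * C^2 + 2 * (- 1 / M)^2 * B'" and ?F0.0 = F1])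
  show "F1 \<in> W" using F1 by (simp add: W_def)
  show "ip (S F1) F1 > 0"
  proof -
   have "ip (S F1) F1 = C * ip F1 F1 + (- 1 / M) * ip (ops ls F1) F1"
    unfolding S_def[abs_def] by (rule ip_lincomb_left[OF cont[OF F1(1)] ops_continuous[OF ls cont[OF F1(1)]] cont[OF F1(1)]])
   also have "\<dots> = ip F1 F1 + (\<bar>ip (ops ls F1) F1\<bar> - ip (ops ls F1) F1) / M"
    using F1(2) M by (simp add: C_def field_simps)
   also have "\<dots> > 0" using F1(2) M by (intro add_pos_nonneg divide_nonneg_pos) auto
   finally show ?thesis .
  qed
  fix F assume F: "F \<in> W"
  show "S F \<in> W" unfolding S_def[abs_def] by (rule W_lin[OF F lsW[OF F]])
  show "invariant F" by (rule W(3)[OF F])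
  have "ip (S F) (S F) \<le> 2 * C^2 * ip F F + 2 * (- 1 / M)^2 * ip (ops ls F) (ops ls F)"
   unfolding S_def[abs_def] by (rule ip_parallelogram[OF W(2)[OF F] W(2)[OF lsW[OF F]]])
  also have "\<dots> \<le> 2 * C^2 * ip F F + 2 * (- 1 / M)^2 * (B' * ip F F)"
   using B'(2)[OF W(3)[OF F]] by (intro add_left_mono mult_left_mono) auto
  finally show "ip (S F) (S F) \<le> (2 * C^2 + 2 * (- 1 / M)^2 * B') * ip F F" by (simp add: algebra_simps)
  fix H assume H: "H \<in> W"
  show "(\<lambda>x. a * F x + b * H x) \<in> W" for a b by (rule W_lin[OF F H])
  show "S (\<lambda>x. a * F x + b * H x) x = a * S F x + b * S H x" if "x \<in> H3" for a b x
   unfolding S_def ops_lincomb[OF ls W(2)[OF F] W(2)[OF H] that] by (simp add: algebra_simps)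
  have "ip (S F) H = C * ip F H + (- 1 / M) * ip (ops ls F) H"
   unfolding S_def[abs_def] by (rule ip_lincomb_left[OF W(2)[OF F] W(2)[OF lsW[OF F]] W(2)[OF H]])
  also have "ip (ops ls F) H = ip F (ops ls H)" by (rule ops_symmetric[OF ls W(3)[OF F] W(3)[OF H]])
  also have "C * ip F H + (- 1 / M) * ip F (ops ls H) = ip F (S H)"
   unfolding S_def[abs_def] by (rule ip_lincomb_right[OF W(2)[OF H] W(2)[OF lsW[OF H]] W(2)[OF F], symmetric])
  finally show "ip (S F) H = ip F (S H)" .
 next
  fix f :: "nat \<Rightarrow> point3 \<Rightarrow> real"
  assume f: "\<And>n. f n \<in> W" and f1: "\<And>n. ip (f n) (f n) \<le> 1"
  from compact[of f, OF W(1)[OF f] f1] obtain r H where r: "strict_mono (r :: nat \<Rightarrow> nat)" and H: "mean_zero H"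
   and lim: "uniform_limit H3 (\<lambda>n. ops ks (f (r n))) H sequentially" by (elim exE conjE) (rule that)
  \<comment> \<open>On W the compact operator is multiplication by M, so convergence of the images
    is convergence of the sequence itself. This is where the finite dimension of W enters, in the
    form of compactness.\<close>
  define H' where "H' x = (1 / M) * H x + 0 * H x" for x
  have "uniform_limit H3 (\<lambda>n x. (1 / M) * ops ks (f (r n)) x + 0 * ops ks (f (r n)) x) H' sequentially"
   unfolding H'_def[abs_def] by (rule uniform_limit_lincomb[OF lim lim])
  then have lim': "uniform_limit H3 (\<lambda>n. f (r n)) H' sequentially"
   by (rule uniform_limit_cong'[THEN iffD1, rotated -1]) (use W(4)[OF f] M in auto)
  have H': "mean_zero H'" by (rule mean_zero_uniform_limit[OF W(1)[OF f] lim'])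
  have "ops ks H' x = M * H' x" if x: "x \<in> H3" for x
  proof (rule LIMSEQ_unique)
   show "(\<lambda>n. ops ks (f (r n)) x) \<longlonglongrightarrow> ops ks H' x"
    by (rule tendsto_uniform_limitI[OF uniform_limit_ops[OF ks(1) W(2)[OF f] cont[OF H'] lim'] x])
   show "(\<lambda>n. ops ks (f (r n)) x) \<longlonglongrightarrow> M * H' x"
    unfolding W(4)[OF f x] by (intro tendsto_intros tendsto_uniform_limitI[OF lim' x])
  qed
  then have HW: "H' \<in> W" using H' by (simp add: W_def)
  have limS: "uniform_limit H3 (\<lambda>n. S (f (r n))) (S H') sequentially" unfolding S_def[abs_def]
   by (rule uniform_limit_lincomb[OF lim' uniform_limit_ops[OF ls W(2)[OF f] cont[OF H'] lim']])
  have SW: "S F \<in> W" if "F \<in> W" for F unfolding S_def[abs_def] by (rule W_lin[OF that lsW[OF that]])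
  show "\<exists>r H. strict_mono (r :: nat \<Rightarrow> nat) \<and> H \<in> W \<and>
    (\<lambda>n. ip (\<lambda>x. 1 * S (f (r n)) x + (-1) * H x) (\<lambda>x. 1 * S (f (r n)) x + (-1) * H x)) \<longlonglongrightarrow> 0"
   by (rule exI[of _ r], rule exI[of _ "S H'"], intro conjI r SW[OF HW]
     ip_uniform_limit(2)[OF W(2)[OF SW[OF f]] W(2)[OF SW[OF HW]] continuous_on_const limS])
 qed (rule that)
 define m where "m = C - M2"
 have c2: "continuous_on H3 (ops [k, P] F)" by (rule ops_continuous[OF ks(3) W(2)[OF F(1)]])
 have scale: "radial_op l (\<lambda>x. (1 / M) * ops [k, P] F x + 0 * ops [k, P] F x) x = ops (l # [k, P]) F x / M"
  if "profile_fun c l" "x \<in> H3" for l x unfolding radial_op_lincomb[OF that(1) c2 c2 that(2)] by simp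
 have eig: "eigenfunction m F"
 proof (rule eigenfunctionI)
  show "continuous_on H3 (\<lambda>x. (1 / M) * ops [k, P] F x + 0 * ops [k, P] F x)" by (intro continuous_intros c2)
  fix x assume x: "x \<in> H3"
  show "radial_op (cut_power c 3) (\<lambda>x. (1 / M) * ops [k, P] F x + 0 * ops [k, P] F x) x = F x"
   using scale[OF P x] W(4)[OF F(1) x] M by (simp add: P_def ks_def)
  have "C * F x - ops ls F x / M = M2 * F x" using F(3)[OF x] by (simp add: S_def)
  then show "radial_op (lap_cut_power c) (\<lambda>x. (1 / M) * ops [k, P] F x + 0 * ops [k, P] F x) x = m * F x"
   unfolding scale[OF Q x] by (simp add: ls_def m_def left_diff_distrib)
 qed
 obtain x where x: "x \<in> H3" "F x \<noteq> 0" by (rule nonzero_point[OF F(2)]) blast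
 have "(\<Prod>k\<leftarrow>ks. sphere_area * sph.profile m k) * F x = M * F x"
  by (rule trans[OF eigenfunction_ops[OF eig ks(1) x(1), symmetric] W(4)[OF F(1) x(1)]])
 \<comment> \<open>The smoothing factor stands on both sides of k and contributes a square, so
   positivity of M passes to the transform of k itself.\<close>
 then have "(sphere_area * sph.profile m P)^2 * (sphere_area * sph.profile m k) = M"
  using x(2) by (simp add: ks_def power2_eq_square mult_ac)
 then have "sphere_area * sph.profile m k > 0" using M by (metis zero_le_power2 zero_less_mult_pos zero_less_mult_iff not_less)
 then have "sph.profile m k > 0" using sphere_area_pos by (simp add: zero_less_mult_iff)
 then show thesis using that[OF W(1)[OF F(1)] eig F(2)] by blast
qed

end

section \<open>Eigenvalues of the orbifold\<close>

lemma sph_moment_nonpos: "\<mu> \<le> 0 \<Longrightarrow> c \<ge> 1 \<Longrightarrow> sph.moment 0 3 c \<le> sph.moment \<mu> 3 c"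
proof -
 assume \<mu>: "\<mu> \<le> 0" and c: "c \<ge> 1"
 have "1 * sph.moment 0 3 c \<le> sph.moment \<mu> 3 c"
 proof (rule sph_moment_mono)
  fix s :: real assume s: "0 \<le> s"
  have "1 * s \<le> sqrt (1 - \<mu>) * s" using \<mu> s by (intro mult_right_mono) auto
  then show "1 * sph' 0 s \<le> sph' \<mu> s" using s \<mu> by (simp add: sph'_def cosh_real_nonneg_le_iff)
 qed (use c in auto)
 then show ?thesis by simp
qed

text \<open>On a radius of 1 / r the phase sqrt (\<mu> - 1) s is at most 1 for all \<mu> up to b,
  hence below pi / 3, where the cosine is at least 1/2; for \<mu> \<le> 1 the derivative
  \<open>sph'\<close> is at least 1. Half the moment for \<mu> = 1 is thus a common lower
  bound.\<close>

lemma sph_moment_uniform: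
 fixes b :: real obtains c h where "c > 1" "h > 0" "\<And>\<mu>. \<mu> \<le> b \<Longrightarrow> h \<le> sph.moment \<mu> 3 c"
proof -
 define r where "r = sqrt (max b 1)"
 have r: "r \<ge> 1" by (simp add: r_def)
 define c where "c = cosh (1 / r)"
 have c: "c > 1" unfolding c_def using r cosh_real_strict_mono[of 0 "1 / r"] by simp
 have ac: "arcosh c = 1 / r" using r by (simp add: c_def arcosh_cosh_real)
 have pos: "sph.moment 1 3 c > 0" by (rule sph_moment_pos[of _ "arcosh c"]) (use c in \<open>auto simp: sph_def\<close>)
 show thesis
 proof (rule that[OF c, of "1/2 * sph.moment 1 3 c"])
  fix \<mu> assume \<mu>: "\<mu> \<le> b"
  show "1/2 * sph.moment 1 3 c \<le> sph.moment \<mu> 3 c"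
  proof (rule sph_moment_mono)
   fix s assume s: "0 \<le> s" "s \<le> arcosh c"
   show "1/2 * sph' 1 s \<le> sph' \<mu> s"
   proof (cases "\<mu> > 1")
    case True
    have "sqrt (\<mu> - 1) \<le> r" using \<mu> by (simp add: r_def)
    then have "sqrt (\<mu> - 1) * s \<le> r * (1 / r)" using s ac r True by (intro mult_mono) auto
    then have x: "0 \<le> sqrt (\<mu> - 1) * s" "sqrt (\<mu> - 1) * s \<le> pi / 3" using s True r pi_gt3 by auto
    have "cos (pi / 3) \<le> cos (sqrt (\<mu> - 1) * s)" using x by (intro cos_monotone_0_pi_le) auto
    then show ?thesis using True by (simp add: sph'_def cos_60)
   next
    case False
    then show ?thesis using cosh_real_ge_1[of "sqrt (1 - \<mu>) * s"] by (auto simp: sph'_def)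
   qed
  qed (use c in auto)
 qed (use pos in simp)
qed

lemma eigenfunction_lap_op:
 assumes f: "eigenfunction \<mu> f" and x: "x \<in> H3"
 shows "radial_op (lap_cut_power c) f x = \<mu> * radial_op (cut_power c 3) f x"
proof -
 have "C_k_on 2 f H3" using f by (simp add: eigenfunction_def)
 then have "radial_op (lap_cut_power c) f x = radial_op (cut_power c 3) (laplace_beltrami f) x"
  by (rule op_lap_cut_power[OF _ x])
 also have "\<dots> = radial_op (cut_power c 3) (\<lambda>y. \<mu> * f y + 0 * f y) x"
  using f by (intro kernel_op_cong) (simp add: eigenfunction_def)
 also have "\<dots> = \<mu> * radial_op (cut_power c 3) f x"
  using radial_op_lincomb[OF profile_fun_cut_power[of 3 c] eigenfunction_continuous[OF f] eigenfunction_continuous[OF f] x, of \<mu> 0] by simp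
 finally show ?thesis .
qed

lemma lap_op_const: "x \<in> H3 \<Longrightarrow> radial_op (lap_cut_power c) (\<lambda>_. 1) x = 0"
 using eigenfunction_lap_op[OF eigenfunction_const] by simp

text \<open>By the mean value property f is a nonzero multiple of its own average against a kernel
  of any prescribed order of smoothness, taken on a ball where the spherical function is still
  positive.\<close>

lemma eigenfunction_smooth:
 assumes f: "eigenfunction \<mu> f"
 shows "smooth_on f H3" unfolding smooth_on_def
proof
 fix n
 obtain r where r: "r > 0" "\<And>s. 0 < s \<Longrightarrow> s < r \<Longrightarrow> sph \<mu> s > 0" by (rule sph_positive_near_0) blast
 define c where "c = cosh r"
 have c: "c > 1" "arcosh c \<le> r" unfolding c_def using r cosh_real_strict_mono[of 0 r] by (auto simp: arcosh_cosh_real)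
 define a where "a = sphere_area * sph.profile \<mu> (cut_power c (Suc n))"
 have a: "a > 0" unfolding a_def
  using sph_moment_pos[OF _ r(2) c, of "Suc n"] sphere_area_pos by (simp add: sph_moment_cut_power)
 have P: "profile_fun c (cut_power c (Suc n))" by (simp add: profile_fun_cut_power)
 note fc = eigenfunction_continuous[OF f]
 have "C_k_on n (radial_op (cut_power c (Suc n)) (\<lambda>x. (1 / a) * f x + 0 * f x)) H3"
  by (rule C_k_on_kernel_op[OF C_kernel_cut_power kernel_within_radial[of c]])
   (use a in \<open>auto simp: cut_power_out intro!: continuous_intros fc\<close>)
 then show "C_k_on n f H3"
 proof (rule C_k_on_cong[OF open_H3])
  fix x assume x: "x \<in> H3"
  have "radial_op (cut_power c (Suc n)) f x = a * f x" unfolding a_def by (rule mean_value[OF f x profile_funD[OF P]])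
  then show "radial_op (cut_power c (Suc n)) (\<lambda>x. (1 / a) * f x + 0 * f x) x = f x"
   unfolding radial_op_lincomb[OF P fc fc x] using a by simp
 qed
qed

context fundamental_domain
begin

text \<open>The operator with kernel \<open>lap_cut_power\<close> is symmetric and annihilates
  constants, while it multiplies f by a nonzero number. This replaces integration by parts on the
  quotient.\<close>

lemma eigenfunction_mean_zero:
 assumes f: "eigenfunction \<mu> f" and inv: "invariant f" and \<mu>: "\<mu> \<noteq> 0"
 shows "mean_zero f"
proof -
 obtain c h where c: "c > 1" and h: "h > 0" "\<And>\<nu>. \<nu> \<le> \<mu> \<Longrightarrow> h \<le> sph.moment \<nu> 3 c" by (rule sph_moment_uniform[of \<mu>]) blast
 define a where "a = sphere_area * sph.profile \<mu> (cut_power c 3)"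
 have a: "a \<noteq> 0" using h(2)[of \<mu>] h(1) sphere_area_pos by (simp add: a_def sph_moment_cut_power)
 let ?Q = "radial_op (lap_cut_power c)"
 have "ip (?Q f) (\<lambda>_. 1) = ip (?Q (\<lambda>_. 1)) f"
  using radial_op_symmetric[OF profile_fun_lap_cut_power inv invariant_const] by (simp add: ip_commute)
 also have "\<dots> = ip (\<lambda>x. 0 * f x) f" by (intro ip_cong) (auto simp: lap_op_const)
 also have "\<dots> = 0" unfolding ip_scale_left by simp
 finally have 0: "ip (?Q f) (\<lambda>_. 1) = 0" .
 have "ip (?Q f) (\<lambda>_. 1) = ip (\<lambda>x. (\<mu> * a) * f x) (\<lambda>_. 1)"
 proof (rule ip_cong[OF _ refl])
  fix x assume x: "x \<in> H3"
  have "radial_op (cut_power c 3) f x = a * f x"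
   unfolding a_def by (rule mean_value[OF f x profile_funD[OF profile_fun_cut_power[of 3 c]]]) simp_all
  then show "?Q f x = (\<mu> * a) * f x" unfolding eigenfunction_lap_op[OF f x] by simp
 qed
 then have "\<mu> * a * ip f (\<lambda>_. 1) = 0" unfolding ip_scale_left using 0 by simp
 then show ?thesis using a \<mu> inv by (simp add: mean_zero_def)
qed

text \<open>A function dominated by its ball averages at a maximum point is constant on every ball
 around that point.\<close>

lemma max_principle:
 assumes f: "mean_zero f" and p: "p \<in> H3" and max: "\<And>y. y \<in> H3 \<Longrightarrow> f y \<le> f p"
  and mean: "\<And>c. c > 1 \<Longrightarrow> f p * radial_op (cut_power c 3) (\<lambda>_. 1) p \<le> radial_op (cut_power c 3) f p"
 shows "ip f f = 0"
proof -
 note fc = mean_zeroD(2)[OF f]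
 have "f y = f p" if y: "y \<in> H3" for y
 proof -
  define c where "c = cosh_dist p y + 1"
  have c: "c > 1" using cosh_dist_ge_1[OF p y] by (simp add: c_def)
  have P: "profile_fun c (cut_power c 3)" by (simp add: profile_fun_cut_power)
  let ?g = "\<lambda>z. f p * 1 + (-1) * f z"
  have gc: "continuous_on H3 ?g" by (intro continuous_intros fc)
  have "radial_op (cut_power c 3) ?g p \<le> 0"
   unfolding radial_op_lincomb[OF P continuous_on_const fc p] using mean[OF c] by simp
  moreover have nn: "radial (cut_power c 3) p z * ?g z \<ge> 0" if "z \<in> H3" for z
   using max[OF that] by (simp add: radial_def cut_power_def)
  then have nn': "AE z in hyp. radial (cut_power c 3) p z * ?g z \<ge> 0" by (intro AE_I2) simp
  ultimately have "(\<integral>z. radial (cut_power c 3) p z * ?g z \<partial>hyp) = 0"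
   using integral_nonneg_AE[OF nn'] unfolding kernel_op_def by linarith
  then have "AE z in hyp. radial (cut_power c 3) p z * ?g z = 0"
   using integral_nonneg_eq_0_iff_AE[OF radial_op_integrable[OF P gc p] nn'] by blast
  then have "radial (cut_power c 3) p y * ?g y = 0" by (rule AE_hyp_imp_zero[rotated, OF _ y])
    (intro continuous_intros fc continuous_kernel_right[OF profile_fun_kernel(1)[OF P] p])
  then show ?thesis by (simp add: radial_def cut_power_def c_def)
 qed
 then have "ip f f = ip (\<lambda>x. f p * 1) f" by (intro ip_cong) auto
 also have "\<dots> = 0" unfolding ip_scale_left using mean_zeroD(3)[OF f] by (simp add: ip_commute)
 finally show ?thesis .
qed

lemma invariant_attains_max:
 assumes f: "invariant f" obtains p where "p \<in> H3" "\<And>y. y \<in> H3 \<Longrightarrow> f y \<le> f p"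
proof -
 let ?C = "hyp_cball base_point c0"
 have "?C \<noteq> {}" using D_meets[OF base_point_H3] D_bounded by blast
 then have "\<exists>p\<in>?C. \<forall>y\<in>?C. f y \<le> f p"
  using compact_hyp_cball[OF base_point_H3] hyp_cball_subset invariant_continuous[OF f] continuous_on_subset
  by (intro continuous_attains_sup) blast+
 then obtain p where p: "p \<in> ?C" "\<And>y. y \<in> ?C \<Longrightarrow> f y \<le> f p" by blast
 show thesis
 proof (rule that[of p])
  show "p \<in> H3" using p hyp_cball_subset by blast
  fix y assume y: "y \<in> H3"
  obtain A where A: "A \<in> G" "SL2C_act A y \<in> D" using D_meets[OF y] by blast
  then show "f y \<le> f p" using p(2)[of "SL2C_act A y"] D_bounded invariantD[OF f A(1) y] by auto
 qed
qed

text \<open>For \<mu> \<le> 0 the averaging factor is at least that of constants, so a nonnegative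
  maximum is dominated by its averages and \<open>max_principle\<close> applies. Either f or its
  negative has a nonnegative maximum.\<close>

lemma eigenvalue_pos:
 assumes f: "eigenfunction \<mu> f" and mz: "mean_zero f" and nz: "ip f f > 0"
 shows "\<mu> > 0"
proof (rule ccontr)
 assume "\<not> \<mu> > 0"
 then have \<mu>: "\<mu> \<le> 0" by simp
 have key: "ip g g = 0" if g: "mean_zero g"
  and ev: "\<And>c x. x \<in> H3 \<Longrightarrow> radial_op (cut_power c 3) g x = sphere_area * sph.moment \<mu> 3 c * g x"
  and p: "p \<in> H3" "\<And>y. y \<in> H3 \<Longrightarrow> g y \<le> g p" "g p \<ge> 0" for g p
 proof (rule max_principle[OF g p(1,2)])
  fix c :: real assume c: "c > 1"
  have P: "profile_fun c (cut_power c 3)" by (simp add: profile_fun_cut_power)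
  have "radial_op (cut_power c 3) (\<lambda>_. 1) p = sphere_area * sph.moment 0 3 c"
   unfolding sph_moment_cut_power by (rule integral_radial[OF profile_funD[OF P] p(1)])
  then show "g p * radial_op (cut_power c 3) (\<lambda>_. 1) p \<le> radial_op (cut_power c 3) g p"
   unfolding ev[OF p(1)] using sph_moment_nonpos[OF \<mu>, of c] c p(3) sphere_area_pos
    mult_left_mono[of "sphere_area * sph.moment 0 3 c" "sphere_area * sph.moment \<mu> 3 c" "g p"]
   by (simp add: mult.commute[of _ "g p"])
 qed simp
 have P: "profile_fun c (cut_power c 3)" for c by (simp add: profile_fun_cut_power)
 note fc = mean_zeroD(2)[OF mz]
 have ev: "radial_op (cut_power c 3) f x = sphere_area * sph.moment \<mu> 3 c * f x" if "x \<in> H3" for c x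
  unfolding sph_moment_cut_power by (rule mean_value[OF f that profile_funD[OF P]])
 obtain p where p: "p \<in> H3" "\<And>y. y \<in> H3 \<Longrightarrow> f y \<le> f p" by (rule invariant_attains_max[OF mean_zeroD(1)[OF mz]]) blast
 let ?g = "\<lambda>x. (-1) * f x + 0 * f x"
 have g: "mean_zero ?g" by (rule mean_zero_lincomb[OF mz mz])
 have evg: "radial_op (cut_power c 3) ?g x = sphere_area * sph.moment \<mu> 3 c * ?g x" if "x \<in> H3" for c x
  unfolding radial_op_lincomb[OF P fc fc that] ev[OF that] by simp
 obtain q where q: "q \<in> H3" "\<And>y. y \<in> H3 \<Longrightarrow> ?g y \<le> ?g q" by (rule invariant_attains_max[OF mean_zeroD(1)[OF g]]) blast
 show False
 proof (cases "f p \<ge> 0")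
  case True
  then show False using key[OF mz ev p] nz by simp
 next
  case False
  then have "?g q \<ge> 0" using p(2)[OF q(1)] by simp
  then have "ip ?g ?g = 0" by (intro key[OF g evg q])
  then show False using nz unfolding ip_lincomb_both[OF fc fc] by simp
 qed
qed

text \<open>An invariant function descends to orbits by evaluation at a chosen point; smoothness of
  all orders is supplied by \<open>eigenfunction_smooth\<close>.\<close>

lemma orbifold_eigenvalue_iff:
 "orbifold_eigenvalue \<Gamma> \<mu> \<longleftrightarrow> (\<exists>f. invariant f \<and> eigenfunction \<mu> f \<and> ip f f > 0)"
proof
 assume "orbifold_eigenvalue \<Gamma> \<mu>"
 then obtain f p where f: "smooth_on (\<lambda>p. f (orbit \<Gamma> p)) H3" and p: "p \<in> H3" "f (orbit \<Gamma> p) \<noteq> 0"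
  and L: "\<And>p. p \<in> H3 \<Longrightarrow> laplace_beltrami (\<lambda>q. f (orbit \<Gamma> q)) p = \<mu> * f (orbit \<Gamma> p)"
  unfolding orbifold_eigenvalue_def by blast
 let ?f = "\<lambda>p. f (orbit \<Gamma> p)"
 have C: "C_k_on k ?f H3" for k using f by (simp add: smooth_on_def)
 have inv: "invariant ?f" unfolding invariant_def using C[of 0] orbit_act by simp
 moreover have "eigenfunction \<mu> ?f" unfolding eigenfunction_def using C[of 2] L by blast
 moreover have "ip ?f ?f > 0" using ip_zero_imp_zero[OF inv _ p(1)] p(2) ip_nonneg[of ?f] by force
 ultimately show "\<exists>f. invariant f \<and> eigenfunction \<mu> f \<and> ip f f > 0" by blast
next
 assume "\<exists>f. invariant f \<and> eigenfunction \<mu> f \<and> ip f f > 0"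
 then obtain f where inv: "invariant f" and f: "eigenfunction \<mu> f" and nz: "ip f f > 0" by blast
 define F where "F O' = f (SOME p. p \<in> O' \<inter> H3)" for O'
 have F: "f p = F (orbit \<Gamma> p)" if p: "p \<in> H3" for p
 proof -
  have "p \<in> orbit \<Gamma> p \<inter> H3" using orbit_self p by blast
  then have "(SOME q. q \<in> orbit \<Gamma> p \<inter> H3) \<in> orbit \<Gamma> p \<inter> H3" by (rule someI)
  then obtain A where "A \<in> G" "(SOME q. q \<in> orbit \<Gamma> p \<inter> H3) = SL2C_act A p" by (auto simp: orbit_eq)
  then show ?thesis using invariantD[OF inv _ p] by (simp add: F_def)
 qed
 obtain x where x: "x \<in> H3" "f x \<noteq> 0" by (rule nonzero_point[OF nz]) blast
 have "smooth_on (\<lambda>p. F (orbit \<Gamma> p)) H3"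
  using eigenfunction_smooth[OF f] C_k_on_cong[OF open_H3, of _ f "\<lambda>p. F (orbit \<Gamma> p)"] F unfolding smooth_on_def by blast
 moreover have "laplace_beltrami (\<lambda>q. F (orbit \<Gamma> q)) p = \<mu> * F (orbit \<Gamma> p)" if "p \<in> H3" for p
  using laplace_beltrami_cong[of f "\<lambda>q. F (orbit \<Gamma> q)" p, OF _ F that] f that F[OF that] by (simp add: eigenfunction_def)
 ultimately show "orbifold_eigenvalue \<Gamma> \<mu>"
  unfolding orbifold_eigenvalue_def using x F[OF x(1)] by (intro exI[of _ F] conjI bexI[of _ x]) auto
qed

text \<open>The eigenvalue equation is carried along in the form Q g = \<mu> P g, with Q the
  Laplacian of the smoothing operator P. Unlike the Laplacian, P and Q are continuous under uniform
  limits.\<close>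

theorem first_nonzero_eigenvalue_le:
 assumes F: "mean_zero F" and ef: "eigenfunction m F" and nz: "ip F F > 0"
 shows "first_nonzero_eigenvalue \<Gamma> \<le> m"
proof -
 define E where "E = {\<mu>. orbifold_eigenvalue \<Gamma> \<mu> \<and> \<mu> \<noteq> 0}"
 have E: "\<exists>f. mean_zero f \<and> eigenfunction \<mu> f \<and> ip f f > 0" if "\<mu> \<in> E" for \<mu>
  using that eigenfunction_mean_zero unfolding E_def orbifold_eigenvalue_iff by blast
 have E_pos: "\<mu> > 0" if "\<mu> \<in> E" for \<mu> using E[OF that] eigenvalue_pos by blast
 have EI: "\<mu> \<in> E" if "mean_zero f" "eigenfunction \<mu> f" "ip f f > 0" for \<mu> f
  using that mean_zeroD(1) eigenvalue_pos[OF that(2,1,3)] unfolding E_def orbifold_eigenvalue_iff by blast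
 have mE: "m \<in> E" by (rule EI[OF F ef nz])
 have bdd: "bdd_below E" using E_pos by (intro bdd_belowI[of _ 0]) (simp add: less_imp_le)
 define \<nu> where "\<nu> = Inf E"
 \<comment> \<open>One kernel whose eigenvalues stay above a positive bound along the whole
   minimizing sequence, so that the images cannot shrink to 0.\<close>
 obtain c h where c: "c > 1" and h: "h > 0" "\<And>\<mu>. \<mu> \<le> \<nu> + 1 \<Longrightarrow> h \<le> sph.moment \<mu> 3 c" by (rule sph_moment_uniform[of "\<nu> + 1"]) blast
 let ?P = "radial_op (cut_power c 3)" and ?Q = "radial_op (lap_cut_power c)"
 have P: "profile_fun c (cut_power c 3)" and Q: "profile_fun c (lap_cut_power c)"
  by (simp_all add: profile_fun_cut_power profile_fun_lap_cut_power)
 define a where "a \<mu> = sphere_area * sph.moment \<mu> 3 c" for \<mu>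
 have "\<exists>\<mu> g. \<mu> \<ge> \<nu> \<and> \<mu> < \<nu> + 1 / real (Suc n) \<and> mean_zero g \<and> ip g g = 1 \<and> (\<forall>x\<in>H3. ?P g x = a \<mu> * g x) \<and> (\<forall>x\<in>H3. ?Q g x = \<mu> * ?P g x)" for n
 proof -
  have "\<nu> < \<nu> + 1 / real (Suc n)" by simp
  then obtain \<mu> where \<mu>: "\<mu> \<in> E" "\<mu> < \<nu> + 1 / real (Suc n)" unfolding \<nu>_def using cInf_lessD mE by blast
  obtain f where f: "mean_zero f" "eigenfunction \<mu> f" "ip f f > 0" using E[OF \<mu>(1)] by blast
  note fc = mean_zeroD(2)[OF f(1)]
  define t where "t = 1 / sqrt (ip f f)"
  let ?g = "\<lambda>x. t * f x + 0 * f x"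
  have "ip ?g ?g = 1" unfolding ip_lincomb_both[OF fc fc] using f(3) by (simp add: t_def power_divide)
  moreover have "?P f x = a \<mu> * f x" if "x \<in> H3" for x
   unfolding a_def sph_moment_cut_power by (rule mean_value[OF f(2) that profile_funD[OF P]])
  then have "?P ?g x = a \<mu> * ?g x" if "x \<in> H3" for x using that unfolding radial_op_lincomb[OF P fc fc that] by simp
  moreover have "?Q ?g x = \<mu> * ?P ?g x" if "x \<in> H3" for x
   unfolding radial_op_lincomb[OF P fc fc that] radial_op_lincomb[OF Q fc fc that] eigenfunction_lap_op[OF f(2) that] by simp
  moreover have "\<nu> \<le> \<mu>" unfolding \<nu>_def by (rule cInf_lower[OF \<mu>(1) bdd])
  ultimately show ?thesis using \<mu>(2) mean_zero_lincomb[OF f(1) f(1), of t 0] by blast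
 qed
 then obtain \<mu> g where \<mu>: "\<And>n. \<mu> n \<ge> \<nu>" "\<And>n. \<mu> n < \<nu> + 1 / real (Suc n)" and g: "\<And>n. mean_zero (g n)" "\<And>n. ip (g n) (g n) = 1"
  and gP: "\<And>n x. x \<in> H3 \<Longrightarrow> ?P (g n) x = a (\<mu> n) * g n x" and gQ: "\<And>n x. x \<in> H3 \<Longrightarrow> ?Q (g n) x = \<mu> n * ?P (g n) x"
  by metis
 have a: "a (\<mu> n) \<ge> sphere_area * h" for n
 proof -
  have "\<mu> n \<le> \<nu> + 1" using \<mu>(2)[of n] by (rule order_trans[OF less_imp_le]) simp
  then show ?thesis unfolding a_def using h(2) sphere_area_pos by (intro mult_left_mono) auto
 qed
 have ah: "sphere_area * h > 0" using sphere_area_pos h(1) by simp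
 have \<mu>_lim: "\<mu> \<longlonglongrightarrow> \<nu>"
 proof (rule real_tendsto_sandwich[OF _ _ tendsto_const])
  have "(\<lambda>n. \<nu> + 1 / real (Suc n)) \<longlonglongrightarrow> \<nu> + 0" by (intro tendsto_intros LIMSEQ_Suc[OF lim_const_over_n])
  then show "(\<lambda>n. \<nu> + 1 / real (Suc n)) \<longlonglongrightarrow> \<nu>" by simp
  show "\<forall>\<^sub>F n in sequentially. \<mu> n \<le> \<nu> + 1 / real (Suc n)" using \<mu>(2) by (intro always_eventually allI less_imp_le)
 qed (use \<mu> in auto)
 obtain r H where r: "strict_mono (r :: nat \<Rightarrow> nat)" and H: "mean_zero H"
  and lim0: "uniform_limit H3 (\<lambda>n. ops ([] @ [cut_power c 3]) (g (r n))) H sequentially"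
  by (rule ops_compact[OF profiles_Nil P, of g, OF g(1) eq_refl[OF g(2)]])
 \<comment> \<open>Compactness speaks about the images of the g n, so the limit is taken of these;
   each is an eigenfunction again, being a scalar multiple of g n.\<close>
 define u where "u n = ?P (g (r n))" for n
 have lim: "uniform_limit H3 u H sequentially" using lim0 by (simp add: u_def[abs_def])
 note gc = mean_zeroD(2)[OF g(1)] and Hc = mean_zeroD(2)[OF H]
 have uc: "continuous_on H3 (u n)" for n unfolding u_def by (rule radial_op_continuous[OF P gc])
 have u_eq: "u n x = a (\<mu> (r n)) * g (r n) x + 0 * g (r n) x" if "x \<in> H3" for n x using gP[OF that] by (simp add: u_def)
 have uP: "?P (u n) x = a (\<mu> (r n)) * u n x" if x: "x \<in> H3" for n x
 proof -
  have "?P (u n) x = ?P (\<lambda>x. a (\<mu> (r n)) * g (r n) x + 0 * g (r n) x) x" by (rule kernel_op_cong) (rule u_eq)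
  then show ?thesis unfolding radial_op_lincomb[OF P gc gc x] by (simp add: u_def)
 qed
 have uQ: "?Q (u n) x = \<mu> (r n) * ?P (u n) x" if x: "x \<in> H3" for n x
 proof -
  have "?Q (u n) x = ?P (?Q (g (r n))) x" unfolding u_def by (rule radial_op_commute[OF Q P gc x])
  also have "\<dots> = ?P (\<lambda>x. \<mu> (r n) * u n x + 0 * u n x) x" by (rule kernel_op_cong) (simp add: gQ u_def)
  also have "\<dots> = \<mu> (r n) * ?P (u n) x" unfolding radial_op_lincomb[OF P uc uc x] by simp
  finally show ?thesis .
 qed
 have limP: "(\<lambda>n. ?P (u n) x) \<longlonglongrightarrow> ?P H x" and limQ: "(\<lambda>n. ?Q (u n) x) \<longlonglongrightarrow> ?Q H x" if "x \<in> H3" for x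
  using tendsto_uniform_limitI[OF uniform_limit_radial_op[OF P uc Hc lim] that]
   tendsto_uniform_limitI[OF uniform_limit_radial_op[OF Q uc Hc lim] that] by auto
 have \<mu>r: "(\<lambda>n. \<mu> (r n)) \<longlonglongrightarrow> \<nu>" using LIMSEQ_subseq_LIMSEQ[OF \<mu>_lim r] by (simp add: o_def)
 have HQ: "?Q H x = \<nu> * ?P H x" if x: "x \<in> H3" for x
  by (rule LIMSEQ_unique[OF limQ[OF x]]) (unfold uQ[OF x], intro tendsto_mult \<mu>r limP x)
 have "(sphere_area * h)^2 \<le> 2 * 1^2 * ip (\<lambda>x. 1 * u n x + (-1) * H x) (\<lambda>x. 1 * u n x + (-1) * H x) + 2 * 1^2 * ip H H" for n
 proof -
  have "(sphere_area * h)^2 \<le> (a (\<mu> (r n)))^2" using a ah by (intro power_mono) auto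
  also have "\<dots> = ip (\<lambda>x. a (\<mu> (r n)) * g (r n) x + 0 * g (r n) x) (\<lambda>x. a (\<mu> (r n)) * g (r n) x + 0 * g (r n) x)"
   unfolding ip_lincomb_both[OF gc gc] by (simp add: g)
  also have "\<dots> = ip (u n) (u n)" using u_eq by (intro ip_cong) auto
  also have "\<dots> = ip (\<lambda>x. 1 * (1 * u n x + (-1) * H x) + 1 * H x) (\<lambda>x. 1 * (1 * u n x + (-1) * H x) + 1 * H x)" by simp
  also have "\<dots> \<le> 2 * 1^2 * ip (\<lambda>x. 1 * u n x + (-1) * H x) (\<lambda>x. 1 * u n x + (-1) * H x) + 2 * 1^2 * ip H H"
   by (intro ip_parallelogram continuous_intros uc Hc)
  finally show ?thesis .
 qed
 moreover have "(\<lambda>n. 2 * 1^2 * ip (\<lambda>x. 1 * u n x + (-1) * H x) (\<lambda>x. 1 * u n x + (-1) * H x) + 2 * 1^2 * ip H H)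
   \<longlonglongrightarrow> 2 * 1^2 * 0 + 2 * 1^2 * ip H H" by (intro tendsto_intros ip_uniform_limit(2)[OF uc Hc Hc lim])
 ultimately have "(sphere_area * h)^2 \<le> 2 * 1^2 * 0 + 2 * 1^2 * ip H H" by (intro LIMSEQ_le_const) auto
 then have "(sphere_area * h)^2 \<le> 2 * ip H H" by simp
 moreover have "(sphere_area * h)^2 > 0" using ah by (rule zero_less_power)
 ultimately have Hnz: "ip H H > 0" by linarith
 obtain p where p: "p \<in> H3" "H p \<noteq> 0" by (rule nonzero_point[OF Hnz]) blast
 \<comment> \<open>The limit of the factors \<open>a (\<mu> (r n))\<close>, read off at one point
   where H does not vanish.\<close>
 define \<kappa> where "\<kappa> = ?P H p / H p"
 have up: "(\<lambda>n. u n p) \<longlonglongrightarrow> H p" by (rule tendsto_uniform_limitI[OF lim p(1)])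
 have "(\<lambda>n. ?P (u n) p / u n p) \<longlonglongrightarrow> \<kappa>" unfolding \<kappa>_def by (intro tendsto_divide limP p up)
 moreover have "\<forall>\<^sub>F n in sequentially. ?P (u n) p / u n p = a (\<mu> (r n))"
  using tendsto_imp_eventually_ne[OF up p(2)] by eventually_elim (simp add: uP[OF p(1)])
 ultimately have \<kappa>_lim: "(\<lambda>n. a (\<mu> (r n))) \<longlonglongrightarrow> \<kappa>" by (rule Lim_transform_eventually)
 have "\<kappa> \<ge> sphere_area * h" using \<kappa>_lim by (rule LIMSEQ_le_const) (use a in blast)
 then have \<kappa>: "\<kappa> > 0" using ah by simp
 have HP: "?P H x = \<kappa> * H x" if x: "x \<in> H3" for x
  by (rule LIMSEQ_unique[OF limP[OF x]]) (unfold uP[OF x], intro tendsto_mult \<kappa>_lim tendsto_uniform_limitI[OF lim x])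
 have "eigenfunction \<nu> H"
 proof (rule eigenfunctionI)
  show "continuous_on H3 (\<lambda>x. (1 / \<kappa>) * H x + 0 * H x)" by (intro continuous_intros Hc)
  fix x assume x: "x \<in> H3"
  show "?P (\<lambda>x. (1 / \<kappa>) * H x + 0 * H x) x = H x" unfolding radial_op_lincomb[OF P Hc Hc x] HP[OF x] using \<kappa> by simp
  show "?Q (\<lambda>x. (1 / \<kappa>) * H x + 0 * H x) x = \<nu> * H x"
   unfolding radial_op_lincomb[OF Q Hc Hc x] HQ[OF x] HP[OF x] using \<kappa> by simp
 qed
 then have "\<nu> \<in> E" by (rule EI[OF H _ Hnz])
 then have "first_nonzero_eigenvalue \<Gamma> = \<nu>" unfolding first_nonzero_eigenvalue_def using cInf_lower[OF _ bdd]
  by (intro Least_equality) (auto simp: E_def \<nu>_def)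
 then show ?thesis using cInf_lower[OF mE bdd] by (simp add: \<nu>_def)
qed

end

section \<open>The eigenvalue bound: test function and extremal kernel\<close>

section \<open>A concentrated test function\<close>

context fundamental_domain
begin

text \<open>The bump k around the base point summed over the orbit. The index set depends on x, so
  invariance is an exact reindexing with no truncation to account for.\<close>

definition orbit_sum :: "real \<Rightarrow> (real \<Rightarrow> real) \<Rightarrow> point3 \<Rightarrow> real" where
 "orbit_sum c k x = 1/2 * (\<Sum>A | A \<in> G \<and> cosh_dist base_point (SL2C_act A x) \<le> c. radial k base_point (SL2C_act A x))"

lemma near_hits:
 assumes "x \<in> H3" "cosh_dist base_point x \<le> R" "c \<le> R"
 shows "{A \<in> G. cosh_dist base_point (SL2C_act A x) \<le> c} \<subseteq> hits R"
proof
 fix A assume "A \<in> {A \<in> G. cosh_dist base_point (SL2C_act A x) \<le> c}"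
 then show "A \<in> hits R" using assms G_act_H3[of A x] unfolding hits_def hyp_cball_def
  by (intro CollectI conjI bexI[of _ x]) auto
qed

lemma orbit_sum_eq_auto_kernel:
 assumes k: "profile_fun c k" and x: "x \<in> H3" "cosh_dist base_point x \<le> R" and R: "c \<le> R"
 shows "orbit_sum c k x = auto_kernel R k base_point x"
proof -
 have "(\<Sum>A | A \<in> G \<and> cosh_dist base_point (SL2C_act A x) \<le> c. radial k base_point (SL2C_act A x)) =
   (\<Sum>A\<in>hits R. radial k base_point (SL2C_act A x))"
 proof (rule sum.mono_neutral_left[OF finite_hits near_hits[OF x R]])
  show "\<forall>A\<in>hits R - {A \<in> G. cosh_dist base_point (SL2C_act A x) \<le> c}. radial k base_point (SL2C_act A x) = 0"
   using hits_subset profile_funD(2)[OF k] unfolding radial_def by (metis (no_types, lifting) Diff_iff mem_Collect_eq not_less subsetD)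
 qed
 then show ?thesis by (simp add: orbit_sum_def auto_kernel_def)
qed

lemma orbit_sum_invariant:
 assumes k: "profile_fun c k"
 shows "invariant (orbit_sum c k)" unfolding invariant_def
proof (intro conjI ballI)
 \<comment> \<open>On each of these open sets the varying index set can be replaced by one fixed
   finite set, which gives continuity there.\<close>
 define U where "U n = {x \<in> H3. cosh_dist base_point x < real n}" for n
 have cont: "continuous_on H3 (cosh_dist base_point)" using base_point_H3 by (auto intro!: continuous_intros)
 have U: "open (U n)" for n using open_Collect_less_Int[OF cont, of "\<lambda>_. real n"] open_H3
   continuous_on_open_vimage[OF open_H3, THEN iffD1, OF cont, rule_format, of "{..<real n}"]
  by (simp add: U_def vimage_def Int_def conj_commute)
 have UH: "(\<Union>n\<in>UNIV. U n) = H3" using reals_Archimedean2 unfolding U_def by blast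
 have "continuous_on (\<Union>n\<in>UNIV. U n) (orbit_sum c k)"
 proof (rule continuous_on_open_UN[OF U])
  fix n
  have "continuous_on (U n) (auto_kernel (max c (real n)) k base_point)"
   by (rule continuous_on_compose2[OF auto_kernel_continuous[OF k], of _ "\<lambda>y. (base_point, y)", simplified])
    (use base_point_H3 in \<open>auto simp: U_def intro!: continuous_intros\<close>)
  then show "continuous_on (U n) (orbit_sum c k)"
   by (rule continuous_on_eq) (rule orbit_sum_eq_auto_kernel[OF k, symmetric]; auto simp: U_def)
 qed
 then show "continuous_on H3 (orbit_sum c k)" by (simp only: UH)
 fix B x assume B: "B \<in> G" and x: "x \<in> H3"
 have "(\<Sum>A | A \<in> G \<and> cosh_dist base_point (SL2C_act A (SL2C_act B x)) \<le> c. radial k base_point (SL2C_act A (SL2C_act B x))) =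
   (\<Sum>A | A \<in> G \<and> cosh_dist base_point (SL2C_act A x) \<le> c. radial k base_point (SL2C_act A x))"
  by (rule sum.reindex_bij_witness[where i = "\<lambda>A. A ** ginv B" and j = "\<lambda>A. A ** B"])
   (use B x in \<open>simp_all add: G_mult ginv G_act_mult G_act_ginv G_act_H3 matrix_mul_assoc[symmetric]\<close>)
 then show "orbit_sum c k (SL2C_act B x) = orbit_sum c k x" by (simp add: orbit_sum_def)
qed

lemma ip_orbit_sum:
 assumes k: "profile_fun c k" and c: "c \<ge> 0" and F: "invariant F"
 shows "ip F (orbit_sum c k) = radial_op k F base_point"
proof -
 \<comment> \<open>The 1 is the value of \<open>cosh_dist\<close> at the base point and itself, the
   radius around which the kernel is unfolded.\<close>
 define R where "R = max c0 (2 * 1 * c)"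
 have R: "R \<ge> c0" "R \<ge> 2 * 1 * c" "R \<ge> c" using c by (auto simp: R_def)
 have "base_point \<in> hyp_cball base_point 1" by (simp add: hyp_cball_def base_point_H3 cosh_dist_self)
 then have "radial_op k F base_point = (\<integral>y. auto_kernel R k base_point y * F y \<partial>dom)"
  by (rule radial_op_auto_kernel[OF k F _ R(1,2)])
 also have "\<dots> = (\<integral>y. F y * orbit_sum c k y \<partial>dom)"
 proof (intro Bochner_Integration.integral_cong refl)
  fix y assume "y \<in> space dom"
  then have "y \<in> hyp_cball base_point c0" using D_bounded by auto
  then have "y \<in> H3" "cosh_dist base_point y \<le> R" using R(1) by (auto simp: hyp_cball_def)
  then show "auto_kernel R k base_point y * F y = F y * orbit_sum c k y"
   using orbit_sum_eq_auto_kernel[OF k _ _ R(3)] by simp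
 qed
 finally show ?thesis by (simp add: ip_def)
qed

text \<open>Both signs of a matrix in \<open>SL\<^sub>2(\<complex>)\<close> act alike, hence the factor 1/2 in \<open>orbit_sum\<close>.\<close>

lemma orbit_sum_ge:
 assumes k: "profile_fun c k" "\<And>u. k u \<ge> 0" and x: "x \<in> H3"
 shows "orbit_sum c k x \<ge> radial k base_point x" and "orbit_sum c k x \<ge> 0"
proof -
 let ?S = "{A \<in> G. cosh_dist base_point (SL2C_act A x) \<le> c}"
 have fin: "finite ?S" by (rule finite_subset[OF near_hits[OF x, of "max c (cosh_dist base_point x)"] finite_hits]) auto
 show nn: "orbit_sum c k x \<ge> 0" unfolding orbit_sum_def radial_def using k(2) by (simp add: sum_nonneg)
 show "orbit_sum c k x \<ge> radial k base_point x"
 proof (cases "cosh_dist base_point x \<le> c")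
  case True
  let ?I = "mat 1 :: complex^2^2"
  have ne: "?I \<noteq> - ?I" by (simp add: vec_eq_iff mat_def)
  have "(\<Sum>A\<in>{?I, - ?I}. radial k base_point (SL2C_act A x)) \<le> (\<Sum>A\<in>?S. radial k base_point (SL2C_act A x))"
   by (rule sum_mono2[OF fin])
    (use True G_one G_uminus[OF G_one] k(2) in \<open>auto simp: SL2C_act_uminus SL2C_act_mat_1 radial_def\<close>)
  also have "(\<Sum>A\<in>{?I, - ?I}. radial k base_point (SL2C_act A x)) = 2 * radial k base_point x"
   using ne by (simp add: SL2C_act_uminus SL2C_act_mat_1)
  finally show ?thesis by (simp add: orbit_sum_def)
 next
  case False
  then show ?thesis using nn profile_funD(2)[OF k(1)] by (simp add: radial_def)
 qed
qed

lemma concentrated_function: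
 assumes k: "profile_fun ck k" and k0: "\<And>u. k u \<ge> 0" and vol: "vol > 0"
  and big: "sphere_area * sph.profile 0 k < vol * k 1" obtains F0 where "mean_zero F0" "ip (radial_op k F0) F0 > 0"
proof -
 let ?T = "radial_op k" and ?b = base_point
 define h where "h = sphere_area * sph.profile 0 k"
 \<comment> \<open>Half of the available gap, so that a^2 times e remains after the loss from
   continuity of k.\<close>
 define e where "e = (k 1 - h / vol) / 2"
 have e: "e > 0" using big vol by (simp add: e_def h_def field_simps)
 let ?K = "hyp_cball ?b 2"
 have bK: "?b \<in> ?K" by (simp add: hyp_cball_def base_point_H3 cosh_dist_self)
 obtain d where d: "d > 0" "\<And>p. p \<in> H3 \<times> H3 \<Longrightarrow> dist p (?b, ?b) < d \<Longrightarrow> dist (radial k (fst p) (snd p)) (radial k ?b ?b) < e"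
  using profile_fun_kernel(1)[OF k, unfolded case_prod_unfold continuous_on_iff, rule_format, of "(?b, ?b)" e] e base_point_H3 by auto
 obtain c where c: "1 < c" "c \<le> 2" "\<And>x y. x \<in> ?K \<Longrightarrow> y \<in> ?K \<Longrightarrow> cosh_dist x y \<le> c \<Longrightarrow> dist x y < d / 2"
  by (rule cosh_dist_small[OF compact_hyp_cball[OF base_point_H3] hyp_cball_subset, of "d / 2" 2]) (use d(1) in auto)
 have near: "radial k x y \<ge> k 1 - e" if x: "x \<in> hyp_cball ?b c" and y: "y \<in> hyp_cball ?b c" for x y
 proof -
  have "x \<in> ?K" "y \<in> ?K" "cosh_dist ?b x \<le> c" "cosh_dist ?b y \<le> c" using x y c by (auto simp: hyp_cball_def)
  then have "dist ?b x < d / 2" "dist ?b y < d / 2" using c(3) bK by blast+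
  moreover have "dist (x, y) (?b, ?b) \<le> dist x ?b + dist y ?b"
   unfolding dist_Pair_Pair by (rule sqrt_sum_squares_le_sum) auto
  ultimately have "dist (x, y) (?b, ?b) < d" by (simp add: dist_commute)
  then have "dist (radial k x y) (radial k ?b ?b) < e" using d(2)[of "(x, y)"] x y by (simp add: hyp_cball_def)
  then show ?thesis by (simp add: radial_def cosh_dist_self base_point_H3 dist_real_def)
 qed
 define \<eta> where "\<eta> = cut_power c 1"
 have \<eta>: "profile_fun c \<eta>" "\<And>u. \<eta> u \<ge> 0" by (simp_all add: \<eta>_def profile_fun_cut_power, simp add: cut_power_def)
 define H where "H = orbit_sum c \<eta>"
 have H: "invariant H" unfolding H_def by (rule orbit_sum_invariant[OF \<eta>(1)])
 note Hc = invariant_continuous[OF H]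
 have H_ge: "H y \<ge> radial \<eta> ?b y" "H y \<ge> 0" if "y \<in> H3" for y unfolding H_def by (rule orbit_sum_ge[OF \<eta> that])+
 have ipH: "ip F H = radial_op \<eta> F ?b" if "invariant F" for F
  unfolding H_def using ip_orbit_sum[OF \<eta>(1) _ that] c by simp
 define a where "a = radial_op \<eta> (\<lambda>_. 1) ?b"
 have a: "a > 0"
 proof -
  have "a = sphere_area * sph.profile 0 \<eta>" unfolding a_def by (rule integral_radial[OF profile_funD[OF \<eta>(1)] base_point_H3])
  moreover have "sph.moment 0 1 c > 0" by (rule sph_moment_pos[of _ "arcosh c"]) (use c in \<open>auto simp: sph_eq_sinh\<close>)
  ultimately show ?thesis using sphere_area_pos by (simp add: \<eta>_def sph_moment_cut_power)
 qed
 have out: "radial \<eta> ?b y = 0" if "y \<in> H3" "y \<notin> hyp_cball ?b c" for y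
  using that profile_funD(2)[OF \<eta>(1)] by (simp add: radial_def hyp_cball_def)
 have ri: "radial \<eta> ?b y \<ge> 0" for y using \<eta>(2) by (simp add: radial_def)
 have TH: "?T H x \<ge> (k 1 - e) * a" if x: "x \<in> hyp_cball ?b c" for x
 proof -
  have xH: "x \<in> H3" using x hyp_cball_subset by blast
  have "(k 1 - e) * a = (\<integral>y. (k 1 - e) * (radial \<eta> ?b y * 1) \<partial>hyp)" by (simp add: a_def kernel_op_def)
  also have "\<dots> \<le> (\<integral>y. radial k x y * H y \<partial>hyp)"
  proof (rule integral_mono)
   fix y assume "y \<in> space hyp"
   then have y: "y \<in> H3" by simp
   have kn: "radial k x y \<ge> 0" using k0 by (simp add: radial_def)
   have "(k 1 - e) * radial \<eta> ?b y \<le> radial k x y * radial \<eta> ?b y"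
    using out[OF y] by (cases "y \<in> hyp_cball ?b c") (simp_all add: mult_right_mono[OF near[OF x] ri])
   also have "\<dots> \<le> radial k x y * H y" using H_ge[OF y] kn by (intro mult_left_mono)
   finally show "(k 1 - e) * (radial \<eta> ?b y * 1) \<le> radial k x y * H y" by simp
  qed (intro integrable_mult_right radial_op_integrable[OF \<eta>(1) continuous_on_const base_point_H3] radial_op_integrable[OF k Hc xH])+
  finally show ?thesis by (simp add: kernel_op_def)
 qed
 have THH: "ip (?T H) H \<ge> (k 1 - e) * a * a"
 proof -
  have "(k 1 - e) * a * a = (\<integral>x. (k 1 - e) * a * (radial \<eta> ?b x * 1) \<partial>hyp)" by (simp add: a_def kernel_op_def)
  also have "\<dots> \<le> (\<integral>x. radial \<eta> ?b x * ?T H x \<partial>hyp)"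
  proof (rule integral_mono)
   fix x assume "x \<in> space hyp"
   then have x: "x \<in> H3" by simp
   have "radial \<eta> ?b x * ((k 1 - e) * a) \<le> radial \<eta> ?b x * ?T H x"
    using out[OF x] by (cases "x \<in> hyp_cball ?b c") (simp_all add: mult_left_mono[OF TH ri])
   then show "(k 1 - e) * a * (radial \<eta> ?b x * 1) \<le> radial \<eta> ?b x * ?T H x" by (simp add: mult_ac)
  qed (intro integrable_mult_right radial_op_integrable[OF \<eta>(1) _ base_point_H3] continuous_on_const radial_op_continuous[OF k Hc])+
  also have "\<dots> = ip (?T H) H" using ipH[OF radial_op_invariant[OF k H]] by (simp add: kernel_op_def)
  finally show ?thesis .
 qed
 define F0 where "F0 x = 1 * H x + (- a / vol) * 1" for x
 have inv: "invariant F0" unfolding F0_def[abs_def] by (rule invariant_lincomb[OF H invariant_const])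
 have ip1H: "ip (\<lambda>_. 1) H = a" using ipH[OF invariant_const] by (simp add: a_def)
 have "ip F0 (\<lambda>_. 1) = 1 * ip H (\<lambda>_. 1) + (- a / vol) * ip (\<lambda>_. 1) (\<lambda>_. 1)"
  unfolding F0_def[abs_def] by (rule ip_lincomb_left[OF Hc continuous_on_const continuous_on_const])
 then have mz: "mean_zero F0" using inv ip1H vol by (simp add: mean_zero_def ip_1_1 ip_commute[of H])
 have TF0c: "continuous_on H3 (?T F0)" by (rule radial_op_continuous[OF k invariant_continuous[OF inv]])
 have "mean_zero (ops [k] F0)" by (rule ops_mean_zero[OF _ mz]) (use k in \<open>auto simp: profiles_def\<close>)
 then have TF0: "ip (?T F0) (\<lambda>_. 1) = 0" by (simp add: mean_zero_def)
 have T1: "?T (\<lambda>_. 1) x = h" if "x \<in> H3" for x unfolding h_def by (rule integral_radial[OF profile_funD[OF k] that])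
 have "ip (?T F0) F0 = 1 * ip (?T F0) H + (- a / vol) * ip (?T F0) (\<lambda>_. 1)"
  using ip_lincomb_right[OF Hc continuous_on_const TF0c, of 1 "- a / vol" 1] by (simp add: F0_def[abs_def])
 also have "\<dots> = ip (?T F0) H" by (simp add: TF0)
 also have "\<dots> = ip (\<lambda>x. 1 * ?T H x + (- a / vol * h) * 1) H"
 proof (rule ip_cong[OF _ refl])
  fix x assume x: "x \<in> H3"
  show "?T F0 x = 1 * ?T H x + (- a / vol * h) * 1"
   unfolding F0_def[abs_def] radial_op_lincomb[OF k Hc continuous_on_const x] T1[OF x] by simp
 qed
 also have "\<dots> = 1 * ip (?T H) H + (- a / vol * h) * ip (\<lambda>_. 1) H"
  by (rule ip_lincomb_left[OF radial_op_continuous[OF k Hc] continuous_on_const Hc])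
 also have "\<dots> \<ge> (k 1 - e) * a * a + (- a / vol * h) * a" using THH by (simp add: ip1H)
 also have "(k 1 - e) * a * a + (- a / vol * h) * a = e * a * a" using vol by (simp add: e_def field_simps)
 finally have "ip (?T F0) F0 \<ge> e * a * a" .
 moreover have "e * a * a > 0" using e a by simp
 ultimately show thesis using that[OF mz] by linarith
qed

text \<open>Small balls act as an approximate identity, uniformly on \<open>H3\<close>: an invariant
  function is uniformly continuous for the hyperbolic distance, since any pair of close points can
  be moved near D.\<close>

lemma radial_approximation:
 assumes F: "invariant F" and e: "e > 0" obtains c where "c > 1" "\<And>x. x \<in> H3 \<Longrightarrow>
  \<bar>radial_op (cut_power c 3) F x - radial_op (cut_power c 3) (\<lambda>_. 1) base_point * F x\<bar> \<le> e * radial_op (cut_power c 3) (\<lambda>_. 1) base_point"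
proof -
 note Fc = invariant_continuous[OF F]
 have "base_point \<in> H3" by (rule base_point_H3)
 then obtain A where "A \<in> G" "SL2C_act A base_point \<in> D" using D_meets by blast
 then have c0: "c0 \<ge> 1" using hyp_cball_height(4)[OF base_point_H3] D_bounded by blast
 \<comment> \<open>Contains every point whose \<open>cosh_dist\<close> to a point of the ball of
   parameter c0 is at most 2.\<close>
 let ?K = "hyp_cball base_point (2 * c0 * 2)"
 have K: "compact ?K" "?K \<subseteq> H3" by (simp_all add: compact_hyp_cball base_point_H3 hyp_cball_subset)
 have "uniformly_continuous_on ?K F" by (rule compact_uniformly_continuous[OF continuous_on_subset[OF Fc K(2)] K(1)])
 then obtain d where d: "d > 0" "\<And>x y. x \<in> ?K \<Longrightarrow> y \<in> ?K \<Longrightarrow> dist y x < d \<Longrightarrow> dist (F y) (F x) < e"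
  unfolding uniformly_continuous_on_def using e by metis
 obtain c where c: "1 < c" "c \<le> 2" "\<And>x y. x \<in> ?K \<Longrightarrow> y \<in> ?K \<Longrightarrow> cosh_dist x y \<le> c \<Longrightarrow> dist x y < d"
  by (rule cosh_dist_small[OF K d(1)]) blast
 have close: "\<bar>F y - F x\<bar> \<le> e" if x: "x \<in> H3" and y: "y \<in> H3" and xy: "cosh_dist x y \<le> c" for x y
 proof -
  obtain A where A: "A \<in> G" "SL2C_act A x \<in> D" using D_meets[OF x] by blast
  then have Ax: "SL2C_act A x \<in> hyp_cball base_point c0" using D_bounded by blast
  have AH: "SL2C_act A x \<in> H3" by (rule G_act_H3[OF A(1) x])
  have cAB: "cosh_dist (SL2C_act A x) (SL2C_act A y) \<le> c" using G_cosh_dist[OF A(1) x y] xy by simp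
  have "SL2C_act A y \<in> hyp_cball (SL2C_act A x) 2" using cAB c(2) G_act_H3[OF A(1) y] by (simp add: hyp_cball_def)
  then have "SL2C_act A y \<in> ?K" by (rule hyp_cball_subset_cball[OF AH _ Ax base_point_H3])
  moreover have "SL2C_act A x \<in> ?K" using Ax c0 by (auto simp: hyp_cball_def)
  ultimately have "dist (F (SL2C_act A x)) (F (SL2C_act A y)) < e" using d(2) c(3) cAB by blast
  then show ?thesis using invariantD[OF F A(1)] x y by (simp add: dist_real_def)
 qed
 show thesis
 proof (rule that[OF c(1)])
  fix x assume x: "x \<in> H3"
  define P where "P = cut_power c 3"
  have P: "profile_fun c P" by (simp add: P_def profile_fun_cut_power)
  have Pa: "(\<lambda>u. \<bar>P u\<bar>) = P" by (auto simp: P_def cut_power_def)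
  have T1: "radial_op P (\<lambda>_. 1) x = radial_op P (\<lambda>_. 1) base_point"
   by (rule kernel_op_const_homogeneous[OF profile_funD(1)[OF P] x base_point_H3])
  have "radial_op P F x - radial_op P (\<lambda>_. 1) base_point * F x = radial_op P (\<lambda>y. 1 * F y + (- F x) * 1) x"
   unfolding radial_op_lincomb[OF P Fc continuous_on_const x] T1 by simp
  also have "\<bar>\<dots>\<bar> \<le> e * radial_op (\<lambda>u. \<bar>P u\<bar>) (\<lambda>_. 1) x"
   by (rule radial_op_bound[OF P _ x]) (use close[OF x] in \<open>auto intro!: continuous_intros Fc\<close>)
  also have "\<dots> = e * radial_op P (\<lambda>_. 1) base_point" unfolding Pa T1 ..
  finally show "\<bar>radial_op (cut_power c 3) F x - radial_op (cut_power c 3) (\<lambda>_. 1) base_point * F x\<bar>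
    \<le> e * radial_op (cut_power c 3) (\<lambda>_. 1) base_point" unfolding P_def .
 qed
qed

text \<open>\<open>ops_eigenfunction\<close> asks for positivity of the smoothed operator P k P.
  With P a fine enough approximate identity of mass a, applying P twice to F0 is nearly
  multiplication by a^2; as the operators commute, the form of P k P at F0 is nearly a^2 times the
  positive form of k.\<close>

theorem profile_positive_eigenfunction:
 assumes k: "profile_fun ck k" and k0: "\<And>u. k u \<ge> 0" and vol: "vol > 0"
  and big: "sphere_area * sph.profile 0 k < vol * k 1"
 obtains m F where "mean_zero F" "eigenfunction m F" "ip F F > 0" "sph.profile m k > 0"
proof -
 obtain F0 where F0: "mean_zero F0" and q: "ip (radial_op k F0) F0 > 0"
  by (rule concentrated_function[OF k k0 vol big])
 define q where "q = ip (radial_op k F0) F0"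
 define TF where "TF = radial_op k F0"
 note F0c = mean_zeroD(2)[OF F0] and F0i = mean_zeroD(1)[OF F0]
 have TFi: "invariant TF" unfolding TF_def by (rule radial_op_invariant[OF k F0i])
 note TFc = invariant_continuous[OF TFi]
 define s where "s = sqrt vol * sqrt (ip TF TF)"
 have s: "s \<ge> 0" using vol_nonneg ip_nonneg[of TF] by (simp add: s_def)
 \<comment> \<open>The error in applying P twice is at most 2 e a^2 pointwise, so pairing it with TF
   costs at most 2 e s a^2, which has to stay below a^2 q.\<close>
 define e where "e = q / (2 * (s + 1))"
 have e: "e > 0" "2 * e * s < q" using q s by (simp_all add: e_def q_def divide_less_eq mult_less_cancel_left1)
 obtain c where c: "c > 1" and app: "\<And>x. x \<in> H3 \<Longrightarrow>
  \<bar>radial_op (cut_power c 3) F0 x - radial_op (cut_power c 3) (\<lambda>_. 1) base_point * F0 x\<bar> \<le> e * radial_op (cut_power c 3) (\<lambda>_. 1) base_point"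
  by (rule radial_approximation[OF F0i e(1)]) blast
 define P where "P = cut_power c 3"
 define a where "a = radial_op P (\<lambda>_. 1) base_point"
 have P: "profile_fun c P" by (simp add: P_def profile_fun_cut_power)
 have Pa: "(\<lambda>u. \<bar>P u\<bar>) = P" by (auto simp: P_def cut_power_def)
 have "a = sphere_area * sph.profile 0 P" unfolding a_def by (rule integral_radial[OF profile_funD[OF P] base_point_H3])
 then have a: "a > 0" using sph_moment_0_pos[OF c] sphere_area_pos by (simp add: P_def sph_moment_cut_power)
 let ?P = "radial_op P"
 have Pc: "continuous_on H3 (?P F0)" by (rule radial_op_continuous[OF P F0c])
 have app': "\<bar>?P F0 x - a * F0 x\<bar> \<le> e * a" if "x \<in> H3" for x using app[OF that] by (simp add: P_def a_def)
 define E where "E x = 1 * ?P (?P F0) x + (- (a^2)) * F0 x" for x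
 have E: "\<bar>E x\<bar> \<le> 2 * e * a^2" if x: "x \<in> H3" for x
 proof -
  define y z where "y = ?P (\<lambda>y. 1 * ?P F0 y + (- a) * F0 y) x" and "z = ?P F0 x - a * F0 x"
  have eq: "E x = y + a * z"
   unfolding y_def z_def radial_op_lincomb[OF P Pc F0c x] by (simp add: E_def power2_eq_square algebra_simps)
  have T1: "radial_op (\<lambda>u. \<bar>P u\<bar>) (\<lambda>_. 1) x = a"
   unfolding Pa a_def by (rule kernel_op_const_homogeneous[OF profile_funD(1)[OF P] x base_point_H3])
  have "\<bar>y\<bar> \<le> (e * a) * radial_op (\<lambda>u. \<bar>P u\<bar>) (\<lambda>_. 1) x"
   unfolding y_def by (rule radial_op_bound[OF P _ x]) (use app' in \<open>auto intro!: continuous_intros Pc F0c\<close>)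
  then have "\<bar>y\<bar> \<le> (e * a) * a" unfolding T1 .
  moreover have "a * \<bar>z\<bar> \<le> a * (e * a)" using app'[OF x] a unfolding z_def by (intro mult_left_mono) auto
  moreover have "\<bar>a * z\<bar> = a * \<bar>z\<bar>" using a by (simp add: abs_mult)
  ultimately have "\<bar>y\<bar> + \<bar>a * z\<bar> \<le> (e * a) * a + a * (e * a)" by linarith
  then show ?thesis unfolding eq using abs_triangle_ineq[of y "a * z"] by (simp add: power2_eq_square mult_ac)
 qed
 have Ec: "continuous_on H3 E" unfolding E_def[abs_def] by (intro continuous_intros radial_op_continuous[OF P Pc] F0c)
 have pr: "profiles [P, P]" "profiles [k, P]" "profiles [P, k, P]" using P k by (auto simp: profiles_def)
 have "ip (ops [P, k, P] F0) F0 = ip (ops [P, P] TF) F0"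
  using radial_op_commute[OF k P F0c] unfolding TF_def by (intro ip_cong) (auto intro!: kernel_op_cong)
 also have "\<dots> = ip (ops [P, P] F0) TF" unfolding ops_symmetric[OF pr(1) TFi F0i] by (rule ip_commute)
 also have "\<dots> = ip (\<lambda>x. 1 * E x + a^2 * F0 x) TF" by (intro ip_cong) (simp_all add: E_def)
 also have "\<dots> = 1 * ip E TF + a^2 * ip F0 TF" by (rule ip_lincomb_left[OF Ec F0c TFc])
 also have "ip F0 TF = q" by (simp add: q_def TF_def ip_commute)
 finally have eq: "ip (ops [P, k, P] F0) F0 = ip E TF + a^2 * q" by simp
 have "\<bar>ip E TF\<bar> \<le> (2 * e * a^2) * (sqrt vol * sqrt (ip TF TF))"
  by (rule abs_ip_le[OF TFc Ec]) (use E D_H3 e a in auto)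
 also have "\<dots> = a^2 * (2 * e * s)" by (simp add: s_def)
 also have "\<dots> < a^2 * q" using e(2) a by (intro mult_strict_left_mono) auto
 finally have "ip (ops [P, k, P] F0) F0 > 0" unfolding eq by linarith
 then show thesis unfolding P_def using that by (rule ops_eigenfunction[OF k F0]) 
qed

theorem first_eigenvalue_less:
 assumes k: "profile_fun ck k" and k0: "\<And>u. k u \<ge> 0" and vol: "vol > 0"
  and big: "sphere_area * sph.profile 0 k < vol * k 1" and neg: "\<And>m. m \<ge> b \<Longrightarrow> sph.profile m k \<le> 0"
 shows "first_nonzero_eigenvalue \<Gamma> < b"
proof -
 obtain m F where m: "mean_zero F" "eigenfunction m F" "ip F F > 0" "sph.profile m k > 0"
  by (rule profile_positive_eigenfunction[OF k k0 vol big])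
 then have "m < b" using neg[of m] by force
 then show ?thesis using first_nonzero_eigenvalue_le[OF m(1-3)] by linarith
qed

end

section \<open>The extremal kernel\<close>

text \<open>With \<open>w = 2 \<pi> / L\<close> the profile is nonnegative on \<open>[0, L]\<close>, and its sine transform at \<open>r\<close> is
 \<open>(cos (r L) - 1) w\<^sup>2 (r\<^sup>2 - R w\<^sup>2) / (r (r\<^sup>2 - w\<^sup>2)\<^sup>2)\<close>, so it is nonpositive for
 \<open>r\<^sup>2 \<ge> R w\<^sup>2\<close>. Any \<open>R > 1\<close> keeps the value of the kernel at distance 0 positive.\<close>

definition ext_profile :: "real \<Rightarrow> real \<Rightarrow> real \<Rightarrow> real" where
 "ext_profile R w s = R * (1 - cos (w * s)) + (R - 1) / 2 * ((2 * pi - w * s) * sin (w * s))"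

lemma ext_profile_0 [simp]: "ext_profile R w 0 = 0" by (simp add: ext_profile_def)

lemma continuous_ext_profile [continuous_intros]: "continuous_on A (ext_profile R w)"
 unfolding ext_profile_def[abs_def] by (intro continuous_intros)

lemma x_cos_le_sin:
 fixes x :: real
 assumes "0 \<le> x" "x \<le> pi"
 shows "x * cos x \<le> sin x"
proof -
 have "sin 0 - 0 * cos 0 \<le> sin x - x * cos x"
 proof (rule DERIV_nonneg_imp_nondecreasing[OF assms(1)])
  fix y assume y: "0 \<le> y" "y \<le> x"
  have "((\<lambda>x. sin x - x * cos x) has_real_derivative y * sin y) (at y)" by (auto intro!: derivative_eq_intros)
  moreover have "y * sin y \<ge> 0" using y assms by (simp add: sin_ge_zero)
  ultimately show "\<exists>d. ((\<lambda>x. sin x - x * cos x) has_real_derivative d) (at y) \<and> d \<ge> 0" by blast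
 qed
 then show ?thesis by simp
qed

text \<open>With y = pi - w s / 2 the profile factors as 2 sin y times (R - 1) (sin y - y cos y) +
  sin y, and each part is nonnegative on [0, pi].\<close>

lemma ext_profile_nonneg:
 assumes R: "R \<ge> 1" and s: "0 \<le> w * s" "w * s \<le> 2 * pi"
 shows "ext_profile R w s \<ge> 0"
proof -
 define y where "y = pi - w * s / 2"
 have y: "0 \<le> y" "y \<le> pi" and ws: "w * s = 2 * pi - 2 * y" using s by (auto simp: y_def)
 have c: "cos (w * s) = 1 - 2 * (sin y)^2" unfolding ws by (simp add: cos_diff cos_double_sin)
 have d: "sin (w * s) = - (2 * sin y * cos y)" unfolding ws by (simp add: sin_diff sin_double)
 have e: "2 * pi - w * s = 2 * y" using ws by simp
 have "ext_profile R w s = 2 * sin y * ((R - 1) * (sin y - y * cos y) + sin y)"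
  unfolding ext_profile_def c d e by (simp add: power2_eq_square field_simps)
 also have "\<dots> \<ge> 0" using R y x_cos_le_sin[OF y] sin_ge_zero[OF y] by (intro mult_nonneg_nonneg add_nonneg_nonneg) auto
 finally show ?thesis .
qed

text \<open>C and A are antiderivatives of the products of cos (w s) and sin (w s) with sin (r s),
  and B is one of A, needed for the linear factor. Because w L = 2 pi, the value of \<Phi> at L is
  cos (r L) times its value at 0, whence the factor cos (r L) - 1.\<close>

lemma ext_profile_sin_integral:
 assumes R: "R \<ge> 1" and L: "L > 0" and w: "w = 2 * pi / L" and r: "r > 0" "r^2 \<ge> R * w^2" "r > w"
 shows "integral {0..L} (\<lambda>s. ext_profile R w s * sin (r * s)) \<le> 0"
proof -
 have w0: "w > 0" and wL: "w * L = 2 * pi" using L by (simp_all add: w)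
 define q where "q = r^2 - w^2"
 have q: "q > 0" using r w0 by (simp add: q_def power2_eq_square mult_strict_mono)
 define C where "C s = (- (r * cos (w * s) * cos (r * s)) - w * sin (w * s) * sin (r * s)) / q" for s
 define A where "A s = (w * cos (w * s) * sin (r * s) - r * sin (w * s) * cos (r * s)) / q" for s
 define B where "B s = (- (2 * r * w * cos (w * s) * cos (r * s)) - (w^2 + r^2) * sin (w * s) * sin (r * s)) / q^2" for s
 define \<Phi> where "\<Phi> s = R * (- cos (r * s) / r - C s) + (R - 1) / 2 * ((2 * pi - w * s) * A s + w * B s)" for s
 have dC: "(C has_real_derivative cos (w * s) * sin (r * s)) (at s within S)" for s S
 proof -
  have "(C has_real_derivative (r^2 - w^2) * (cos (w * s) * sin (r * s)) / q) (at s within S)"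
   unfolding C_def[abs_def] using q by (auto intro!: derivative_eq_intros simp: power2_eq_square algebra_simps diff_divide_distrib add_divide_distrib)
  then show ?thesis using q by (simp add: q_def)
 qed
 have dA: "(A has_real_derivative sin (w * s) * sin (r * s)) (at s within S)" for s S
 proof -
  have "(A has_real_derivative (r^2 - w^2) * (sin (w * s) * sin (r * s)) / q) (at s within S)"
   unfolding A_def[abs_def] using q by (auto intro!: derivative_eq_intros simp: power2_eq_square algebra_simps diff_divide_distrib add_divide_distrib)
  then show ?thesis using q by (simp add: q_def)
 qed
 have dB: "(B has_real_derivative A s) (at s within S)" for s S
 proof -
  have "(B has_real_derivative (r^2 - w^2) * (w * cos (w * s) * sin (r * s) - r * sin (w * s) * cos (r * s)) / q^2) (at s within S)"
   unfolding B_def[abs_def] using q by (auto intro!: derivative_eq_intros simp: power2_eq_square algebra_simps diff_divide_distrib add_divide_distrib)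
  moreover have "(r^2 - w^2) * x / q^2 = x / q" for x unfolding q_def[symmetric] using q by (simp add: power2_eq_square)
  ultimately show ?thesis by (simp only: A_def)
 qed
 have d\<Phi>: "(\<Phi> has_real_derivative ext_profile R w s * sin (r * s)) (at s within S)" for s S
  unfolding \<Phi>_def[abs_def] using r(1)
  by (auto intro!: derivative_eq_intros dA dB dC simp: ext_profile_def field_simps)
 have "((\<lambda>s. ext_profile R w s * sin (r * s)) has_integral \<Phi> L - \<Phi> 0) {0..L}"
  using L d\<Phi> by (intro fundamental_theorem_of_calculus) (auto simp: has_real_derivative_iff_has_vector_derivative[symmetric])
 then have "integral {0..L} (\<lambda>s. ext_profile R w s * sin (r * s)) = \<Phi> L - \<Phi> 0" by (rule integral_unique)
 also have "\<dots> = (cos (r * L) - 1) * (w^2 * (r^2 - R * w^2) / (r * q^2))"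
 proof -
  have r2: "r^2 = q + w^2" by (simp add: q_def)
  have "\<Phi> L - \<Phi> 0 = (cos (r * L) - 1) * (- R / r + R * r / q - (R - 1) * r * w^2 / q^2)"
  proof -
   have L': "\<Phi> L = R * (- cos (r * L) / r + r * cos (r * L) / q) - (R - 1) * r * w^2 * cos (r * L) / q^2"
    unfolding \<Phi>_def A_def B_def C_def wL by (simp add: power2_eq_square)
   have 0: "\<Phi> 0 = R * (- 1 / r + r / q) - (R - 1) * r * w^2 / q^2"
    by (simp add: \<Phi>_def A_def B_def C_def power2_eq_square)
   show ?thesis unfolding L' 0 by (simp add: algebra_simps diff_divide_distrib add_divide_distrib)
  qed
  also have "- R / r + R * r / q - (R - 1) * r * w^2 / q^2 = (- (R * q^2) + R * r^2 * q - (R - 1) * r^2 * w^2) / (r * q^2)"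
   using r(1) q by (simp add: field_simps power2_eq_square)
  also have "- (R * q^2) + R * r^2 * q - (R - 1) * r^2 * w^2 = w^2 * (r^2 - R * w^2)"
   unfolding r2 by (simp add: power2_eq_square algebra_simps)
  finally show ?thesis .
 qed
 also have "\<dots> \<le> 0" using r q by (intro mult_nonpos_nonneg) auto
 finally show ?thesis .
qed

text \<open>The value at 0 is the limit of the quotient, namely the derivative of the profile at
  0.\<close>

definition ext_ratio :: "real \<Rightarrow> real \<Rightarrow> real \<Rightarrow> real" where
 "ext_ratio R w s = (if s = 0 then (R - 1) * pi * w else ext_profile R w s / sinh s)"

text \<open>The truncations extend the kernel continuously to the whole line. Beyond
  \<open>cosh L\<close> it is constantly its value at L, which is 0 because the profile vanishes
  there.\<close>

definition ext_kernel :: "real \<Rightarrow> real \<Rightarrow> real \<Rightarrow> real" where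
 "ext_kernel R L u = ext_ratio R (2 * pi / L) (min L (arcosh (max 1 u)))"

lemma ext_ratio_sinh: "ext_ratio R w s * sinh s = ext_profile R w s" by (simp add: ext_ratio_def)

lemma continuous_ext_ratio: "continuous_on UNIV (ext_ratio R w)" unfolding continuous_on_eq_continuous_at[OF open_UNIV]
proof
 fix s :: real
 show "isCont (ext_ratio R w) s"
 proof (cases "s = 0")
  case True
  have "(ext_profile R w has_real_derivative (R - 1) * pi * w) (at 0)"
   unfolding ext_profile_def[abs_def] by (auto intro!: derivative_eq_intros simp: field_simps)
  then have 1: "((\<lambda>s. ext_profile R w s / s) \<longlongrightarrow> (R - 1) * pi * w) (at 0)" by (simp add: DERIV_def)
  have 2: "((\<lambda>s::real. sinh s / s) \<longlongrightarrow> 1) (at 0)" using sph_derivative[of 0 0 UNIV] by (simp add: DERIV_def sph_eq_sinh)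
  have "((\<lambda>s. (ext_profile R w s / s) / (sinh s / s)) \<longlongrightarrow> (R - 1) * pi * w / 1) (at 0)" by (rule tendsto_divide[OF 1 2]) simp
  moreover have "\<forall>\<^sub>F s in at 0. (ext_profile R w s / s) / (sinh s / s) = ext_ratio R w s"
   by (auto simp: eventually_at_filter ext_ratio_def)
  ultimately have "((ext_ratio R w) \<longlongrightarrow> (R - 1) * pi * w) (at 0)" by (simp add: tendsto_cong)
  then show ?thesis using True by (simp add: isCont_def ext_ratio_def)
 next
  case False
  have "isCont (\<lambda>s. ext_profile R w s / sinh s) s"
   using False continuous_ext_profile[of UNIV] by (intro continuous_intros) (auto simp: continuous_on_eq_continuous_at)
  moreover have ev: "\<forall>\<^sub>F x in nhds s. ext_profile R w x / sinh x = ext_ratio R w x"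
   using t1_space_nhds[OF False] by eventually_elim (simp add: ext_ratio_def)
  ultimately show ?thesis unfolding isCont_cong[OF ev] by blast
 qed
qed

context
 fixes R L :: real
 assumes R: "R \<ge> 1" and L: "L > 0"
begin

lemma ext_profile_L: "ext_profile R (2 * pi / L) L = 0" using L by (simp add: ext_profile_def)

lemma ext_kernel_profile_fun: "profile_fun (cosh L) (ext_kernel R L)" unfolding profile_fun_def
proof (intro conjI allI impI)
 have "continuous_on UNIV (\<lambda>u::real. min L (arcosh (max 1 u)))" by (intro continuous_intros) auto
 then show "continuous_on UNIV (ext_kernel R L)"
  unfolding ext_kernel_def[abs_def] by (rule continuous_on_compose2[OF continuous_ext_ratio]) simp
 fix u assume u: "u > cosh L"
 have "\<not> u \<le> cosh L \<and> u \<ge> 1" using u cosh_real_ge_1[of L] by linarith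
 then have "L \<le> arcosh u" using arcosh_cosh_real[of L] arcosh_le_iff[of L u] L u by simp
 then have "min L (arcosh (max 1 u)) = L" using u cosh_real_ge_1[of L] by (simp add: max_def min_def)
 then show "ext_kernel R L u = 0" using L ext_profile_L by (simp add: ext_kernel_def ext_ratio_def)
qed

lemma ext_kernel_nonneg: "ext_kernel R L u \<ge> 0"
proof -
 define s where "s = min L (arcosh (max 1 u))"
 have s: "0 \<le> s" "s \<le> L" using L by (auto simp: s_def arcosh_nonneg_real)
 have "2 * pi / L * s \<le> 2 * pi / L * L" using s L by (intro mult_left_mono) auto
 then have "ext_profile R (2 * pi / L) s \<ge> 0" using L s by (intro ext_profile_nonneg R) auto
 then show ?thesis using s L R by (auto simp: ext_kernel_def s_def[symmetric] ext_ratio_def)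
qed

lemma ext_kernel_1: "ext_kernel R L 1 = (R - 1) * pi * (2 * pi / L)" using L by (simp add: ext_kernel_def ext_ratio_def)

text \<open>The sinh left over from the volume density cancels the division in
  \<open>ext_ratio\<close>, so the spherical transform of the kernel is a plain one-dimensional
  transform of the profile.\<close>

lemma sph_profile_ext_kernel:
 "sph.profile \<mu> (ext_kernel R L) = integral {0..L} (\<lambda>s. ext_profile R (2 * pi / L) s * sph \<mu> s)"
proof -
 have "sph.profile \<mu> (ext_kernel R L) = integral {0..arcosh (cosh L)} (\<lambda>s. ext_kernel R L (cosh s) * (sinh s * sph \<mu> s))"
  by (rule sph_profile_eq_integral)
   (use profile_funD[OF ext_kernel_profile_fun] cosh_real_ge_1 in \<open>auto intro: continuous_on_subset\<close>)
 also have "\<dots> = integral {0..L} (\<lambda>s. ext_profile R (2 * pi / L) s * sph \<mu> s)"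
 proof -
  have "ext_kernel R L (cosh s) * (sinh s * sph \<mu> s) = ext_profile R (2 * pi / L) s * sph \<mu> s" if "s \<in> {0..L}" for s
  proof -
   have "min L (arcosh (max 1 (cosh s))) = s" using that cosh_real_ge_1[of s] by (simp add: arcosh_cosh_real max_def)
   then show ?thesis by (simp add: ext_kernel_def ext_ratio_sinh[symmetric])
  qed
  moreover have "arcosh (cosh L) = L" using L by (simp add: arcosh_cosh_real)
  ultimately show ?thesis by (simp only:) (rule Henstock_Kurzweil_Integration.integral_cong)
 qed
 finally show ?thesis .
qed

lemma ext_kernel_negative:
 assumes m: "m \<ge> 1 + R * (2 * pi / L)^2" and R1: "R > 1"
 shows "sph.profile m (ext_kernel R L) \<le> 0"
proof -
 define w where "w = 2 * pi / L"
 have w: "w > 0" using L by (simp add: w_def)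
 define r where "r = sqrt (m - 1)"
 have "m - 1 \<ge> R * w^2" using m by (simp add: w_def)
 moreover have "R * w^2 > 1 * w^2" using R1 w by (intro mult_strict_right_mono) auto
 ultimately have m1: "m - 1 > w^2" by linarith
 then have "r^2 = m - 1" unfolding r_def using zero_le_power2[of w] by (intro real_sqrt_pow2) linarith
 then have r2: "r^2 \<ge> R * w^2" using \<open>m - 1 \<ge> R * w^2\<close> by simp
 have "r > w" unfolding r_def using m1 by (intro real_less_rsqrt)
 then have r: "r > 0" using w by simp
 have "m > 1" using m1 zero_le_power2[of w] by linarith
 then have "sph.profile m (ext_kernel R L) = integral {0..L} (\<lambda>s. (ext_profile R w s * sin (r * s)) * (1 / r))"
  unfolding sph_profile_ext_kernel w_def r_def by (simp add: sph_def)
 also have "\<dots> = integral {0..L} (\<lambda>s. ext_profile R w s * sin (r * s)) * (1 / r)" by (rule integral_mult_left)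
 also have "\<dots> \<le> 0" using ext_profile_sin_integral[OF R L w_def r r2 \<open>r > w\<close>] r by (intro mult_nonpos_nonneg) auto
 finally show ?thesis .
qed

text \<open>The bounds 1 - cos \<le> 2 and (2 pi - w s) sin (w s) \<le> 2 pi < 8 give at most 2 R +
  4 (R - 1) for the profile, hence the 6 R. The exponential bounds the spherical factor sinh s for
  the eigenvalue 0.\<close>

lemma ext_kernel_0_bound: "sph.profile 0 (ext_kernel R L) \<le> 6 * R * L * exp L"
proof -
 define w where "w = 2 * pi / L"
 have "sph.profile 0 (ext_kernel R L) = integral {0..L} (\<lambda>s. ext_profile R w s * sph 0 s)"
  unfolding sph_profile_ext_kernel w_def ..
 also have "\<dots> = integral {0..L} (\<lambda>s. ext_profile R w s * sinh s)" unfolding sph_eq_sinh ..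
 also have "\<dots> \<le> integral {0..L} (\<lambda>s. 6 * R * exp L)"
 proof (intro integral_le integrable_continuous_interval continuous_intros)
  fix s assume s: "s \<in> {0..L}"
  have "w * s \<le> w * L" using s L by (intro mult_left_mono) (auto simp: w_def)
  then have ws: "0 \<le> w * s" "w * s \<le> 2 * pi" using s L by (auto simp: w_def)
  have "(2 * pi - w * s) * sin (w * s) \<le> (2 * pi - w * s) * 1" using ws by (intro mult_left_mono) auto
  then have "(2 * pi - w * s) * sin (w * s) \<le> 2 * pi" by (rule order_trans) (use ws in simp)
  then have "(R - 1) / 2 * ((2 * pi - w * s) * sin (w * s)) \<le> (R - 1) / 2 * (2 * 4)"
   using R pi_less_4 by (intro mult_left_mono) auto
  moreover have "R * (1 - cos (w * s)) \<le> R * 2" using R by (intro mult_left_mono) auto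
  ultimately have "ext_profile R w s \<le> R * 2 + (R - 1) / 2 * (2 * 4)" unfolding ext_profile_def by (intro add_mono)
  then have "ext_profile R w s \<le> 6 * R" by (simp add: field_simps)
  moreover have "sinh s \<le> exp L"
  proof -
   have "sinh s \<le> exp s" using cosh_plus_sinh[of s] cosh_real_nonneg[of s] by linarith
   also have "exp s \<le> exp L" using s by simp
   finally show ?thesis .
  qed
  ultimately show "ext_profile R w s * sinh s \<le> 6 * R * exp L" using s R by (intro mult_mono) auto
 qed
 also have "\<dots> = 6 * R * L * exp L" using L by simp
 finally show ?thesis .
qed

end

text \<open>With L = (19/20) ln V the left side grows like V^(19/20) ln V and the right side like V
  / ln V.\<close>

lemma ext_kernel_eventually:
 fixes a :: real
 assumes a: "a > 0"
 shows "\<forall>\<^sub>F V in at_top. 19/20 * ln V > 0 \<and>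
  a * (6 * (11/10) * (19/20 * ln V) * exp (19/20 * ln V)) < V * ((11/10 - 1) * pi * (2 * pi / (19/20 * ln V)))"
proof (rule eventually_conj)
 show "\<forall>\<^sub>F V in at_top. 19/20 * ln V > (0::real)" by real_asymp
 show "\<forall>\<^sub>F V in at_top. a * (6 * (11/10) * (19/20 * ln V) * exp (19/20 * ln V)) < V * ((11/10 - 1) * pi * (2 * pi / (19/20 * ln V)))"
  using a by real_asymp
qed

theorem theorem1p3:
  fixes \<epsilon> :: real
  assumes "\<epsilon> > 0"
  shows "\<exists>V\<^sub>0 > 0. \<forall>\<Gamma>. closed_hyp_3_orbifold \<Gamma> \<and> orbifold_volume \<Gamma> > V\<^sub>0 \<longrightarrow>
           first_nonzero_eigenvalue \<Gamma> < 1 + 54 * (1 + \<epsilon>) / (ln (orbifold_volume \<Gamma>))\<^sup>2"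
proof -
 let ?R = "11/10 :: real"
 obtain V0 where V0: "\<And>V. V \<ge> V0 \<Longrightarrow> 19/20 * ln V > 0 \<and>
   sphere_area * (6 * ?R * (19/20 * ln V) * exp (19/20 * ln V)) < V * ((?R - 1) * pi * (2 * pi / (19/20 * ln V)))"
  using ext_kernel_eventually[OF sphere_area_pos] unfolding eventually_at_top_linorder by blast
 show ?thesis
 proof (intro exI[of _ "max V0 1"] conjI allI impI)
  \<comment> \<open>Taking the maximum with 1 makes the threshold positive even if V0 is
    not.\<close>
  fix \<Gamma> assume \<Gamma>: "closed_hyp_3_orbifold \<Gamma> \<and> orbifold_volume \<Gamma> > max V0 1"
  interpret cocompact_group \<Gamma> by unfold_locales (use \<Gamma> in blast)
  obtain c0 where c0: "dirichlet \<subseteq> hyp_cball base_point c0" by (rule dirichlet_bounded)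
  interpret fundamental_domain \<Gamma> dirichlet c0 by unfold_locales (rule dirichlet_strict_fundamental_domain, rule c0)
  \<comment> \<open>With this L and R = 11/10 the coefficient of 1 / (ln vol)^2 is (11/10) (40 pi /
    19)^2, about 48.1 and so below 54.\<close>
  define L where "L = 19/20 * ln vol"
  have vol: "vol > V0" "vol > 1" using \<Gamma> by (auto simp: vol_eq)
  then have L: "L > 0" and big: "sphere_area * (6 * ?R * L * exp L) < vol * ext_kernel ?R L 1"
   using V0[of vol] by (auto simp: L_def ext_kernel_1)
  have "sphere_area * sph.profile 0 (ext_kernel ?R L) \<le> sphere_area * (6 * ?R * L * exp L)"
   using ext_kernel_0_bound[of ?R L] L sphere_area_pos by (intro mult_left_mono) auto
  then have "first_nonzero_eigenvalue \<Gamma> < 1 + ?R * (2 * pi / L)^2"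
   using big vol L ext_kernel_nonneg[of ?R L] ext_kernel_negative[of ?R L]
   by (intro first_eigenvalue_less[OF ext_kernel_profile_fun[of ?R L]]) auto
  also have "?R * (2 * pi / L)^2 \<le> 54 / (ln vol)^2"
  proof -
   have "pi * pi \<le> 3.15 * 3.15" using pi_approx by (intro mult_mono) auto
   then have "?R * (2 * pi / (19/20))^2 \<le> 54" by (simp add: power2_eq_square)
   then have "?R * (2 * pi / (19/20))^2 / (ln vol)^2 \<le> 54 / (ln vol)^2" by (rule divide_right_mono) simp
   then show ?thesis by (simp add: L_def power_divide power_mult_distrib)
  qed
  also have "54 / (ln vol)^2 \<le> 54 * (1 + \<epsilon>) / (ln vol)^2" using assms by (intro divide_right_mono) auto
  finally show "first_nonzero_eigenvalue \<Gamma> < 1 + 54 * (1 + \<epsilon>) / (ln (orbifold_volume \<Gamma>))^2" by (simp add: vol_eq)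
 qed simp
qed

end
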